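(* Let $M\in\mathcal M$. For each $k\in\mathbb N$, $$\lambda_k(M_t)\to\lambda_k(M)\qquad\text{as }t\to0^+.$$
   Context: Fix $n\in\mathbb N$ and $\lambda,D,i_0,s_0>0$. A compact Riemannian manifold $(M,g)$ with boundary $\partial M$ has cylindrical boundary of width $s$ if a neighbourhood of $\partial M$ is isometric to $(\partial M\times[0,s],\,g_{\partial M}+d\tau^2)$, where $\tau$ is the coordinate on $[0,s]$ and $\partial M$ corresponds to $\tau=0$. $\mathcal M$ is the class of smooth compact $n$-dimensional Riemannian manifolds with cylindrical boundary of width greater than $s_0$ satisfying $|\mathrm{Ric}|\le\lambda$, $\mathrm{diam}\le D$ and injectivity radius $\ge i_0$ (meaning: for every interior point $x$ and $0<r<\min(i_0,d(x,\partial M))$, $\exp_x$ is a diffeomorphism from the $r$-ball of $T_xM$ onto $B_r(x)$). For $0<t\le s_0$, $M_t=\{x\in M: d(x,\partial M)\ge t\}$. $\lambda_k(M_t)$ and $\lambda_k(M)$ denote the $k$-th eigenvalues (counted with multiplicity) of minus the Laplace–Beltrami operator with Dirichlet boundary condition on $M_t$ and on $M$ respectively. *)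

theory Defs
  imports "HOL-Analysis.Analysis" "HOL-Library.Extended_Nat"
begin

section \<open>Smooth maps on subsets of Euclidean space\<close>

primrec Ck_on :: "nat \<Rightarrow> (real^'n) set \<Rightarrow> (real^'n \<Rightarrow> 'b::real_normed_vector) \<Rightarrow> bool" where
  "Ck_on 0 S f \<longleftrightarrow> continuous_on S f"
| "Ck_on (Suc k) S f \<longleftrightarrow> (\<forall>x\<in>S. f differentiable (at x)) \<and>
     (\<forall>v. Ck_on k S (\<lambda>x. frechet_derivative f (at x) v))"

text \<open>On a set that need not be open, smoothness means local extendability to a smooth map.\<close>

definition smooth_on :: "(real^'n) set \<Rightarrow> (real^'n \<Rightarrow> 'b::real_normed_vector) \<Rightarrow> bool" where
  "smooth_on S f \<longleftrightarrow> (\<forall>x\<in>S. \<exists>W F. open W \<and> x \<in> W \<and> (\<forall>k. Ck_on k W F) \<and> (\<forall>y\<in>W \<inter> S. F y = f y))"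

text \<open>The model half-space is cut out by one coordinate; which one it is does not matter.\<close>

definition bdi :: "'n::finite" where "bdi = (SOME i. True)"

definition halfspace :: "(real^'n) set" where "halfspace = {x. 0 \<le> x $ bdi}"

text \<open>Partial derivatives are taken within the half-space: at its interior points they are the
  usual ones, at boundary points they are one-sided in the normal direction.\<close>

definition partial :: "'n \<Rightarrow> (real^'n \<Rightarrow> real) \<Rightarrow> real^'n \<Rightarrow> real" where
  "partial i f x = frechet_derivative f (at x within halfspace) (axis i 1)"

section \<open>Riemannian manifolds with boundary\<close>

text \<open>A chart is a domain together with a coordinate map, which is only relevant on the domain.
  The metric is given by its matrix of coefficients in the coordinates of every chart.\<close>

type_synonym ('a, 'n) chart = "'a set \<times> ('a \<Rightarrow> real^'n)"

record ('a, 'n::finite) rmfd =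
  pts :: "'a set"
  atlas :: "('a, 'n) chart set"
  coeff :: "('a, 'n) chart \<Rightarrow> real^'n \<Rightarrow> real^'n^'n"

abbreviation cdom :: "('a, 'n) chart \<Rightarrow> 'a set" where "cdom c \<equiv> fst c"
abbreviation coord :: "('a, 'n) chart \<Rightarrow> 'a \<Rightarrow> real^'n" where "coord c \<equiv> snd c"
abbreviation crange :: "('a, 'n) chart \<Rightarrow> (real^'n) set" where "crange c \<equiv> coord c ` cdom c"
abbreviation param :: "('a, 'n) chart \<Rightarrow> real^'n \<Rightarrow> 'a" where "param c \<equiv> inv_into (cdom c) (coord c)"

definition ginner :: "('a, 'n::finite) rmfd \<Rightarrow> ('a, 'n) chart \<Rightarrow> real^'n \<Rightarrow> real^'n \<Rightarrow> real^'n \<Rightarrow> real" where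
  "ginner R c x v w = v \<bullet> (coeff R c x *v w)"

definition smooth_atlas :: "'a::t2_space set \<Rightarrow> ('a, 'n::finite) chart set \<Rightarrow> bool" where
  "smooth_atlas M A \<longleftrightarrow>
     (\<Union>c\<in>A. cdom c) = M \<and>
     (\<forall>c\<in>A. openin (top_of_set M) (cdom c) \<and> openin (top_of_set halfspace) (crange c) \<and>
        homeomorphism (cdom c) (crange c) (coord c) (param c)) \<and>
     (\<forall>c\<in>A. \<forall>c'\<in>A. smooth_on (coord c ` (cdom c \<inter> cdom c')) (coord c' \<circ> param c))"

definition riemannian_metric :: "('a::t2_space, 'n::finite) rmfd \<Rightarrow> bool" where
  "riemannian_metric R \<longleftrightarrow>
     (\<forall>c\<in>atlas R. smooth_on (crange c) (coeff R c) \<and>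
        (\<forall>x\<in>crange c. transpose (coeff R c x) = coeff R c x \<and>
           (\<forall>v. v \<noteq> 0 \<longrightarrow> 0 < ginner R c x v v))) \<and>
     (\<forall>c\<in>atlas R. \<forall>c'\<in>atlas R. \<forall>x\<in>coord c ` (cdom c \<inter> cdom c').
        let T = coord c' \<circ> param c; T' = frechet_derivative T (at x within halfspace)
        in \<forall>v w. ginner R c x v w = ginner R c' (T x) (T' v) (T' w))"

definition compact_riemannian :: "('a::t2_space, 'n::finite) rmfd \<Rightarrow> bool" where
  "compact_riemannian R \<longleftrightarrow> compact (pts R) \<and> smooth_atlas (pts R) (atlas R) \<and> riemannian_metric R"

definition bdry :: "('a, 'n::finite) rmfd \<Rightarrow> 'a set" where
  "bdry R = {p. \<exists>c\<in>atlas R. p \<in> cdom c \<and> coord c p $ bdi = 0}"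

text \<open>Pointwise geometric quantities below are computed in an arbitrary chart at the point; by the
  transformation laws they do not depend on it.\<close>

definition chart_at :: "('a, 'n::finite) rmfd \<Rightarrow> 'a \<Rightarrow> ('a, 'n) chart" where
  "chart_at R p = (SOME c. c \<in> atlas R \<and> p \<in> cdom c)"

section \<open>Riemannian distance\<close>

definition speed :: "('a, 'n::finite) rmfd \<Rightarrow> (real \<Rightarrow> 'a) \<Rightarrow> real \<Rightarrow> real" where
  "speed R \<gamma> t = (let c = chart_at R (\<gamma> t); v = vector_derivative (coord c \<circ> \<gamma>) (at t)
                 in sqrt (ginner R c (coord c (\<gamma> t)) v v))"

definition pw_C1_path :: "('a::t2_space, 'n::finite) rmfd \<Rightarrow> (real \<Rightarrow> 'a) \<Rightarrow> bool" where
  "pw_C1_path R \<gamma> \<longleftrightarrow> path \<gamma> \<and> path_image \<gamma> \<subseteq> pts R \<and>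
     (\<exists>S. finite S \<and> (\<forall>c\<in>atlas R. (coord c \<circ> \<gamma>) C1_differentiable_on {t \<in> {0..1} - S. \<gamma> t \<in> cdom c}))"

definition curve_length :: "('a, 'n::finite) rmfd \<Rightarrow> (real \<Rightarrow> 'a) \<Rightarrow> ennreal" where
  "curve_length R \<gamma> = (\<integral>\<^sup>+t\<in>{0..1}. ennreal (speed R \<gamma> t) \<partial>lborel)"

text \<open>Distances take the value infinity between different components and to an empty boundary.\<close>

definition rdist :: "('a::t2_space, 'n::finite) rmfd \<Rightarrow> 'a \<Rightarrow> 'a \<Rightarrow> ennreal" where
  "rdist R p q = (INF \<gamma>\<in>{\<gamma>. pw_C1_path R \<gamma> \<and> pathstart \<gamma> = p \<and> pathfinish \<gamma> = q}. curve_length R \<gamma>)"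

definition bdry_dist :: "('a::t2_space, 'n::finite) rmfd \<Rightarrow> 'a \<Rightarrow> ennreal" where
  "bdry_dist R p = (INF q\<in>bdry R. rdist R p q)"

definition rdiam :: "('a::t2_space, 'n::finite) rmfd \<Rightarrow> ennreal" where
  "rdiam R = (SUP p\<in>pts R. SUP q\<in>pts R. rdist R p q)"

definition rball :: "('a::t2_space, 'n::finite) rmfd \<Rightarrow> 'a \<Rightarrow> real \<Rightarrow> 'a set" where
  "rball R p r = {q \<in> pts R. rdist R p q < ennreal r}"

section \<open>Connection and curvature\<close>

definition gamma :: "('a, 'n::finite) rmfd \<Rightarrow> ('a, 'n) chart \<Rightarrow> 'n \<Rightarrow> 'n \<Rightarrow> 'n \<Rightarrow> real^'n \<Rightarrow> real" where
  "gamma R c k i j x = (\<Sum>l\<in>UNIV. matrix_inv (coeff R c x) $ k $ l *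
     (partial i (\<lambda>y. coeff R c y $ j $ l) x + partial j (\<lambda>y. coeff R c y $ i $ l) x
        - partial l (\<lambda>y. coeff R c y $ i $ j) x)) / 2"

definition ricci :: "('a, 'n::finite) rmfd \<Rightarrow> ('a, 'n) chart \<Rightarrow> real^'n \<Rightarrow> real^'n^'n" where
  "ricci R c x = (\<chi> i j. \<Sum>k\<in>UNIV. partial k (gamma R c k i j) x - partial i (gamma R c k k j) x
     + (\<Sum>l\<in>UNIV. gamma R c k k l x * gamma R c l i j x - gamma R c k i l x * gamma R c l k j x))"

text \<open>The norm of the symmetric form Ric is its operator norm with respect to the metric.\<close>

definition ricci_bounded :: "('a, 'n::finite) rmfd \<Rightarrow> real \<Rightarrow> bool" where
  "ricci_bounded R lam \<longleftrightarrow> (\<forall>c\<in>atlas R. \<forall>x\<in>crange c. \<forall>v.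
     \<bar>v \<bullet> (ricci R c x *v v)\<bar> \<le> lam * ginner R c x v v)"

section \<open>Exponential map and injectivity radius\<close>

definition geodesic :: "('a::t2_space, 'n::finite) rmfd \<Rightarrow> (real \<Rightarrow> 'a) \<Rightarrow> bool" where
  "geodesic R \<gamma> \<longleftrightarrow> path \<gamma> \<and> path_image \<gamma> \<subseteq> pts R \<and>
     (\<forall>c\<in>atlas R. \<exists>v. \<forall>t\<in>{0..1}. \<gamma> t \<in> cdom c \<longrightarrow>
        ((coord c \<circ> \<gamma>) has_vector_derivative v t) (at t within {0..1}) \<and>
        (v has_vector_derivative
           (\<chi> k. - (\<Sum>i\<in>UNIV. \<Sum>j\<in>UNIV. gamma R c k i j (coord c (\<gamma> t)) * v t $ i * v t $ j)))
          (at t within {0..1}))"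

text \<open>The point q is the value of the exponential map at p on the tangent vector with
  coordinates v in the chart c.\<close>

definition is_exp :: "('a::t2_space, 'n::finite) rmfd \<Rightarrow> ('a, 'n) chart \<Rightarrow> 'a \<Rightarrow> real^'n \<Rightarrow> 'a \<Rightarrow> bool" where
  "is_exp R c p v q \<longleftrightarrow> (\<exists>\<gamma>. geodesic R \<gamma> \<and> pathstart \<gamma> = p \<and> pathfinish \<gamma> = q \<and>
     ((coord c \<circ> \<gamma>) has_vector_derivative v) (at 0 within {0..1}))"

definition tball :: "('a, 'n::finite) rmfd \<Rightarrow> ('a, 'n) chart \<Rightarrow> 'a \<Rightarrow> real \<Rightarrow> (real^'n) set" where
  "tball R c p r = {v. sqrt (ginner R c (coord c p) v v) < r}"

definition inj_radius_ge :: "('a::t2_space, 'n::finite) rmfd \<Rightarrow> real \<Rightarrow> bool" where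
  "inj_radius_ge R i0 \<longleftrightarrow>
     (\<forall>p\<in>pts R - bdry R. \<forall>r>0. ennreal r < min (ennreal i0) (bdry_dist R p) \<longrightarrow>
        (\<forall>c\<in>atlas R. p \<in> cdom c \<longrightarrow>
           (\<exists>E E'. (\<forall>v\<in>tball R c p r. is_exp R c p v (E v)) \<and>
              homeomorphism (tball R c p r) (rball R p r) E E' \<and>
              (\<forall>c'\<in>atlas R. smooth_on {v \<in> tball R c p r. E v \<in> cdom c'} (coord c' \<circ> E) \<and>
                 smooth_on (coord c' ` (cdom c' \<inter> rball R p r)) (E' \<circ> param c')))))"

section \<open>Cylindrical boundary\<close>

text \<open>The boundary is a manifold with the charts of R restricted to it, and with the metric induced
  by R. In the product of the boundary with [0,s], the point (q,\<tau>) has the coordinates of q plus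
  \<tau> times the inner normal basis vector, so foot x below is the boundary component of x, and
  the product metric at x is that of R at foot x on the tangential parts plus the square of the
  normal differential. The map \<Phi> is smooth, a homeomorphism onto a neighbourhood of the boundary
  and pulls the metric of R back to the product metric; its inverse is then smooth too, by the
  inverse function theorem.\<close>

definition foot :: "real^'n \<Rightarrow> real^'n" where
  "foot x = x - (x $ bdi) *\<^sub>R axis bdi 1"

definition cylindrical_boundary :: "('a::t2_space, 'n::finite) rmfd \<Rightarrow> real \<Rightarrow> bool" where
  "cylindrical_boundary R s \<longleftrightarrow>
     (\<exists>\<Phi> \<Psi> W N. homeomorphism (bdry R \<times> {0..s}) W \<Phi> \<Psi> \<and> W \<subseteq> pts R \<and>
        openin (top_of_set (pts R)) N \<and> bdry R \<subseteq> N \<and> N \<subseteq> W \<and>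
        (\<forall>q\<in>bdry R. \<Phi> (q, 0) = q) \<and>
        (\<forall>c\<in>atlas R. \<forall>c'\<in>atlas R.
           let F = (\<lambda>x. coord c' (\<Phi> (param c (foot x), x $ bdi)));
               C = {x. x $ bdi \<in> {0..s} \<and> foot x \<in> crange c \<and>
                       \<Phi> (param c (foot x), x $ bdi) \<in> cdom c'}
           in smooth_on C F \<and>
              (\<forall>x\<in>C. \<forall>v w. let F' = frechet_derivative F (at x within C) in
                 ginner R c' (F x) (F' v) (F' w) =
                 ginner R c (foot x) (foot v) (foot w) + v $ bdi * w $ bdi)))"

section \<open>The class of manifolds and the truncated manifolds\<close>

definition mfd_class :: "real \<Rightarrow> real \<Rightarrow> real \<Rightarrow> real \<Rightarrow> ('a::t2_space, 'n::finite) rmfd set" where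
  "mfd_class lam D i0 s0 = {R. compact_riemannian R \<and> (\<exists>s>s0. cylindrical_boundary R s) \<and>
     ricci_bounded R lam \<and> rdiam R \<le> ennreal D \<and> inj_radius_ge R i0}"

definition trunc :: "('a::t2_space, 'n::finite) rmfd \<Rightarrow> real \<Rightarrow> 'a set" where
  "trunc R t = {p \<in> pts R. ennreal t \<le> bdry_dist R p}"

section \<open>Dirichlet eigenvalues\<close>

text \<open>Existence and uniqueness of the Riemannian volume hold on compact Riemannian manifolds.\<close>

definition vol :: "('a::t2_space, 'n::finite) rmfd \<Rightarrow> 'a measure" where
  "vol R = (THE \<mu>. sets \<mu> = sets (restrict_space borel (pts R)) \<and>
     (\<forall>c\<in>atlas R. \<forall>B\<in>sets \<mu>. B \<subseteq> cdom c \<longrightarrow>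
        emeasure \<mu> B = (\<integral>\<^sup>+x\<in>coord c ` B. ennreal (sqrt (det (coeff R c x))) \<partial>lborel)))"

text \<open>Squared length of the gradient, and the Laplace-Beltrami operator.\<close>

definition grad_sq :: "('a, 'n::finite) rmfd \<Rightarrow> ('a \<Rightarrow> real) \<Rightarrow> 'a \<Rightarrow> real" where
  "grad_sq R f p = (let c = chart_at R p; x = coord c p; h = f \<circ> param c in
     \<Sum>i\<in>UNIV. \<Sum>j\<in>UNIV. matrix_inv (coeff R c x) $ i $ j * partial i h x * partial j h x)"

definition laplacian :: "('a, 'n::finite) rmfd \<Rightarrow> ('a \<Rightarrow> real) \<Rightarrow> 'a \<Rightarrow> real" where
  "laplacian R f p = (let c = chart_at R p; x = coord c p; h = f \<circ> param c in
     (\<Sum>i\<in>UNIV. partial i (\<lambda>y. sqrt (det (coeff R c y)) *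
        (\<Sum>j\<in>UNIV. matrix_inv (coeff R c y) $ i $ j * partial j h y)) x) / sqrt (det (coeff R c x)))"

text \<open>The Dirichlet problem is posed on a subset N of the manifold. Its manifold interior consists of
  the interior points of the manifold of which N is a neighbourhood: for N the whole manifold this is
  the complement of the boundary, for the truncated manifolds it removes the hypersurface at
  distance t.\<close>

definition mfd_interior :: "('a::t2_space, 'n::finite) rmfd \<Rightarrow> 'a set \<Rightarrow> 'a set" where
  "mfd_interior R N = {p \<in> pts R - bdry R. \<exists>U. openin (top_of_set (pts R)) U \<and> p \<in> U \<and> U \<subseteq> N}"

definition test_fun :: "('a::t2_space, 'n::finite) rmfd \<Rightarrow> 'a set \<Rightarrow> ('a \<Rightarrow> real) set" where
  "test_fun R \<Omega> = {f. (\<forall>c\<in>atlas R. smooth_on (crange c) (f \<circ> param c)) \<and>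
     (\<exists>K. compact K \<and> K \<subseteq> \<Omega> \<and> (\<forall>p\<in>pts R - K. f p = 0))}"

definition L2 :: "('a::t2_space, 'n::finite) rmfd \<Rightarrow> 'a set \<Rightarrow> ('a \<Rightarrow> real) set" where
  "L2 R \<Omega> = {u \<in> borel_measurable (vol R). set_integrable (vol R) \<Omega> (\<lambda>p. (u p)\<^sup>2)}"

text \<open>Closure of the test functions in the first-order Sobolev norm: L2 limits of sequences of test
  functions which are Cauchy for the Dirichlet form.\<close>

definition H10 :: "('a::t2_space, 'n::finite) rmfd \<Rightarrow> 'a set \<Rightarrow> ('a \<Rightarrow> real) set" where
  "H10 R \<Omega> = {u \<in> L2 R \<Omega>. \<exists>f. (\<forall>j::nat. f j \<in> test_fun R \<Omega>) \<and>
     (\<lambda>j. LINT p:\<Omega>|vol R. (f j p - u p)\<^sup>2) \<longlonglongrightarrow> 0 \<and>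
     (\<forall>e>0. \<exists>J. \<forall>i\<ge>J. \<forall>j\<ge>J. (LINT p:\<Omega>|vol R. grad_sq R (\<lambda>q. f i q - f j q) p) < e)}"

text \<open>The Dirichlet Laplacian is the self-adjoint realisation of the Laplace-Beltrami operator with
  domain the functions in H10 whose distributional Laplacian is in L2.\<close>

definition dirichlet_eigenspace :: "('a::t2_space, 'n::finite) rmfd \<Rightarrow> 'a set \<Rightarrow> real \<Rightarrow> ('a \<Rightarrow> real) set" where
  "dirichlet_eigenspace R \<Omega> \<mu> = {u \<in> H10 R \<Omega>. \<forall>f\<in>test_fun R \<Omega>.
     (LINT p:\<Omega>|vol R. u p * - laplacian R f p) = \<mu> * (LINT p:\<Omega>|vol R. u p * f p)}"

text \<open>Dimension of the eigenspace modulo equality almost everywhere; it is zero unless \<mu> is an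
  eigenvalue.\<close>

definition lin_indep_ae :: "('a::t2_space, 'n::finite) rmfd \<Rightarrow> 'a set \<Rightarrow> nat \<Rightarrow> (nat \<Rightarrow> 'a \<Rightarrow> real) \<Rightarrow> bool" where
  "lin_indep_ae R \<Omega> m u \<longleftrightarrow> (\<forall>a. (AE p in vol R. p \<in> \<Omega> \<longrightarrow> (\<Sum>i<m. a i * u i p) = 0) \<longrightarrow> (\<forall>i<m. a i = 0))"

definition dirichlet_mult :: "('a::t2_space, 'n::finite) rmfd \<Rightarrow> 'a set \<Rightarrow> real \<Rightarrow> enat" where
  "dirichlet_mult R \<Omega> \<mu> = Sup {enat m | m u. (\<forall>i<m. u i \<in> dirichlet_eigenspace R \<Omega> \<mu>) \<and> lin_indep_ae R \<Omega> m u}"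

text \<open>The k-th eigenvalue (k = 1, 2, ...) is the least number such that the eigenvalues up to it,
  counted with multiplicity, are at least k in number.\<close>

definition dirichlet_eigenvalue :: "('a::t2_space, 'n::finite) rmfd \<Rightarrow> 'a set \<Rightarrow> nat \<Rightarrow> real" where
  "dirichlet_eigenvalue R N k =
     Inf {x. \<exists>S. finite S \<and> S \<subseteq> {..x} \<and> enat k \<le> (\<Sum>\<mu>\<in>S. dirichlet_mult R (mfd_interior R N) \<mu>)}"

end

theory Submission
  imports Defs "HOL-Library.Function_Algebras" "HOL-Library.Diagonal_Subsequence"
begin

text \<open>On the test functions of an open set \<open>\<Omega>\<close> avoiding the boundary consider the Dirichlet form
  a(f, g), the integral of the inner product of the gradients, and b(f, g), the integral of f g.
  Elements of H10 are represented by Cauchy sequences of test functions for a + b. By Rellich's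
  theorem a sequence bounded for a + b has a b-Cauchy subsequence, so the completed forms have as many
  eigenvectors as the space has dimensions, and the k-th Dirichlet eigenvalue of \<open>\<Omega>\<close> is the
  min-max value: the infimum of the x for which a is at most x b on some k-dimensional space of test
  functions. It decreases when \<open>\<Omega>\<close> grows. Finitely many test functions of the interior of M
  have their supports in one compact set K that does not meet the boundary; a path from K to the
  boundary has to leave a coordinate ball and so has length bounded below, hence K lies in the interior
  of M_t for small t. So every min-max bound for M is one for M_t, t small.\<close>

section \<open>Functions of class \<open>C\<^sup>k\<close>\<close>

text \<open>The definitions decide the shape of the proof. \<open>vol\<close> is a definite
  description, so a measure with the chart formula has to be built and shown unique before any
  integral can be computed. Gradient and Laplacian are evaluated at each point in an arbitrarily
  chosen chart, so even continuity of the Laplacian rests on chart independence; this is derived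
  weakly, from Green's formula in single charts. Eigenfunctions are given by a distributional
  equation, which the global Green formula turns into a relation between a and b. Charts reach up to
  the boundary but supports of test functions do not: functions are differentiated at interior
  points only, where chart ranges are open. Rellich's theorem comes directly from Poincare's
  inequality on small coordinate boxes, which may touch the boundary: the means over the boxes are
  finitely many functionals, and what they miss is small against a. Spaces of eigenvectors live in
  the completion and need not consist of test functions. Approximating them by test functions costs
  an arbitrarily small amount, which is why the upper half of the min-max principle carries an
  epsilon.\<close>

lemma Ck_on_cong:
  assumes "open S" "\<And>x. x \<in> S \<Longrightarrow> f x = g x" "Ck_on k S f"
  shows "Ck_on k S g"
  using assms
proof (induction k arbitrary: f g)
  case 0
  then show ?case by (simp cong: continuous_on_cong)
next
  case (Suc k)
  have d: "f differentiable (at x)" if "x \<in> S" for x using Suc.prems that by auto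
  have g: "g differentiable (at x)" if "x \<in> S" for x
    using d[OF that] Suc.prems(1,2) that
    by (meson differentiable_def has_derivative_transform_within_open)
  have e: "frechet_derivative f (at x) = frechet_derivative g (at x)" if "x \<in> S" for x
    by (rule frechet_derivative_transform_within_open[OF d[OF that] Suc.prems(1) that]) (use Suc.prems in auto)
  have "Ck_on k S (\<lambda>x. frechet_derivative g (at x) v)" for v
    by (rule Suc.IH[OF \<open>open S\<close>, of "\<lambda>x. frechet_derivative f (at x) v"]) (use Suc.prems e in auto)
  then show ?case using g by simp
qed

lemma Ck_on_subset: "Ck_on k T f \<Longrightarrow> S \<subseteq> T \<Longrightarrow> Ck_on k S f"
  by (induction k arbitrary: f) (auto intro: continuous_on_subset)

lemma Ck_on_SucD: "Ck_on (Suc k) S f \<Longrightarrow> Ck_on k S f"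
proof (induction k arbitrary: f)
  case 0
  then show ?case
    by (auto intro!: continuous_at_imp_continuous_on differentiable_imp_continuous_within)
next
  case (Suc k)
  then show ?case by (metis Ck_on.simps(2))
qed

lemma Ck_on_le: "Ck_on m S f \<Longrightarrow> k \<le> m \<Longrightarrow> Ck_on k S f"
  by (induction m) (auto simp: le_Suc_eq dest: Ck_on_SucD simp del: Ck_on.simps(2))

text \<open>Glued functions are shown to be smooth through this: one neighbourhood on which a
  formula holds, another on which the function vanishes.\<close>

lemma Ck_on_local:
  assumes "\<And>x. x \<in> S \<Longrightarrow> \<exists>W. open W \<and> x \<in> W \<and> Ck_on k W f"
  shows "Ck_on k S f"
  using assms
proof (induction k arbitrary: f)
  case 0
  show ?case unfolding Ck_on.simps continuous_on_eq_continuous_within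
  proof
    fix x assume "x \<in> S"
    with 0 obtain W where "open W" "x \<in> W" "continuous_on W f" by auto
    then have "continuous (at x) f" by (simp add: continuous_on_eq_continuous_at)
    then show "continuous (at x within S) f" by (rule continuous_at_imp_continuous_at_within)
  qed
next
  case (Suc k)
  have "Ck_on k S (\<lambda>x. frechet_derivative f (at x) v)" for v
    by (rule Suc.IH) (use Suc.prems in fastforce)
  moreover have "f differentiable (at x)" if "x \<in> S" for x using Suc.prems[OF that] by auto
  ultimately show ?case by simp
qed

lemma Ck_on_const [intro]: "Ck_on k S (\<lambda>x. c)"
  by (induction k arbitrary: c) auto

lemma Ck_on_bounded_linear: "bounded_linear f \<Longrightarrow> Ck_on k S f"
proof (cases k)
  case (Suc m)
  assume "bounded_linear f"
  then have d: "(f has_derivative f) (at x)" for x by (rule bounded_linear_imp_has_derivative)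
  then have "frechet_derivative f (at x) = f" for x by (metis frechet_derivative_at)
  then show ?thesis using Suc d by (auto simp: differentiable_def)
qed (auto intro: linear_continuous_on)

lemma Ck_on_compose_bounded_linear:
  assumes "open S" "bounded_linear L" "Ck_on k S f"
  shows "Ck_on k S (\<lambda>x. L (f x))"
  using assms(3)
proof (induction k arbitrary: f)
  case 0
  then show ?case using assms by (auto intro: bounded_linear.continuous_on)
next
  case (Suc k)
  have d: "((\<lambda>x. L (f x)) has_derivative (\<lambda>v. L (frechet_derivative f (at x) v))) (at x)" if "x \<in> S" for x
    using Suc.prems that by (auto intro!: bounded_linear.has_derivative[OF assms(2)] simp: frechet_derivative_works)
  have "Ck_on k S (\<lambda>x. frechet_derivative (\<lambda>x. L (f x)) (at x) v)" for v
    by (rule Ck_on_cong[OF assms(1) _ Suc.IH[of "\<lambda>x. frechet_derivative f (at x) v"]])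
      (use Suc.prems in \<open>auto simp: frechet_derivative_at[OF d, symmetric]\<close>)
  then show ?case using d by (auto simp: differentiable_def)
qed

text \<open>The product rule makes the derivative a sum, so the induction step has to add C^k
  functions; that closure property is passed in as the premise \<open>add\<close>.\<close>

lemma Ck_on_bilinear:
  assumes "open S" "bounded_bilinear B" "Ck_on k S f" "Ck_on k S g"
    and add: "\<And>k (f::real^'n \<Rightarrow> 'b) g. Ck_on k S f \<Longrightarrow> Ck_on k S g \<Longrightarrow> Ck_on k S (\<lambda>x. f x + g x)"
  shows "Ck_on k S (\<lambda>x. B (f x) (g x) :: 'b::real_normed_vector)"
  using assms(3,4)
proof (induction k arbitrary: f g)
  case 0
  then show ?case using assms by (auto intro: bounded_bilinear.continuous_on)
next
  case (Suc k)
  have d: "((\<lambda>x. B (f x) (g x)) has_derivative (\<lambda>v. B (f x) (frechet_derivative g (at x) v) + B (frechet_derivative f (at x) v) (g x))) (at x)"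
    if "x \<in> S" for x
    using Suc.prems that by (auto intro!: bounded_bilinear.FDERIV[OF assms(2)] simp: frechet_derivative_works)
  have "Ck_on k S (\<lambda>x. frechet_derivative (\<lambda>x. B (f x) (g x)) (at x) v)" for v
    by (rule Ck_on_cong[OF assms(1) _ add[OF Suc.IH[of f "\<lambda>x. frechet_derivative g (at x) v"]
         Suc.IH[of "\<lambda>x. frechet_derivative f (at x) v" g]]])
      (use Suc.prems Ck_on_SucD[OF Suc.prems(1)] Ck_on_SucD[OF Suc.prems(2)] in \<open>auto simp: frechet_derivative_at[OF d, symmetric]\<close>)
  then show ?case using d by (auto simp: differentiable_def)
qed

lemma Ck_on_add:
  assumes "open S" "Ck_on k S f" "Ck_on k S g"
  shows "Ck_on k S (\<lambda>x. f x + g x)"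
  using assms(2,3)
proof (induction k arbitrary: f g)
  case 0
  then show ?case by (auto intro: continuous_intros)
next
  case (Suc k)
  have d: "((\<lambda>x. f x + g x) has_derivative (\<lambda>v. frechet_derivative f (at x) v + frechet_derivative g (at x) v)) (at x)" if "x \<in> S" for x
    using Suc.prems that by (auto intro!: has_derivative_add simp: frechet_derivative_works)
  have "Ck_on k S (\<lambda>x. frechet_derivative (\<lambda>x. f x + g x) (at x) v)" for v
    by (rule Ck_on_cong[OF assms(1) _ Suc.IH[of "\<lambda>x. frechet_derivative f (at x) v" "\<lambda>x. frechet_derivative g (at x) v"]])
      (use Suc.prems in \<open>auto simp: frechet_derivative_at[OF d, symmetric]\<close>)
  then show ?case using d by (auto simp: differentiable_def)
qed

lemma Ck_on_mult:
  fixes f g :: "real^'n \<Rightarrow> real"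
  assumes "open S" "Ck_on k S f" "Ck_on k S g"
  shows "Ck_on k S (\<lambda>x. f x * g x)"
  by (rule Ck_on_bilinear[OF assms(1) bounded_bilinear_mult assms(2,3) Ck_on_add[OF assms(1)]])

lemma Ck_on_cmult:
  fixes f :: "real^'n \<Rightarrow> real"
  assumes "open S" "Ck_on k S f"
  shows "Ck_on k S (\<lambda>x. c * f x)"
  by (intro Ck_on_mult assms Ck_on_const)

lemma Ck_on_diff:
  fixes f g :: "real^'n \<Rightarrow> real"
  assumes "open S" "Ck_on k S f" "Ck_on k S g"
  shows "Ck_on k S (\<lambda>x. f x - g x)"
  using Ck_on_add[OF assms(1,2) Ck_on_cmult[OF assms(1,3), of "-1"]] by simp

lemma Ck_on_sum:
  assumes "open S" "\<And>i. i \<in> I \<Longrightarrow> Ck_on k S (f i)"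
  shows "Ck_on k S (\<lambda>x. \<Sum>i\<in>I. f i x)"
  using assms(2) by (induction I rule: infinite_finite_induct) (auto intro!: Ck_on_add assms(1))

lemma Ck_on_prod:
  fixes f :: "'i \<Rightarrow> real^'n \<Rightarrow> real"
  assumes "open S" "\<And>i. i \<in> I \<Longrightarrow> Ck_on k S (f i)"
  shows "Ck_on k S (\<lambda>x. \<Prod>i\<in>I. f i x)"
  using assms(2) by (induction I rule: infinite_finite_induct) (auto intro!: Ck_on_mult assms(1))

text \<open>The derivative of 1/f is a product of Df with two factors 1/f, so the induction
  hypothesis is applied to the same f and nothing is generalised.\<close>

lemma Ck_on_inverse:
  fixes f :: "real^'n \<Rightarrow> real"
  assumes "open S" "Ck_on k S f" "\<And>x. x \<in> S \<Longrightarrow> f x \<noteq> 0"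
  shows "Ck_on k S (\<lambda>x. inverse (f x))"
  using assms(2)
proof (induction k)
  case 0
  then show ?case using assms by (auto intro!: continuous_intros)
next
  case (Suc k)
  have d: "((\<lambda>x. inverse (f x)) has_derivative (\<lambda>v. - (inverse (f x) * frechet_derivative f (at x) v * inverse (f x)))) (at x)" if "x \<in> S" for x
    using Suc.prems that assms(3) by (auto intro!: has_derivative_inverse simp: frechet_derivative_works)
  have "Ck_on k S (\<lambda>x. frechet_derivative (\<lambda>x. inverse (f x)) (at x) v)" for v
    by (rule Ck_on_cong[OF assms(1), of "\<lambda>x. (-1) * (inverse (f x) * frechet_derivative f (at x) v * inverse (f x))"], 
        use frechet_derivative_at[OF d, symmetric] in simp, intro Ck_on_mult assms(1) Suc.IH Ck_on_const)
      (use Suc.prems Ck_on_SucD[OF Suc.prems] in auto)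
  then show ?case using d by (auto simp: differentiable_def)
qed

lemma Ck_on_divide:
  fixes f :: "real^'n \<Rightarrow> real"
  assumes "open S" "Ck_on k S f" "Ck_on k S g" "\<And>x. x \<in> S \<Longrightarrow> g x \<noteq> 0"
  shows "Ck_on k S (\<lambda>x. f x / g x)"
  unfolding divide_inverse by (intro Ck_on_mult Ck_on_inverse assms)

lemma Ck_on_sqrt:
  fixes f :: "real^'n \<Rightarrow> real"
  assumes "open S" "Ck_on k S f" "\<And>x. x \<in> S \<Longrightarrow> f x > 0"
  shows "Ck_on k S (\<lambda>x. sqrt (f x))"
  using assms(2)
proof (induction k)
  case 0
  then show ?case using assms by (auto intro!: continuous_intros)
next
  case (Suc k)
  have d: "((\<lambda>x. sqrt (f x)) has_derivative (\<lambda>v. inverse (sqrt (f x)) / 2 * frechet_derivative f (at x) v)) (at x)" if "x \<in> S" for x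
  proof -
    have "(f has_derivative frechet_derivative f (at x)) (at x)"
      using Suc.prems that by (auto simp: frechet_derivative_works)
    from has_derivative_compose[OF this, of sqrt "(*) (inverse (sqrt (f x)) / 2)"]
    show ?thesis using DERIV_real_sqrt[OF assms(3)[OF that]] unfolding has_field_derivative_def by simp
  qed
  have "Ck_on k S (\<lambda>x. frechet_derivative (\<lambda>x. sqrt (f x)) (at x) v)" for v
    by (rule Ck_on_cong[OF assms(1), of "\<lambda>x. (inverse (sqrt (f x)) * (1/2) * frechet_derivative f (at x) v)"], 
        use frechet_derivative_at[OF d, symmetric] in simp, intro Ck_on_mult assms(1) Ck_on_inverse Suc.IH Ck_on_const)
      (use Suc.prems Ck_on_SucD[OF Suc.prems] assms(3) in \<open>auto dest!: assms(3)\<close>)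
  then show ?case using d by (auto simp: differentiable_def)
qed

lemma Ck_on_component:
  assumes "open S" "Ck_on k S f"
  shows "Ck_on k S (\<lambda>x. f x $ i)"
  by (rule Ck_on_compose_bounded_linear[OF assms(1) bounded_linear_vec_nth assms(2)])

lemma frechet_derivative_cart_sum:
  fixes f :: "real^'m \<Rightarrow> 'b::real_normed_vector"
  assumes "f differentiable (at x within S)"
  shows "frechet_derivative f (at x within S) v = (\<Sum>i\<in>UNIV. v $ i *\<^sub>R frechet_derivative f (at x within S) (axis i 1))"
proof -
  have l: "linear (frechet_derivative f (at x within S))" using assms by (rule linear_frechet_derivative)
  have "frechet_derivative f (at x within S) v = frechet_derivative f (at x within S) (\<Sum>i\<in>UNIV. v $ i *\<^sub>R axis i 1)"
    by (simp add: basis_expansion[of v, unfolded scalar_mult_eq_scaleR])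
  then show ?thesis by (simp add: linear_sum[OF l] linear_cmul[OF l])
qed

text \<open>In coordinates the chain rule is a sum of products of a component of Df with a partial
  derivative of g along f. The partial derivatives are new outer functions, hence the induction over
  arbitrary g with f fixed.\<close>

lemma Ck_on_compose:
  fixes g :: "real^'m \<Rightarrow> real" and f :: "real^'n \<Rightarrow> real^'m"
  assumes "open S" "open T" "Ck_on k S f" "Ck_on k T g" "f ` S \<subseteq> T"
  shows "Ck_on k S (\<lambda>x. g (f x))"
  using assms(3,4)
proof (induction k arbitrary: g)
  case 0
  then show ?case using assms(5) by (auto intro: continuous_on_compose2)
next
  case (Suc k)
  have fx: "f x \<in> T" if "x \<in> S" for x using assms(5) that by auto
  have d: "((\<lambda>x. g (f x)) has_derivative (\<lambda>v. frechet_derivative g (at (f x)) (frechet_derivative f (at x) v))) (at x)" if "x \<in> S" for x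
    using has_derivative_compose[of f "frechet_derivative f (at x)" x UNIV g] Suc.prems that fx[OF that]
    by (auto simp: frechet_derivative_works)
  have "Ck_on k S (\<lambda>x. frechet_derivative (\<lambda>x. g (f x)) (at x) v)" for v
  proof (rule Ck_on_cong[OF assms(1)])
    show "Ck_on k S (\<lambda>x. \<Sum>i\<in>UNIV. frechet_derivative f (at x) v $ i * frechet_derivative g (at (f x)) (axis i 1))"
      by (intro Ck_on_sum Ck_on_mult assms(1) Ck_on_component Suc.IH[of "\<lambda>y. frechet_derivative g (at y) (axis _ 1)"])
        (use Suc.prems Ck_on_SucD[OF Suc.prems(1)] in auto)
    fix x assume x: "x \<in> S"
    show "(\<Sum>i\<in>UNIV. frechet_derivative f (at x) v $ i * frechet_derivative g (at (f x)) (axis i 1)) =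
         frechet_derivative (\<lambda>x. g (f x)) (at x) v"
      unfolding frechet_derivative_at[OF d[OF x], symmetric]
      by (subst (2) frechet_derivative_cart_sum) (use Suc.prems fx[OF x] in auto)
  qed
  then show ?case using d by (auto simp: differentiable_def)
qed

lemma smooth_onD:
  assumes "smooth_on S f" "x \<in> S"
  shows "\<exists>W F. open W \<and> x \<in> W \<and> (\<forall>k. Ck_on k W F) \<and> (\<forall>y\<in>W \<inter> S. F y = f y)"
  by (rule bspec[OF assms(1)[unfolded smooth_on_def] assms(2)])

text \<open>On open sets local extendability adds nothing, so smoothness there can be handled by the
  closure rules for \<open>Ck_on\<close>.\<close>

lemma smooth_on_open_iff:
  assumes "open S"
  shows "smooth_on S f \<longleftrightarrow> (\<forall>k. Ck_on k S f)"
proof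
  assume l: "smooth_on S f"
  show "\<forall>k. Ck_on k S f"
  proof (intro allI Ck_on_local)
    fix k x assume "x \<in> S"
    from smooth_onD[OF l \<open>x \<in> S\<close>] obtain W F where W: "open W \<and> x \<in> W \<and> (\<forall>k. Ck_on k W F) \<and> (\<forall>y\<in>W \<inter> S. F y = f y)"
      by (elim exE)
    have "Ck_on k (W \<inter> S) f"
      by (rule Ck_on_cong[of _ F]) (use W assms Ck_on_subset[of k W F "W \<inter> S"] in auto)
    then show "\<exists>W. open W \<and> x \<in> W \<and> Ck_on k W f" using W \<open>x \<in> S\<close> assms by (intro exI[of _ "W \<inter> S"]) auto
  qed
next
  assume "\<forall>k. Ck_on k S f"
  then show "smooth_on S f" unfolding smooth_on_def using assms by (intro ballI exI[of _ S] exI[of _ f]) simp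
qed

lemma smooth_on_subset:
  assumes "smooth_on T f" "S \<subseteq> T"
  shows "smooth_on S f"
  unfolding smooth_on_def
proof
  fix x assume "x \<in> S"
  then have "x \<in> T" using assms(2) by auto
  from smooth_onD[OF assms(1) this]
  obtain W F where "open W \<and> x \<in> W \<and> (\<forall>k. Ck_on k W F) \<and> (\<forall>y\<in>W \<inter> T. F y = f y)"
    by (elim exE)
  then show "\<exists>W F. open W \<and> x \<in> W \<and> (\<forall>k. Ck_on k W F) \<and> (\<forall>y\<in>W \<inter> S. F y = f y)"
    using assms(2) by (intro exI[of _ W] exI[of _ F]) auto
qed

lemma smooth_on_Ck_on:
  assumes "smooth_on T f" "open S" "S \<subseteq> T"
  shows "Ck_on k S f"
  using smooth_on_subset[OF assms(1,3)] smooth_on_open_iff[OF assms(2), of f] by simp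

lemma smooth_on_differentiable:
  assumes "smooth_on S f" "x \<in> S"
  shows "f differentiable (at x within S)"
proof -
  from smooth_onD[OF assms] obtain W F where W: "open W \<and> x \<in> W \<and> (\<forall>k. Ck_on k W F) \<and> (\<forall>y\<in>W \<inter> S. F y = f y)"
    by (elim exE)
  have "Ck_on (Suc 0) W F" using W by blast
  then have "\<forall>x\<in>W. F differentiable (at x)" by simp
  then have "F differentiable (at x)" using W by blast
  then have "(F has_derivative frechet_derivative F (at x)) (at x within S)"
    by (metis frechet_derivative_works has_derivative_at_withinI)
  then have "(f has_derivative frechet_derivative F (at x)) (at x within S)"
  proof (rule has_derivative_transform_eventually)
    show "\<forall>\<^sub>F y in at x within S. F y = f y"
      unfolding eventually_at_topological using W by (intro exI[of _ W]) auto
  qed (use W assms in auto)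
  then show ?thesis unfolding differentiable_def by blast
qed

lemma smooth_on_continuous_on: "smooth_on S f \<Longrightarrow> continuous_on S f"
  unfolding continuous_on_eq_continuous_within
  by (intro ballI differentiable_imp_continuous_within smooth_on_differentiable)

section \<open>Bump functions and positive definite matrices\<close>

text \<open>The family is closed under differentiation: the derivative of expk k is expk (k + 2) - k * expk (k + 1).\<close>

definition expk :: "nat \<Rightarrow> real \<Rightarrow> real" where
  "expk k t = (if 0 < t then exp (- (1 / t)) / t ^ k else 0)"

text \<open>With t replaced by 1/t the right-hand limit is the decay of t^k exp(-t) at
  infinity.\<close>

lemma expk_tendsto_0: "(expk k \<longlongrightarrow> 0) (at 0)"
proof -
  have "((\<lambda>t::real. t ^ k * exp (- t)) \<longlongrightarrow> 0) at_top"
    using tendsto_power_div_exp_0[of k] by (simp add: exp_minus divide_inverse)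
  then have "((\<lambda>t::real. (inverse t) ^ k * exp (- inverse t)) \<longlongrightarrow> 0) (at_right 0)"
    by (rule filterlim_compose[OF _ filterlim_inverse_at_top_right])
  moreover have "\<forall>\<^sub>F t in at_right (0::real). (inverse t) ^ k * exp (- inverse t) = expk k t"
    unfolding expk_def by (auto simp: eventually_at_filter divide_simps)
  ultimately have r: "(expk k \<longlongrightarrow> 0) (at_right 0)"
    by (rule Lim_transform_eventually)
  have "\<forall>\<^sub>F t in at_left (0::real). 0 = expk k t"
    unfolding expk_def by (auto simp: eventually_at_filter)
  then have "(expk k \<longlongrightarrow> 0) (at_left 0)"
    by (rule Lim_transform_eventually[OF tendsto_const])
  with r show ?thesis by (simp add: filterlim_at_split)
qed

lemma DERIV_expk: "(expk k has_real_derivative (expk (k + 2) t - k * expk (k + 1) t)) (at t)"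
proof (cases "t = 0")
  case False
  show ?thesis
  proof (cases "t > 0")
    case True
    have "((\<lambda>t. exp (- (1 / t)) / t ^ k) has_real_derivative (expk (k + 2) t - k * expk (k + 1) t)) (at t)"
      using True by (auto intro!: derivative_eq_intros simp: expk_def power2_eq_square)
        (cases k; simp add: field_simps power2_eq_square)
    then show ?thesis
      by (rule has_field_derivative_transform_within_open[of _ _ _ "{0<..}"]) (use True in \<open>auto simp: expk_def\<close>)
  next
    case F: False
    have "((\<lambda>t. 0) has_real_derivative (expk (k + 2) t - k * expk (k + 1) t)) (at t)"
      using F by (auto simp: expk_def)
    then show ?thesis
      by (rule has_field_derivative_transform_within_open[of _ _ _ "{..<0}"]) (use F False in \<open>auto simp: expk_def\<close>)
  qed
next
  case True
  \<comment> \<open>The difference quotient at 0 is itself a member of the family, so its limit is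
    0, which is also the claimed derivative there.\<close>
  have "(\<lambda>h. (expk k (0 + h) - expk k 0) / h) = expk (Suc k)"
    by (auto simp: expk_def fun_eq_iff)
  then show ?thesis using expk_tendsto_0[of "Suc k"] True
    by (simp add: DERIV_def expk_def[of _ 0])
qed

lemma Ck_on_expk:
  assumes "open S" "\<And>m. Ck_on m S q"
  shows "Ck_on m S (\<lambda>y. expk k (q y))"
proof (induction m arbitrary: k)
  case 0
  have "continuous_on UNIV (expk k)"
    by (intro continuous_at_imp_continuous_on ballI) (rule DERIV_isCont[OF DERIV_expk])
  then show ?case using assms(2)[of 0] by (auto intro: continuous_on_compose2)
next
  case (Suc m)
  have d: "((\<lambda>y. expk k (q y)) has_derivative
      (\<lambda>v. (expk (k + 2) (q y) - k * expk (k + 1) (q y)) * frechet_derivative q (at y) v)) (at y)"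
    if "y \<in> S" for y
  proof -
    have "(q has_derivative frechet_derivative q (at y)) (at y)"
      using assms(2)[of 1] that by (auto simp: frechet_derivative_works)
    from has_derivative_compose[OF this, of "expk k" "(*) (expk (k + 2) (q y) - k * expk (k + 1) (q y))"]
    show ?thesis using DERIV_expk[of k "q y"] unfolding has_field_derivative_def by simp
  qed
  have "Ck_on m S (\<lambda>x. frechet_derivative (\<lambda>y. expk k (q y)) (at x) v)" for v
  proof (rule Ck_on_cong[OF assms(1)])
    show "Ck_on m S (\<lambda>y. (expk (k + 2) (q y) - k * expk (k + 1) (q y)) * frechet_derivative q (at y) v)"
      using assms(2)[of "Suc m"] by (intro Ck_on_mult Ck_on_diff Ck_on_cmult Suc.IH assms(1)) auto
  qed (simp add: frechet_derivative_at[OF d, symmetric])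
  then show ?case using d by (auto simp: differentiable_def)
qed

text \<open>Built from the square of the norm, a polynomial in the coordinates, so that the centre
  needs no special care.\<close>

definition bump :: "real^'n \<Rightarrow> real \<Rightarrow> real^'n \<Rightarrow> real" where
  "bump x r y = expk 0 (r\<^sup>2 - (norm (y - x))\<^sup>2)"

lemma Ck_on_bump: "Ck_on k UNIV (bump x r)"
proof -
  have c: "Ck_on m UNIV (\<lambda>y. y $ i - x $ i)" for m i
    by (intro Ck_on_diff open_UNIV Ck_on_const Ck_on_bounded_linear bounded_linear_vec_nth)
  have "(norm (y - x))\<^sup>2 = (\<Sum>i\<in>UNIV. (y $ i - x $ i) * (y $ i - x $ i))" for y
    unfolding power2_norm_eq_inner inner_vec_def by simp
  then have "bump x r = (\<lambda>y. expk 0 (r\<^sup>2 - (\<Sum>i\<in>UNIV. (y $ i - x $ i) * (y $ i - x $ i))))"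
    by (auto simp: bump_def)
  then show ?thesis
    by (simp only:) (intro Ck_on_expk Ck_on_diff Ck_on_sum Ck_on_mult c open_UNIV Ck_on_const)
qed

lemma bump_nonneg: "0 \<le> bump x r y" by (auto simp: bump_def expk_def)

lemma bump_pos: "norm (y - x) < r \<Longrightarrow> 0 < bump x r y"
  by (auto simp: bump_def expk_def intro!: power_strict_mono)

lemma bump_zero: "0 < r \<Longrightarrow> r \<le> norm (y - x) \<Longrightarrow> bump x r y = 0"
  by (auto simp: bump_def expk_def not_less intro!: power_mono)

section \<open>Inverses and determinants of positive definite matrices\<close>

lemma matrix_inv_eqI:
  fixes A B :: "real^'n^'n"
  assumes "A ** B = mat 1" "B ** A = mat 1"
  shows "matrix_inv A = B"
proof -
  have "A ** matrix_inv A = mat 1 \<and> matrix_inv A ** A = mat 1"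
    unfolding matrix_inv_def by (rule someI[of _ B]) (use assms in simp)
  then show ?thesis by (metis assms(2) matrix_mul_assoc matrix_mul_lid matrix_mul_rid)
qed

lemma matrix_inv_inverse:
  fixes A :: "real^'n^'n"
  assumes "invertible A"
  shows matrix_inv_right: "A ** matrix_inv A = mat 1" and matrix_inv_left: "matrix_inv A ** A = mat 1"
proof -
  obtain B where B: "A ** B = mat 1" "B ** A = mat 1" using assms unfolding invertible_def by blast
  then show "A ** matrix_inv A = mat 1" "matrix_inv A ** A = mat 1" using matrix_inv_eqI[OF B] by auto
qed

text \<open>Cramer's rule exhibits the entries of the inverse as quotients of polynomials in the
  entries of the matrix; smoothness and continuity of the inverse metric are read off from
  it.\<close>

lemma matrix_inv_cramer:
  fixes A :: "real^'n^'n"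
  assumes "det A \<noteq> 0"
  shows "matrix_inv A $ i $ j = det (\<chi> a b. if b = i then axis j 1 $ a else A $ a $ b) / det A"
proof -
  have "invertible A" using assms by (simp add: invertible_det_nz)
  then have "A *v (matrix_inv A *v axis j 1) = axis j 1"
    by (simp add: matrix_vector_mul_assoc matrix_inv_right)
  then have "matrix_inv A *v axis j 1 = (\<chi> k. det (\<chi> a b. if b = k then axis j 1 $ a else A $ a $ b) / det A)"
    by (subst (asm) cramer[OF assms]) simp
  moreover have "matrix_inv A $ i $ j = (matrix_inv A *v axis j 1) $ i"
    by (simp add: matrix_vector_mult_basis column_def)
  ultimately show ?thesis by simp
qed

lemma Ck_on_det:
  fixes A :: "real^'n \<Rightarrow> real^'m^'m"
  assumes "open S" "\<And>i j. Ck_on k S (\<lambda>x. A x $ i $ j)"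
  shows "Ck_on k S (\<lambda>x. det (A x))"
  unfolding det_def by (intro Ck_on_sum Ck_on_mult Ck_on_prod Ck_on_const assms)

lemma Ck_on_matrix_inv:
  fixes A :: "real^'n \<Rightarrow> real^'m^'m"
  assumes "open S" "\<And>i j. Ck_on k S (\<lambda>x. A x $ i $ j)" "\<And>x. x \<in> S \<Longrightarrow> det (A x) \<noteq> 0"
  shows "Ck_on k S (\<lambda>x. matrix_inv (A x) $ i $ j)"
proof (rule Ck_on_cong[OF assms(1)])
  have "Ck_on k S (\<lambda>x. if b = i then axis j 1 $ a else A x $ a $ b)" for a b
    using assms(2) by (cases "b = i") (auto intro: Ck_on_const)
  then show "Ck_on k S (\<lambda>x. det (\<chi> a b. if b = i then axis j 1 $ a else A x $ a $ b) / det (A x))"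
    by (intro Ck_on_divide Ck_on_det assms) simp_all
qed (simp add: matrix_inv_cramer assms(3))

lemma continuous_on_matrix_inv:
  fixes A :: "real^'n \<Rightarrow> real^'m^'m"
  assumes "continuous_on S A" "\<And>x. x \<in> S \<Longrightarrow> det (A x) \<noteq> 0"
  shows "continuous_on S (\<lambda>x. matrix_inv (A x) $ i $ j)"
proof -
  have "continuous_on S (\<lambda>x. if b = i then axis j 1 $ a else A x $ a $ b)" for a b
    using assms(1) by (cases "b = i") (auto intro: continuous_intros)
  then have "continuous_on S (\<lambda>x. det (\<chi> a b. if b = i then axis j 1 $ a else A x $ a $ b) / det (A x))"
    using assms unfolding det_def by (intro continuous_intros) (auto simp: det_def)
  then show ?thesis by (simp add: matrix_inv_cramer assms(2) cong: continuous_on_cong)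
qed

definition posdef :: "real^'n^'n \<Rightarrow> bool" where
  "posdef A \<longleftrightarrow> (\<forall>v. v \<noteq> 0 \<longrightarrow> 0 < v \<bullet> (A *v v))"

lemma posdef_det_nz: "posdef A \<Longrightarrow> det A \<noteq> 0"
  unfolding posdef_def invertible_det_nz[symmetric] matrix_left_invertible_ker invertible_left_inverse
  by (metis inner_zero_right less_irrefl)

text \<open>On the segment from the identity to A every matrix is positive definite and so has
  non-zero determinant; by continuity the determinant keeps the sign it has at the identity.\<close>

lemma posdef_det_pos:
  fixes A :: "real^'n^'n"
  assumes "posdef A"
  shows "det A > 0"
proof (rule ccontr)
  assume n: "\<not> det A > 0"
  define B where "B = (\<lambda>t::real. (1 - t) *\<^sub>R mat 1 + t *\<^sub>R A)"
  have pd: "posdef (B t)" if "0 \<le> t" "t \<le> 1" for t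
    unfolding posdef_def
  proof (intro allI impI)
    fix v :: "real^'n" assume v: "v \<noteq> 0"
    have "v \<bullet> (B t *v v) = (1 - t) * (v \<bullet> v) + t * (v \<bullet> (A *v v))"
      unfolding B_def
      by (simp add: matrix_vector_mult_add_rdistrib scaleR_matrix_vector_assoc[symmetric] inner_add_right)
    moreover have "0 < v \<bullet> v" "0 < v \<bullet> (A *v v)" using v assms by (auto simp: posdef_def)
    ultimately show "0 < v \<bullet> (B t *v v)" using that
      by (cases "t = 0") (auto intro!: add_nonneg_pos mult_nonneg_nonneg)
  qed
  have "continuous_on {0..1} (\<lambda>t. det (B t))"
    unfolding B_def det_def by (intro continuous_intros)
  moreover have "det (B 0) = 1" "det (B 1) = det A" by (auto simp: B_def)
  ultimately obtain t where "0 \<le> t" "t \<le> 1" "det (B t) = 0"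
    using IVT2'[of "\<lambda>t. det (B t)" 1 0 0] n by auto
  with pd posdef_det_nz show False by blast
qed

lemma posdef_matrix_inv:
  fixes A :: "real^'n^'n"
  assumes "posdef A" "transpose A = A"
  shows "posdef (matrix_inv A)" "transpose (matrix_inv A) = matrix_inv A"
proof -
  have i: "invertible A" using posdef_det_nz[OF assms(1)] by (simp add: invertible_det_nz)
  show t: "transpose (matrix_inv A) = matrix_inv A"
  proof (rule matrix_inv_eqI[symmetric])
    show "A ** transpose (matrix_inv A) = mat 1"
      by (metis assms(2) i matrix_inv_left matrix_transpose_mul transpose_mat)
    show "transpose (matrix_inv A) ** A = mat 1"
      by (metis assms(2) i matrix_inv_right matrix_transpose_mul transpose_mat)
  qed
  show "posdef (matrix_inv A)" unfolding posdef_def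
  proof (intro allI impI)
    fix v :: "real^'n" assume v: "v \<noteq> 0"
    define w where "w = matrix_inv A *v v"
    have vw: "v = A *v w" unfolding w_def by (simp add: matrix_vector_mul_assoc matrix_inv_right[OF i])
    then have "w \<noteq> 0" using v by auto
    then have "0 < w \<bullet> (A *v w)" using assms(1) by (auto simp: posdef_def)
    then show "0 < v \<bullet> (matrix_inv A *v v)" unfolding w_def[symmetric] vw[symmetric] by (simp add: inner_commute)
  qed
qed

text \<open>Compactness of Q times the unit sphere yields the minimum, homogeneity extends it to all
  vectors. For the inverse metric this compares energies with Euclidean ones, for the metric it
  compares lengths of curves.\<close>

lemma posdef_lower_bound:
  fixes G :: "real^'n \<Rightarrow> real^'n^'n"
  assumes Q: "compact Q" and G: "\<And>i j. continuous_on Q (\<lambda>x. G x $ i $ j)" "\<And>x. x \<in> Q \<Longrightarrow> posdef (G x)"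
  shows "\<exists>m>0. \<forall>x\<in>Q. \<forall>\<xi>. m * (\<xi> \<bullet> \<xi>) \<le> \<xi> \<bullet> (G x *v \<xi>)"
proof (cases "Q = {}")
  case True then show ?thesis by (intro exI[of _ 1]) simp
next
  case False
  let ?S = "Q \<times> sphere (0::real^'n) 1"
  let ?q = "\<lambda>t::(real^'n) \<times> (real^'n). snd t \<bullet> (G (fst t) *v snd t)"
  have g: "continuous_on ?S (\<lambda>t. G (fst t) $ i $ j)" for i j
    by (rule continuous_on_compose2[OF G(1)]) (auto intro: continuous_intros)
  have s: "continuous_on ?S (\<lambda>t. snd t $ i)" for i by (intro continuous_intros)
  have cq: "continuous_on ?S ?q" unfolding inner_vec_def matrix_vector_mult_def
    by (simp, intro continuous_on_sum continuous_on_mult g s)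
  have "sphere (0::real^'n) 1 \<noteq> {}" by (simp add: sphere_eq_empty)
  then have "?S \<noteq> {}" using False by simp
  moreover have "compact ?S" by (intro compact_Times Q(1) compact_sphere)
  ultimately obtain t where t: "t \<in> ?S" "\<And>s. s \<in> ?S \<Longrightarrow> ?q t \<le> ?q s" using continuous_attains_inf[OF _ _ cq] by blast
  have "fst t \<in> Q" "snd t \<noteq> 0" using t(1) by (auto simp: mem_Times_iff)
  then have "0 < ?q t" using G(2)[of "fst t"] by (simp add: posdef_def)
  moreover have "?q t * (\<xi> \<bullet> \<xi>) \<le> \<xi> \<bullet> (G x *v \<xi>)" if x: "x \<in> Q" for x \<xi>
  proof (cases "\<xi> = 0")
    case False
    have "?q t \<le> ?q (x, (1 / norm \<xi>) *\<^sub>R \<xi>)" using x False by (intro t(2)) simp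
    also have "\<dots> = (\<xi> \<bullet> (G x *v \<xi>)) / (\<xi> \<bullet> \<xi>)"
      using False by (simp add: matrix_vector_mult_scaleR power2_norm_eq_inner[symmetric] power2_eq_square)
    finally show ?thesis using False by (simp add: field_simps)
  qed simp
  ultimately show ?thesis by blast
qed

section \<open>Charts\<close>

lemma closed_halfspace: "closed (halfspace :: (real^'n) set)"
proof -
  show ?thesis unfolding halfspace_def by (intro closed_Collect_le continuous_intros)
qed

lemma open_pos: "open {x::real^'n. 0 < x $ bdi}"
  by (intro open_Collect_less continuous_intros)

lemma interior_halfspace: "interior (halfspace :: (real^'n) set) = {x. 0 < x $ bdi}"
proof -
  have h: "(halfspace :: (real^'n) set) = {x. axis bdi 1 \<bullet> x \<ge> 0}"
    by (auto simp: halfspace_def inner_axis inner_commute)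
  show ?thesis unfolding h
    by (subst interior_halfspace_ge) (auto simp: inner_axis inner_commute axis_eq_0_iff)
qed

text \<open>Chart ranges are relatively open in the half-space, so derivatives within a range and
  within the half-space agree.\<close>

lemma at_within_openin:
  assumes "openin (top_of_set T) S" "x \<in> S"
  shows "at x within S = at x within T"
proof -
  obtain W where W: "open W" "S = T \<inter> W" using assms(1) by (auto simp: openin_open)
  show ?thesis by (rule at_within_nhd[of x W]) (use W assms(2) in auto)
qed

lemma matrix_works_real: "linear f \<Longrightarrow> matrix f *v x = f (x :: real^'n) " for f :: "real^'n \<Rightarrow> real^'m"
  by (simp add: matrix_works linear_matrix_vector_mul_eq)

lemma inner_matrix_left: "(A *v v) \<bullet> w = v \<bullet> (transpose A *v w)" for A :: "real^'n^'m"
  by (simp only: dot_lmul_matrix[symmetric] vector_transpose_matrix)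

locale compact_riemannian_mfd =
  fixes R :: "('a::t2_space, 'n::finite) rmfd"
  assumes compact_riemannian: "compact_riemannian R"
begin

definition inn :: "'a set" where "inn = pts R - bdry R"

text \<open>The part of the range away from the boundary hyperplane. It is open in the whole space,
  so ordinary derivatives replace those within the half-space.\<close>

definition uset :: "('a, 'n) chart \<Rightarrow> (real^'n) set" where
  "uset c = {x \<in> crange c. 0 < x $ bdi}"

definition overlap :: "('a, 'n) chart \<Rightarrow> ('a, 'n) chart \<Rightarrow> (real^'n) set" where
  "overlap c c' = coord c ` (cdom c \<inter> cdom c')"

definition trans :: "('a, 'n) chart \<Rightarrow> ('a, 'n) chart \<Rightarrow> real^'n \<Rightarrow> real^'n" where
  "trans c c' = coord c' \<circ> param c"

definition jac :: "('a, 'n) chart \<Rightarrow> ('a, 'n) chart \<Rightarrow> real^'n \<Rightarrow> real^'n^'n" where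
  "jac c c' x = matrix (frechet_derivative (trans c c') (at x within halfspace))"

lemma compact_pts: "compact (pts R)" and atlas: "smooth_atlas (pts R) (atlas R)"
  and metric: "riemannian_metric R"
  using compact_riemannian by (auto simp: compact_riemannian_def)

lemma cdom_cover: "(\<Union>c\<in>atlas R. cdom c) = pts R"
  using atlas by (simp add: smooth_atlas_def)

lemma cdom_subset: "c \<in> atlas R \<Longrightarrow> cdom c \<subseteq> pts R"
  using cdom_cover by blast

lemma openin_cdom: "c \<in> atlas R \<Longrightarrow> openin (top_of_set (pts R)) (cdom c)"
  using atlas by (simp add: smooth_atlas_def)

lemma openin_crange: "c \<in> atlas R \<Longrightarrow> openin (top_of_set halfspace) (crange c)"
  using atlas by (simp add: smooth_atlas_def)

lemma homeo: "c \<in> atlas R \<Longrightarrow> homeomorphism (cdom c) (crange c) (coord c) (param c)"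
  using atlas by (simp add: smooth_atlas_def)

lemma crange_subset: "c \<in> atlas R \<Longrightarrow> crange c \<subseteq> halfspace"
  using openin_crange openin_imp_subset by blast

lemma param_coord [simp]: "c \<in> atlas R \<Longrightarrow> p \<in> cdom c \<Longrightarrow> param c (coord c p) = p"
  using homeo[of c] unfolding homeomorphism_def by blast

lemma coord_param [simp]: "x \<in> crange c \<Longrightarrow> coord c (param c x) = x"
  by (simp add: f_inv_into_f)

lemma param_in [simp]: "x \<in> crange c \<Longrightarrow> param c x \<in> cdom c"
  by (simp add: inv_into_into)

lemma continuous_coord: "c \<in> atlas R \<Longrightarrow> continuous_on (cdom c) (coord c)"
  and continuous_param: "c \<in> atlas R \<Longrightarrow> continuous_on (crange c) (param c)"
  using homeo[of c] unfolding homeomorphism_def by blast+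

lemma inj_coord: "c \<in> atlas R \<Longrightarrow> inj_on (coord c) (cdom c)"
  by (metis inj_onI param_coord)

lemma chart_exists: "p \<in> pts R \<Longrightarrow> \<exists>c\<in>atlas R. p \<in> cdom c"
  using cdom_cover by blast

lemma chart_at: "p \<in> pts R \<Longrightarrow> chart_at R p \<in> atlas R \<and> p \<in> cdom (chart_at R p)"
  unfolding chart_at_def by (rule someI_ex) (use chart_exists in blast)

lemma uset_subset: "uset c \<subseteq> crange c" by (auto simp: uset_def)

lemma open_uset: assumes "c \<in> atlas R" shows "open (uset c)"
proof -
  obtain W where W: "open W" "crange c = halfspace \<inter> W"
    using openin_crange[OF assms] by (auto simp: openin_open)
  have "uset c = W \<inter> {x. 0 < x $ bdi}" unfolding uset_def W(2) by (auto simp: halfspace_def)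
  then show ?thesis using open_Int[OF W(1) open_pos] by simp
qed

lemma openin_coord_image:
  assumes "c \<in> atlas R" "openin (top_of_set (pts R)) N" "N \<subseteq> cdom c"
  shows "openin (top_of_set halfspace) (coord c ` N)"
proof -
  have "openin (top_of_set (cdom c)) N"
    using assms cdom_subset by (meson openin_subset_trans)
  then have "openin (top_of_set (crange c)) (coord c ` N)"
    using homeomorphism_imp_open_map[OF homeo[OF assms(1)]] by blast
  then show ?thesis using openin_crange[OF assms(1)] openin_trans by blast
qed

lemma openin_param_image:
  assumes "c \<in> atlas R" "openin (top_of_set halfspace) W" "W \<subseteq> crange c"
  shows "openin (top_of_set (pts R)) (param c ` W)"
proof -
  have "openin (top_of_set (crange c)) W"
    using assms crange_subset by (meson openin_subset_trans)
  then have "openin (top_of_set (cdom c)) (param c ` W)"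
    using homeomorphism_imp_open_map[OF homeo[OF assms(1), THEN homeomorphism_symD]] by blast
  then show ?thesis using openin_cdom[OF assms(1)] openin_trans by blast
qed

lemma openin_overlap: "c \<in> atlas R \<Longrightarrow> c' \<in> atlas R \<Longrightarrow> openin (top_of_set halfspace) (overlap c c')"
  unfolding overlap_def by (intro openin_coord_image) (auto intro: openin_Int openin_cdom)

lemma overlap_subset: "overlap c c' \<subseteq> crange c" by (auto simp: overlap_def)

lemma mem_overlap: "c \<in> atlas R \<Longrightarrow> x \<in> overlap c c' \<longleftrightarrow> x \<in> crange c \<and> param c x \<in> cdom c'"
  by (auto simp: overlap_def)

lemma smooth_trans: "c \<in> atlas R \<Longrightarrow> c' \<in> atlas R \<Longrightarrow> smooth_on (overlap c c') (trans c c')"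
  using atlas by (simp add: smooth_atlas_def overlap_def trans_def)

lemma trans_in: "c \<in> atlas R \<Longrightarrow> x \<in> overlap c c' \<Longrightarrow> trans c c' x \<in> overlap c' c"
  by (auto simp: overlap_def trans_def)

lemma param_trans: "c \<in> atlas R \<Longrightarrow> c' \<in> atlas R \<Longrightarrow> x \<in> overlap c c' \<Longrightarrow> param c' (trans c c' x) = param c x"
  by (auto simp: overlap_def trans_def)

lemma trans_trans: "c \<in> atlas R \<Longrightarrow> c' \<in> atlas R \<Longrightarrow> x \<in> overlap c c' \<Longrightarrow> trans c' c (trans c c' x) = x"
  by (auto simp: overlap_def trans_def)

lemma inj_trans: "c \<in> atlas R \<Longrightarrow> c' \<in> atlas R \<Longrightarrow> inj_on (trans c c') (overlap c c')"
  by (metis inj_onI trans_trans)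

text \<open>Invariance of domain: the image of the interior part of the overlap is open and
  contained in the half-space, hence in its interior. So being a boundary point does not depend on
  the chart.\<close>

lemma trans_pos:
  assumes c: "c \<in> atlas R" "c' \<in> atlas R" and x: "x \<in> overlap c c'" "0 < x $ bdi"
  shows "0 < trans c c' x $ bdi"
proof -
  define V where "V = overlap c c' \<inter> {x. 0 < x $ bdi}"
  obtain W where W: "open W" "overlap c c' = halfspace \<inter> W"
    using openin_overlap[OF c] by (auto simp: openin_open)
  have "V = W \<inter> {x. 0 < x $ bdi}" unfolding V_def W(2) by (auto simp: halfspace_def)
  then have "open V" using open_Int[OF W(1) open_pos] by simp
  moreover have "continuous_on V (trans c c')"
    using smooth_on_continuous_on[OF smooth_trans[OF c]] by (rule continuous_on_subset) (auto simp: V_def)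
  moreover have "inj_on (trans c c') V"
    using inj_trans[OF c] by (rule inj_on_subset) (auto simp: V_def)
  ultimately have "open (trans c c' ` V)" by (intro invariance_of_domain) auto
  moreover have "trans c c' ` V \<subseteq> halfspace"
    using trans_in[OF c(1)] overlap_subset crange_subset[OF c(2)] unfolding V_def by blast
  ultimately have "trans c c' ` V \<subseteq> {x. 0 < x $ bdi}"
    using interior_halfspace interior_maximal by blast
  then show ?thesis using x by (auto simp: V_def)
qed

lemma inn_iff: "c \<in> atlas R \<Longrightarrow> p \<in> cdom c \<Longrightarrow> p \<in> inn \<longleftrightarrow> coord c p \<in> uset c"
proof -
  assume c: "c \<in> atlas R" "p \<in> cdom c"
  have nn: "0 \<le> coord c' p $ bdi" if "c' \<in> atlas R" "p \<in> cdom c'" for c'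
    using crange_subset[OF that(1)] that(2) by (auto simp: halfspace_def)
  have "p \<in> inn \<longleftrightarrow> (\<forall>c'\<in>atlas R. p \<in> cdom c' \<longrightarrow> 0 < coord c' p $ bdi)"
  proof -
    have "p \<in> pts R" using c cdom_subset by blast
    then have "p \<in> inn \<longleftrightarrow> (\<forall>c'\<in>atlas R. p \<in> cdom c' \<longrightarrow> coord c' p $ bdi \<noteq> 0)"
      by (simp add: inn_def bdry_def)
    moreover have "coord c' p $ bdi \<noteq> 0 \<longleftrightarrow> 0 < coord c' p $ bdi" if "c' \<in> atlas R" "p \<in> cdom c'" for c'
      using nn[OF that] by linarith
    ultimately show ?thesis by meson
  qed
  also have "\<dots> \<longleftrightarrow> 0 < coord c p $ bdi"
  proof
    assume a: "0 < coord c p $ bdi"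
    show "\<forall>c'\<in>atlas R. p \<in> cdom c' \<longrightarrow> 0 < coord c' p $ bdi"
    proof (intro ballI impI)
      fix c' assume c': "c' \<in> atlas R" "p \<in> cdom c'"
      have "coord c p \<in> overlap c c'" using c c' by (auto simp: overlap_def)
      from trans_pos[OF c(1) c'(1) this a] show "0 < coord c' p $ bdi"
        using c by (simp add: trans_def)
    qed
  qed (use c in blast)
  also have "\<dots> \<longleftrightarrow> coord c p \<in> uset c" using c by (auto simp: uset_def)
  finally show ?thesis .
qed

lemma param_inn: "c \<in> atlas R \<Longrightarrow> x \<in> uset c \<Longrightarrow> param c x \<in> inn"
  using inn_iff[of c "param c x"] uset_subset[of c] by auto

lemma inn_subset: "inn \<subseteq> pts R" by (auto simp: inn_def)

lemma openin_inn: "openin (top_of_set (pts R)) inn"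
proof (subst openin_subopen, intro ballI)
  fix p assume p: "p \<in> inn"
  then obtain c where c: "c \<in> atlas R" "p \<in> cdom c" using inn_subset chart_exists by blast
  have "openin (top_of_set halfspace) (uset c)"
    using open_uset[OF c(1)] uset_subset crange_subset[OF c(1)] by (meson open_subset order_trans)
  then have "openin (top_of_set (pts R)) (param c ` uset c)"
    using openin_param_image[OF c(1)] uset_subset by blast
  moreover have "p \<in> param c ` uset c" using p c inn_iff[OF c] by (metis image_eqI param_coord)
  moreover have "param c ` uset c \<subseteq> inn" using param_inn[OF c(1)] by blast
  ultimately show "\<exists>T. openin (top_of_set (pts R)) T \<and> p \<in> T \<and> T \<subseteq> inn" by blast
qed

lemma has_derivative_trans:
  assumes c: "c \<in> atlas R" "c' \<in> atlas R" and x: "x \<in> overlap c c'"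
  shows "(trans c c' has_derivative (*v) (jac c c' x)) (at x within halfspace)"
proof -
  have "trans c c' differentiable (at x within overlap c c')"
    by (rule smooth_on_differentiable[OF smooth_trans[OF c] x])
  then have d: "trans c c' differentiable (at x within halfspace)"
    using at_within_openin[OF openin_overlap[OF c] x] by simp
  then have "(trans c c' has_derivative frechet_derivative (trans c c') (at x within halfspace)) (at x within halfspace)"
    by (simp add: frechet_derivative_works)
  moreover have "frechet_derivative (trans c c') (at x within halfspace) = (*v) (jac c c' x)"
    unfolding jac_def by (rule ext) (simp add: matrix_works_real[OF linear_frechet_derivative[OF d]])
  ultimately show ?thesis by simp
qed

lemma metric_jac:
  assumes c: "c \<in> atlas R" "c' \<in> atlas R" and x: "x \<in> overlap c c'"
  shows "coeff R c x = transpose (jac c c' x) ** coeff R c' (trans c c' x) ** jac c c' x"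
proof -
  let ?D = "frechet_derivative (trans c c') (at x within halfspace)"
  have d: "?D = (*v) (jac c c' x)"
    unfolding jac_def
    by (rule ext) (simp add: matrix_works_real[OF linear_frechet_derivative[OF differentiableI[OF has_derivative_trans[OF assms]]]])
  have "ginner R c x v w = ginner R c' (trans c c' x) (?D v) (?D w)" for v w
    using metric[unfolded riemannian_metric_def Let_def, THEN conjunct2, THEN bspec[OF _ c(1)], THEN bspec[OF _ c(2)],
        folded overlap_def trans_def, THEN bspec[OF _ x]] by simp
  then have "v \<bullet> (coeff R c x *v w) = (jac c c' x *v v) \<bullet> (coeff R c' (trans c c' x) *v (jac c c' x *v w))" for v w
    unfolding d ginner_def by simp
  then have "v \<bullet> (coeff R c x *v w) = v \<bullet> ((transpose (jac c c' x) ** coeff R c' (trans c c' x) ** jac c c' x) *v w)" for v w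
    by (simp only: inner_matrix_left matrix_vector_mul_assoc matrix_mul_assoc)
  then show ?thesis by (metis matrix_eq vector_eq_ldot)
qed

lemma smooth_coeff: "c \<in> atlas R \<Longrightarrow> smooth_on (crange c) (coeff R c)"
  using metric unfolding riemannian_metric_def by blast

lemma posdef_coeff:
  assumes "c \<in> atlas R" "x \<in> crange c"
  shows "posdef (coeff R c x)" "transpose (coeff R c x) = coeff R c x"
  using metric assms unfolding riemannian_metric_def posdef_def ginner_def by blast+

definition ginv :: "('a, 'n) chart \<Rightarrow> real^'n \<Rightarrow> real^'n^'n" where
  "ginv c x = matrix_inv (coeff R c x)"

definition dens :: "('a, 'n) chart \<Rightarrow> real^'n \<Rightarrow> real" where
  "dens c x = sqrt (det (coeff R c x))"

lemma det_coeff_pos: "c \<in> atlas R \<Longrightarrow> x \<in> crange c \<Longrightarrow> 0 < det (coeff R c x)"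
  using posdef_det_pos posdef_coeff by blast

lemma dens_pos: "c \<in> atlas R \<Longrightarrow> x \<in> crange c \<Longrightarrow> 0 < dens c x"
  using det_coeff_pos by (simp add: dens_def)

lemma invertible_coeff: "c \<in> atlas R \<Longrightarrow> x \<in> crange c \<Longrightarrow> invertible (coeff R c x)"
  using det_coeff_pos[of c x] by (simp add: invertible_det_nz)

lemma dens_jac:
  assumes c: "c \<in> atlas R" "c' \<in> atlas R" and x: "x \<in> overlap c c'"
  shows "dens c x = \<bar>det (jac c c' x)\<bar> * dens c' (trans c c' x)"
proof -
  have "det (coeff R c x) = (det (jac c c' x))\<^sup>2 * det (coeff R c' (trans c c' x))"
    by (subst metric_jac[OF assms]) (simp add: det_mul power2_eq_square mult_ac)
  then show ?thesis by (simp add: dens_def real_sqrt_mult)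
qed

lemma jac_invertible:
  assumes c: "c \<in> atlas R" "c' \<in> atlas R" and x: "x \<in> overlap c c'"
  shows "invertible (jac c c' x)"
  using dens_jac[OF assms] dens_pos[OF c(1), of x] x overlap_subset[of c c'] by (auto simp: invertible_det_nz)

text \<open>The right-hand side is checked to be a right inverse of the metric in the second chart;
  for square matrices it is then a left inverse too.\<close>

lemma ginv_jac:
  assumes c: "c \<in> atlas R" "c' \<in> atlas R" and x: "x \<in> overlap c c'"
  shows "ginv c' (trans c c' x) = jac c c' x ** ginv c x ** transpose (jac c c' x)"
proof -
  let ?J = "jac c c' x" and ?G = "coeff R c x" and ?G' = "coeff R c' (trans c c' x)"
  have "x \<in> crange c" "trans c c' x \<in> crange c'"
    using x trans_in[OF c(1) x] overlap_subset by blast+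
  note i = invertible_coeff[OF c(1) this(1)] invertible_coeff[OF c(2) this(2)] jac_invertible[OF assms]
  have "?G' = transpose (matrix_inv ?J) ** ?G ** matrix_inv ?J"
  proof -
    have "transpose (matrix_inv ?J) ** ?G ** matrix_inv ?J =
      (transpose (matrix_inv ?J) ** transpose ?J) ** ?G' ** (?J ** matrix_inv ?J)"
      by (subst metric_jac[OF assms]) (simp add: matrix_mul_assoc)
    then show ?thesis
      by (simp add: matrix_transpose_mul[symmetric] matrix_inv_right[OF i(3)])
  qed
  have "?G' ** (?J ** ginv c x ** transpose ?J) = transpose (matrix_inv ?J) ** ?G ** (matrix_inv ?J ** ?J) ** ginv c x ** transpose ?J"
    by (subst \<open>?G' = _\<close>) (simp add: matrix_mul_assoc)
  also have "\<dots> = transpose (matrix_inv ?J) ** (?G ** ginv c x) ** transpose ?J"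
    by (simp add: matrix_inv_left[OF i(3)] matrix_mul_assoc)
  also have "\<dots> = mat 1"
    by (simp add: ginv_def matrix_inv_right[OF i(1)] matrix_inv_right[OF i(3)] matrix_transpose_mul[symmetric])
  finally have r: "?G' ** (?J ** ginv c x ** transpose ?J) = mat 1" .
  then have "(?J ** ginv c x ** transpose ?J) ** ?G' = mat 1"
    by (simp add: matrix_left_right_inverse)
  with r show ?thesis unfolding ginv_def[of c'] by (intro matrix_inv_eqI) 
qed

lemma Ck_on_coeff: "c \<in> atlas R \<Longrightarrow> Ck_on k (uset c) (\<lambda>x. coeff R c x $ i $ j)"
  by (intro Ck_on_component open_uset smooth_on_Ck_on[OF smooth_coeff] uset_subset)

lemma Ck_on_dens: "c \<in> atlas R \<Longrightarrow> Ck_on k (uset c) (dens c)"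
  unfolding dens_def using uset_subset[of c]
  by (intro Ck_on_sqrt Ck_on_det open_uset Ck_on_coeff) (auto intro: det_coeff_pos)

lemma Ck_on_ginv: "c \<in> atlas R \<Longrightarrow> Ck_on k (uset c) (\<lambda>x. ginv c x $ i $ j)"
  unfolding ginv_def using uset_subset[of c]
  by (intro Ck_on_matrix_inv open_uset Ck_on_coeff) (auto dest: det_coeff_pos[of c])

lemma continuous_on_coeff: "c \<in> atlas R \<Longrightarrow> continuous_on (crange c) (coeff R c)"
  using smooth_coeff smooth_on_continuous_on by blast

lemma continuous_on_dens: "c \<in> atlas R \<Longrightarrow> continuous_on (crange c) (dens c)"
  unfolding dens_def det_def by (intro continuous_intros continuous_on_coeff)

lemma continuous_on_ginv: "c \<in> atlas R \<Longrightarrow> continuous_on (crange c) (\<lambda>x. ginv c x $ i $ j)"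
  unfolding ginv_def using det_coeff_pos
  by (intro continuous_on_matrix_inv continuous_on_coeff) (auto simp: less_le)

end

section \<open>Change of variables\<close>

text \<open>The change of variables theorem of the library needs a well-ordered index type; every finite type
  has a well-ordered copy.\<close>

typedef 'a wo = "UNIV :: 'a set" morphisms un_wo mk_wo by simp



instance wo :: (finite) finite
proof
  have "UNIV = mk_wo ` (UNIV :: 'a set)" by (metis mk_wo_cases surj_def)
  then show "finite (UNIV :: 'a wo set)" by (metis finite finite_imageI)
qed

definition wo_enc :: "'a::finite wo \<Rightarrow> nat" where
  "wo_enc = (SOME f. inj f)"

lemma inj_wo_enc: "inj (wo_enc :: 'a::finite wo \<Rightarrow> nat)"
proof -
  have "\<exists>f :: 'a wo \<Rightarrow> nat. inj f" using finite_imp_inj_to_nat_seg[OF finite_class.finite_UNIV] by blast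
  then show ?thesis unfolding wo_enc_def by (rule someI_ex)
qed

instantiation wo :: (finite) wellorder
begin

definition "x \<le> y \<longleftrightarrow> wo_enc x \<le> wo_enc y"
definition "x < y \<longleftrightarrow> wo_enc x < wo_enc y"

instance
proof
  fix P :: "'a wo \<Rightarrow> bool" and a :: "'a wo"
  assume "\<And>x. (\<And>y. y < x \<Longrightarrow> P y) \<Longrightarrow> P x"
  then show "P a" unfolding less_wo_def using measure_induct[of wo_enc P a] by blast
qed (auto simp: less_eq_wo_def less_wo_def inj_eq[OF inj_wo_enc])

end

text \<open>Conjugation by f matches the permutations of the two index types and preserves their
  signs. It is needed for Jacobians transported to the well-ordered index type.\<close>

lemma det_reindex:
  fixes A :: "real^'n^'n" and f :: "'m::finite \<Rightarrow> 'n"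
  assumes f: "bij f"
  shows "det (\<chi> i j. A $ f i $ f j) = det A"
proof -
  have fi [simp]: "f (inv f x) = x" "inv f (f y) = y" for x y
    using f by (auto simp: bij_is_surj surj_f_inv_f bij_is_inj)
  have mp: "map_permutation UNIV f q = f \<circ> q \<circ> inv f" for q
    using f by (auto simp: map_permutation_def restrict_id_def fun_eq_iff bij_is_surj)
  show ?thesis unfolding det_def
  proof (rule sum.reindex_bij_witness[where i="\<lambda>p. inv f \<circ> p \<circ> f" and j="\<lambda>q. f \<circ> q \<circ> inv f"])
    fix q :: "'m \<Rightarrow> 'm" assume q: "q \<in> {p. p permutes UNIV}"
    show "f \<circ> q \<circ> inv f \<in> {p. p permutes UNIV}"
      using map_permutation_permutes[of f UNIV UNIV q] q f by (simp add: mp)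
    have "evenperm (f \<circ> q \<circ> inv f) \<longleftrightarrow> evenperm q"
      using evenperm_map_permutation[of f UNIV q] q f by (simp add: mp bij_is_inj)
    then have "sign (f \<circ> q \<circ> inv f) = sign q" by (simp add: sign_def)
    moreover have "(\<Prod>i\<in>UNIV. A $ i $ (f \<circ> q \<circ> inv f) i) = (\<Prod>i\<in>UNIV. A $ f i $ f (q i))"
      by (subst prod.reindex_bij_betw[OF f, symmetric]) simp
    ultimately show "of_int (sign (f \<circ> q \<circ> inv f)) * (\<Prod>i\<in>UNIV. A $ i $ (f \<circ> q \<circ> inv f) i) =
      of_int (sign q) * (\<Prod>i\<in>UNIV. (\<chi> i j. A $ f i $ f j) $ i $ q i)" by simp
  next
    fix p :: "'n \<Rightarrow> 'n" assume p: "p \<in> {p. p permutes UNIV}"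
    then show "inv f \<circ> p \<circ> f \<in> {p. p permutes UNIV}"
      using f by (auto intro!: bij_imp_permutes bij_comp bij_imp_bij_inv dest: permutes_bij)
  qed (auto simp: fun_eq_iff)
qed

definition reix :: "real^'n wo \<Rightarrow> real^'n" where "reix x = (\<chi> i. x $ mk_wo i)"
definition reix' :: "real^'n \<Rightarrow> real^'n wo" where "reix' y = (\<chi> i. y $ un_wo i)"

lemma reix_inverse [simp]: "reix (reix' y) = y" "reix' (reix x) = x"
  by (auto simp: reix_def reix'_def vec_eq_iff mk_wo_inverse un_wo_inverse)

lemma bounded_linear_reix: "bounded_linear reix"
  by (intro linear_conv_bounded_linear[THEN iffD1] linearI) (auto simp: reix_def vec_eq_iff)

lemma bounded_linear_reix': "bounded_linear reix'"
  by (intro linear_conv_bounded_linear[THEN iffD1] linearI) (auto simp: reix'_def vec_eq_iff)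

lemma bij_un_wo: "bij un_wo"
  by (metis bijI' mk_wo_inverse UNIV_I un_wo_inject)

lemma measurable_reix [measurable]: "reix \<in> borel_measurable borel"
  using bounded_linear_reix by (intro borel_measurable_continuous_onI linear_continuous_on)

text \<open>Relabelling the coordinates permutes the side lengths of a box, and Lebesgue measure is
  determined by its values on boxes.\<close>

lemma lborel_reix: "distr lborel borel reix = (lborel :: (real^'n) measure)"
proof (rule lborel_eqI[symmetric])
  fix l u :: "real^'n" assume lu: "\<And>b. b \<in> Basis \<Longrightarrow> l \<bullet> b \<le> u \<bullet> b"
  have le: "l $ i \<le> u $ i" for i using lu[of "axis i 1"] by (auto simp: inner_axis Basis_vec_def axis_eq_axis)
  have b: "Basis = (\<lambda>i::'k::finite. axis i (1::real)) ` UNIV" by (auto simp: Basis_vec_def)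
  have ij: "inj (\<lambda>i::'k::finite. axis i (1::real))" by (auto simp: inj_on_def axis_eq_axis)
  have "reix -` box l u = box (reix' l) (reix' u)"
    by (auto simp: mem_box_cart reix_def reix'_def) (metis un_wo_inverse, metis un_wo_inverse, metis mk_wo_inverse UNIV_I, metis mk_wo_inverse UNIV_I)
  then have "emeasure (distr lborel borel reix) (box l u) = emeasure lborel (box (reix' l) (reix' u))"
    by (simp add: emeasure_distr)
  also have "\<dots> = (\<Prod>b\<in>Basis. (reix' u - reix' l) \<bullet> b)"
    using le by (intro emeasure_lborel_box) (auto simp: b inner_axis reix'_def)
  also have "(\<Prod>b\<in>Basis. (reix' u - reix' l) \<bullet> b) = (\<Prod>i\<in>UNIV. u $ un_wo i - l $ un_wo i)"
    by (simp add: b prod.reindex[OF ij] inner_axis reix'_def)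
  also have "\<dots> = (\<Prod>i\<in>UNIV. u $ i - l $ i)"
    by (rule prod.reindex_bij_betw[OF bij_un_wo])
  also have "\<dots> = (\<Prod>b\<in>Basis. (u - l) \<bullet> b)"
    by (simp add: b prod.reindex[OF ij] inner_axis)
  finally show "emeasure (distr lborel borel reix) (box l u) = (\<Prod>b\<in>Basis. (u - l) \<bullet> b)" by simp
qed simp

text \<open>For Henstock-Kurzweil integrals one side has integral b exactly when the other has. This
  carries finite values over; if one side is infinite then so is the other, because a finite value
  would be carried back.\<close>

lemma nn_integral_change_of_variables_wo:
  fixes g h :: "real^'n::{finite,wellorder} \<Rightarrow> real^'n::_" and f :: "real^'n::_ \<Rightarrow> real"
  assumes dg: "\<And>x. x \<in> S \<Longrightarrow> (g has_derivative (*v) (J x)) (at x within S)"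
    and dh: "\<And>y. y \<in> T \<Longrightarrow> (h has_derivative (*v) (K y)) (at y within T)"
    and f0: "\<And>y. y \<in> T \<Longrightarrow> 0 \<le> f y"
    and hg: "\<And>x. x \<in> S \<Longrightarrow> g x \<in> T \<and> h (g x) = x"
    and gh: "\<And>y. y \<in> T \<Longrightarrow> h y \<in> S \<and> g (h y) = y"
    and id: "\<And>y. y \<in> T \<Longrightarrow> K y ** J (h y) = mat 1"
    and mf: "(\<lambda>y. indicator T y * f y) \<in> borel_measurable borel"
    and mg: "(\<lambda>x. indicator S x * (\<bar>det (J x)\<bar> * f (g x))) \<in> borel_measurable borel"
  shows "(\<integral>\<^sup>+y. ennreal (indicator T y * f y) \<partial>lborel) = (\<integral>\<^sup>+x. ennreal (indicator S x * (\<bar>det (J x)\<bar> * f (g x))) \<partial>lborel)"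
proof -
  let ?F = "\<lambda>x. \<bar>det (J x)\<bar> * f (g x)"
  have iff: "(?F has_integral b) S \<longleftrightarrow> (f has_integral b) T" for b
    using cov_invertible_nonneg_eq[where S=S and g=g and g'="\<lambda>x. (*v) (J x)" and T=T and h=h and h'="\<lambda>y. (*v) (K y)" and f=f and b=b] dg dh f0 hg gh id
    by (simp add: matrix_of_matrix_vector_mul fun_eq_iff matrix_vector_mul_assoc)
  have nn: "0 \<le> ?F x" if "x \<in> S" for x using f0 hg[OF that] by auto
  have A: "\<exists>b. (k has_integral b) X \<and> (\<integral>\<^sup>+x. ennreal (indicator X x * k x) \<partial>lborel) = ennreal b"
    if m: "(\<lambda>x. indicator X x * k x) \<in> borel_measurable borel" and p: "\<And>x. x \<in> X \<Longrightarrow> 0 \<le> k x"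
      and fin: "(\<integral>\<^sup>+x. ennreal (indicator X x * k x) \<partial>lborel) < \<infinity>" for X and k :: "real^'n::_ \<Rightarrow> real"
  proof -
    have "((\<lambda>x. indicator X x * k x) has_integral enn2real (\<integral>\<^sup>+x. ennreal (indicator X x * k x) \<partial>lborel)) UNIV"
      by (rule nn_integral_has_integral) (use m p fin in \<open>auto simp: indicator_def\<close>)
    then have "(k has_integral enn2real (\<integral>\<^sup>+x. ennreal (indicator X x * k x) \<partial>lborel)) X"
      using has_integral_restrict_UNIV[of X k] by (simp add: indicator_def of_bool_def if_distrib if_distribR cong: if_cong)
    then show ?thesis using fin by (intro exI conjI) (assumption, simp)
  qed
  show ?thesis
  proof (cases "(\<integral>\<^sup>+y. ennreal (indicator T y * f y) \<partial>lborel) < \<infinity>")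
    case True
    obtain b where b: "(f has_integral b) T" "(\<integral>\<^sup>+y. ennreal (indicator T y * f y) \<partial>lborel) = ennreal b"
      using A[OF mf f0 True] by blast
    show ?thesis using nn_integral_has_integral_lebesgue[where \<Omega>=S and f="?F" and I=b] nn iff b by simp
  next
    case False
    have "\<not> (\<integral>\<^sup>+x. ennreal (indicator S x * ?F x) \<partial>lborel) < \<infinity>"
    proof
      assume t: "(\<integral>\<^sup>+x. ennreal (indicator S x * ?F x) \<partial>lborel) < \<infinity>"
      obtain b where b: "(?F has_integral b) S" using A[OF mg nn t] by blast
      show False using nn_integral_has_integral_lebesgue[where \<Omega>=T and f=f and I=b] f0 iff b False by simp
    qed
    with False show ?thesis by (simp add: top.not_eq_extremum[symmetric])
  qed
qed

text \<open>All data are conjugated by \<open>reix\<close>, which preserves Lebesgue measure and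
  leaves the Jacobian determinants unchanged.\<close>

lemma nn_integral_change_of_variables:
  fixes g h :: "real^'n \<Rightarrow> real^'n" and f :: "real^'n \<Rightarrow> real"
  assumes dg: "\<And>x. x \<in> S \<Longrightarrow> (g has_derivative (*v) (J x)) (at x within S)"
    and dh: "\<And>y. y \<in> T \<Longrightarrow> (h has_derivative (*v) (K y)) (at y within T)"
    and f0: "\<And>y. y \<in> T \<Longrightarrow> 0 \<le> f y"
    and hg: "\<And>x. x \<in> S \<Longrightarrow> g x \<in> T \<and> h (g x) = x"
    and gh: "\<And>y. y \<in> T \<Longrightarrow> h y \<in> S \<and> g (h y) = y"
    and id: "\<And>y. y \<in> T \<Longrightarrow> K y ** J (h y) = mat 1"
    and mf: "(\<lambda>y. indicator T y * f y) \<in> borel_measurable borel"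
    and mg: "(\<lambda>x. indicator S x * (\<bar>det (J x)\<bar> * f (g x))) \<in> borel_measurable borel"
  shows "(\<integral>\<^sup>+y. ennreal (indicator T y * f y) \<partial>lborel) = (\<integral>\<^sup>+x. ennreal (indicator S x * (\<bar>det (J x)\<bar> * f (g x))) \<partial>lborel)"
proof -
  let ?S = "reix -` S" and ?T = "reix -` T"
  let ?g = "\<lambda>x. reix' (g (reix x))" and ?h = "\<lambda>x. reix' (h (reix x))"
  let ?c = "\<lambda>A::real^'n^'n. (\<chi> i j. A $ un_wo i $ un_wo j) :: real^'n wo^'n wo"
  have c: "?c A *v v = reix' (A *v reix v)" for A v
    using sum.reindex_bij_betw[OF bij_un_wo, of "\<lambda>k. A $ _ $ k * v $ mk_wo k"]
    by (simp add: matrix_vector_mult_def reix'_def reix_def vec_eq_iff un_wo_inverse)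
  have cm: "?c A ** ?c B = ?c (A ** B)" for A B
    using sum.reindex_bij_betw[OF bij_un_wo, of "\<lambda>k. A $ _ $ k * B $ k $ _"]
    by (simp add: matrix_matrix_mult_def vec_eq_iff)
  have c1: "?c (mat 1) = mat 1" by (auto simp: mat_def vec_eq_iff un_wo_inject)
  have d: "((\<lambda>x. reix' (k (reix x))) has_derivative (*v) (?c A)) (at x within reix -` X)"
    if "(k has_derivative (*v) A) (at (reix x) within X)" for k A X x
  proof -
    have "(reix has_derivative reix) (at x within reix -` X)"
      by (rule bounded_linear_imp_has_derivative[OF bounded_linear_reix])
    moreover have "(k has_derivative (*v) A) (at (reix x) within reix ` (reix -` X))"
      using that by (rule has_derivative_subset) auto
    ultimately have "((\<lambda>x. k (reix x)) has_derivative (\<lambda>v. A *v reix v)) (at x within reix -` X)"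
      by (rule has_derivative_in_compose)
    from bounded_linear.has_derivative[OF bounded_linear_reix' this]
    show ?thesis by (simp only: c[symmetric])
  qed
  have "(\<integral>\<^sup>+y. ennreal (indicator ?T y * f (reix y)) \<partial>lborel) =
    (\<integral>\<^sup>+x. ennreal (indicator ?S x * (\<bar>det (?c (J (reix x)))\<bar> * f (reix (?g x)))) \<partial>lborel)"
  proof (rule nn_integral_change_of_variables_wo[where h="?h" and K="\<lambda>y. ?c (K (reix y))"])
    show "(?g has_derivative (*v) (?c (J (reix x)))) (at x within ?S)" if "x \<in> ?S" for x
      by (rule d) (use dg that in auto)
    show "(?h has_derivative (*v) (?c (K (reix x)))) (at x within ?T)" if "x \<in> ?T" for x
      by (rule d) (use dh that in auto)
    have "(\<lambda>y. (\<lambda>y. indicator T y * f y) (reix y)) \<in> borel_measurable borel"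
      using mf by measurable
    then show "(\<lambda>y. indicator ?T y * f (reix y)) \<in> borel_measurable borel"
      by (simp add: indicator_def)
    have "(\<lambda>y. (\<lambda>x. indicator S x * (\<bar>det (J x)\<bar> * f (g x))) (reix y)) \<in> borel_measurable borel"
      using mg by measurable
    then show "(\<lambda>x. indicator ?S x * (\<bar>det (?c (J (reix x)))\<bar> * f (reix (?g x)))) \<in> borel_measurable borel"
      by (simp add: det_reindex[OF bij_un_wo] indicator_def)
  qed (use f0 hg gh id in \<open>auto simp: cm c1\<close>)
  moreover have "(\<integral>\<^sup>+y. ennreal (indicator T y * f y) \<partial>lborel) = (\<integral>\<^sup>+y. ennreal (indicator ?T y * f (reix y)) \<partial>lborel)"
    using mf by (subst lborel_reix[symmetric], subst nn_integral_distr) (auto simp: indicator_def)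
  moreover have "(\<integral>\<^sup>+x. ennreal (indicator S x * (\<bar>det (J x)\<bar> * f (g x))) \<partial>lborel) =
     (\<integral>\<^sup>+x. ennreal (indicator ?S x * (\<bar>det (?c (J (reix x)))\<bar> * f (reix (?g x)))) \<partial>lborel)"
    using mg by (subst lborel_reix[symmetric], subst nn_integral_distr) (auto simp: indicator_def det_reindex[OF bij_un_wo])
  ultimately show ?thesis by simp
qed

section \<open>The Riemannian volume\<close>

text \<open>A positive step along any coordinate axis does not leave the half-space, which is enough
  to determine a derivative even at boundary points.\<close>

lemma halfspace_has_derivative_unique:
  fixes f :: "real^'n \<Rightarrow> 'b::real_normed_vector"
  assumes "(f has_derivative f') (at x within halfspace)" "(f has_derivative f'') (at x within halfspace)"
    and "x \<in> halfspace"
  shows "f' = f''"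
proof (rule frechet_derivative_unique_within[OF assms(1,2)])
  fix i :: "real^'n" and e :: real assume i: "i \<in> Basis" and e: "0 < e"
  then obtain j where j: "i = axis j 1" by (auto simp: Basis_vec_def)
  show "\<exists>d. 0 < \<bar>d\<bar> \<and> \<bar>d\<bar> < e \<and> x + d *\<^sub>R i \<in> halfspace"
    using e assms(3) by (intro exI[of _ "e/2"]) (auto simp: j halfspace_def axis_def)
qed

context compact_riemannian_mfd begin

text \<open>The composite of the two transition maps is the identity on a relatively open subset of
  the half-space, and derivatives within the half-space are unique.\<close>

lemma jac_jac:
  assumes c: "c \<in> atlas R" "c' \<in> atlas R" and x: "x \<in> overlap c c'"
  shows "jac c' c (trans c c' x) ** jac c c' x = mat 1"
proof -
  let ?y = "trans c c' x"
  have y: "?y \<in> overlap c' c" by (rule trans_in[OF c(1) x])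
  note w = at_within_openin[OF openin_overlap[OF c] x]
  have "(trans c c' has_derivative (*v) (jac c c' x)) (at x within overlap c c')"
    using has_derivative_trans[OF c x] w by simp
  moreover have "(trans c' c has_derivative (*v) (jac c' c ?y)) (at ?y within trans c c' ` overlap c c')"
    by (rule has_derivative_subset[OF has_derivative_trans[OF c(2,1) y]])
      (use trans_in[OF c(1)] overlap_subset crange_subset[OF c(2)] in blast)
  ultimately have "((\<lambda>x. trans c' c (trans c c' x)) has_derivative (\<lambda>v. jac c' c ?y *v (jac c c' x *v v))) (at x within overlap c c')"
    by (rule has_derivative_in_compose)
  then have "((\<lambda>x. x) has_derivative (\<lambda>v. jac c' c ?y *v (jac c c' x *v v))) (at x within overlap c c')"
    by (rule has_derivative_transform[rotated 2]) (use x trans_trans[OF c] in auto)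
  then have "((\<lambda>x. x) has_derivative (\<lambda>v. jac c' c ?y *v (jac c c' x *v v))) (at x within halfspace)"
    by (simp add: w)
  then have "(\<lambda>v. jac c' c ?y *v (jac c c' x *v v)) = (\<lambda>v. v)"
    by (rule halfspace_has_derivative_unique[OF _ has_derivative_ident])
      (use x overlap_subset crange_subset[OF c(1)] in blast)
  then show ?thesis by (simp add: matrix_eq matrix_vector_mul_assoc[symmetric] fun_eq_iff)
qed

lemma pts_borel [measurable]: "pts R \<in> sets borel"
  by (intro borel_closed compact_imp_closed compact_pts)

lemma openin_pts_borel: "openin (top_of_set (pts R)) N \<Longrightarrow> N \<in> sets borel"
  by (auto simp: openin_open)

lemma cdom_borel: "c \<in> atlas R \<Longrightarrow> cdom c \<in> sets borel"
  by (intro openin_pts_borel openin_cdom)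

lemma crange_borel: "c \<in> atlas R \<Longrightarrow> crange c \<in> sets borel"
  using openin_crange[of c] borel_closed[OF closed_halfspace] by (auto simp: openin_open intro!: sets.Int)

lemma coord_image_vimage: "c \<in> atlas R \<Longrightarrow> B \<subseteq> cdom c \<Longrightarrow> coord c ` B = param c -` B \<inter> crange c"
  by (auto simp: subset_iff)

lemma coord_image_borel:
  assumes c: "c \<in> atlas R" and B: "B \<in> sets borel" "B \<subseteq> cdom c"
  shows "coord c ` B \<in> sets borel"
proof -
  have "param c -` B \<inter> space (restrict_space borel (crange c)) \<in> sets (restrict_space borel (crange c))"
    by (rule measurable_sets[OF borel_measurable_continuous_on_restrict[OF continuous_param[OF c]] B(1)])
  then show ?thesis
    unfolding coord_image_vimage[OF c B(2)] using crange_borel[OF c]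
    by (subst (asm) sets_restrict_space_iff) (auto simp: space_restrict_space)
qed

lemma dens_measurable: "c \<in> atlas R \<Longrightarrow> dens c \<in> borel_measurable (restrict_space borel (crange c))"
  by (intro borel_measurable_continuous_on_restrict continuous_on_dens)

lemma indicator_dens_measurable:
  assumes "c \<in> atlas R" "S \<in> sets borel" "S \<subseteq> crange c"
  shows "(\<lambda>x. indicator S x * dens c x) \<in> borel_measurable borel"
  using borel_measurable_continuous_on_indicator[of S "dens c"] continuous_on_subset[OF continuous_on_dens[OF assms(1)] assms(3)] assms(2)
  by simp

definition cvol :: "('a, 'n) chart \<Rightarrow> 'a set \<Rightarrow> ennreal" where
  "cvol c B = (\<integral>\<^sup>+x\<in>coord c ` B. ennreal (dens c x) \<partial>lborel)"

text \<open>The Jacobian factor of the change of variables is exactly the one by which the densities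
  of the two charts differ.\<close>

lemma cvol_overlap:
  assumes c: "c \<in> atlas R" "c' \<in> atlas R" and B: "B \<in> sets borel" "B \<subseteq> cdom c" "B \<subseteq> cdom c'"
  shows "cvol c B = cvol c' B"
proof -
  let ?S = "coord c ` B" and ?T = "coord c' ` B"
  have S: "?S \<subseteq> overlap c c'" "?T \<subseteq> overlap c' c" using B by (auto simp: overlap_def)
  have g: "trans c c' x \<in> ?T \<and> trans c' c (trans c c' x) = x" if "x \<in> ?S" for x
    using that trans_trans[OF c] S B c by (auto simp: trans_def subset_iff)
  have h: "trans c' c x \<in> ?S \<and> trans c c' (trans c' c x) = x" if "x \<in> ?T" for x
    using that trans_trans[OF c(2,1)] S B c by (auto simp: trans_def subset_iff)
  have sub: "?S \<subseteq> crange c" "?T \<subseteq> crange c'" using B by auto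
  have hs: "?S \<subseteq> halfspace" "?T \<subseteq> halfspace" using sub crange_subset c by blast+
  have eq: "indicator ?S x * (\<bar>det (jac c c' x)\<bar> * dens c' (trans c c' x)) = indicator ?S x * dens c x" for x
    using S dens_jac[OF c, of x] by (auto simp: indicator_def)
  have "(\<integral>\<^sup>+y. ennreal (indicator ?T y * dens c' y) \<partial>lborel) =
    (\<integral>\<^sup>+x. ennreal (indicator ?S x * (\<bar>det (jac c c' x)\<bar> * dens c' (trans c c' x))) \<partial>lborel)"
  proof (rule nn_integral_change_of_variables[where h="trans c' c" and K="jac c' c"])
    show "(trans c c' has_derivative (*v) (jac c c' x)) (at x within ?S)" if "x \<in> ?S" for x
      by (rule has_derivative_subset[OF has_derivative_trans[OF c]]) (use that S hs in auto)
    show "(trans c' c has_derivative (*v) (jac c' c x)) (at x within ?T)" if "x \<in> ?T" for x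
      by (rule has_derivative_subset[OF has_derivative_trans[OF c(2,1)]]) (use that S hs in auto)
    show "0 \<le> dens c' y" if "y \<in> ?T" for y
      by (intro less_imp_le dens_pos c(2)) (use that sub(2) in blast)
    show "jac c' c y ** jac c c' (trans c' c y) = mat 1" if "y \<in> ?T" for y
      using jac_jac[OF c, of "trans c' c y"] h[OF that] S by auto
    show "(\<lambda>y. indicator ?T y * dens c' y) \<in> borel_measurable borel"
      by (intro indicator_dens_measurable coord_image_borel c B sub)
    show "(\<lambda>x. indicator ?S x * (\<bar>det (jac c c' x)\<bar> * dens c' (trans c c' x))) \<in> borel_measurable borel"
      unfolding eq by (intro indicator_dens_measurable coord_image_borel c B sub)
  qed (use g h in auto)
  then show ?thesis unfolding eq cvol_def
    by (simp add: indicator_def of_bool_def if_distrib if_distribR cong: if_cong)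
qed

definition cdens :: "('a, 'n) chart \<Rightarrow> (real^'n) measure" where
  "cdens c = density lborel (\<lambda>x. ennreal (indicator (crange c) x * dens c x))"

lemma cvol_eq_emeasure:
  assumes c: "c \<in> atlas R" and B: "B \<in> sets borel" "B \<subseteq> cdom c"
  shows "cvol c B = emeasure (cdens c) (coord c ` B)"
proof -
  have "emeasure (cdens c) (coord c ` B) =
      (\<integral>\<^sup>+x. ennreal (indicator (crange c) x * dens c x) * indicator (coord c ` B) x \<partial>lborel)"
    unfolding cdens_def using indicator_dens_measurable[OF c crange_borel[OF c] order_refl] coord_image_borel[OF c B]
    by (subst emeasure_density) auto
  also have "\<dots> = cvol c B" unfolding cvol_def
    by (intro nn_integral_cong) (use B in \<open>auto simp: indicator_def\<close>)
  finally show ?thesis by simp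
qed

lemma cvol_suminf:
  assumes c: "c \<in> atlas R" and B: "\<And>i::nat. B i \<in> sets borel" "\<And>i. B i \<subseteq> cdom c" and d: "disjoint_family B"
  shows "(\<Sum>i. cvol c (B i)) = cvol c (\<Union>i. B i)"
proof -
  have "(\<Sum>i. emeasure (cdens c) (coord c ` B i)) = emeasure (cdens c) (\<Union>i. coord c ` B i)"
  proof (rule suminf_emeasure)
    show "range (\<lambda>i. coord c ` B i) \<subseteq> sets (cdens c)"
      using coord_image_borel[OF c B] by (auto simp: cdens_def)
    show "disjoint_family (\<lambda>i. coord c ` B i)"
      using d B(2) inj_coord[OF c] unfolding disjoint_family_on_def inj_on_def by blast
  qed
  moreover have "emeasure (cdens c) (\<Union>i. coord c ` B i) = cvol c (\<Union>i. B i)"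
    by (subst cvol_eq_emeasure[OF c]) (use B in \<open>auto simp: image_UN\<close>)
  ultimately show ?thesis by (simp add: cvol_eq_emeasure[OF c B])
qed

lemma cvol_empty [simp]: "cvol c {} = 0" by (simp add: cvol_def)

lemma finite_chart_cover: "\<exists>cs. set cs \<subseteq> atlas R \<and> (\<Union>c\<in>set cs. cdom c) = pts R"
proof -
  have "\<exists>D\<subseteq>cdom ` atlas R. finite D \<and> pts R \<subseteq> \<Union>D"
  proof (rule compact_pts[unfolded compact_eq_openin_cover, rule_format], intro conjI ballI)
    show "pts R \<subseteq> \<Union> (cdom ` atlas R)" using cdom_cover by simp
  qed (use openin_cdom in auto)
  then obtain D where "D \<subseteq> cdom ` atlas R" "finite D" "pts R \<subseteq> \<Union>D" by blast
  then obtain C where C: "C \<subseteq> atlas R" "finite C" "pts R \<subseteq> (\<Union>c\<in>C. cdom c)"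
    by (metis finite_subset_image)
  obtain cs where "set cs = C" using finite_list[OF C(2)] by blast
  then show ?thesis using C cdom_subset by (intro exI[of _ cs]) blast
qed

definition cover :: "('a, 'n) chart list" where
  "cover = (SOME cs. set cs \<subseteq> atlas R \<and> (\<Union>c\<in>set cs. cdom c) = pts R)"

lemma cover: "set cover \<subseteq> atlas R" "(\<Union>c\<in>set cover. cdom c) = pts R"
  using someI_ex[OF finite_chart_cover] unfolding cover_def[symmetric] by auto

text \<open>The manifold is cut into disjoint Borel sets, each inside one chart domain of the finite
  cover. Beyond the length of the cover they are empty, so that series over all indices are finite
  sums.\<close>

definition piece :: "nat \<Rightarrow> 'a set" where
  "piece i = disjointed (\<lambda>j. if j < length cover then cdom (cover ! j) else {}) i"

lemma disjoint_piece: "disjoint_family piece"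
  unfolding piece_def by (rule disjoint_family_disjointed)

lemma piece_subset: "i < length cover \<Longrightarrow> piece i \<subseteq> cdom (cover ! i)"
  using disjointed_subset[of "\<lambda>j. if j < length cover then cdom (cover ! j) else {}" i] by (simp add: piece_def)

lemma piece_empty: "\<not> i < length cover \<Longrightarrow> piece i = {}"
  using disjointed_subset[of "\<lambda>j. if j < length cover then cdom (cover ! j) else {}" i] by (simp add: piece_def)

lemma UN_piece: "(\<Union>i. piece i) = pts R"
proof -
  have "(\<Union>i. piece i) = (\<Union>j. if j < length cover then cdom (cover ! j) else {})"
    unfolding piece_def by (rule UN_disjointed_eq)
  also have "\<dots> = (\<Union>c\<in>set cover. cdom c)" by (fastforce simp: in_set_conv_nth split: if_splits)
  finally show ?thesis using cover(2) by simp
qed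

lemma cover_nth: "i < length cover \<Longrightarrow> cover ! i \<in> atlas R"
  using cover(1) nth_mem by blast

lemma piece_borel: "piece i \<in> sets borel"
  unfolding piece_def disjointed_def using cdom_borel[OF cover_nth] by (auto intro!: sets.Diff)

definition volm :: "'a set \<Rightarrow> ennreal" where
  "volm B = (\<Sum>i<length cover. cvol (cover ! i) (B \<inter> piece i))"

text \<open>Inside one chart domain all pieces may be measured in that chart, because the chart
  volumes agree on overlaps; additivity in the chart puts them together again.\<close>

lemma volm_chart:
  assumes c: "c \<in> atlas R" and B: "B \<in> sets borel" "B \<subseteq> cdom c"
  shows "volm B = cvol c B"
proof -
  have "volm B = (\<Sum>i<length cover. cvol c (B \<inter> piece i))"
    unfolding volm_def
    by (intro sum.cong refl cvol_overlap cover_nth c) (use B piece_borel piece_subset in auto)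
  also have "\<dots> = (\<Sum>i. cvol c (B \<inter> piece i))"
    by (rule suminf_finite[symmetric]) (auto simp: piece_empty)
  also have "\<dots> = cvol c (\<Union>i. B \<inter> piece i)"
    using disjoint_piece by (intro cvol_suminf c) (use B piece_borel in \<open>auto simp: disjoint_family_on_def\<close>)
  also have "(\<Union>i. B \<inter> piece i) = B" using UN_piece B(2) cdom_subset[OF c] by blast
  finally show ?thesis .
qed

lemma borel_pts_iff: "B \<in> sets (restrict_space borel (pts R)) \<longleftrightarrow> B \<in> sets borel \<and> B \<subseteq> pts R"
  by (subst sets_restrict_space_iff) auto

lemma volm_suminf:
  assumes B: "\<And>i::nat. B i \<in> sets borel" and d: "disjoint_family B"
  shows "(\<Sum>i. volm (B i)) = volm (\<Union>i. B i)"
proof -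
  have "(\<Sum>m. volm (B m)) = (\<Sum>i<length cover. \<Sum>m. cvol (cover ! i) (B m \<inter> piece i))"
    unfolding volm_def by (rule suminf_sum) auto
  also have "\<dots> = (\<Sum>i<length cover. cvol (cover ! i) (\<Union>m. B m \<inter> piece i))"
  proof (intro sum.cong refl cvol_suminf)
    fix i assume i: "i \<in> {..<length cover}"
    show "cover ! i \<in> atlas R" using i cover_nth by simp
    show "disjoint_family (\<lambda>m. B m \<inter> piece i)" using d unfolding disjoint_family_on_def by blast
    show "B m \<inter> piece i \<subseteq> cdom (cover ! i)" for m using piece_subset[of i] i by auto
  qed (use B piece_borel in auto)
  also have "\<dots> = volm (\<Union>i. B i)" by (simp add: volm_def)
  finally show ?thesis .
qed

definition is_vol :: "'a measure \<Rightarrow> bool" where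
  "is_vol \<mu> \<longleftrightarrow> sets \<mu> = sets (restrict_space borel (pts R)) \<and>
     (\<forall>c\<in>atlas R. \<forall>B\<in>sets \<mu>. B \<subseteq> cdom c \<longrightarrow>
        emeasure \<mu> B = (\<integral>\<^sup>+x\<in>coord c ` B. ennreal (sqrt (det (coeff R c x))) \<partial>lborel))"

text \<open>The uniqueness half of the definite description: the chart formula fixes the measure of
  every set contained in a piece, and the pieces are disjoint.\<close>

lemma is_vol_emeasure:
  assumes "is_vol \<mu>" "B \<in> sets \<mu>"
  shows "emeasure \<mu> B = volm B"
proof -
  have s: "sets \<mu> = sets (restrict_space borel (pts R))" using assms by (simp add: is_vol_def)
  have B: "B \<in> sets borel" "B \<subseteq> pts R" using assms(2) by (auto simp: s borel_pts_iff)
  have Bi: "B \<inter> piece i \<in> sets \<mu>" for i using B piece_borel by (auto simp: s borel_pts_iff)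
  have "B = (\<Union>i. B \<inter> piece i)" using B(2) UN_piece by blast
  then have "emeasure \<mu> B = emeasure \<mu> (\<Union>i. B \<inter> piece i)" by simp
  also have "\<dots> = (\<Sum>i. emeasure \<mu> (B \<inter> piece i))"
    by (rule suminf_emeasure[symmetric]) (use Bi disjoint_piece in \<open>auto simp: disjoint_family_on_def\<close>)
  also have "\<dots> = (\<Sum>i<length cover. emeasure \<mu> (B \<inter> piece i))"
    by (rule suminf_finite) (auto simp: piece_empty)
  also have "\<dots> = volm B"
    unfolding volm_def
  proof (intro sum.cong refl)
    fix i assume "i \<in> {..<length cover}"
    then have "cover ! i \<in> atlas R" "B \<inter> piece i \<subseteq> cdom (cover ! i)"
      using cover_nth piece_subset[of i] by auto
    then show "emeasure \<mu> (B \<inter> piece i) = cvol (cover ! i) (B \<inter> piece i)"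
      using assms(1) Bi[of i] unfolding is_vol_def cvol_def dens_def by blast
  qed
  finally show ?thesis .
qed

text \<open>\<open>volm\<close> is countably additive and satisfies the chart formula, and any
  competitor agrees with it; so \<open>vol R\<close> denotes the measure that it should.\<close>

lemma is_vol_vol: "is_vol (vol R)"
proof -
  let ?S = "sets (restrict_space borel (pts R))"
  define \<mu> where "\<mu> = measure_of (pts R) ?S volm"
  have sp: "space (restrict_space borel (pts R)) = pts R" by (simp add: space_restrict_space)
  have sa: "sigma_algebra (pts R) ?S" using sets.sigma_algebra_axioms[of "restrict_space borel (pts R)"] sp by simp
  have sets: "sets \<mu> = ?S" unfolding \<mu>_def using sa sigma_algebra.sets_measure_of_eq by blast
  have em: "emeasure \<mu> B = volm B" if "B \<in> ?S" for B
  proof (rule emeasure_measure_of[OF \<mu>_def])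
    show "?S \<subseteq> Pow (pts R)" by (auto simp: borel_pts_iff)
    show "B \<in> sets \<mu>" using that sets by simp
    show "positive (sets \<mu>) volm" by (simp add: positive_def volm_def)
    show "countably_additive (sets \<mu>) volm"
      unfolding countably_additive_def sets by (auto simp: borel_pts_iff image_subset_iff intro!: volm_suminf)
  qed
  have "is_vol \<mu>" unfolding is_vol_def
    using em volm_chart by (auto simp: sets borel_pts_iff cvol_def dens_def)
  moreover have "\<nu> = \<mu>" if "is_vol \<nu>" for \<nu>
    using is_vol_emeasure[OF that] is_vol_emeasure[OF \<open>is_vol \<mu>\<close>] that \<open>is_vol \<mu>\<close>
    by (intro measure_eqI) (auto simp: is_vol_def)
  ultimately show ?thesis unfolding vol_def is_vol_def[symmetric] by (rule theI)
qed

lemma sets_vol: "sets (vol R) = sets (restrict_space borel (pts R))"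
  using is_vol_vol by (simp add: is_vol_def)

lemma sets_vol_iff: "B \<in> sets (vol R) \<longleftrightarrow> B \<in> sets borel \<and> B \<subseteq> pts R"
  by (simp add: sets_vol borel_pts_iff)

lemma space_vol [simp]: "space (vol R) = pts R"
  using sets_eq_imp_space_eq[OF sets_vol] by (simp add: space_restrict_space)

lemma measurable_vol_iff: "borel_measurable (vol R) = borel_measurable (restrict_space borel (pts R))"
  by (rule measurable_cong_sets[OF sets_vol refl])

lemma emeasure_vol_chart:
  assumes "c \<in> atlas R" "B \<in> sets borel" "B \<subseteq> cdom c"
  shows "emeasure (vol R) B = cvol c B"
  using is_vol_vol assms cdom_subset[OF assms(1)] by (auto simp: is_vol_def cvol_def dens_def sets_vol_iff)

lemma cdom_sets_vol: "c \<in> atlas R \<Longrightarrow> cdom c \<in> sets (vol R)"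
  using cdom_borel cdom_subset by (simp add: sets_vol_iff)

lemma param_measurable:
  assumes c: "c \<in> atlas R"
  shows "param c \<in> measurable (restrict_space borel (crange c)) (restrict_space (vol R) (cdom c))"
proof (rule measurable_restrict_space2)
  show "param c \<in> space (restrict_space borel (crange c)) \<rightarrow> cdom c"
    by (auto simp: space_restrict_space)
  have "param c \<in> measurable (restrict_space borel (crange c)) (restrict_space borel (pts R))"
    using borel_measurable_continuous_on_restrict[OF continuous_param[OF c]] cdom_subset[OF c]
    by (intro measurable_restrict_space2) (auto simp: space_restrict_space)
  then show "param c \<in> measurable (restrict_space borel (crange c)) (vol R)"
    using measurable_cong_sets[OF refl sets_vol] by blast
qed

text \<open>Writing the volume on a chart domain as the image of a weighted Lebesgue measure gives
  the coordinate formula for nonnegative and for integrable functions at once.\<close>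

lemma vol_chart_distr:
  assumes c: "c \<in> atlas R"
  shows "restrict_space (vol R) (cdom c) =
    distr (density (restrict_space lborel (crange c)) (\<lambda>x. ennreal (dens c x))) (restrict_space (vol R) (cdom c)) (param c)"
proof (rule measure_eqI)
  fix B assume B: "B \<in> sets (restrict_space (vol R) (cdom c))"
  then have B': "B \<in> sets borel" "B \<subseteq> cdom c"
    using cdom_sets_vol[OF c] by (auto simp: sets_restrict_space_iff sets_vol_iff)
  let ?L = "restrict_space lborel (crange c)"
  have m [measurable]: "param c \<in> measurable ?L (restrict_space (vol R) (cdom c))"
    using param_measurable[OF c] by (simp add: measurable_cong_sets[OF sets_restrict_space_cong[OF sets_lborel] refl])
  have d [measurable]: "dens c \<in> borel_measurable ?L"
    using dens_measurable[OF c] by (simp add: measurable_cong_sets[OF sets_restrict_space_cong[OF sets_lborel] refl])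
  have sp: "space ?L = crange c" by (simp add: space_restrict_space)
  have cr: "crange c \<inter> space lborel \<in> sets lborel" using crange_borel[OF c] by simp
  have pB: "param c -` B \<inter> space ?L \<in> sets ?L" using measurable_sets[OF m B] .
  have "emeasure (distr (density ?L (\<lambda>x. ennreal (dens c x))) (restrict_space (vol R) (cdom c)) (param c)) B
     = emeasure (density ?L (\<lambda>x. ennreal (dens c x))) (param c -` B \<inter> space ?L)"
    using B m by (subst emeasure_distr) auto
  also have "\<dots> = (\<integral>\<^sup>+x. ennreal (dens c x) * indicator (param c -` B \<inter> space ?L) x \<partial>?L)"
    using pB by (subst emeasure_density) auto
  also have "\<dots> = (\<integral>\<^sup>+x. ennreal (dens c x) * indicator (param c -` B \<inter> space ?L) x * indicator (crange c) x \<partial>lborel)"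
    using cr by (rule nn_integral_restrict_space)
  also have "\<dots> = cvol c B"
    unfolding cvol_def sp coord_image_vimage[OF c B'(2)] by (intro nn_integral_cong) (auto simp: indicator_def)
  also have "\<dots> = emeasure (restrict_space (vol R) (cdom c)) B"
    using emeasure_vol_chart[OF c B'] cdom_sets_vol[OF c] B' Int_absorb2[OF cdom_subset[OF c]]
    by (subst emeasure_restrict_space) auto
  finally show "emeasure (restrict_space (vol R) (cdom c)) B =
    emeasure (distr (density ?L (\<lambda>x. ennreal (dens c x))) (restrict_space (vol R) (cdom c)) (param c)) B" ..
qed simp

end

section \<open>Integrals in coordinates and finiteness of the volume\<close>

context compact_riemannian_mfd begin

lemma lborel_restrict_cong: "measurable (restrict_space lborel S) N = measurable (restrict_space borel S) N"
  by (rule measurable_cong_sets[OF sets_restrict_space_cong[OF sets_lborel] refl])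

lemma nn_integral_chart:
  assumes c: "c \<in> atlas R" and h: "h \<in> borel_measurable (vol R)"
  shows "(\<integral>\<^sup>+p\<in>cdom c. h p \<partial>vol R) = (\<integral>\<^sup>+x\<in>crange c. (ennreal (dens c x) * h (param c x)) \<partial>lborel)"
proof -
  let ?L = "restrict_space lborel (crange c)"
  have pm: "param c \<in> measurable ?L (restrict_space (vol R) (cdom c))"
    using param_measurable[OF c] by (simp add: lborel_restrict_cong)
  have d: "dens c \<in> borel_measurable ?L" using dens_measurable[OF c] by (simp add: lborel_restrict_cong)
  have cd: "cdom c \<inter> space (vol R) \<in> sets (vol R)"
    using cdom_sets_vol[OF c] by (simp add: Int_absorb2[OF cdom_subset[OF c]])
  have hr: "h \<in> borel_measurable (restrict_space (vol R) (cdom c))" using h by (rule measurable_restrict_space1)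
  have hp: "(\<lambda>x. h (param c x)) \<in> borel_measurable ?L" by (rule measurable_compose[OF pm hr])
  have "(\<integral>\<^sup>+p\<in>cdom c. h p \<partial>vol R) = (\<integral>\<^sup>+p. h p \<partial>restrict_space (vol R) (cdom c))"
    by (rule nn_integral_restrict_space[OF cd, symmetric])
  also have "\<dots> = (\<integral>\<^sup>+x. h (param c x) \<partial>density ?L (\<lambda>x. ennreal (dens c x)))"
    by (subst vol_chart_distr[OF c], subst nn_integral_distr) (use pm hr in simp_all)
  also have "\<dots> = (\<integral>\<^sup>+x. ennreal (dens c x) * h (param c x) \<partial>?L)"
    by (subst nn_integral_density) (use hp d in auto)
  also have "\<dots> = (\<integral>\<^sup>+x\<in>crange c. (ennreal (dens c x) * h (param c x)) \<partial>lborel)"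
    by (rule nn_integral_restrict_space) (use crange_borel[OF c] in simp)
  finally show ?thesis .
qed

lemma integral_chart:
  fixes h :: "'a \<Rightarrow> real"
  assumes c: "c \<in> atlas R" and h: "h \<in> borel_measurable (vol R)"
  shows "set_integrable (vol R) (cdom c) h \<longleftrightarrow> set_integrable lborel (crange c) (\<lambda>x. dens c x * h (param c x))"
    and "(LINT p:cdom c|vol R. h p) = (LINT x:crange c|lborel. dens c x * h (param c x))"
proof -
  let ?L = "restrict_space lborel (crange c)"
  have pm: "param c \<in> measurable ?L (restrict_space (vol R) (cdom c))"
    using param_measurable[OF c] by (simp add: lborel_restrict_cong)
  have d: "dens c \<in> borel_measurable ?L" using dens_measurable[OF c] by (simp add: lborel_restrict_cong)
  have cd: "cdom c \<inter> space (vol R) \<in> sets (vol R)"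
    using cdom_sets_vol[OF c] by (simp add: Int_absorb2[OF cdom_subset[OF c]])
  have cr: "crange c \<inter> space lborel \<in> sets lborel" using crange_borel[OF c] by simp
  have hr: "h \<in> borel_measurable (restrict_space (vol R) (cdom c))" using h by (rule measurable_restrict_space1)
  have hp: "(\<lambda>x. h (param c x)) \<in> borel_measurable ?L" by (rule measurable_compose[OF pm hr])
  have pos: "AE x in ?L. 0 \<le> dens c x"
    by (rule AE_I2) (auto simp: space_restrict_space intro!: less_imp_le dens_pos[OF c])
  have "set_integrable (vol R) (cdom c) h \<longleftrightarrow> integrable (restrict_space (vol R) (cdom c)) h"
    unfolding set_integrable_def by (rule integrable_restrict_space[OF cd, symmetric])
  also have "\<dots> \<longleftrightarrow> integrable (density ?L (\<lambda>x. ennreal (dens c x))) (\<lambda>x. h (param c x))"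
    by (subst vol_chart_distr[OF c], subst integrable_distr_eq) (use pm hr in simp_all)
  also have "\<dots> \<longleftrightarrow> integrable ?L (\<lambda>x. dens c x * h (param c x))"
    by (subst integrable_density) (use hp d pos in auto)
  also have "\<dots> \<longleftrightarrow> set_integrable lborel (crange c) (\<lambda>x. dens c x * h (param c x))"
    unfolding set_integrable_def by (rule integrable_restrict_space[OF cr])
  finally show "set_integrable (vol R) (cdom c) h \<longleftrightarrow> set_integrable lborel (crange c) (\<lambda>x. dens c x * h (param c x))" .
  have "(LINT p:cdom c|vol R. h p) = integral\<^sup>L (restrict_space (vol R) (cdom c)) h"
    unfolding set_lebesgue_integral_def by (rule integral_restrict_space[OF cd, symmetric])
  also have "\<dots> = (\<integral>x. h (param c x) \<partial>density ?L (\<lambda>x. ennreal (dens c x)))"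
    by (subst vol_chart_distr[OF c], subst integral_distr) (use pm hr in simp_all)
  also have "\<dots> = (\<integral>x. dens c x * h (param c x) \<partial>?L)"
    by (subst integral_density) (use hp d pos in auto)
  also have "\<dots> = (LINT x:crange c|lborel. dens c x * h (param c x))"
    unfolding set_lebesgue_integral_def by (rule integral_restrict_space[OF cr])
  finally show "(LINT p:cdom c|vol R. h p) = (LINT x:crange c|lborel. dens c x * h (param c x))" .
qed

lemma param_pts: "c \<in> atlas R \<Longrightarrow> x \<in> crange c \<Longrightarrow> param c x \<in> pts R"
  using cdom_subset[of c] param_in[of x c] by (rule subsetD)

text \<open>Boxes rather than balls, since a box cut by the half-space is again a box: boundary
  points and interior points need no distinction, neither here nor in Rellich's theorem.\<close>

lemma box_neighbourhood:
  assumes p: "p \<in> pts R"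
  shows "\<exists>c a b N. c \<in> atlas R \<and> cbox a b \<subseteq> crange c \<and> openin (top_of_set (pts R)) N \<and> p \<in> N \<and> N \<subseteq> param c ` cbox a b"
proof -
  obtain c where c: "c \<in> atlas R" "p \<in> cdom c" using p chart_exists by blast
  let ?x = "coord c p"
  obtain W where W: "open W" "crange c = halfspace \<inter> W"
    using openin_crange[OF c(1)] by (auto simp: openin_open)
  have x: "?x \<in> halfspace" "?x \<in> W" using W c by auto
  obtain l u where lu: "?x \<in> box l u" "cbox l u \<subseteq> W"
    using open_contains_cbox[OF W(1)] x(2) by (metis W(1) open_contains_cbox)
  \<comment> \<open>Raising the lower corner to 0 in the direction \<open>bdi\<close> cuts off
    exactly the part of the box outside the half-space.\<close>
  define a :: "real^'n" where "a = (\<chi> i. if i = bdi then max 0 (l $ i) else l $ i)"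
  have ab: "cbox a u = halfspace \<inter> cbox l u"
    by (auto simp: a_def mem_box_cart halfspace_def split: if_splits) (metis max.bounded_iff)+
  then have sub: "cbox a u \<subseteq> crange c" using lu W by auto
  let ?V = "halfspace \<inter> box l u"
  have V: "?V \<subseteq> cbox a u" unfolding ab using box_subset_cbox by blast
  have "openin (top_of_set halfspace) ?V" by (intro openin_open_Int open_box)
  then have o: "openin (top_of_set (pts R)) (param c ` ?V)"
    by (rule openin_param_image[OF c(1)]) (use V sub in blast)
  have "p \<in> param c ` ?V" using x lu c by (metis IntI image_eqI param_coord)
  then show ?thesis
    by (intro exI[of _ c] exI[of _ a] exI[of _ u] exI[of _ "param c ` ?V"]) (use o V sub c(1) in auto)
qed

lemma finite_box_cover:
  "\<exists>F. finite F \<and> (\<forall>(c, a, b)\<in>F. c \<in> atlas R \<and> cbox a b \<subseteq> crange c) \<and> pts R = (\<Union>(c, a, b)\<in>F. param c ` cbox a b)"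
proof -
  define G where "G = {((c, a, b), N). c \<in> atlas R \<and> cbox a b \<subseteq> crange c \<and> openin (top_of_set (pts R)) N \<and> N \<subseteq> param c ` cbox a b}"
  have "pts R \<subseteq> \<Union> (snd ` G)"
  proof
    fix p assume "p \<in> pts R"
    from box_neighbourhood[OF this] obtain c a b N
      where "c \<in> atlas R \<and> cbox a b \<subseteq> crange c \<and> openin (top_of_set (pts R)) N \<and> p \<in> N \<and> N \<subseteq> param c ` cbox a b" by blast
    then have "((c, a, b), N) \<in> G" "p \<in> N" by (auto simp: G_def)
    then show "p \<in> \<Union> (snd ` G)" by force
  qed
  moreover have "\<forall>N\<in>snd ` G. openin (top_of_set (pts R)) N" by (auto simp: G_def)
  ultimately have "\<exists>D\<subseteq>snd ` G. finite D \<and> pts R \<subseteq> \<Union>D"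
    by (intro compact_pts[unfolded compact_eq_openin_cover, THEN spec, THEN mp] conjI)
  then obtain D where D: "D \<subseteq> snd ` G" "finite D" "pts R \<subseteq> \<Union>D" by (elim exE conjE)
  obtain G' where G': "G' \<subseteq> G" "finite G'" "D = snd ` G'"
    using finite_subset_image[OF D(2,1)] by (elim exE conjE)
  show ?thesis
  proof (intro exI conjI)
    show "finite (fst ` G')" using G' by simp
    show "\<forall>(c, a, b)\<in>fst ` G'. c \<in> atlas R \<and> cbox a b \<subseteq> crange c" using G'(1) by (auto simp: G_def)
    show "pts R = (\<Union>(c, a, b)\<in>fst ` G'. param c ` cbox a b)"
    proof
      show "pts R \<subseteq> (\<Union>(c, a, b)\<in>fst ` G'. param c ` cbox a b)"
      proof
        fix q assume "q \<in> pts R"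
        then obtain c a b N where t: "((c, a, b), N) \<in> G'" "q \<in> N" using D(3) unfolding G'(3) by auto
        then have "N \<subseteq> param c ` cbox a b" using G'(1) by (auto simp: G_def)
        then have "q \<in> param c ` cbox a b" using t(2) by (rule subsetD)
        moreover have "(c, a, b) \<in> fst ` G'" using t(1) by (metis fst_conv image_eqI)
        ultimately show "q \<in> (\<Union>(c, a, b)\<in>fst ` G'. param c ` cbox a b)" by blast
      qed
      show "(\<Union>(c, a, b)\<in>fst ` G'. param c ` cbox a b) \<subseteq> pts R"
      proof (rule UN_least)
        fix t assume "t \<in> fst ` G'"
        then obtain c a b N where t: "t = (c, a, b)" "((c, a, b), N) \<in> G'" by (metis imageE prod.collapse)
        then have "c \<in> atlas R" "cbox a b \<subseteq> crange c" using G'(1) by (auto simp: G_def)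
        then show "(case t of (c, a, b) \<Rightarrow> param c ` cbox a b) \<subseteq> pts R"
          unfolding t(1) prod.case by (intro image_subsetI param_pts) blast+
      qed
    qed
  qed
qed

lemma param_image_borel:
  assumes c: "c \<in> atlas R" and S: "S \<in> sets borel" "S \<subseteq> crange c"
  shows "param c ` S \<in> sets borel"
proof -
  have e: "param c ` S = coord c -` S \<inter> cdom c"
    using S(2) by (auto simp: subset_iff) (metis (no_types, lifting) S(2) c coord_param image_eqI param_coord param_in subsetD)+
  have "coord c -` S \<inter> space (restrict_space borel (cdom c)) \<in> sets (restrict_space borel (cdom c))"
    by (rule measurable_sets[OF borel_measurable_continuous_on_restrict[OF continuous_coord[OF c]] S(1)])
  then show ?thesis
    unfolding e using cdom_borel[OF c] by (subst (asm) sets_restrict_space_iff) (auto simp: space_restrict_space)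
qed

lemma coord_param_image: "S \<subseteq> crange c \<Longrightarrow> coord c ` param c ` S = S"
  by (force simp: image_image subset_iff)

text \<open>Finitely many compact coordinate boxes cover the manifold, and on each of them the
  density is bounded.\<close>

lemma finite_measure_vol: "finite_measure (vol R)"
proof
  obtain F where F0: "finite F \<and> (\<forall>(c, a, b)\<in>F. c \<in> atlas R \<and> cbox a b \<subseteq> crange c) \<and>
    pts R = (\<Union>(c, a, b)\<in>F. param c ` cbox a b)" using finite_box_cover by (elim exE)
  have F: "finite F" "\<And>c a b. (c, a, b) \<in> F \<Longrightarrow> c \<in> atlas R \<and> cbox a b \<subseteq> crange c"
    "pts R = (\<Union>(c, a, b)\<in>F. param c ` cbox a b)" using F0 by fast+
  have *: "param c ` cbox a b \<in> sets (vol R) \<and> emeasure (vol R) (param c ` cbox a b) < \<infinity>" if "(c, a, b) \<in> F" for c a b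
  proof
    have c: "c \<in> atlas R" "cbox a b \<subseteq> crange c" using F(2) that by auto
    have s: "param c ` cbox a b \<in> sets borel" "param c ` cbox a b \<subseteq> cdom c"
      using param_image_borel[OF c(1) _ c(2)] c(2) param_in by (auto simp: subset_iff)
    then show "param c ` cbox a b \<in> sets (vol R)" using cdom_subset[OF c(1)] by (auto simp: sets_vol_iff)
    have "compact (dens c ` cbox a b)"
      using continuous_on_subset[OF continuous_on_dens[OF c(1)] c(2)] by (intro compact_continuous_image) auto
    then obtain K where K: "\<And>x. x \<in> cbox a b \<Longrightarrow> dens c x \<le> K"
      using compact_imp_bounded[THEN bounded_imp_bdd_above] unfolding bdd_above_def by (metis image_eqI)
    have "emeasure (vol R) (param c ` cbox a b) = (\<integral>\<^sup>+x\<in>cbox a b. ennreal (dens c x) \<partial>lborel)"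
      using emeasure_vol_chart[OF c(1) s] by (simp add: cvol_def coord_param_image[OF c(2)])
    also have "\<dots> \<le> (\<integral>\<^sup>+x\<in>cbox a b. ennreal K \<partial>lborel)"
      by (intro nn_integral_mono) (auto simp: indicator_def intro!: ennreal_leI K)
    also have "\<dots> < \<infinity>"
      using emeasure_lborel_cbox_finite[of a b]
      by (simp add: nn_integral_cmult_indicator ennreal_mult_less_top infinity_ennreal_def)
    finally show "emeasure (vol R) (param c ` cbox a b) < \<infinity>" .
  qed
  have "emeasure (vol R) (pts R) = emeasure (vol R) (\<Union>t\<in>F. case t of (c, a, b) \<Rightarrow> param c ` cbox a b)"
    using F(3) by simp
  also have "\<dots> \<le> (\<Sum>t\<in>F. emeasure (vol R) (case t of (c, a, b) \<Rightarrow> param c ` cbox a b))"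
    using * by (intro emeasure_subadditive_finite F(1)) auto
  also have "\<dots> < \<infinity>" using * F(1) by (auto simp: sum_Inf[symmetric] less_top)
  finally show "emeasure (vol R) (space (vol R)) \<noteq> \<infinity>" by simp
qed

sublocale vol: finite_measure "vol R" by (rule finite_measure_vol)

end

section \<open>Semidefinite forms and their completion\<close>

text \<open>The same pointwise structure serves the test functions and the sequences of test
  functions that make up the completion.\<close>

instantiation "fun" :: (type, real_vector) real_vector
begin

definition "scaleR_fun r f = (\<lambda>x. r *\<^sub>R f x)"

instance
  by standard (auto simp: scaleR_fun_def fun_eq_iff scaleR_add_right scaleR_add_left)

end

lemma scaleR_fun_apply [simp]: "(r *\<^sub>R f) x = r *\<^sub>R f x"
  by (simp add: scaleR_fun_def)

lemma sum_fun_apply: "(\<Sum>i\<in>I. f i) x = (\<Sum>i\<in>I. f i x)"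
  by (induction I rule: infinite_finite_induct) auto

text \<open>The laws are restricted to V because integrals are additive only where they exist. Only
  semidefiniteness is asked, so that neither functions equal almost everywhere nor Cauchy sequences
  at distance zero have to be identified.\<close>

locale semi_form =
  fixes V :: "'v::real_vector set" and q :: "'v \<Rightarrow> 'v \<Rightarrow> real"
  assumes subspace_V: "subspace V"
    and add_left: "x \<in> V \<Longrightarrow> y \<in> V \<Longrightarrow> z \<in> V \<Longrightarrow> q (x + y) z = q x z + q y z"
    and scale_left: "x \<in> V \<Longrightarrow> z \<in> V \<Longrightarrow> q (r *\<^sub>R x) z = r * q x z"
    and sym: "x \<in> V \<Longrightarrow> y \<in> V \<Longrightarrow> q x y = q y x"
    and nonneg: "x \<in> V \<Longrightarrow> 0 \<le> q x x"
begin

lemma V_add: "x \<in> V \<Longrightarrow> y \<in> V \<Longrightarrow> x + y \<in> V"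
  and V_scale: "x \<in> V \<Longrightarrow> r *\<^sub>R x \<in> V"
  and V_zero: "0 \<in> V"
  and V_diff: "x \<in> V \<Longrightarrow> y \<in> V \<Longrightarrow> x - y \<in> V"
  and V_sum: "(\<And>i. i \<in> I \<Longrightarrow> f i \<in> V) \<Longrightarrow> sum f I \<in> V"
  using subspace_V by (auto intro: subspace_add subspace_scale subspace_0 subspace_diff subspace_sum)

lemma add_right: "x \<in> V \<Longrightarrow> y \<in> V \<Longrightarrow> z \<in> V \<Longrightarrow> q z (x + y) = q z x + q z y"
  using add_left[of x y z] sym[of z "x + y"] sym[of z x] sym[of z y] V_add by simp

lemma scale_right: "x \<in> V \<Longrightarrow> z \<in> V \<Longrightarrow> q z (r *\<^sub>R x) = r * q z x"
  using scale_left[of x z] sym[of z "r *\<^sub>R x"] sym[of z x] V_scale by simp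

lemma diff_left: "x \<in> V \<Longrightarrow> y \<in> V \<Longrightarrow> z \<in> V \<Longrightarrow> q (x - y) z = q x z - q y z"
  using add_left[of x "(-1) *\<^sub>R y" z] scale_left[of y z "-1"] V_scale[of y "-1"] by simp

lemma diff_right: "x \<in> V \<Longrightarrow> y \<in> V \<Longrightarrow> z \<in> V \<Longrightarrow> q z (x - y) = q z x - q z y"
  using diff_left[of x y z] sym[of z "x - y"] sym[of z x] sym[of z y] V_diff by simp

lemma zero_left [simp]: "z \<in> V \<Longrightarrow> q 0 z = 0"
  using scale_left[of 0 z 0] V_zero by simp

lemma zero_right [simp]: "z \<in> V \<Longrightarrow> q z 0 = 0"
  using scale_right[of 0 z 0] V_zero by simp

lemma sum_left:
  assumes "\<And>i. i \<in> I \<Longrightarrow> f i \<in> V" "z \<in> V"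
  shows "q (\<Sum>i\<in>I. f i) z = (\<Sum>i\<in>I. q (f i) z)"
  using assms(1)
  by (induction I rule: infinite_finite_induct) (auto simp: add_left V_sum assms(2))

lemma sum_right:
  assumes "\<And>i. i \<in> I \<Longrightarrow> f i \<in> V" "z \<in> V"
  shows "q z (\<Sum>i\<in>I. f i) = (\<Sum>i\<in>I. q z (f i))"
  using sum_left[of I f z] sym[of z "\<Sum>i\<in>I. f i"] sym[of z] assms V_sum[of I f] by simp

lemma lincomb:
  assumes "\<And>i. i \<in> I \<Longrightarrow> f i \<in> V" "\<And>i. i \<in> J \<Longrightarrow> g i \<in> V"
  shows "q (\<Sum>i\<in>I. r i *\<^sub>R f i) (\<Sum>j\<in>J. s j *\<^sub>R g j) = (\<Sum>i\<in>I. \<Sum>j\<in>J. r i * s j * q (f i) (g j))"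
  using assms
  by (simp add: sum_left sum_right V_scale V_sum scale_left scale_right sum_distrib_left mult_ac, intro sum.swap)

lemma quad_add: "x \<in> V \<Longrightarrow> y \<in> V \<Longrightarrow> q (x + y) (x + y) = q x x + 2 * q x y + q y y"
  using sym[of x y] by (simp add: add_left add_right V_add)

lemma quad_diff: "x \<in> V \<Longrightarrow> y \<in> V \<Longrightarrow> q (x - y) (x - y) = q x x - 2 * q x y + q y y"
  using sym[of x y] by (simp add: diff_left diff_right V_diff)

lemma quad_scale: "x \<in> V \<Longrightarrow> q (r *\<^sub>R x) (r *\<^sub>R x) = r\<^sup>2 * q x x"
  by (simp add: scale_left scale_right V_scale power2_eq_square)

lemma Cauchy_Schwarz:
  assumes x: "x \<in> V" and y: "y \<in> V"
  shows "(q x y)\<^sup>2 \<le> q x x * q y y"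
proof -
  have nn: "0 \<le> q x x + 2 * t * q x y + t\<^sup>2 * q y y" for t
  proof -
    have "0 \<le> q (x + t *\<^sub>R y) (x + t *\<^sub>R y)" using x y by (intro nonneg V_add V_scale)
    then show ?thesis by (simp only: quad_add[OF x V_scale[OF y]] scale_right[OF y x] quad_scale[OF y] mult.assoc)
  qed
  show ?thesis
  proof (cases "q y y = 0")
    case True
    have "q x y = 0"
    proof (rule ccontr)
      assume "q x y \<noteq> 0"
      \<comment> \<open>When \<open>q y y\<close> is 0 the expression is affine in t; this t gives
        it the value -1.\<close>
      then show False using nn[of "- (q x x + 1) / (2 * q x y)"] True by (simp add: field_simps)
    qed
    then show ?thesis using True by simp
  next
    case False
    then have "0 < q y y" using nonneg[OF y] by simp
    then show ?thesis using nn[of "- q x y / q y y"]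
      by (simp add: field_simps power2_eq_square)
  qed
qed

definition nrm :: "'v \<Rightarrow> real" where "nrm x = sqrt (q x x)"

lemma nrm_nonneg: "x \<in> V \<Longrightarrow> 0 \<le> nrm x"
  by (simp add: nrm_def nonneg)

lemma nrm_power2: "x \<in> V \<Longrightarrow> (nrm x)\<^sup>2 = q x x"
  by (simp add: nrm_def nonneg)

lemma abs_le_nrm: "x \<in> V \<Longrightarrow> y \<in> V \<Longrightarrow> \<bar>q x y\<bar> \<le> nrm x * nrm y"
  using real_sqrt_le_mono[OF Cauchy_Schwarz[of x y]] by (simp add: nrm_def real_sqrt_mult)

lemma nrm_add_le: assumes "x \<in> V" "y \<in> V" shows "nrm (x + y) \<le> nrm x + nrm y"
proof (rule power2_le_imp_le)
  have "(nrm (x + y))\<^sup>2 = (nrm x)\<^sup>2 + 2 * q x y + (nrm y)\<^sup>2"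
    using assms by (simp add: nrm_power2 V_add quad_add)
  also have "\<dots> \<le> (nrm x + nrm y)\<^sup>2"
    using abs_le_nrm[OF assms] by (simp add: power2_sum)
  finally show "(nrm (x + y))\<^sup>2 \<le> (nrm x + nrm y)\<^sup>2" .
qed (use assms nrm_nonneg in auto)

lemma nrm_minus_commute: "x \<in> V \<Longrightarrow> y \<in> V \<Longrightarrow> nrm (x - y) = nrm (y - x)"
  using sym[of x y] by (simp add: nrm_def quad_diff)

lemma nrm_triangle: "x \<in> V \<Longrightarrow> y \<in> V \<Longrightarrow> z \<in> V \<Longrightarrow> nrm (x - z) \<le> nrm (x - y) + nrm (y - z)"
  using nrm_add_le[of "x - y" "y - z"] by (simp add: V_diff)

lemma nrm_triangle2: "x \<in> V \<Longrightarrow> y \<in> V \<Longrightarrow> nrm x \<le> nrm y + nrm (x - y)"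
  using nrm_add_le[of y "x - y"] by (simp add: V_diff)

definition qconv :: "(nat \<Rightarrow> 'v) \<Rightarrow> 'v \<Rightarrow> bool" where
  "qconv f u \<longleftrightarrow> (\<lambda>j. nrm (f j - u)) \<longlonglongrightarrow> 0"

definition qcauchy :: "(nat \<Rightarrow> 'v) \<Rightarrow> bool" where
  "qcauchy f \<longleftrightarrow> (\<forall>e>0. \<exists>J. \<forall>i\<ge>J. \<forall>j\<ge>J. nrm (f i - f j) < e)"

lemma qcauchyD: "qcauchy f \<Longrightarrow> 0 < e \<Longrightarrow> \<exists>J. \<forall>i\<ge>J. \<forall>j\<ge>J. nrm (f i - f j) < e"
  by (simp add: qcauchy_def)

lemma qconv_left:
  assumes "\<And>j. f j \<in> V" "u \<in> V" "z \<in> V" "qconv f u"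
  shows "(\<lambda>j. q (f j) z) \<longlonglongrightarrow> q u z"
proof (rule LIM_zero_cancel, rule Lim_null_comparison)
  show "(\<lambda>j. nrm (f j - u) * nrm z) \<longlonglongrightarrow> 0"
    using assms(4) tendsto_mult_left_zero by (auto simp: qconv_def)
  show "\<forall>\<^sub>F j in sequentially. norm (q (f j) z - q u z) \<le> nrm (f j - u) * nrm z"
    using abs_le_nrm[of "f _ - u" z] assms by (intro always_eventually allI) (simp add: diff_left V_diff)
qed

lemma qconv_quad:
  assumes f: "\<And>j. f j \<in> V" "u \<in> V" "qconv f u"
  shows "(\<lambda>j. q (f j) (f j)) \<longlonglongrightarrow> q u u"
proof -
  have "(\<lambda>j. (nrm (f j - u))\<^sup>2 + 2 * q (f j) u - q u u) \<longlonglongrightarrow> 0\<^sup>2 + 2 * q u u - q u u"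
    using f by (intro tendsto_intros qconv_left) (auto simp: qconv_def)
  moreover have "(nrm (f j - u))\<^sup>2 + 2 * q (f j) u - q u u = q (f j) (f j)" for j
    using f by (simp add: nrm_power2 V_diff quad_diff)
  ultimately show ?thesis by simp
qed

lemma qcauchy_bounded:
  assumes f: "\<And>j. f j \<in> V" and c: "qcauchy f"
  shows "\<exists>K. \<forall>j. nrm (f j) \<le> K"
proof -
  obtain J where J: "\<And>i j. i \<ge> J \<Longrightarrow> j \<ge> J \<Longrightarrow> nrm (f i - f j) < 1"
    using qcauchyD[OF c, of 1] by auto
  define K where "K = Max ((\<lambda>j. nrm (f j)) ` {..J}) + 1"
  have "nrm (f j) \<le> K" for j
  proof (cases "j \<le> J")
    case True
    then have "nrm (f j) \<le> Max ((\<lambda>j. nrm (f j)) ` {..J})" by (intro Max_ge) auto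
    then show ?thesis by (simp add: K_def)
  next
    case False
    have "nrm (f j) \<le> nrm (f J) + nrm (f j - f J)" using f by (intro nrm_triangle2)
    also have "\<dots> \<le> Max ((\<lambda>j. nrm (f j)) ` {..J}) + 1"
      using J[of j J] False by (intro add_mono Max_ge) auto
    finally show ?thesis by (simp add: K_def)
  qed
  then show ?thesis by blast
qed

text \<open>Cauchy sequences stand for the elements of the completion; sequences at distance zero are not
  identified.\<close>

definition seqs :: "(nat \<Rightarrow> 'v) set" where
  "seqs = {F. (\<forall>j. F j \<in> V) \<and> qcauchy F}"

definition qlim :: "(nat \<Rightarrow> 'v) \<Rightarrow> (nat \<Rightarrow> 'v) \<Rightarrow> real" where
  "qlim F G = lim (\<lambda>j. q (F j) (G j))"

lemma seqsD: "F \<in> seqs \<Longrightarrow> F j \<in> V" "F \<in> seqs \<Longrightarrow> qcauchy F"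
  by (auto simp: seqs_def)

lemma const_seqs: "x \<in> V \<Longrightarrow> (\<lambda>j. x) \<in> seqs"
  by (auto simp: seqs_def qcauchy_def nrm_def V_zero)

lemma subspace_seqs: "subspace seqs"
proof (rule subspaceI)
  show "0 \<in> seqs" by (auto simp: seqs_def qcauchy_def nrm_def V_zero)
next
  fix F G assume F: "F \<in> seqs" and G: "G \<in> seqs"
  have "qcauchy (F + G)" unfolding qcauchy_def
  proof (intro allI impI)
    fix e :: real assume e: "0 < e"
    obtain I where I: "\<forall>i\<ge>I. \<forall>j\<ge>I. nrm (F i - F j) < e/2" using qcauchyD[OF seqsD(2)[OF F], of "e/2"] e by auto
    obtain J where J: "\<forall>i\<ge>J. \<forall>j\<ge>J. nrm (G i - G j) < e/2" using qcauchyD[OF seqsD(2)[OF G], of "e/2"] e by auto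
    have "nrm ((F + G) i - (F + G) j) < e" if "i \<ge> max I J" "j \<ge> max I J" for i j
    proof -
      have "nrm ((F + G) i - (F + G) j) = nrm ((F i - F j) + (G i - G j))" by (simp add: algebra_simps)
      also have "\<dots> \<le> nrm (F i - F j) + nrm (G i - G j)"
        using F G by (intro nrm_add_le V_diff seqsD)
      also have "\<dots> < e" using I[rule_format, of i j] J[rule_format, of i j] that by simp
      finally show ?thesis .
    qed
    then show "\<exists>J. \<forall>i\<ge>J. \<forall>j\<ge>J. nrm ((F + G) i - (F + G) j) < e" by blast
  qed
  then show "F + G \<in> seqs" using F G by (auto simp: seqs_def V_add)
next
  fix F and r :: real assume F: "F \<in> seqs"
  have n: "nrm (r *\<^sub>R x) = \<bar>r\<bar> * nrm x" if "x \<in> V" for x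
    using that by (simp add: nrm_def quad_scale real_sqrt_mult)
  have "qcauchy (r *\<^sub>R F)" unfolding qcauchy_def
  proof (intro allI impI)
    fix e :: real assume e: "0 < e"
    obtain J where J: "\<forall>i\<ge>J. \<forall>j\<ge>J. nrm (F i - F j) < e / (\<bar>r\<bar> + 1)"
      using qcauchyD[OF seqsD(2)[OF F], of "e / (\<bar>r\<bar> + 1)"] e by auto
    have "nrm ((r *\<^sub>R F) i - (r *\<^sub>R F) j) < e" if "i \<ge> J" "j \<ge> J" for i j
    proof -
      have "nrm ((r *\<^sub>R F) i - (r *\<^sub>R F) j) = \<bar>r\<bar> * nrm (F i - F j)"
        using F by (simp add: scaleR_diff_right[symmetric] n V_diff seqsD)
      also have "\<dots> \<le> (\<bar>r\<bar> + 1) * nrm (F i - F j)"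
        using F by (intro mult_right_mono nrm_nonneg V_diff seqsD) auto
      also have "\<dots> < e" using J[rule_format, OF that] by (simp add: field_simps)
      finally show ?thesis .
    qed
    then show "\<exists>J. \<forall>i\<ge>J. \<forall>j\<ge>J. nrm ((r *\<^sub>R F) i - (r *\<^sub>R F) j) < e" by blast
  qed
  then show "r *\<^sub>R F \<in> seqs" using F by (auto simp: seqs_def V_scale)
qed

lemma qlim_tendsto:
  assumes F: "F \<in> seqs" and G: "G \<in> seqs"
  shows "(\<lambda>j. q (F j) (G j)) \<longlonglongrightarrow> qlim F G"
proof -
  obtain K where K: "\<And>j. nrm (F j) \<le> K" using qcauchy_bounded[OF seqsD[OF F]] by blast
  obtain L where L: "\<And>j. nrm (G j) \<le> L" using qcauchy_bounded[OF seqsD[OF G]] by blast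
  have KL: "0 \<le> K" "0 \<le> L" using K[of 0] L[of 0] nrm_nonneg[OF seqsD(1)[OF F], of 0] nrm_nonneg[OF seqsD(1)[OF G], of 0] by linarith+
  have "Cauchy (\<lambda>j. q (F j) (G j))"
  proof (rule metric_CauchyI)
    fix e :: real assume e: "0 < e"
    define d where "d = e / (K + L + 1)"
    have d: "0 < d" using e KL by (simp add: d_def)
    obtain I where I: "\<forall>i\<ge>I. \<forall>j\<ge>I. nrm (F i - F j) < d" using qcauchyD[OF seqsD(2)[OF F] d] by auto
    obtain J where J: "\<forall>i\<ge>J. \<forall>j\<ge>J. nrm (G i - G j) < d" using qcauchyD[OF seqsD(2)[OF G] d] by auto
    have "dist (q (F i) (G i)) (q (F j) (G j)) < e" if "i \<ge> max I J" "j \<ge> max I J" for i j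
    proof -
      have "q (F i) (G i) - q (F j) (G j) = q (F i - F j) (G i) + q (F j) (G i - G j)"
        using seqsD(1)[OF F] seqsD(1)[OF G] by (simp add: diff_left diff_right)
      also have "\<bar>\<dots>\<bar> \<le> nrm (F i - F j) * nrm (G i) + nrm (F j) * nrm (G i - G j)"
        using seqsD(1)[OF F] seqsD(1)[OF G]
        by (intro order_trans[OF abs_triangle_ineq] add_mono abs_le_nrm V_diff)
      also have "\<dots> \<le> d * L + K * d"
        using seqsD(1)[OF F] seqsD(1)[OF G] I[rule_format, of i j] J[rule_format, of i j] that K L KL d
        by (intro add_mono mult_mono nrm_nonneg V_diff) auto
      also have "\<dots> < e"
      proof -
        have "d * (K + L + 1) = e" using KL by (simp add: d_def)
        then show ?thesis using d by (simp add: algebra_simps)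
      qed
      finally show ?thesis by (simp add: dist_real_def)
    qed
    then show "\<exists>M. \<forall>i\<ge>M. \<forall>j\<ge>M. dist (q (F i) (G i)) (q (F j) (G j)) < e" by blast
  qed
  then show ?thesis unfolding qlim_def
    using Cauchy_convergent_iff convergent_LIMSEQ_iff by blast
qed

lemma qlim_eqI: "F \<in> seqs \<Longrightarrow> G \<in> seqs \<Longrightarrow> (\<lambda>j. q (F j) (G j)) \<longlonglongrightarrow> l \<Longrightarrow> qlim F G = l"
  using LIMSEQ_unique qlim_tendsto by blast

lemma qlim_const [simp]: "qlim (\<lambda>j. x) (\<lambda>j. y) = q x y"
  by (simp add: qlim_def)

text \<open>Formulated for subspaces because the common carrier will be the sequences that are
  Cauchy for a + b, a subspace of the Cauchy sequences of a and of those of b.\<close>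

lemma semi_form_qlim:
  assumes W: "subspace W" "W \<subseteq> seqs"
  shows "semi_form W qlim"
proof
  have add: "F + G \<in> seqs" if "F \<in> W" "G \<in> W" for F G using W that subspace_add by blast
  have scale: "r *\<^sub>R F \<in> seqs" if "F \<in> W" for F r using W that subspace_scale by blast
  have WD: "F \<in> seqs" if "F \<in> W" for F using that W by blast
  fix F G H r assume F: "F \<in> W" and G: "G \<in> W" and H: "H \<in> W"
  show "qlim (F + G) H = qlim F H + qlim G H"
    using F G H
    by (intro qlim_eqI add WD Lim_transform_eventually[OF tendsto_add[OF qlim_tendsto[of F H] qlim_tendsto[of G H]]])
      (auto simp: add_left seqsD WD)
  show "qlim (r *\<^sub>R F) G = r * qlim F G"
    using F G
    by (intro qlim_eqI scale WD Lim_transform_eventually[OF tendsto_mult[OF tendsto_const qlim_tendsto[of F G]]])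
      (auto simp: scale_left seqsD WD)
  show "qlim F G = qlim G F"
    using F G by (intro qlim_eqI WD Lim_transform_eventually[OF qlim_tendsto[of G F]]) (auto simp: seqsD WD sym)
  show "0 \<le> qlim F F"
    using qlim_tendsto[OF WD[OF F] WD[OF F]] by (rule LIMSEQ_le_const) (auto simp: nonneg seqsD WD[OF F])
qed (rule W(1))

lemma semi_form_seqs: "semi_form seqs qlim"
  by (rule semi_form_qlim[OF subspace_seqs order_refl])

lemma nrm_qlim_le:
  assumes F: "F \<in> seqs" and le: "\<And>j. j \<ge> J \<Longrightarrow> nrm (F j) \<le> e"
  shows "semi_form.nrm qlim F \<le> e"
proof -
  have e: "0 \<le> e" using le[of J] nrm_nonneg[OF seqsD(1)[OF F], of J] by simp
  have "qlim F F \<le> e\<^sup>2"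
    using qlim_tendsto[OF F F]
  proof (rule LIMSEQ_le_const2)
    show "\<exists>N. \<forall>j\<ge>N. q (F j) (F j) \<le> e\<^sup>2"
      using le nrm_nonneg[OF seqsD(1)[OF F]] nrm_power2[OF seqsD(1)[OF F]] by (metis power_mono)
  qed
  then show ?thesis using e unfolding semi_form.nrm_def[OF semi_form_seqs] by (simp add: real_le_lsqrt)
qed

text \<open>Density: a Cauchy sequence is the limit of its own members, regarded as constant
  sequences.\<close>

lemma seqs_const_qconv:
  assumes f: "f \<in> seqs"
  shows "semi_form.qconv qlim (\<lambda>m j. f m) f"
proof -
  interpret W: semi_form seqs qlim by (rule semi_form_seqs)
  have cs: "(\<lambda>j. f m) \<in> seqs" for m using const_seqs seqsD(1)[OF f] by blast
  show ?thesis unfolding W.qconv_def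
  proof (rule LIMSEQ_I)
    fix e :: real assume e: "0 < e"
    obtain J where J: "\<forall>i\<ge>J. \<forall>j\<ge>J. nrm (f i - f j) < e/2" using qcauchyD[OF seqsD(2)[OF f], of "e/2"] e by auto
    have "W.nrm ((\<lambda>j. f m) - f) \<le> e/2" if "m \<ge> J" for m
      by (rule nrm_qlim_le[where J=J]) (use J that W.V_diff[OF cs f] in \<open>auto intro: less_imp_le\<close>)
    then show "\<exists>no. \<forall>n\<ge>no. norm (W.nrm ((\<lambda>j. f n) - f) - 0) < e"
      using e W.nrm_nonneg[OF W.V_diff[OF cs f]] by (intro exI[of _ J]) force
  qed
qed

text \<open>Replaces a sequence in the completion by a sequence in V with errors tending to 0. Both
  completeness and compactness of the completion are reduced to V in this way.\<close>

lemma diag_approx: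
  assumes \<Phi>: "\<And>m::nat. \<Phi> m \<in> seqs"
  shows "\<exists>f. \<forall>m. f m \<in> V \<and> semi_form.nrm qlim (\<Phi> m - (\<lambda>j. f m)) \<le> 1 / (real m + 1)"
proof (rule choice, intro allI)
  fix m
  obtain J where J: "\<forall>i\<ge>J. \<forall>j\<ge>J. nrm (\<Phi> m i - \<Phi> m j) < 1 / (real m + 1)"
    using qcauchyD[OF seqsD(2)[OF \<Phi>], of "1 / (real m + 1)" m] by auto
  have "semi_form.nrm qlim (\<Phi> m - (\<lambda>j. \<Phi> m J)) \<le> 1 / (real m + 1)"
  proof (rule nrm_qlim_le[where J=J])
    show "\<Phi> m - (\<lambda>j. \<Phi> m J) \<in> seqs"
      using \<Phi> subspace_diff[OF subspace_seqs] const_seqs seqsD by blast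
  qed (use J in \<open>auto intro: less_imp_le\<close>)
  then show "\<exists>x. x \<in> V \<and> semi_form.nrm qlim (\<Phi> m - (\<lambda>j. x)) \<le> 1 / (real m + 1)"
    using seqsD(1)[OF \<Phi>] by blast
qed

text \<open>The approximating vectors form a Cauchy sequence in V, and this sequence, as an element
  of the completion, is the limit.\<close>

lemma seqs_complete:
  assumes \<Phi>: "\<And>m::nat. \<Phi> m \<in> seqs" and c: "semi_form.qcauchy qlim \<Phi>"
  shows "\<exists>F\<in>seqs. semi_form.qconv qlim \<Phi> F"
proof -
  interpret W: semi_form seqs qlim by (rule semi_form_seqs)
  obtain f where f: "\<And>m. f m \<in> V" "\<And>m. W.nrm (\<Phi> m - (\<lambda>j. f m)) \<le> 1 / (real m + 1)"
    using diag_approx[of \<Phi>] \<Phi> by blast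
  have cs: "(\<lambda>j. f m) \<in> seqs" for m using const_seqs f by blast
  have t: "(\<lambda>m. 1 / (real m + 1)) \<longlonglongrightarrow> 0"
    using LIMSEQ_inverse_real_of_nat by (simp add: inverse_eq_divide add.commute)
  have "qcauchy f" unfolding qcauchy_def
  proof (intro allI impI)
    fix e :: real assume e: "0 < e"
    obtain I where I: "\<forall>i\<ge>I. \<forall>j\<ge>I. W.nrm (\<Phi> i - \<Phi> j) < e/3" using W.qcauchyD[OF c, of "e/3"] e by auto
    obtain J where J: "\<forall>m\<ge>J. 1 / (real m + 1) < e/3"
      using order_tendstoD(2)[OF t, of "e/3"] e by (auto simp: eventually_sequentially)
    have "nrm (f i - f j) < e" if "i \<ge> max I J" "j \<ge> max I J" for i j
    proof -
      have "nrm (f i - f j) = W.nrm ((\<lambda>_. f i) - (\<lambda>_. f j))"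
        by (simp add: nrm_def W.nrm_def fun_diff_def)
      also have "\<dots> \<le> W.nrm ((\<lambda>_. f i) - \<Phi> i) + (W.nrm (\<Phi> i - \<Phi> j) + W.nrm (\<Phi> j - (\<lambda>_. f j)))"
        using W.nrm_triangle[OF cs[of i] \<Phi>[of i] cs[of j]] W.nrm_triangle[OF \<Phi>[of i] \<Phi>[of j] cs[of j]] by simp
      also have "\<dots> < e/3 + (e/3 + e/3)"
        using f(2)[of i] f(2)[of j] J[rule_format, of i] J[rule_format, of j] I[rule_format, of i j] that
          W.nrm_minus_commute[OF cs[of i] \<Phi>[of i]] by (intro add_strict_mono) auto
      finally show ?thesis by simp
    qed
    then show "\<exists>J. \<forall>i\<ge>J. \<forall>j\<ge>J. nrm (f i - f j) < e" by blast
  qed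
  then have fs: "f \<in> seqs" using f by (simp add: seqs_def)
  have "(\<lambda>m. W.nrm ((\<lambda>j. f m) - f)) \<longlonglongrightarrow> 0"
    using seqs_const_qconv[OF fs] by (simp add: W.qconv_def)
  then have l: "(\<lambda>m. 1 / (real m + 1) + W.nrm ((\<lambda>j. f m) - f)) \<longlonglongrightarrow> 0"
    using tendsto_add[OF t] by fastforce
  have "W.qconv \<Phi> f" unfolding W.qconv_def
  proof (rule Lim_null_comparison[OF _ l], intro always_eventually allI)
    fix m
    show "norm (W.nrm (\<Phi> m - f)) \<le> 1 / (real m + 1) + W.nrm ((\<lambda>j. f m) - f)"
      using W.nrm_triangle[OF \<Phi>[of m] cs[of m] fs] f(2)[of m] W.nrm_nonneg[OF W.V_diff[OF \<Phi>[of m] fs]] by simp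
  qed
  then show ?thesis using fs by blast
qed

end

section \<open>The spectrum of a pair of forms\<close>

text \<open>Cantor's diagonal argument. It serves finitely many coefficients on a sphere as well as
  the countably many functionals of Rellich's theorem.\<close>

lemma common_convergent_subsequence:
  fixes X :: "nat \<Rightarrow> nat \<Rightarrow> real"
  assumes "\<And>i. bounded (range (\<lambda>j. X j i))"
  shows "\<exists>r. strict_mono (r :: nat \<Rightarrow> nat) \<and> (\<forall>i. convergent (\<lambda>j. X (r j) i))"
proof -
  interpret subseqs "\<lambda>i s. convergent (\<lambda>j. X (s j) i)"
  proof
    fix i :: nat and s :: "nat \<Rightarrow> nat"
    have "bounded (range (\<lambda>j. X (s j) i))" by (rule bounded_subset[OF assms[of i]]) auto
    then obtain l r where "strict_mono r" "((\<lambda>j. X (s j) i) \<circ> r) \<longlonglongrightarrow> l"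
      using bounded_imp_convergent_subsequence by blast
    then show "\<exists>r'. strict_mono r' \<and> convergent (\<lambda>j. X ((s \<circ> r') j) i)"
      by (auto simp: convergent_def o_def)
  qed
  have "convergent (\<lambda>j. X ((diagseq \<circ> (+) (Suc i)) j) i)" for i
    by (rule diagseq_holds) (auto simp: o_def dest: convergent_subseq_convergent[unfolded o_def])
  then have "convergent (\<lambda>j. X (diagseq (j + Suc i)) i)" for i by (simp add: o_def add.commute[of _ i])
  then have "convergent (\<lambda>j. X (diagseq j) i)" for i
    by (rule convergent_ignore_initial_segment[THEN iffD1])
  then show ?thesis using subseq_diagseq by blast
qed

text \<open>Gaussian elimination: unless it is trivial, the last equation is solved for one unknown
  p, which leaves one equation and one unknown fewer.\<close>

lemma homogeneous_system_nontrivial: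
  fixes M :: "nat \<Rightarrow> 'i \<Rightarrow> real"
  assumes "finite I" "m < card I"
  shows "\<exists>\<gamma>. (\<exists>i\<in>I. \<gamma> i \<noteq> 0) \<and> (\<forall>l<m. (\<Sum>i\<in>I. \<gamma> i * M l i) = 0)"
  using assms
proof (induction m arbitrary: I M)
  case 0
  then have "I \<noteq> {}" by auto
  then show ?case by (intro exI[of _ "\<lambda>_. 1"]) auto
next
  case (Suc m)
  show ?case
  proof (cases "\<forall>i\<in>I. M m i = 0")
    case True
    obtain \<gamma> where "\<exists>i\<in>I. \<gamma> i \<noteq> 0" "\<forall>l<m. (\<Sum>i\<in>I. \<gamma> i * M l i) = 0"
      using Suc.IH[OF Suc.prems(1), of M] Suc.prems(2) by auto
    then show ?thesis using True by (intro exI[of _ \<gamma>]) (auto simp: less_Suc_eq)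
  next
    case False
    then obtain p where p: "p \<in> I" "M m p \<noteq> 0" by blast
    have "m < card (I - {p})" using Suc.prems p by simp
    then obtain \<gamma> where g: "\<exists>i\<in>I - {p}. \<gamma> i \<noteq> 0"
      "\<forall>l<m. (\<Sum>i\<in>I - {p}. \<gamma> i * (M l i - M l p * M m i / M m p)) = 0"
      using Suc.IH[of "I - {p}" "\<lambda>l i. M l i - M l p * M m i / M m p"] Suc.prems(1) by auto
    \<comment> \<open>The value that the last equation dictates for the unknown p.\<close>
    define s where "s = - (\<Sum>i\<in>I - {p}. \<gamma> i * M m i) / M m p"
    define \<delta> where "\<delta> = \<gamma>(p := s)"
    have sum: "(\<Sum>i\<in>I. \<delta> i * M l i) = s * M l p + (\<Sum>i\<in>I - {p}. \<gamma> i * M l i)" for l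
      using p Suc.prems(1) by (subst sum.remove[of I p]) (auto simp: \<delta>_def intro!: sum.cong)
    have "(\<Sum>i\<in>I. \<delta> i * M l i) = 0" if "l < Suc m" for l
    proof (cases "l = m")
      case True
      then show ?thesis using p unfolding sum by (simp add: s_def)
    next
      case False
      then have "0 = (\<Sum>i\<in>I - {p}. \<gamma> i * (M l i - M l p * M m i / M m p))" using g(2) that by simp
      also have "\<dots> = (\<Sum>i\<in>I - {p}. \<gamma> i * M l i - M l p / M m p * (\<gamma> i * M m i))"
        by (intro sum.cong refl) (simp add: algebra_simps)
      also have "\<dots> = (\<Sum>i\<in>I - {p}. \<gamma> i * M l i) - M l p / M m p * (\<Sum>i\<in>I - {p}. \<gamma> i * M m i)"
        by (simp add: sum_subtractf sum_distrib_left)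
      also have "\<dots> = (\<Sum>i\<in>I. \<delta> i * M l i)" unfolding sum by (simp add: s_def)
      finally show ?thesis ..
    qed
    moreover have "\<exists>i\<in>I. \<delta> i \<noteq> 0" using g(1) by (auto simp: \<delta>_def)
    ultimately show ?thesis by blast
  qed
qed

text \<open>The first-order condition at a minimum: for small t of the right sign the linear term
  would dominate the quadratic one.\<close>

lemma linear_term_zero:
  fixes p s :: real
  assumes "\<And>t. 0 \<le> 2 * t * p + t\<^sup>2 * s"
  shows "p = 0"
proof (rule ccontr)
  assume p: "p \<noteq> 0"
  define d where "d = \<bar>s\<bar> + 1"
  have d: "0 < d" "s < d" by (auto simp: d_def)
  have "2 * (- p / d) * p + (- p / d)\<^sup>2 * s = (p\<^sup>2 / d) * (s / d - 2)"
    using d by (simp add: field_simps power2_eq_square)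
  also have "\<dots> < 0" using p d by (intro mult_pos_neg) (auto simp: field_simps)
  finally show False using assms[of "- p / d"] by simp
qed

lemma (in semi_form) lincomb_left:
  assumes "\<And>i. i \<in> I \<Longrightarrow> f i \<in> V" "z \<in> V"
  shows "q (\<Sum>i\<in>I. r i *\<^sub>R f i) z = (\<Sum>i\<in>I. r i * q (f i) z)"
  using assms by (simp add: sum_left V_scale scale_left)

lemma (in semi_form) lincomb_right:
  assumes "\<And>i. i \<in> I \<Longrightarrow> f i \<in> V" "z \<in> V"
  shows "q z (\<Sum>i\<in>I. r i *\<^sub>R f i) = (\<Sum>i\<in>I. r i * q z (f i))"
  using assms by (simp add: sum_right V_scale scale_right)

locale form_pair = A: semi_form V a + B: semi_form V b
  for V :: "'v::real_vector set" and a b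
begin

sublocale C: semi_form V "\<lambda>x y. a x y + b x y"
  by unfold_locales
    (auto simp: A.subspace_V A.add_left B.add_left A.scale_left B.scale_left A.nonneg B.nonneg algebra_simps A.sym B.sym)

lemma nrm_le: "x \<in> V \<Longrightarrow> A.nrm x \<le> C.nrm x" "x \<in> V \<Longrightarrow> B.nrm x \<le> C.nrm x"
  by (simp_all add: A.nrm_def B.nrm_def C.nrm_def A.nonneg B.nonneg)

lemma C_nrm_le: "x \<in> V \<Longrightarrow> C.nrm x \<le> A.nrm x + B.nrm x"
  by (simp add: A.nrm_def B.nrm_def C.nrm_def A.nonneg B.nonneg sqrt_add_le_add_sqrt)

lemma qcauchy_AB:
  assumes "\<And>j. f j \<in> V" "C.qcauchy f"
  shows "A.qcauchy f" "B.qcauchy f"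
  using assms(2) nrm_le[OF A.V_diff[OF assms(1) assms(1)]]
  unfolding A.qcauchy_def B.qcauchy_def C.qcauchy_def by (meson le_less_trans)+

lemma qcauchy_C:
  assumes "\<And>j. f j \<in> V" "A.qcauchy f" "B.qcauchy f"
  shows "C.qcauchy f"
  unfolding C.qcauchy_def
proof (intro allI impI)
  fix e :: real assume e: "0 < e"
  obtain I where I: "\<forall>i\<ge>I. \<forall>j\<ge>I. A.nrm (f i - f j) < e/2" using A.qcauchyD[OF assms(2), of "e/2"] e by auto
  obtain J where J: "\<forall>i\<ge>J. \<forall>j\<ge>J. B.nrm (f i - f j) < e/2" using B.qcauchyD[OF assms(3), of "e/2"] e by auto
  have "C.nrm (f i - f j) < e" if "i \<ge> max I J" "j \<ge> max I J" for i j
    using C_nrm_le[OF A.V_diff[OF assms(1) assms(1)], of i j] I[rule_format, of i j] J[rule_format, of i j] that by simp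
  then show "\<exists>J. \<forall>i\<ge>J. \<forall>j\<ge>J. C.nrm (f i - f j) < e" by blast
qed

lemma qconv_AB:
  assumes "\<And>j. f j \<in> V" "u \<in> V" "C.qconv f u"
  shows "A.qconv f u" "B.qconv f u"
  using assms nrm_le[OF A.V_diff[OF assms(1,2)]] A.nrm_nonneg[OF A.V_diff[OF assms(1,2)]] B.nrm_nonneg[OF A.V_diff[OF assms(1,2)]]
  unfolding A.qconv_def B.qconv_def C.qconv_def
  by (auto intro!: Lim_null_comparison[of _ "\<lambda>j. C.nrm (f j - u)"])

text \<open>The first condition makes the span of the e i k-dimensional, even modulo the null space of b; on it
  the Rayleigh quotient a/b is at most x.\<close>

definition rayleigh :: "nat \<Rightarrow> real \<Rightarrow> bool" where
  "rayleigh k x \<longleftrightarrow> (\<exists>e. (\<forall>i<k. e i \<in> V) \<and>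
     (\<forall>\<gamma>. let w = (\<Sum>i<k. \<gamma> i *\<^sub>R e i) in ((\<exists>i<k. \<gamma> i \<noteq> 0) \<longrightarrow> 0 < b w w) \<and> a w w \<le> x * b w w))"

text \<open>Dimension count behind the min-max principle: k free coefficients against m < k
  orthogonality conditions.\<close>

lemma rayleigh_vector_orthogonal:
  assumes "rayleigh k x" "m < k" "\<And>l. l < m \<Longrightarrow> us l \<in> V"
  shows "\<exists>w\<in>V. 0 < b w w \<and> a w w \<le> x * b w w \<and> (\<forall>l<m. b w (us l) = 0)"
proof -
  obtain e where e: "\<And>i. i < k \<Longrightarrow> e i \<in> V"
    "\<And>\<gamma>. let w = (\<Sum>i<k. \<gamma> i *\<^sub>R e i) in ((\<exists>i<k. \<gamma> i \<noteq> 0) \<longrightarrow> 0 < b w w) \<and> a w w \<le> x * b w w"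
    using assms(1) unfolding rayleigh_def by blast
  obtain \<gamma> where g: "\<exists>i<k. \<gamma> i \<noteq> 0" "\<forall>l<m. (\<Sum>i<k. \<gamma> i * b (e i) (us l)) = 0"
    using homogeneous_system_nontrivial[of "{..<k}" m "\<lambda>l i. b (e i) (us l)"] assms(2) by auto
  define w where "w = (\<Sum>i<k. \<gamma> i *\<^sub>R e i)"
  have w: "w \<in> V" unfolding w_def using e(1) by (intro A.V_sum A.V_scale) auto
  have "b w (us l) = 0" if "l < m" for l
    using g(2) that e(1) assms(3)[OF that] unfolding w_def by (subst B.lincomb_left) auto
  moreover have "0 < b w w" "a w w \<le> x * b w w" using e(2)[of \<gamma>] g(1) unfolding w_def Let_def by auto
  ultimately show ?thesis using w by blast
qed

definition eigensystem :: "nat \<Rightarrow> (nat \<Rightarrow> 'v) \<Rightarrow> (nat \<Rightarrow> real) \<Rightarrow> bool" where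
  "eigensystem k u \<mu> \<longleftrightarrow> (\<forall>i<k. u i \<in> V) \<and> (\<forall>i<k. \<forall>j<k. b (u i) (u j) = (if i = j then 1 else 0)) \<and>
     (\<forall>i<k. \<forall>z\<in>V. a (u i) z = \<mu> i * b (u i) z)"

end

text \<open>The conclusion of Rellich's theorem as an axiom. It is kept apart from completeness: it
  is established for the test functions, and their completion then has both properties.\<close>

locale compact_form_pair = form_pair +
  assumes compact: "(\<And>j. f j \<in> V) \<Longrightarrow> (\<And>j. C.nrm (f j) \<le> K) \<Longrightarrow> \<exists>r. strict_mono (r :: nat \<Rightarrow> nat) \<and> B.qcauchy (f \<circ> r)"

locale complete_form_pair = compact_form_pair +
  assumes complete: "(\<And>j. f j \<in> V) \<Longrightarrow> C.qcauchy f \<Longrightarrow> \<exists>u\<in>V. C.qconv f u"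
begin

text \<open>A minimizing sequence is b-Cauchy along a subsequence by compactness, and then a-Cauchy by the
  parallelogram identity.\<close>

lemma minimizer:
  assumes us: "\<And>l. l < m \<Longrightarrow> us l \<in> V"
    and z0: "z0 \<in> V" "0 < b z0 z0" "\<And>l. l < m \<Longrightarrow> b z0 (us l) = 0"
  shows "\<exists>u\<in>V. (\<forall>l<m. b u (us l) = 0) \<and> b u u = 1 \<and>
    (\<forall>z\<in>V. (\<forall>l<m. b z (us l) = 0) \<longrightarrow> a u u * b z z \<le> a z z)"
proof -
  define Z where "Z = {z \<in> V. \<forall>l<m. b z (us l) = 0}"
  have ZV: "z \<in> V" if "z \<in> Z" for z using that by (simp add: Z_def)
  have Zadd: "z + z' \<in> Z" if "z \<in> Z" "z' \<in> Z" for z z'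
    using that us by (auto simp: Z_def A.V_add B.add_left)
  have Zscale: "r *\<^sub>R z \<in> Z" if "z \<in> Z" for r z
    using that us by (auto simp: Z_def A.V_scale B.scale_left)
  define S where "S = (\<lambda>z. a z z) ` {z \<in> Z. b z z = 1}"
  define \<mu> where "\<mu> = Inf S"
  have norm1: "(1 / sqrt (b z z)) *\<^sub>R z \<in> Z \<and> b ((1 / sqrt (b z z)) *\<^sub>R z) ((1 / sqrt (b z z)) *\<^sub>R z) = 1 \<and>
      a ((1 / sqrt (b z z)) *\<^sub>R z) ((1 / sqrt (b z z)) *\<^sub>R z) = a z z / b z z" if "z \<in> Z" "0 < b z z" for z
    using that Zscale[OF that(1)] ZV[OF that(1)] by (simp add: B.quad_scale A.quad_scale power_divide)
  have bdd: "bdd_below S" unfolding S_def by (rule bdd_belowI2[of _ 0]) (auto intro: A.nonneg ZV)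
  have ne: "S \<noteq> {}" using norm1[of z0] z0 unfolding S_def Z_def by auto
  have low: "\<mu> * b z z \<le> a z z" if z: "z \<in> Z" for z
  proof (cases "b z z = 0")
    case True then show ?thesis using A.nonneg[OF ZV[OF z]] by simp
  next
    case False
    then have p: "0 < b z z" using B.nonneg[OF ZV[OF z]] by simp
    then have "\<mu> \<le> a z z / b z z" unfolding \<mu>_def using norm1[OF z p]
      by (intro cInf_lower bdd) (auto simp: S_def image_iff intro!: bexI[of _ "(1 / sqrt (b z z)) *\<^sub>R z"])
    then show ?thesis using p by (simp add: field_simps)
  qed
  have mu0: "0 \<le> \<mu>" unfolding \<mu>_def using ne by (intro cInf_greatest) (auto simp: S_def intro: A.nonneg ZV)
  have "\<exists>z. z \<in> Z \<and> b z z = 1 \<and> a z z < \<mu> + 1 / (real n + 1)" for n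
  proof -
    have "Inf S < \<mu> + 1 / (real n + 1)" by (simp add: \<mu>_def)
    then show ?thesis using cInf_lessD[OF ne] unfolding S_def by auto
  qed
  then obtain f where f: "\<And>n. f n \<in> Z" "\<And>n. b (f n) (f n) = 1" "\<And>n. a (f n) (f n) < \<mu> + 1 / (real n + 1)"
    by metis
  have fV: "f n \<in> V" for n using f(1) ZV by blast
  have nr: "C.nrm (f n) \<le> sqrt (\<mu> + 2)" for n
  proof -
    have "1 / (real n + 1) \<le> 1" by simp
    then show ?thesis unfolding C.nrm_def using f(2,3)[of n] by (intro real_sqrt_le_mono) linarith
  qed
  have "\<exists>r. strict_mono (r :: nat \<Rightarrow> nat) \<and> B.qcauchy (f \<circ> r)" by (rule compact[of f, OF fV nr])
  then obtain r :: "nat \<Rightarrow> nat" where r: "strict_mono r" "B.qcauchy (f \<circ> r)" by (elim exE conjE)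
  define g where "g = f \<circ> r"
  have gZ: "g n \<in> Z" and gV: "g n \<in> V" and g1: "b (g n) (g n) = 1" for n
    using f(1,2)[of "r n"] fV[of "r n"] by (simp_all add: g_def)
  have ga: "a (g n) (g n) < \<mu> + 1 / (real n + 1)" for n
  proof -
    have "1 / (real (r n) + 1) \<le> 1 / (real n + 1)"
      using seq_suble[OF r(1), of n] by (intro divide_left_mono) auto
    then show ?thesis using f(3)[of "r n"] by (simp add: g_def)
  qed
  have t: "(\<lambda>m. 1 / (real m + 1)) \<longlonglongrightarrow> 0"
    using LIMSEQ_inverse_real_of_nat by (simp add: inverse_eq_divide add.commute)
  have par: "a (g i - g j) (g i - g j) \<le> 2 / (real i + 1) + 2 / (real j + 1) + \<mu> * (B.nrm (g i - g j))\<^sup>2" for i j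
  proof -
    have "a (g i - g j) (g i - g j) = 2 * a (g i) (g i) + 2 * a (g j) (g j) - a (g i + g j) (g i + g j)"
      using gV by (simp add: A.quad_add A.quad_diff)
    also have "\<dots> \<le> 2 * a (g i) (g i) + 2 * a (g j) (g j) - \<mu> * b (g i + g j) (g i + g j)"
      using low[OF Zadd[OF gZ gZ]] by simp
    also have "b (g i + g j) (g i + g j) = 4 - (B.nrm (g i - g j))\<^sup>2"
      using gV by (simp add: B.nrm_power2 A.V_diff B.quad_add B.quad_diff g1)
    also have "2 * a (g i) (g i) + 2 * a (g j) (g j) - \<mu> * (4 - (B.nrm (g i - g j))\<^sup>2) \<le>
       2 * (\<mu> + 1 / (real i + 1)) + 2 * (\<mu> + 1 / (real j + 1)) - \<mu> * (4 - (B.nrm (g i - g j))\<^sup>2)"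
      using ga[of i] ga[of j] by simp
    finally show ?thesis by (simp add: algebra_simps)
  qed
  have "A.qcauchy g" unfolding A.qcauchy_def
  proof (intro allI impI)
    fix e :: real assume e: "0 < e"
    \<comment> \<open>The three terms of \<open>par\<close> will be less than 2 * d, less than 2 * d
      and at most d, which together stays below 8 * d = e^2.\<close>
    define d where "d = e\<^sup>2 / 8"
    have d: "0 < d" using e by (simp add: d_def)
    obtain I where I: "\<forall>m\<ge>I. 1 / (real m + 1) < d"
      using order_tendstoD(2)[OF t d] by (auto simp: eventually_sequentially)
    \<comment> \<open>The summand 1 keeps the quotient meaningful for \<mu> = 0; multiplied by \<mu>
      the square of this bound is still at most d.\<close>
    obtain J where J: "\<forall>i\<ge>J. \<forall>j\<ge>J. B.nrm (g i - g j) < sqrt (d / (\<mu> + 1))"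
      using B.qcauchyD[OF r(2), of "sqrt (d / (\<mu> + 1))"] d mu0 by (auto simp: g_def)
    have "A.nrm (g i - g j) < e" if "i \<ge> max I J" "j \<ge> max I J" for i j
    proof -
      have "(B.nrm (g i - g j))\<^sup>2 \<le> (sqrt (d / (\<mu> + 1)))\<^sup>2"
        using J[rule_format, of i j] that B.nrm_nonneg[OF A.V_diff[OF gV gV]] by (intro power_mono) auto
      then have "(B.nrm (g i - g j))\<^sup>2 \<le> d / (\<mu> + 1)" using d mu0 by simp
      then have "\<mu> * (B.nrm (g i - g j))\<^sup>2 \<le> \<mu> * (d / (\<mu> + 1))" using mu0 by (rule mult_left_mono)
      also have "\<dots> \<le> d" using mu0 d by (simp add: field_simps)
      finally have "a (g i - g j) (g i - g j) < 8 * d"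
        using par[of i j] I[rule_format, of i] I[rule_format, of j] that d by simp
      then have "A.nrm (g i - g j) < sqrt (e\<^sup>2)" unfolding A.nrm_def d_def by (intro real_sqrt_less_mono) simp
      then show ?thesis using e by simp
    qed
    then show "\<exists>J. \<forall>i\<ge>J. \<forall>j\<ge>J. A.nrm (g i - g j) < e" by blast
  qed
  then have "C.qcauchy g" using qcauchy_C[of g, OF gV] r(2) by (simp add: g_def)
  from complete[of g, OF gV this] obtain u where u: "u \<in> V" "C.qconv g u" by blast
  note uc = qconv_AB[of g u, OF gV u]
  have "(\<lambda>n. b (g n) (g n)) \<longlonglongrightarrow> b u u" by (rule B.qconv_quad[of g u, OF gV u(1) uc(2)])
  then have bu: "b u u = 1" by (simp add: g1 LIMSEQ_const_iff)
  have bus: "b u (us l) = 0" if "l < m" for l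
  proof -
    have "(\<lambda>n. b (g n) (us l)) \<longlonglongrightarrow> b u (us l)" by (rule B.qconv_left[of g u "us l", OF gV u(1) us[OF that] uc(2)])
    moreover have "b (g n) (us l) = 0" for n using gZ that by (simp add: Z_def)
    ultimately show ?thesis by (simp add: LIMSEQ_const_iff)
  qed
  have "a u u \<le> \<mu>"
  proof (rule LIMSEQ_le[OF A.qconv_quad[of g u, OF gV u(1) uc(1)]])
    show "(\<lambda>n. \<mu> + 1 / (real n + 1)) \<longlonglongrightarrow> \<mu>" using tendsto_add[OF tendsto_const t] by fastforce
  qed (use ga in \<open>auto intro: less_imp_le\<close>)
  then have "a u u * b z z \<le> a z z" if "z \<in> Z" for z
    using low[OF that] mult_right_mono[of "a u u" \<mu> "b z z"] B.nonneg[OF ZV[OF that]] by linarith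
  then show ?thesis using u(1) bu bus by (intro bexI[of _ u]) (auto simp: Z_def)
qed

text \<open>The first-order condition at the minimizer w gives the eigenvalue equation against
  vectors orthogonal to the previous eigenvectors. Against those both sides are 0, by symmetry and
  their own equation, so it holds against every vector.\<close>

lemma eigenvector_step:
  assumes E: "eigensystem m u \<mu>" and z0: "z0 \<in> V" "0 < b z0 z0" "\<And>l. l < m \<Longrightarrow> b z0 (u l) = 0"
  shows "\<exists>w\<in>V. (\<forall>l<m. b w (u l) = 0) \<and> b w w = 1 \<and> (\<forall>z\<in>V. a w z = a w w * b w z) \<and>
    (\<forall>z\<in>V. (\<forall>l<m. b z (u l) = 0) \<longrightarrow> a w w * b z z \<le> a z z)"
proof -
  have uV: "u i \<in> V" if "i < m" for i using E that by (simp add: eigensystem_def)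
  obtain w where w: "w \<in> V" "\<And>l. l < m \<Longrightarrow> b w (u l) = 0" "b w w = 1"
    "\<And>z. z \<in> V \<Longrightarrow> (\<And>l. l < m \<Longrightarrow> b z (u l) = 0) \<Longrightarrow> a w w * b z z \<le> a z z"
    using minimizer[of m u z0] uV z0 by blast
  have orth: "a w z = a w w * b w z" if z: "z \<in> V" "\<And>l. l < m \<Longrightarrow> b z (u l) = 0" for z
  proof -
    have "a w z - a w w * b w z = 0"
    proof (rule linear_term_zero)
      fix t :: real
      have "a w w * b (w + t *\<^sub>R z) (w + t *\<^sub>R z) \<le> a (w + t *\<^sub>R z) (w + t *\<^sub>R z)"
        using w z uV by (intro w(4)) (auto simp: A.V_add A.V_scale B.add_left B.scale_left)
      then show "0 \<le> 2 * t * (a w z - a w w * b w z) + t\<^sup>2 * (a z z - a w w * b z z)"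
        unfolding A.quad_add[OF w(1) A.V_scale[OF z(1)]] B.quad_add[OF w(1) A.V_scale[OF z(1)]]
          A.scale_right[OF z(1) w(1)] B.scale_right[OF z(1) w(1)] A.quad_scale[OF z(1)] B.quad_scale[OF z(1)] w(3)
        by (simp add: algebra_simps)
    qed
    then show ?thesis by simp
  qed
  have ev: "a w z = a w w * b w z" if z: "z \<in> V" for z
  proof -
    \<comment> \<open>The b-orthogonal projection of z onto the span of the previous eigenvectors; z
      - p is then an admissible variation.\<close>
    define p where "p = (\<Sum>l<m. b z (u l) *\<^sub>R u l)"
    have p: "p \<in> V" unfolding p_def using uV by (intro A.V_sum A.V_scale) auto
    have bp: "b p (u l) = b z (u l)" if "l < m" for l
    proof -
      have "b p (u l) = (\<Sum>i<m. b z (u i) * b (u i) (u l))"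
        unfolding p_def using uV uV[OF that] by (intro B.lincomb_left) auto
      also have "\<dots> = (\<Sum>i<m. if i = l then b z (u i) else 0)"
        using E that by (intro sum.cong refl) (auto simp: eigensystem_def)
      finally show ?thesis using that by simp
    qed
    have wp: "b w p = 0"
      unfolding p_def using uV w(1,2) by (subst B.lincomb_right) auto
    have "a w (u l) = 0" if "l < m" for l
      using E that w(1) w(2)[OF that] A.sym[OF w(1) uV[OF that]] B.sym[OF w(1) uV[OF that]] by (simp add: eigensystem_def)
    then have ap: "a w p = 0"
      unfolding p_def using uV w(1) by (subst A.lincomb_right) auto
    have "a w (z - p) = a w w * b w (z - p)"
      by (rule orth) (use z p bp uV in \<open>auto simp: A.V_diff B.diff_left\<close>)
    then show ?thesis using z p w(1) wp ap by (simp add: A.diff_right B.diff_right)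
  qed
  show ?thesis
  proof (intro bexI[of _ w] conjI allI ballI impI)
    show "a w z = a w w * b w z" if "z \<in> V" for z by (rule ev[OF that])
    show "a w w * b z z \<le> a z z" if "z \<in> V" "\<forall>l<m. b z (u l) = 0" for z
      by (rule w(4)) (use that in auto)
  qed (rule w | assumption)+
qed

text \<open>Each new eigenvalue is the minimum of the quotient on the complement of the earlier
  eigenvectors. A k-dimensional space with quotient at most x meets this complement as long as m <
  k, so the minimum is at most x.\<close>

lemma eigensystem_exists:
  assumes "rayleigh k x0" "m \<le> k"
  shows "\<exists>u \<mu>. eigensystem m u \<mu> \<and> (\<forall>i<m. \<forall>x. rayleigh k x \<longrightarrow> \<mu> i \<le> x)"
  using assms(2)
proof (induction m)
  case 0
  show ?case by (simp add: eigensystem_def)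
next
  case (Suc m)
  then have "\<exists>u \<mu>. eigensystem m u \<mu> \<and> (\<forall>i<m. \<forall>x. rayleigh k x \<longrightarrow> \<mu> i \<le> x)" by simp
  then obtain u \<mu> where E: "eigensystem m u \<mu>" and le: "\<forall>i<m. \<forall>x. rayleigh k x \<longrightarrow> \<mu> i \<le> x" by (elim exE conjE)
  have uV: "u i \<in> V" if "i < m" for i using E that by (simp add: eigensystem_def)
  have mk: "m < k" using Suc.prems by simp
  obtain z0 where z0: "z0 \<in> V" "0 < b z0 z0" "\<And>l. l < m \<Longrightarrow> b z0 (u l) = 0"
    using rayleigh_vector_orthogonal[OF assms(1) mk, of u] uV by blast
  have "\<exists>w\<in>V. (\<forall>l<m. b w (u l) = 0) \<and> b w w = 1 \<and>
    (\<forall>z\<in>V. a w z = a w w * b w z) \<and> (\<forall>z\<in>V. (\<forall>l<m. b z (u l) = 0) \<longrightarrow> a w w * b z z \<le> a z z)"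
    by (rule eigenvector_step[OF E z0(1,2)]) (rule z0(3))
  then obtain w where w0: "w \<in> V" "(\<forall>l<m. b w (u l) = 0) \<and> b w w = 1 \<and>
    (\<forall>z\<in>V. a w z = a w w * b w z) \<and> (\<forall>z\<in>V. (\<forall>l<m. b z (u l) = 0) \<longrightarrow> a w w * b z z \<le> a z z)" by (elim bexE)
  then have w: "\<And>l. l < m \<Longrightarrow> b w (u l) = 0" "b w w = 1" "\<forall>z\<in>V. a w z = a w w * b w z"
    "\<And>z. z \<in> V \<Longrightarrow> (\<forall>l<m. b z (u l) = 0) \<Longrightarrow> a w w * b z z \<le> a z z" by blast+
  have wx: "a w w \<le> x" if rx: "rayleigh k x" for x
  proof -
    obtain z where z: "z \<in> V" "0 < b z z" "a z z \<le> x * b z z" "\<forall>l<m. b z (u l) = 0"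
      using rayleigh_vector_orthogonal[OF rx mk, of u] uV by blast
    then have "a w w * b z z \<le> x * b z z" using w(4)[OF z(1,4)] by linarith
    then show ?thesis using z(2) by simp
  qed
  have "eigensystem (Suc m) (u(m := w)) (\<mu>(m := a w w))"
    unfolding eigensystem_def
  proof (intro conjI allI impI ballI)
    fix i assume i: "i < Suc m"
    show "(u(m := w)) i \<in> V" using i uV w0(1) by (auto simp: less_Suc_eq)
    show "a ((u(m := w)) i) z = (\<mu>(m := a w w)) i * b ((u(m := w)) i) z" if "z \<in> V" for z
    proof (cases "i = m")
      case True
      then show ?thesis using w(3) that by simp
    next
      case False
      then show ?thesis using E i that by (simp add: eigensystem_def)
    qed
    fix j assume j: "j < Suc m"
    show "b ((u(m := w)) i) ((u(m := w)) j) = (if i = j then 1 else 0)"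
      using i j E w(1,2) B.sym[OF w0(1) uV] by (auto simp: eigensystem_def less_Suc_eq)
  qed
  moreover have "\<forall>i<Suc m. \<forall>x. rayleigh k x \<longrightarrow> (\<mu>(m := a w w)) i \<le> x"
    using le wx by (auto simp: less_Suc_eq)
  ultimately show ?case by blast
qed

end

context form_pair begin

lemma eigenvectors_orthogonal:
  assumes "x \<in> V" "y \<in> V" "a x y = \<mu> * b x y" "a y x = \<nu> * b y x" "\<mu> \<noteq> \<nu>"
  shows "b x y = 0"
  using assms A.sym[of x y] B.sym[of x y] by simp

text \<open>Eigenvectors of one eigenvalue need not be orthogonal here. The difference x * b(w, w) -
  a(w, w) is b on the diagonal at the combination with coefficients \<gamma> i * sqrt (x - \<mu> i):
  for equal eigenvalues the roots multiply to x - \<mu> i, for different ones the mixed terms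
  vanish.\<close>

lemma eigenvectors_quotient_le:
  assumes u: "\<And>i. i \<in> I \<Longrightarrow> u i \<in> V" and ev: "\<And>i z. i \<in> I \<Longrightarrow> z \<in> V \<Longrightarrow> a (u i) z = \<mu> i * b (u i) z"
    and le: "\<And>i. i \<in> I \<Longrightarrow> \<mu> i \<le> x" and w: "w = (\<Sum>i\<in>I. \<gamma> i *\<^sub>R u i)"
  shows "a w w \<le> x * b w w"
proof -
  define s where "s i = sqrt (x - \<mu> i)" for i
  have *: "x * (\<gamma> i * \<gamma> j * b (u i) (u j)) - \<gamma> i * \<gamma> j * a (u i) (u j) = (\<gamma> i * s i) * (\<gamma> j * s j) * b (u i) (u j)"
    if "i \<in> I" "j \<in> I" for i j
  proof (cases "\<mu> i = \<mu> j")
    case True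
    then have ss: "s i * s j = x - \<mu> i" using le[OF that(1)] by (simp add: s_def)
    have "(\<gamma> i * s i) * (\<gamma> j * s j) * b (u i) (u j) = \<gamma> i * \<gamma> j * (s i * s j) * b (u i) (u j)" by simp
    then show ?thesis using ev[OF that(1) u[OF that(2)]] unfolding ss by (simp add: algebra_simps)
  next
    case False
    have "b (u i) (u j) = 0"
      by (rule eigenvectors_orthogonal[OF u u ev ev False]) (use that u in auto)
    then show ?thesis using ev[OF that(1) u[OF that(2)]] by simp
  qed
  have "x * b w w - a w w = (\<Sum>i\<in>I. \<Sum>j\<in>I. x * (\<gamma> i * \<gamma> j * b (u i) (u j)) - \<gamma> i * \<gamma> j * a (u i) (u j))"
    unfolding w using u by (simp add: A.lincomb B.lincomb sum_distrib_left sum_subtractf)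
  also have "\<dots> = (\<Sum>i\<in>I. \<Sum>j\<in>I. (\<gamma> i * s i) * (\<gamma> j * s j) * b (u i) (u j))"
    by (intro sum.cong refl *)
  also have "\<dots> = b (\<Sum>i\<in>I. (\<gamma> i * s i) *\<^sub>R u i) (\<Sum>i\<in>I. (\<gamma> i * s i) *\<^sub>R u i)"
    using u by (simp add: B.lincomb)
  also have "\<dots> \<ge> 0" using u by (intro B.nonneg A.V_sum A.V_scale) auto
  finally show ?thesis by simp
qed

lemma seqs_subset: "C.seqs \<subseteq> A.seqs" "C.seqs \<subseteq> B.seqs"
  using qcauchy_AB by (auto simp: A.seqs_def B.seqs_def C.seqs_def)

lemma C_qlim: "F \<in> C.seqs \<Longrightarrow> G \<in> C.seqs \<Longrightarrow> C.qlim F G = A.qlim F G + B.qlim F G"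
  using seqs_subset by (intro C.qlim_eqI tendsto_add A.qlim_tendsto B.qlim_tendsto) auto

lemma form_pair_seqs: "form_pair C.seqs A.qlim B.qlim"
  unfolding form_pair_def using C.subspace_seqs seqs_subset A.semi_form_qlim B.semi_form_qlim by blast

lemma sum_const_seq: "(\<Sum>i\<in>I. \<gamma> i *\<^sub>R (\<lambda>_::nat. e i)) = (\<lambda>_. \<Sum>i\<in>I. \<gamma> i *\<^sub>R e i)"
  by (simp add: fun_eq_iff sum_fun_apply)

lemma rayleigh_seqs:
  assumes "rayleigh k x"
  shows "form_pair.rayleigh C.seqs A.qlim B.qlim k x"
proof -
  obtain e where e: "\<And>i. i < k \<Longrightarrow> e i \<in> V"
    "\<And>\<gamma>. let w = (\<Sum>i<k. \<gamma> i *\<^sub>R e i) in ((\<exists>i<k. \<gamma> i \<noteq> 0) \<longrightarrow> 0 < b w w) \<and> a w w \<le> x * b w w"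
    using assms(1) unfolding rayleigh_def by blast
  show ?thesis unfolding form_pair.rayleigh_def[OF form_pair_seqs]
    by (intro exI[of _ "\<lambda>i _. e i"] conjI allI impI)
      (use e C.const_seqs in \<open>simp_all add: sum_const_seq Let_def\<close>)
qed

text \<open>The coefficients of vectors violating the approximate bound accumulate on the compact unit sphere, and
  their limit violates the exact bound.\<close>

lemma rayleigh_approx:
  assumes R: "form_pair.rayleigh C.seqs A.qlim B.qlim k x" and \<epsilon>: "0 < \<epsilon>"
  shows "rayleigh k (x + \<epsilon>)"
proof (rule ccontr)
  interpret W: form_pair C.seqs A.qlim B.qlim by (rule form_pair_seqs)
  assume n: "\<not> rayleigh k (x + \<epsilon>)"
  obtain e where e: "\<And>i. i < k \<Longrightarrow> e i \<in> C.seqs"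
    "\<And>\<gamma>. let w = (\<Sum>i<k. \<gamma> i *\<^sub>R e i) in ((\<exists>i<k. \<gamma> i \<noteq> 0) \<longrightarrow> 0 < B.qlim w w) \<and> A.qlim w w \<le> x * B.qlim w w"
    using R unfolding W.rayleigh_def by blast
  have eV: "e i j \<in> V" if "i < k" for i j using e(1)[OF that] by (rule C.seqsD)
  let ?w = "\<lambda>\<gamma> j. \<Sum>i<k. \<gamma> i *\<^sub>R e i j"
  have wV: "?w \<gamma> j \<in> V" for \<gamma> j using eV by (intro A.V_sum A.V_scale) auto
  have "\<exists>\<gamma>. (\<Sum>i<k. (\<gamma> i)\<^sup>2) = 1 \<and> (b (?w \<gamma> j) (?w \<gamma> j) \<le> 0 \<or> (x + \<epsilon>) * b (?w \<gamma> j) (?w \<gamma> j) < a (?w \<gamma> j) (?w \<gamma> j))" for j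
  proof -
    have "\<not> ((\<forall>i<k. e i j \<in> V) \<and> (\<forall>\<gamma>. let w = ?w \<gamma> j in ((\<exists>i<k. \<gamma> i \<noteq> 0) \<longrightarrow> 0 < b w w) \<and> a w w \<le> (x + \<epsilon>) * b w w))"
      using n unfolding rayleigh_def by (rule contrapos_nn) (rule exI[of _ "\<lambda>i. e i j"])
    then have "\<not> (\<forall>\<gamma>. ((\<exists>i<k. \<gamma> i \<noteq> 0) \<longrightarrow> 0 < b (?w \<gamma> j) (?w \<gamma> j)) \<and> a (?w \<gamma> j) (?w \<gamma> j) \<le> (x + \<epsilon>) * b (?w \<gamma> j) (?w \<gamma> j))"
      using eV unfolding Let_def by blast
    then obtain \<gamma> where g: "\<not> (((\<exists>i<k. \<gamma> i \<noteq> 0) \<longrightarrow> 0 < b (?w \<gamma> j) (?w \<gamma> j)) \<and> a (?w \<gamma> j) (?w \<gamma> j) \<le> (x + \<epsilon>) * b (?w \<gamma> j) (?w \<gamma> j))"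
      by (elim not_all[THEN iffD1, THEN exE])
    have nz: "\<exists>i<k. \<gamma> i \<noteq> 0"
    proof (rule ccontr)
      assume "\<not> (\<exists>i<k. \<gamma> i \<noteq> 0)"
      then have "?w \<gamma> j = 0" by simp
      with g show False using \<open>\<not> (\<exists>i<k. \<gamma> i \<noteq> 0)\<close> by (simp add: A.V_zero)
    qed
    \<comment> \<open>Normalisation makes the coefficients bounded; both failures of the bound are
      homogeneous, so they survive it.\<close>
    define s where "s = sqrt (\<Sum>i<k. (\<gamma> i)\<^sup>2)"
    have "0 < (\<Sum>i<k. (\<gamma> i)\<^sup>2)" using nz by (auto intro!: sum_pos2)
    then have s: "0 < s" "s\<^sup>2 = (\<Sum>i<k. (\<gamma> i)\<^sup>2)" by (simp_all add: s_def)
    have ws: "?w (\<lambda>i. \<gamma> i / s) j = (1 / s) *\<^sub>R ?w \<gamma> j" by (simp add: scaleR_sum_right)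
    have "(\<Sum>i<k. (\<gamma> i / s)\<^sup>2) = 1"
      using s by (simp add: power_divide sum_divide_distrib[symmetric] s(2)[symmetric])
    moreover have "b (?w (\<lambda>i. \<gamma> i / s) j) (?w (\<lambda>i. \<gamma> i / s) j) \<le> 0 \<or>
       (x + \<epsilon>) * b (?w (\<lambda>i. \<gamma> i / s) j) (?w (\<lambda>i. \<gamma> i / s) j) < a (?w (\<lambda>i. \<gamma> i / s) j) (?w (\<lambda>i. \<gamma> i / s) j)"
    proof -
      have p: "0 < (1 / s)\<^sup>2" using s(1) by simp
      consider "b (?w \<gamma> j) (?w \<gamma> j) \<le> 0" | "(x + \<epsilon>) * b (?w \<gamma> j) (?w \<gamma> j) < a (?w \<gamma> j) (?w \<gamma> j)"
        using g nz by linarith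
      then show ?thesis
        unfolding ws A.quad_scale[OF wV] B.quad_scale[OF wV]
      proof cases
        case 1
        then show "(1 / s)\<^sup>2 * b (?w \<gamma> j) (?w \<gamma> j) \<le> 0 \<or>
          (x + \<epsilon>) * ((1 / s)\<^sup>2 * b (?w \<gamma> j) (?w \<gamma> j)) < (1 / s)\<^sup>2 * a (?w \<gamma> j) (?w \<gamma> j)"
          using p by (intro disjI1 mult_nonneg_nonpos) auto
      next
        case 2
        then show "(1 / s)\<^sup>2 * b (?w \<gamma> j) (?w \<gamma> j) \<le> 0 \<or>
          (x + \<epsilon>) * ((1 / s)\<^sup>2 * b (?w \<gamma> j) (?w \<gamma> j)) < (1 / s)\<^sup>2 * a (?w \<gamma> j) (?w \<gamma> j)"
          using mult_strict_left_mono[OF 2 p] by (intro disjI2) (simp only: mult.left_commute)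
      qed
    qed
    ultimately show ?thesis by (intro exI[of _ "\<lambda>i. \<gamma> i / s"] conjI)
  qed
  then have "\<forall>j. \<exists>\<gamma>. (\<Sum>i<k. (\<gamma> i)\<^sup>2) = 1 \<and> (b (?w \<gamma> j) (?w \<gamma> j) \<le> 0 \<or> (x + \<epsilon>) * b (?w \<gamma> j) (?w \<gamma> j) < a (?w \<gamma> j) (?w \<gamma> j))"
    by (rule allI)
  from choice[OF this] obtain g where g: "\<forall>j. (\<Sum>i<k. (g j i)\<^sup>2) = 1 \<and>
    (b (?w (g j) j) (?w (g j) j) \<le> 0 \<or> (x + \<epsilon>) * b (?w (g j) j) (?w (g j) j) < a (?w (g j) j) (?w (g j) j))"
    by (elim exE)
  then have g1: "(\<Sum>i<k. (g j i)\<^sup>2) = 1"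
    and g2: "b (?w (g j) j) (?w (g j) j) \<le> 0 \<or> (x + \<epsilon>) * b (?w (g j) j) (?w (g j) j) < a (?w (g j) j) (?w (g j) j)" for j
    by (simp_all only:)
  have gb: "\<bar>g j i\<bar> \<le> 1" if "i < k" for i j
  proof -
    have "(g j i)\<^sup>2 \<le> (\<Sum>i<k. (g j i)\<^sup>2)" using that by (intro member_le_sum) auto
    then show ?thesis using g1[of j] by (simp add: abs_square_le_1)
  qed
  have "bounded (range (\<lambda>j. if i < k then g j i else 0))" for i
    unfolding bounded_iff using gb by (intro exI[of _ 1]) auto
  from common_convergent_subsequence[of "\<lambda>j i. if i < k then g j i else 0", OF this]
  obtain r :: "nat \<Rightarrow> nat" where r: "strict_mono r" "\<And>i. convergent (\<lambda>j. if i < k then g (r j) i else 0)" by blast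
  define \<gamma> where "\<gamma> i = lim (\<lambda>j. g (r j) i)" for i
  have gl: "(\<lambda>j. g (r j) i) \<longlonglongrightarrow> \<gamma> i" if "i < k" for i
    using r(2)[of i] that unfolding \<gamma>_def by (simp add: convergent_LIMSEQ_iff)
  have "(\<lambda>j. \<Sum>i<k. (g (r j) i)\<^sup>2) \<longlonglongrightarrow> (\<Sum>i<k. (\<gamma> i)\<^sup>2)" by (intro tendsto_intros gl) auto
  then have "(\<Sum>i<k. (\<gamma> i)\<^sup>2) = 1" by (simp add: g1 LIMSEQ_const_iff)
  then have nz: "\<exists>i<k. \<gamma> i \<noteq> 0" by (metis (no_types, lifting) lessThan_iff power_zero_numeral sum.neutral zero_neq_one)
  define w where "w = (\<Sum>i<k. \<gamma> i *\<^sub>R e i)"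
  have w: "0 < B.qlim w w" "A.qlim w w \<le> x * B.qlim w w"
    using e(2)[of \<gamma>] nz unfolding w_def[symmetric] Let_def by auto
  have la: "(\<lambda>j. a (?w (g (r j)) (r j)) (?w (g (r j)) (r j))) \<longlonglongrightarrow> A.qlim w w"
  proof -
    have "(\<lambda>j. \<Sum>i<k. \<Sum>l<k. g (r j) i * g (r j) l * a (e i (r j)) (e l (r j))) \<longlonglongrightarrow> (\<Sum>i<k. \<Sum>l<k. \<gamma> i * \<gamma> l * A.qlim (e i) (e l))"
      using e(1) seqs_subset
      by (intro tendsto_intros gl LIMSEQ_subseq_LIMSEQ[OF A.qlim_tendsto r(1), unfolded o_def]) auto
    moreover have "a (?w (g (r j)) (r j)) (?w (g (r j)) (r j)) = (\<Sum>i<k. \<Sum>l<k. g (r j) i * g (r j) l * a (e i (r j)) (e l (r j)))" for j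
      by (rule A.lincomb) (use eV in auto)
    moreover have "A.qlim w w = (\<Sum>i<k. \<Sum>l<k. \<gamma> i * \<gamma> l * A.qlim (e i) (e l))"
      unfolding w_def by (rule W.A.lincomb) (use e(1) in auto)
    ultimately show ?thesis by (simp only:)
  qed
  have lb: "(\<lambda>j. b (?w (g (r j)) (r j)) (?w (g (r j)) (r j))) \<longlonglongrightarrow> B.qlim w w"
  proof -
    have "(\<lambda>j. \<Sum>i<k. \<Sum>l<k. g (r j) i * g (r j) l * b (e i (r j)) (e l (r j))) \<longlonglongrightarrow> (\<Sum>i<k. \<Sum>l<k. \<gamma> i * \<gamma> l * B.qlim (e i) (e l))"
      using e(1) seqs_subset
      by (intro tendsto_intros gl LIMSEQ_subseq_LIMSEQ[OF B.qlim_tendsto r(1), unfolded o_def]) auto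
    moreover have "b (?w (g (r j)) (r j)) (?w (g (r j)) (r j)) = (\<Sum>i<k. \<Sum>l<k. g (r j) i * g (r j) l * b (e i (r j)) (e l (r j)))" for j
      by (rule B.lincomb) (use eV in auto)
    moreover have "B.qlim w w = (\<Sum>i<k. \<Sum>l<k. \<gamma> i * \<gamma> l * B.qlim (e i) (e l))"
      unfolding w_def by (rule W.B.lincomb) (use e(1) in auto)
    ultimately show ?thesis by (simp only:)
  qed
  have "\<forall>\<^sub>F j in sequentially. 0 < b (?w (g (r j)) (r j)) (?w (g (r j)) (r j))"
    by (rule order_tendstoD(1)[OF lb w(1)])
  moreover have "(\<lambda>j. (x + \<epsilon>) * b (?w (g (r j)) (r j)) (?w (g (r j)) (r j)) - a (?w (g (r j)) (r j)) (?w (g (r j)) (r j))) \<longlonglongrightarrow> (x + \<epsilon>) * B.qlim w w - A.qlim w w"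
    by (intro tendsto_intros la lb)
  \<comment> \<open>The limit is at least \<open>\<epsilon> * B.qlim w w\<close>, which is positive;
    without the slack \<epsilon> the inequality would not be strict.\<close>
  then have "\<forall>\<^sub>F j in sequentially. 0 < (x + \<epsilon>) * b (?w (g (r j)) (r j)) (?w (g (r j)) (r j)) - a (?w (g (r j)) (r j)) (?w (g (r j)) (r j))"
    by (rule order_tendstoD(1)) (use w mult_pos_pos[OF \<epsilon> w(1)] in \<open>simp add: algebra_simps\<close>)
  ultimately have "\<forall>\<^sub>F j in sequentially. False"
  proof eventually_elim
    case (elim j)
    then show False using g2[of "r j"] by linarith
  qed
  then show False by simp
qed

end

context compact_form_pair begin

text \<open>Compactness passes to the completion because approximants in V of a bounded sequence are
  bounded; a subsequence that is b-Cauchy for the approximants is so for the original elements, as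
  the errors tend to 0.\<close>

lemma complete_form_pair_seqs: "complete_form_pair C.seqs A.qlim B.qlim"
proof -
  interpret W: form_pair C.seqs A.qlim B.qlim by (rule form_pair_seqs)
  interpret CW: semi_form C.seqs C.qlim by (rule C.semi_form_seqs)
  have nrm: "W.C.nrm F = CW.nrm F" if "F \<in> C.seqs" for F
    using that by (simp add: W.C.nrm_def CW.nrm_def C_qlim)
  show ?thesis
  proof unfold_locales
    fix \<Phi> K assume \<Phi>: "\<And>j::nat. \<Phi> j \<in> C.seqs" and K: "\<And>j. W.C.nrm (\<Phi> j) \<le> K"
    obtain f where f: "\<And>m. f m \<in> V" "\<And>m. CW.nrm (\<Phi> m - (\<lambda>j. f m)) \<le> 1 / (real m + 1)"
      using C.diag_approx[of \<Phi>] \<Phi> by blast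
    have cs: "(\<lambda>j. f m) \<in> C.seqs" for m using C.const_seqs f by blast
    \<comment> \<open>All approximation errors are at most 1, hence the bound
      \<open>K + 1\<close>.\<close>
    have "C.nrm (f m) \<le> K + 1" for m
    proof -
      have "C.nrm (f m) = CW.nrm (\<lambda>j. f m)" by (simp add: C.nrm_def CW.nrm_def)
      also have "\<dots> \<le> CW.nrm (\<Phi> m) + CW.nrm ((\<lambda>j. f m) - \<Phi> m)" by (rule CW.nrm_triangle2[OF cs \<Phi>])
      also have "CW.nrm ((\<lambda>j. f m) - \<Phi> m) = CW.nrm (\<Phi> m - (\<lambda>j. f m))" by (rule CW.nrm_minus_commute[OF cs \<Phi>])
      also have "\<dots> \<le> 1 / (real m + 1)" by (rule f(2))
      also have "\<dots> \<le> 1" by simp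
      finally show ?thesis using K[of m] nrm[OF \<Phi>] by simp
    qed
    from compact[of f, OF f(1) this] obtain r :: "nat \<Rightarrow> nat" where r: "strict_mono r" "B.qcauchy (f \<circ> r)" by blast
    have t: "(\<lambda>m. 1 / (real m + 1)) \<longlonglongrightarrow> 0"
      using LIMSEQ_inverse_real_of_nat by (simp add: inverse_eq_divide add.commute)
    have le: "W.B.nrm (\<Phi> (r i) - (\<lambda>_. f (r i))) \<le> 1 / (real i + 1)" for i
    proof -
      have s: "\<Phi> (r i) - (\<lambda>_. f (r i)) \<in> C.seqs" by (rule CW.V_diff[OF \<Phi> cs])
      have "W.B.nrm (\<Phi> (r i) - (\<lambda>_. f (r i))) \<le> 1 / (real (r i) + 1)"
        using W.nrm_le(2)[OF s] nrm[OF s] f(2)[of "r i"] by simp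
      also have "\<dots> \<le> 1 / (real i + 1)" using seq_suble[OF r(1), of i] by (intro divide_left_mono) auto
      finally show ?thesis .
    qed
    have "W.B.qcauchy (\<Phi> \<circ> r)" unfolding W.B.qcauchy_def
    proof (intro allI impI)
      fix e :: real assume e: "0 < e"
      obtain I where I: "\<forall>i\<ge>I. \<forall>j\<ge>I. B.nrm ((f \<circ> r) i - (f \<circ> r) j) < e/3" using B.qcauchyD[OF r(2), of "e/3"] e by auto
      obtain J where J: "\<forall>m\<ge>J. 1 / (real m + 1) < e/3"
        using order_tendstoD(2)[OF t, of "e/3"] e by (auto simp: eventually_sequentially)
      have "W.B.nrm ((\<Phi> \<circ> r) i - (\<Phi> \<circ> r) j) < e" if ij: "i \<ge> max I J" "j \<ge> max I J" for i j
      proof -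
        let ?f = "\<lambda>i. (\<lambda>_. f (r i)) :: nat \<Rightarrow> 'a"
        have "W.B.nrm (\<Phi> (r i) - \<Phi> (r j)) \<le> W.B.nrm (\<Phi> (r i) - ?f i) + (W.B.nrm (?f i - ?f j) + W.B.nrm (?f j - \<Phi> (r j)))"
          using W.B.nrm_triangle[OF \<Phi> cs[of "r i"] \<Phi>, of "r i" "r j"] W.B.nrm_triangle[OF cs[of "r i"] cs[of "r j"] \<Phi>[of "r j"]] by linarith
        also have "W.B.nrm (?f i - ?f j) = B.nrm (f (r i) - f (r j))"
          by (simp add: W.B.nrm_def B.nrm_def fun_diff_def)
        also have "W.B.nrm (?f j - \<Phi> (r j)) = W.B.nrm (\<Phi> (r j) - ?f j)" by (rule W.B.nrm_minus_commute[OF cs \<Phi>])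
        also have "W.B.nrm (\<Phi> (r i) - ?f i) + (B.nrm (f (r i) - f (r j)) + W.B.nrm (\<Phi> (r j) - ?f j)) < e/3 + (e/3 + e/3)"
          using le[of i] le[of j] J[rule_format, of i] J[rule_format, of j] I[rule_format, of i j] ij
          by (intro add_strict_mono) auto
        also have "\<dots> = e" by simp
        finally show ?thesis by (simp only: o_apply)
      qed
      then show "\<exists>J. \<forall>i\<ge>J. \<forall>j\<ge>J. W.B.nrm ((\<Phi> \<circ> r) i - (\<Phi> \<circ> r) j) < e" by blast
    qed
    then show "\<exists>r. strict_mono (r :: nat \<Rightarrow> nat) \<and> W.B.qcauchy (\<Phi> \<circ> r)" using r(1) by blast
  next
    fix \<Phi> assume \<Phi>: "\<And>j::nat. \<Phi> j \<in> C.seqs" and c: "W.C.qcauchy \<Phi>"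
    have d: "\<Phi> i - F \<in> C.seqs" if "F \<in> C.seqs" for i F by (rule CW.V_diff[OF \<Phi> that])
    have "CW.qcauchy \<Phi>"
      using c unfolding W.C.qcauchy_def CW.qcauchy_def by (simp add: nrm[OF d[OF \<Phi>]])
    then obtain F where F: "F \<in> C.seqs" "CW.qconv \<Phi> F" using C.seqs_complete[of \<Phi>] \<Phi> by blast
    then have "W.C.qconv \<Phi> F" unfolding W.C.qconv_def CW.qconv_def by (simp add: nrm[OF d])
    then show "\<exists>u\<in>C.seqs. W.C.qconv \<Phi> u" using F(1) by blast
  qed
qed

lemma eigensystem_seqs:
  assumes "rayleigh k x0"
  shows "\<exists>U \<mu>. form_pair.eigensystem C.seqs A.qlim B.qlim k U \<mu> \<and> (\<forall>i<k. \<forall>x. rayleigh k x \<longrightarrow> \<mu> i \<le> x)"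
proof -
  interpret W: complete_form_pair C.seqs A.qlim B.qlim by (rule complete_form_pair_seqs)
  from W.eigensystem_exists[OF rayleigh_seqs[OF assms] order_refl] rayleigh_seqs
  show ?thesis by blast
qed

end

section \<open>Poincare's inequality and L2 limits\<close>

lemma frechet_derivative_zero_open:
  assumes "open S" "x \<in> S" "\<And>y. y \<in> S \<Longrightarrow> F y = 0"
  shows "frechet_derivative F (at x) v = 0"
proof -
  have "((\<lambda>_. 0) has_derivative (\<lambda>_. 0)) (at x)" by simp
  then have "(F has_derivative (\<lambda>_. 0)) (at x)"
    by (rule has_derivative_transform_within_open[OF _ assms(1,2)]) (simp add: assms(3))
  then show ?thesis by (simp add: frechet_derivative_at[symmetric])
qed

lemma integrable_continuous_compact_support:
  fixes f :: "'a::euclidean_space \<Rightarrow> real"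
  assumes "continuous_on UNIV f" "compact K" "\<And>x. x \<notin> K \<Longrightarrow> f x = 0"
  shows "integrable lborel f"
proof -
  have "integrable lborel (\<lambda>x. indicator K x *\<^sub>R f x)"
    by (rule borel_integrable_compact[OF assms(2)]) (rule continuous_on_subset[OF assms(1)], simp)
  moreover have "(\<lambda>x. indicator K x *\<^sub>R f x) = f" using assms(3) by (auto simp: indicator_def fun_eq_iff)
  ultimately show ?thesis by simp
qed

lemma integral_translate:
  fixes f :: "'a::euclidean_space \<Rightarrow> real"
  assumes "f \<in> borel_measurable borel"
  shows "integral\<^sup>L lborel (\<lambda>x. f (t + x)) = integral\<^sup>L lborel f"
proof -
  have "integral\<^sup>L lborel f = integral\<^sup>L (distr lborel borel ((+) t)) f" by (simp add: lborel_distr_plus)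
  also have "\<dots> = integral\<^sup>L lborel (\<lambda>x. f (t + x))" using assms by (subst integral_distr) auto
  finally show ?thesis ..
qed

text \<open>Integrals are translation invariant, so the difference quotients of F have integral zero.\<close>

lemma integral_derivative_compact_support:
  fixes F :: "'a::euclidean_space \<Rightarrow> real"
  assumes K: "compact K" "\<And>x. x \<notin> K \<Longrightarrow> F x = 0"
    and d: "\<And>x. F differentiable (at x)" and c: "continuous_on UNIV (\<lambda>x. frechet_derivative F (at x) v)"
  shows "integrable lborel (\<lambda>x. frechet_derivative F (at x) v)"
    and "integral\<^sup>L lborel (\<lambda>x. frechet_derivative F (at x) v) = 0"
proof -
  define D where "D x = frechet_derivative F (at x) v" for x
  have D0: "D x = 0" if "x \<notin> K" for x
    unfolding D_def using K that compact_imp_closed[OF K(1)]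
    by (intro frechet_derivative_zero_open[of "- K"]) (auto simp: open_Compl)
  show "integrable lborel (\<lambda>x. frechet_derivative F (at x) v)"
    using integrable_continuous_compact_support[OF c K(1)] D0 by (simp add: D_def)
  have cD: "compact (D ` K)" using c K(1) by (intro compact_continuous_image) (auto simp: D_def intro: continuous_on_subset)
  then obtain B0 where B0: "\<And>x. x \<in> K \<Longrightarrow> \<bar>D x\<bar> \<le> B0" using compact_imp_bounded[OF cD] unfolding bounded_iff by auto
  define B where "B = \<bar>B0\<bar>"
  have B: "\<bar>D x\<bar> \<le> B" for x
    using B0[of x] D0[of x] by (cases "x \<in> K") (auto simp: B_def)
  \<comment> \<open>Contains every point where a difference quotient with step in [0, 1] can be
    non-zero: it is K swept backwards along v. A multiple of its indicator is the integrable
    majorant.\<close>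
  define K' where "K' = (\<lambda>(x, s). x - s *\<^sub>R v) ` (K \<times> {0..1::real})"
  have K': "compact K'" unfolding K'_def
    by (intro compact_continuous_image compact_Times K) (auto simp: case_prod_unfold intro!: continuous_intros)
  have dF: "(F has_derivative frechet_derivative F (at x)) (at x)" for x
    using d[of x] by (simp add: frechet_derivative_works)
  have cF: "continuous_on UNIV F" using d by (intro continuous_at_imp_continuous_on ballI differentiable_imp_continuous_within) auto
  have mF: "F \<in> borel_measurable borel" by (rule borel_measurable_continuous_onI[OF cF])
  have line: "((\<lambda>s. F (x + s *\<^sub>R v)) has_real_derivative D (x + s *\<^sub>R v)) (at s)" for x s
  proof -
    have "((\<lambda>s. x + s *\<^sub>R v) has_derivative (\<lambda>h. h *\<^sub>R v)) (at s)" by (auto intro!: derivative_eq_intros)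
    from has_derivative_compose[OF this dF]
    have "((\<lambda>s. F (x + s *\<^sub>R v)) has_derivative (\<lambda>h. frechet_derivative F (at (x + s *\<^sub>R v)) (h *\<^sub>R v))) (at s)" .
    moreover have "frechet_derivative F (at y) (h *\<^sub>R v) = D y * h" for y h
      using linear_cmul[OF linear_frechet_derivative[OF d]] by (simp add: D_def)
    ultimately show ?thesis by (simp add: has_field_derivative_def)
  qed
  define q where "q m x = (F ((1 / (real m + 1)) *\<^sub>R v + x) - F x) / (1 / (real m + 1))" for m x
  have q_lim: "(\<lambda>m. q m x) \<longlonglongrightarrow> D x" for x
  proof -
    have "((\<lambda>h. (F (x + h *\<^sub>R v) - F x) / h) \<longlongrightarrow> D x) (at 0)"
      using line[of x 0] by (simp add: DERIV_def)
    moreover have "filterlim (\<lambda>m. 1 / (real m + 1)) (at 0) sequentially"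
      using LIMSEQ_inverse_real_of_nat by (auto simp: filterlim_at inverse_eq_divide add.commute)
    ultimately show ?thesis unfolding q_def by (auto dest: filterlim_compose simp: add.commute)
  qed
  have q_le: "\<bar>q m x\<bar> \<le> B * indicator K' x" for m x
  proof (cases "x \<in> K'")
    case True
    define h where "h = 1 / (real m + 1)"
    have h: "0 < h" by (simp add: h_def)
    obtain \<xi> where "F (x + h *\<^sub>R v) - F (x + 0 *\<^sub>R v) = (h - 0) * D (x + \<xi> *\<^sub>R v)"
      using MVT2[OF h, of "\<lambda>s. F (x + s *\<^sub>R v)" "\<lambda>s. D (x + s *\<^sub>R v)"] line by blast
    then have "q m x = D (x + \<xi> *\<^sub>R v)" using h unfolding q_def h_def[symmetric] by (simp add: add.commute)
    then show ?thesis using B True by simp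
  next
    case False
    have "x \<notin> K"
    proof
      assume "x \<in> K"
      then have "x \<in> K'" unfolding K'_def by (intro image_eqI[of _ _ "(x, 0)"]) auto
      then show False using False by simp
    qed
    moreover have "(1 / (real m + 1)) *\<^sub>R v + x \<notin> K"
    proof
      assume "(1 / (real m + 1)) *\<^sub>R v + x \<in> K"
      then have "x \<in> K'" unfolding K'_def
        by (intro image_eqI[of _ _ "((1 / (real m + 1)) *\<^sub>R v + x, 1 / (real m + 1))"]) auto
      then show False using False by simp
    qed
    ultimately show ?thesis using K(2) False by (simp add: q_def)
  qed
  have iF: "integrable lborel F" by (rule integrable_continuous_compact_support[OF cF K])
  have "(\<lambda>m. integral\<^sup>L lborel (q m)) \<longlonglongrightarrow> integral\<^sup>L lborel D"
  proof (rule integral_dominated_convergence[where w="\<lambda>x. B * indicator K' x"])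
    show "integrable lborel (\<lambda>x. B * indicator K' x)"
      using emeasure_bounded_finite[OF compact_imp_bounded[OF K']] compact_imp_closed[OF K']
      by (intro integrable_mult_right integrable_real_indicator) auto
    show "D \<in> borel_measurable lborel" using borel_measurable_continuous_onI[OF c] by (simp add: D_def[abs_def])
    have "(\<lambda>x. F (t + x)) \<in> borel_measurable borel" for t using mF by measurable
    then show "q m \<in> borel_measurable lborel" for m unfolding q_def[abs_def] using mF by measurable
  qed (use q_lim q_le in auto)
  moreover have "integral\<^sup>L lborel (q m) = 0" for m
  proof -
    have "integrable lborel (\<lambda>x. F (t + x))" for t
      using iF mF by (subst (asm) lborel_distr_plus[of t, symmetric], subst (asm) integrable_distr_eq) auto
    then have "integral\<^sup>L lborel (q m) = (integral\<^sup>L lborel (\<lambda>x. F ((1 / (real m + 1)) *\<^sub>R v + x)) - integral\<^sup>L lborel F) / (1 / (real m + 1))"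
      unfolding q_def using iF by (simp add: Bochner_Integration.integral_diff)
    then show ?thesis by (simp add: integral_translate[OF mF])
  qed
  ultimately show "integral\<^sup>L lborel (\<lambda>x. frechet_derivative F (at x) v) = 0"
    by (simp add: D_def[abs_def] LIMSEQ_const_iff)
qed

text \<open>The substitution costs the factor 1 / s^DIM, which is at most 2^DIM as long as s does
  not drop below 1/2.\<close>

lemma nn_integral_affine_le:
  fixes g :: "'a::euclidean_space \<Rightarrow> ennreal"
  assumes g: "g \<in> borel_measurable borel" and s: "1/2 \<le> s"
  shows "(\<integral>\<^sup>+x. g (t + s *\<^sub>R x) \<partial>lborel) \<le> 2 ^ DIM('a) * (\<integral>\<^sup>+x. g x \<partial>lborel)"
proof -
  have "(\<integral>\<^sup>+x. g x \<partial>lborel) = (\<integral>\<^sup>+x. ennreal (s ^ DIM('a)) * g (t + s *\<^sub>R x) \<partial>lborel)"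
    using g s by (subst lborel_affine[of s t]) (simp_all add: nn_integral_density nn_integral_distr)
  also have "\<dots> = ennreal (s ^ DIM('a)) * (\<integral>\<^sup>+x. g (t + s *\<^sub>R x) \<partial>lborel)"
    by (intro nn_integral_cmult measurable_compose[where f="\<lambda>x. t + s *\<^sub>R x", OF _ g]) simp_all
  finally have e: "(\<integral>\<^sup>+x. g x \<partial>lborel) = ennreal (s ^ DIM('a)) * (\<integral>\<^sup>+x. g (t + s *\<^sub>R x) \<partial>lborel)" .
  have "1 \<le> (2 * s) ^ DIM('a)" using s by (intro one_le_power) simp
  then have "1 \<le> 2 ^ DIM('a) * ennreal (s ^ DIM('a))"
  proof -
    assume a: "1 \<le> (2 * s) ^ DIM('a)"
    have "ennreal ((2 * s) ^ DIM('a)) = ennreal (2 ^ DIM('a)) * ennreal (s ^ DIM('a))"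
      using s by (simp add: power_mult_distrib ennreal_mult)
    also have "ennreal (2 ^ DIM('a)) = 2 ^ DIM('a)" by (simp add: ennreal_power[symmetric])
    finally show ?thesis using ennreal_leI[OF a] by simp
  qed
  then have "1 * (\<integral>\<^sup>+x. g (t + s *\<^sub>R x) \<partial>lborel) \<le> 2 ^ DIM('a) * ennreal (s ^ DIM('a)) * (\<integral>\<^sup>+x. g (t + s *\<^sub>R x) \<partial>lborel)"
    by (rule mult_right_mono) simp
  then show ?thesis unfolding e by (simp add: mult.assoc)
qed

text \<open>The fundamental theorem along the segment from y to x, followed by the Cauchy-Schwarz
  inequality once for the integral over s and once for the directional derivative.\<close>

lemma segment_estimate:
  fixes f :: "real^'n \<Rightarrow> real"
  assumes U: "open U" "convex U" and f: "Ck_on 1 U f" and xy: "x \<in> U" "y \<in> U"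
  shows "ennreal ((f x - f y)\<^sup>2) \<le> ennreal ((norm (x - y))\<^sup>2) *
    (\<integral>\<^sup>+s\<in>{0..1}. ennreal (\<Sum>i\<in>UNIV. (frechet_derivative f (at (y + s *\<^sub>R (x - y))) (axis i 1))\<^sup>2) \<partial>lborel)"
proof -
  let ?g = "\<lambda>i z. frechet_derivative f (at z) (axis i 1)"
  let ?z = "\<lambda>s. y + s *\<^sub>R (x - y)"
  let ?G = "\<lambda>z. \<Sum>i\<in>UNIV. (?g i z)\<^sup>2"
  have zU: "?z s \<in> U" if "s \<in> {0..1}" for s
  proof -
    have "(1 - s) *\<^sub>R y + s *\<^sub>R x \<in> U" using that xy U(2) by (intro convexD) auto
    then show ?thesis by (simp add: algebra_simps)
  qed
  have cg: "continuous_on U (?g i)" for i using f by simp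
  have czl: "continuous_on {0..1} ?z" by (intro continuous_intros)
  have cgz: "continuous_on {0..1} (\<lambda>s. ?g i (?z s))" for i
    by (rule continuous_on_compose2[OF cg czl]) (use zU in auto)
  define p where "p s = (\<Sum>i\<in>UNIV. (x - y) $ i * ?g i (?z s))" for s
  have cp: "continuous_on {0..1} p" unfolding p_def by (intro continuous_intros cgz)
  have "((\<lambda>s. f (?z s)) has_real_derivative p s) (at s within {0..1})" if s: "s \<in> {0..1}" for s
  proof -
    have fd: "f differentiable at (?z s)" using f zU[OF s] by simp
    have "(?z has_derivative (\<lambda>h. h *\<^sub>R (x - y))) (at s within {0..1})" by (auto intro!: derivative_eq_intros)
    moreover have "(f has_derivative frechet_derivative f (at (?z s))) (at (?z s))" using fd by (simp add: frechet_derivative_works)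
    ultimately have "((\<lambda>s. f (?z s)) has_derivative (\<lambda>h. frechet_derivative f (at (?z s)) (h *\<^sub>R (x - y)))) (at s within {0..1})"
      by (rule has_derivative_compose)
    moreover have "frechet_derivative f (at (?z s)) (h *\<^sub>R (x - y)) = p s * h" for h
      using frechet_derivative_cart_sum[of f "?z s" UNIV "x - y"] fd linear_cmul[OF linear_frechet_derivative[OF fd], of h "x - y"]
      by (simp add: p_def)
    ultimately show ?thesis by (simp add: has_field_derivative_def)
  qed
  then have I1: "(p has_integral (f x - f y)) {0..1}"
    using fundamental_theorem_of_calculus[of 0 1 "\<lambda>s. f (?z s)" p] by (auto simp: has_real_derivative_iff_has_vector_derivative)
  define c where "c = f x - f y"
  have I2: "((\<lambda>s. (p s)\<^sup>2) has_integral (integral {0..1} (\<lambda>s. (p s)\<^sup>2))) {0..1}"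
    by (intro integrable_integral integrable_continuous_real continuous_intros cp)
  \<comment> \<open>Here c is the mean of p over the unit interval; integrating the nonnegative
    square of p - c gives that c^2 is at most the integral of p^2.\<close>
  have "((\<lambda>s. (p s)\<^sup>2 - 2 * c * p s + c\<^sup>2) has_integral (integral {0..1} (\<lambda>s. (p s)\<^sup>2) - 2 * c * c + c\<^sup>2)) {0..1}"
    using has_integral_add[OF has_integral_diff[OF I2 has_integral_mult_right[OF I1, of "2 * c"]] has_integral_const_real[of "c\<^sup>2" 0 1]]
    by (simp add: c_def mult.assoc)
  then have "0 \<le> integral {0..1} (\<lambda>s. (p s)\<^sup>2) - 2 * c * c + c\<^sup>2"
  proof (rule has_integral_nonneg)
    fix s :: real
    have "(p s)\<^sup>2 - 2 * c * p s + c\<^sup>2 = (p s - c)\<^sup>2" by (simp add: power2_diff)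
    then show "0 \<le> (p s)\<^sup>2 - 2 * c * p s + c\<^sup>2" by simp
  qed
  then have "c\<^sup>2 \<le> integral {0..1} (\<lambda>s. (p s)\<^sup>2)" by (simp add: power2_eq_square)
  also have "\<dots> \<le> integral {0..1} (\<lambda>s. (norm (x - y))\<^sup>2 * ?G (?z s))"
  proof (rule integral_le)
    show "(\<lambda>s. (norm (x - y))\<^sup>2 * ?G (?z s)) integrable_on {0..1}"
      by (intro integrable_continuous_real continuous_intros cgz)
    fix s :: real
    have "(\<Sum>i\<in>UNIV. (x - y) $ i * ?g i (?z s))\<^sup>2 \<le> (\<Sum>i\<in>UNIV. ((x - y) $ i)\<^sup>2) * (\<Sum>i\<in>UNIV. (?g i (?z s))\<^sup>2)"
      by (rule Cauchy_Schwarz_ineq_sum)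
    moreover have "(norm (x - y))\<^sup>2 = (\<Sum>i\<in>UNIV. ((x - y) $ i)\<^sup>2)"
      unfolding power2_norm_eq_inner inner_vec_def by (simp add: power2_eq_square)
    ultimately show "(p s)\<^sup>2 \<le> (norm (x - y))\<^sup>2 * ?G (?z s)" by (simp add: p_def)
  qed (use I2 in blast)
  also have "\<dots> = (norm (x - y))\<^sup>2 * integral {0..1} (\<lambda>s. ?G (?z s))" by (rule integral_mult_right)
  finally have "ennreal (c\<^sup>2) \<le> ennreal ((norm (x - y))\<^sup>2 * integral {0..1} (\<lambda>s. ?G (?z s)))" by (rule ennreal_leI)
  also have "\<dots> = ennreal ((norm (x - y))\<^sup>2) * ennreal (integral {0..1} (\<lambda>s. ?G (?z s)))"
    by (rule ennreal_mult') simp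
  also have "ennreal (integral {0..1} (\<lambda>s. ?G (?z s))) = (\<integral>\<^sup>+s\<in>{0..1}. ennreal (?G (?z s)) \<partial>lborel)"
    by (rule nn_integral_has_integral_lebesgue'[symmetric])
      (auto intro!: sum_nonneg integrable_integral integrable_continuous_real continuous_intros cgz)
  finally show ?thesis by (simp add: c_def)
qed

lemma set_integrable_bounded_continuous:
  fixes h :: "real^'n \<Rightarrow> real"
  assumes U: "open U" "bounded U" and h: "continuous_on U h" and B: "\<And>x. x \<in> U \<Longrightarrow> \<bar>h x\<bar> \<le> B"
  shows "set_integrable lborel U h"
  unfolding set_integrable_def
proof (rule Bochner_Integration.integrable_bound)
  show "integrable lborel (\<lambda>x. B * indicator U x)"
    using emeasure_bounded_finite[OF U(2)] U(1) by (intro integrable_mult_right integrable_real_indicator) auto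
  show "AE x in lborel. norm (indicator U x *\<^sub>R h x) \<le> norm (B * indicator U x)"
    using B by (intro AE_I2) (force simp: indicator_def)
  show "(\<lambda>x. indicator U x *\<^sub>R h x) \<in> borel_measurable lborel"
    using borel_measurable_continuous_on_indicator[OF _ h] U(1) by simp
qed

text \<open>The segment estimate is integrated over pairs of points of U. The left side becomes 2 *
  (|U| * integral of f^2 - (integral of f)^2). On the right, integrating over one point of the pair
  for fixed s and fixed other point is an affine substitution, and extending the gradient by zero
  outside U as \<open>g\<close> lets it run over the whole space.\<close>

lemma poincare_inequality:
  fixes f :: "real^'n \<Rightarrow> real"
  assumes U: "open U" "convex U" "bounded U" and f: "Ck_on 1 U f" and bd: "\<And>x. x \<in> U \<Longrightarrow> \<bar>f x\<bar> \<le> K"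
    and d: "\<And>x y. x \<in> U \<Longrightarrow> y \<in> U \<Longrightarrow> norm (x - y) \<le> d"
  shows "ennreal (2 * (measure lborel U * (LINT x:U|lborel. (f x)\<^sup>2) - (LINT x:U|lborel. f x)\<^sup>2)) \<le>
    ennreal (d\<^sup>2) * (2 ^ CARD('n) * (ennreal (measure lborel U) *
      (\<integral>\<^sup>+x\<in>U. ennreal (\<Sum>i\<in>UNIV. (frechet_derivative f (at x) (axis i 1))\<^sup>2) \<partial>lborel)))"
proof -
  let ?G = "\<lambda>z. \<Sum>i\<in>UNIV. (frechet_derivative f (at z) (axis i 1))\<^sup>2"
  define g where "g z = indicator U z * ennreal (?G z)" for z
  define m where "m = measure lborel U"
  define I1 where "I1 = (LINT x:U|lborel. f x)"
  define I2 where "I2 = (LINT x:U|lborel. (f x)\<^sup>2)"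
  have Ub [measurable]: "U \<in> sets borel" using U(1) by simp
  have emfin: "emeasure lborel U < \<infinity>" by (rule emeasure_bounded_finite[OF U(3)])
  have em: "emeasure lborel U = ennreal m" using emfin by (simp add: m_def emeasure_eq_ennreal_measure)
  have cf: "continuous_on U f" using Ck_on_le[OF f, of 0] by simp
  have cg: "continuous_on U (\<lambda>z. frechet_derivative f (at z) (axis i 1))" for i using f by simp
  have "(\<lambda>z. indicator U z *\<^sub>R ?G z) \<in> borel_measurable borel"
    by (rule borel_measurable_continuous_on_indicator[OF Ub]) (intro continuous_intros cg)
  then have "(\<lambda>z. ennreal (indicator U z *\<^sub>R ?G z)) \<in> borel_measurable borel" by measurable
  then have gm [measurable]: "g \<in> borel_measurable borel"
    by (rule measurable_cong[THEN iffD1, rotated]) (auto simp: g_def indicator_def)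
  have i0: "integrable lborel (\<lambda>x. indicator U x *\<^sub>R (1::real))"
    using emfin by (simp add: integrable_real_indicator)
  have i1: "integrable lborel (\<lambda>x. indicator U x *\<^sub>R f x)"
    using set_integrable_bounded_continuous[OF U(1,3) cf bd] by (simp add: set_integrable_def)
  have "\<bar>(f x)\<^sup>2\<bar> \<le> K\<^sup>2" if "x \<in> U" for x using power_mono[OF bd[OF that], of 2] by simp
  from set_integrable_bounded_continuous[OF U(1,3) continuous_on_power[OF cf] this]
  have i2: "integrable lborel (\<lambda>x. indicator U x *\<^sub>R (f x)\<^sup>2)" by (simp add: set_integrable_def)
  have m: "integral\<^sup>L lborel (\<lambda>x. indicator U x *\<^sub>R (1::real)) = m" by (simp add: m_def)
  let ?h = "\<lambda>x y. indicator U x * indicator U y * (f x - f y)\<^sup>2 :: real"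
  let ?E = "\<lambda>x. indicator U x * ((f x)\<^sup>2 * m - 2 * f x * I1 + I2)"
  let ?W = "\<lambda>s x y. indicator U x * indicator U y * g (y + s *\<^sub>R (x - y))"
  let ?W' = "\<lambda>s x y. indicator {0..1} s * ?W s x y"
  have inner: "(\<integral>\<^sup>+y. ennreal (?h x y) \<partial>lborel) = ennreal (?E x) \<and>
      0 \<le> ?E x" for x
  proof -
    have e: "?h x y = indicator U x * ((f x)\<^sup>2 * (indicator U y *\<^sub>R 1) - 2 * f x * (indicator U y *\<^sub>R f y) + indicator U y *\<^sub>R (f y)\<^sup>2)" for y
      by (simp add: indicator_def power2_diff)
    have int: "integrable lborel (?h x)" unfolding e using i0 i1 i2 by (intro integrable_mult_right Bochner_Integration.integrable_add Bochner_Integration.integrable_diff)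
    have val: "integral\<^sup>L lborel (?h x) = ?E x"
      unfolding e I1_def I2_def set_lebesgue_integral_def using i0 i1 i2
      by (simp only: integral_mult_right_zero Bochner_Integration.integral_add Bochner_Integration.integral_diff
          integrable_mult_right Bochner_Integration.integrable_diff m)
    have "0 \<le> integral\<^sup>L lborel (?h x)" by (intro Bochner_Integration.integral_nonneg) (simp add: indicator_def)
    moreover have "(\<integral>\<^sup>+y. ennreal (?h x y) \<partial>lborel) = ennreal (integral\<^sup>L lborel (?h x))"
      by (intro nn_integral_eq_integral int AE_I2) (simp add: indicator_def)
    ultimately show ?thesis using val by simp
  qed
  have "ennreal (2 * (m * I2 - I1\<^sup>2)) = (\<integral>\<^sup>+x. \<integral>\<^sup>+y. ennreal (?h x y) \<partial>lborel \<partial>lborel)"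
  proof -
    have e: "?E x =
      m * (indicator U x *\<^sub>R (f x)\<^sup>2) - 2 * I1 * (indicator U x *\<^sub>R f x) + I2 * (indicator U x *\<^sub>R 1)" for x
      by (simp add: indicator_def)
    have "(\<integral>\<^sup>+x. \<integral>\<^sup>+y. ennreal (?h x y) \<partial>lborel \<partial>lborel) = (\<integral>\<^sup>+x. ennreal (?E x) \<partial>lborel)"
      using inner by simp
    also have "\<dots> = ennreal (integral\<^sup>L lborel (\<lambda>x. ?E x))"
      using inner unfolding e
      by (intro nn_integral_eq_integral AE_I2 Bochner_Integration.integrable_add Bochner_Integration.integrable_diff integrable_mult_right i0 i1 i2) simp
    also have "integral\<^sup>L lborel (\<lambda>x. ?E x) = m * I2 - 2 * I1 * I1 + I2 * m"
      unfolding e using i0 i1 i2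
      by (simp only: integral_mult_right_zero Bochner_Integration.integral_add Bochner_Integration.integral_diff
          integrable_mult_right Bochner_Integration.integrable_diff m I1_def[unfolded set_lebesgue_integral_def, symmetric]
          I2_def[unfolded set_lebesgue_integral_def, symmetric])
    finally show ?thesis by (simp add: power2_eq_square algebra_simps)
  qed
  also have "\<dots> \<le>
     (\<integral>\<^sup>+x. \<integral>\<^sup>+y. ennreal (d\<^sup>2) * (\<integral>\<^sup>+s. ?W' s x y \<partial>lborel) \<partial>lborel \<partial>lborel)"
  proof (intro nn_integral_mono)
    fix x y
    show "ennreal (?h x y) \<le> ennreal (d\<^sup>2) * (\<integral>\<^sup>+s. ?W' s x y \<partial>lborel)"
    proof (cases "x \<in> U \<and> y \<in> U")
      case True
      have zU: "y + s *\<^sub>R (x - y) \<in> U" if "s \<in> {0..1}" for s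
      proof -
        have "(1 - s) *\<^sub>R y + s *\<^sub>R x \<in> U" using that True U(2) by (intro convexD) auto
        then show ?thesis by (simp add: algebra_simps)
      qed
      have "ennreal (?h x y) = ennreal ((f x - f y)\<^sup>2)" using True by simp
      also have "\<dots> \<le> ennreal ((norm (x - y))\<^sup>2) * (\<integral>\<^sup>+s\<in>{0..1}. ennreal (?G (y + s *\<^sub>R (x - y))) \<partial>lborel)"
        using True by (intro segment_estimate[OF U(1,2) f]) auto
      also have "\<dots> \<le> ennreal (d\<^sup>2) * (\<integral>\<^sup>+s\<in>{0..1}. ennreal (?G (y + s *\<^sub>R (x - y))) \<partial>lborel)"
        using True d by (intro mult_right_mono ennreal_leI power_mono) auto
      also have "(\<integral>\<^sup>+s\<in>{0..1}. ennreal (?G (y + s *\<^sub>R (x - y))) \<partial>lborel) =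
          (\<integral>\<^sup>+s. ?W' s x y \<partial>lborel)"
        using True zU by (intro nn_integral_cong) (auto simp: g_def indicator_def)
      finally show ?thesis .
    qed (auto simp: indicator_def)
  qed
  also have "\<dots> = ennreal (d\<^sup>2) * (\<integral>\<^sup>+x. \<integral>\<^sup>+y. \<integral>\<^sup>+s. ?W' s x y \<partial>lborel \<partial>lborel \<partial>lborel)"
    by (simp add: nn_integral_cmult)
  also have "\<dots> \<le> ennreal (d\<^sup>2) * (2 ^ CARD('n) * (ennreal m * (\<integral>\<^sup>+z. g z \<partial>lborel)))"
  proof (rule mult_left_mono)
    have "(\<integral>\<^sup>+x. \<integral>\<^sup>+y. \<integral>\<^sup>+s. ?W' s x y \<partial>lborel \<partial>lborel \<partial>lborel) =
        (\<integral>\<^sup>+x. \<integral>\<^sup>+s. \<integral>\<^sup>+y. ?W' s x y \<partial>lborel \<partial>lborel \<partial>lborel)"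
      by (intro nn_integral_cong lborel_pair.Fubini') measurable
    also have "\<dots> = (\<integral>\<^sup>+s. \<integral>\<^sup>+x. \<integral>\<^sup>+y. ?W' s x y \<partial>lborel \<partial>lborel \<partial>lborel)"
      by (intro lborel_pair.Fubini') measurable
    also have "\<dots> \<le> (\<integral>\<^sup>+s. indicator {0..1::real} s * (2 ^ CARD('n) * (ennreal m * (\<integral>\<^sup>+z. g z \<partial>lborel))) \<partial>lborel)"
    proof (intro nn_integral_mono)
      fix s :: real
      let ?T = "\<integral>\<^sup>+z. g z \<partial>lborel"
      show "(\<integral>\<^sup>+x. \<integral>\<^sup>+y. ?W' s x y \<partial>lborel \<partial>lborel) \<le>
        indicator {0..1::real} s * (2 ^ CARD('n) * (ennreal m * ?T))"
      proof (cases "s \<in> {0..1}")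
        case s: True
        have c: "(\<integral>\<^sup>+x. indicator U x * (2 ^ CARD('n) * ?T) \<partial>lborel) = 2 ^ CARD('n) * (ennreal m * ?T)"
          using em by (simp add: nn_integral_multc mult_ac)
        have "(\<integral>\<^sup>+x. \<integral>\<^sup>+y. ?W s x y \<partial>lborel \<partial>lborel) \<le> 2 ^ CARD('n) * (ennreal m * ?T)"
          \<comment> \<open>substitute in whichever of x and y has the coefficient at least 1/2\<close>
        proof (cases "1/2 \<le> s")
          case True
          have "(\<integral>\<^sup>+x. \<integral>\<^sup>+y. ?W s x y \<partial>lborel \<partial>lborel) =
            (\<integral>\<^sup>+y. \<integral>\<^sup>+x. ?W s x y \<partial>lborel \<partial>lborel)"
            by (intro lborel_pair.Fubini') measurable
          also have "\<dots> \<le> (\<integral>\<^sup>+y. indicator U y * (2 ^ CARD('n) * ?T) \<partial>lborel)"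
          proof (intro nn_integral_mono)
            fix y
            have "(\<integral>\<^sup>+x. ?W s x y \<partial>lborel) \<le>
              (\<integral>\<^sup>+x. indicator U y * g ((y - s *\<^sub>R y) + s *\<^sub>R x) \<partial>lborel)"
              by (intro nn_integral_mono) (auto simp: indicator_def algebra_simps)
            also have "\<dots> = indicator U y * (\<integral>\<^sup>+x. g ((y - s *\<^sub>R y) + s *\<^sub>R x) \<partial>lborel)"
              by (intro nn_integral_cmult) measurable
            also have "\<dots> \<le> indicator U y * (2 ^ CARD('n) * ?T)"
              using nn_integral_affine_le[OF gm True, of "y - s *\<^sub>R y"] by (intro mult_left_mono) auto
            finally show "(\<integral>\<^sup>+x. ?W s x y \<partial>lborel) \<le> indicator U y * (2 ^ CARD('n) * ?T)" .
          qed
          finally show ?thesis using c by simp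
        next
          case False
          then have s': "1/2 \<le> 1 - s" by simp
          have "(\<integral>\<^sup>+x. \<integral>\<^sup>+y. ?W s x y \<partial>lborel \<partial>lborel) \<le> (\<integral>\<^sup>+x. indicator U x * (2 ^ CARD('n) * ?T) \<partial>lborel)"
          proof (intro nn_integral_mono)
            fix x
            have "(\<integral>\<^sup>+y. ?W s x y \<partial>lborel) \<le>
              (\<integral>\<^sup>+y. indicator U x * g (s *\<^sub>R x + (1 - s) *\<^sub>R y) \<partial>lborel)"
              by (intro nn_integral_mono) (auto simp: indicator_def algebra_simps)
            also have "\<dots> = indicator U x * (\<integral>\<^sup>+y. g (s *\<^sub>R x + (1 - s) *\<^sub>R y) \<partial>lborel)"
              by (intro nn_integral_cmult) measurable
            also have "\<dots> \<le> indicator U x * (2 ^ CARD('n) * ?T)"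
              using nn_integral_affine_le[OF gm s', of "s *\<^sub>R x"] by (intro mult_left_mono) auto
            finally show "(\<integral>\<^sup>+y. ?W s x y \<partial>lborel) \<le> indicator U x * (2 ^ CARD('n) * ?T)" .
          qed
          then show ?thesis using c by simp
        qed
        then show ?thesis using s by simp
      qed simp
    qed
    also have "\<dots> = 2 ^ CARD('n) * (ennreal m * (\<integral>\<^sup>+z. g z \<partial>lborel))"
      by (simp add: nn_integral_multc)
    finally show "(\<integral>\<^sup>+x. \<integral>\<^sup>+y. \<integral>\<^sup>+s. ?W' s x y \<partial>lborel \<partial>lborel \<partial>lborel) \<le>
        2 ^ CARD('n) * (ennreal m * (\<integral>\<^sup>+z. g z \<partial>lborel))" .
  qed simp
  finally have "ennreal (2 * (m * I2 - I1\<^sup>2)) \<le> ennreal (d\<^sup>2) * (2 ^ CARD('n) * (ennreal m * (\<integral>\<^sup>+z. g z \<partial>lborel)))" .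
  moreover have "(\<integral>\<^sup>+z. g z \<partial>lborel) = (\<integral>\<^sup>+z\<in>U. ennreal (?G z) \<partial>lborel)"
    by (intro nn_integral_cong) (simp add: g_def mult.commute)
  ultimately show ?thesis by (simp add: m_def I1_def I2_def)
qed

text \<open>Poincare's inequality solved for the integral of h^2. The constant is (2 * \<delta>)^2 *
  2^n / 2, so on sets of small diameter the gradient term is small and only the mean
  remains.\<close>

lemma poincare_nn_integral:
  fixes h :: "real^'n \<Rightarrow> real"
  assumes U: "open U" "convex U" "bounded U" and ne: "U \<noteq> {}" and Ck: "Ck_on 1 U h" and bd: "\<And>x. x \<in> U \<Longrightarrow> \<bar>h x\<bar> \<le> K"
    and \<delta>: "0 < \<delta>" and d: "\<And>x y. x \<in> U \<Longrightarrow> y \<in> U \<Longrightarrow> norm (x - y) \<le> 2 * \<delta>"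
  shows "(\<integral>\<^sup>+x\<in>U. ennreal ((h x)\<^sup>2) \<partial>lborel) \<le> ennreal ((LINT x:U|lborel. h x)\<^sup>2 / measure lborel U) +
    ennreal (2 * \<delta>\<^sup>2 * 2 ^ CARD('n)) * (\<integral>\<^sup>+x\<in>U. ennreal (\<Sum>i\<in>UNIV. (frechet_derivative h (at x) (axis i 1))\<^sup>2) \<partial>lborel)"
proof -
  have ch: "continuous_on U h" using Ck_on_le[OF Ck, of 0] by simp
  define \<mu> where "\<mu> = measure lborel U"
  have \<mu>: "0 < \<mu>"
  proof -
    have "\<not> negligible U" by (rule open_not_negligible[OF U(1) ne])
    then have "emeasure lborel U \<noteq> 0" using U(1) by (auto simp: negligible_iff_null_sets null_sets_def)
    then show ?thesis using emeasure_bounded_finite[OF U(3)]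
      by (simp add: \<mu>_def measure_def enn2real_positive_iff zero_less_iff_neq_zero)
  qed
  have iS: "set_integrable lborel U (\<lambda>x. (h x)\<^sup>2)"
  proof (rule set_integrable_bounded_continuous[OF U(1,3), where B="K\<^sup>2"])
    show "\<bar>(h x)\<^sup>2\<bar> \<le> K\<^sup>2" if "x \<in> U" for x using power_mono[OF bd[OF that], of 2] by simp
  qed (intro continuous_on_power ch)
  define I2 where "I2 = (LINT x:U|lborel. (h x)\<^sup>2)"
  have I2: "(\<integral>\<^sup>+x\<in>U. ennreal ((h x)\<^sup>2) \<partial>lborel) = ennreal I2"
  proof -
    have "(\<integral>\<^sup>+x\<in>U. ennreal ((h x)\<^sup>2) \<partial>lborel) = (\<integral>\<^sup>+x. ennreal (indicator U x *\<^sub>R (h x)\<^sup>2) \<partial>lborel)"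
      by (intro nn_integral_cong) (simp add: indicator_def)
    also have "\<dots> = ennreal I2" unfolding I2_def set_lebesgue_integral_def
      using iS by (intro nn_integral_eq_integral) (auto simp: set_integrable_def)
    finally show ?thesis .
  qed
  define T where "T = (\<integral>\<^sup>+x\<in>U. ennreal (\<Sum>i\<in>UNIV. (frechet_derivative h (at x) (axis i 1))\<^sup>2) \<partial>lborel)"
  have P0: "ennreal (2 * (\<mu> * I2 - (LINT x:U|lborel. h x)\<^sup>2)) \<le> ennreal ((2 * \<delta>)\<^sup>2) * (2 ^ CARD('n) * (ennreal \<mu> * T))"
    unfolding \<mu>_def I2_def T_def
    by (rule poincare_inequality[OF U Ck, where K=K]) (use bd d in auto)
  have "ennreal I2 \<le> ennreal ((LINT x:U|lborel. h x)\<^sup>2 / \<mu>) + ennreal (2 * \<delta>\<^sup>2 * 2 ^ CARD('n)) * T"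
  proof (cases T)
    case (real \<tau>)
    have "ennreal ((2 * \<delta>)\<^sup>2) * (2 ^ CARD('n) * (ennreal \<mu> * T)) = ennreal ((2 * \<delta>)\<^sup>2 * (2 ^ CARD('n) * (\<mu> * \<tau>)))"
      using real \<mu> by (simp add: ennreal_mult ennreal_power[symmetric])
    then have "2 * (\<mu> * I2 - (LINT x:U|lborel. h x)\<^sup>2) \<le> (2 * \<delta>)\<^sup>2 * (2 ^ CARD('n) * (\<mu> * \<tau>))"
    proof -
      assume e: "ennreal ((2 * \<delta>)\<^sup>2) * (2 ^ CARD('n) * (ennreal \<mu> * T)) = ennreal ((2 * \<delta>)\<^sup>2 * (2 ^ CARD('n) * (\<mu> * \<tau>)))"
      have "0 \<le> (2 * \<delta>)\<^sup>2 * (2 ^ CARD('n) * (\<mu> * \<tau>))" using real \<mu> by simp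
      then show ?thesis using P0 unfolding e by (simp only: ennreal_le_iff)
    qed
    then have "I2 \<le> (LINT x:U|lborel. h x)\<^sup>2 / \<mu> + 2 * \<delta>\<^sup>2 * 2 ^ CARD('n) * \<tau>"
      using \<mu> by (simp add: field_simps power2_eq_square)
    then have "ennreal I2 \<le> ennreal ((LINT x:U|lborel. h x)\<^sup>2 / \<mu> + 2 * \<delta>\<^sup>2 * 2 ^ CARD('n) * \<tau>)" by (rule ennreal_leI)
    also have "\<dots> = ennreal ((LINT x:U|lborel. h x)\<^sup>2 / \<mu>) + ennreal (2 * \<delta>\<^sup>2 * 2 ^ CARD('n)) * T"
      using real \<mu> by (simp add: ennreal_mult)
    finally show ?thesis .
  next
    case top
    then show ?thesis using \<delta> by (simp add: ennreal_mult_top)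
  qed
  then show ?thesis unfolding I2 \<mu>_def T_def .
qed

text \<open>Riesz-Fischer: along a fast subsequence the increments are absolutely summable almost
  everywhere, which gives the limit; Fatou's lemma then estimates the distance of the whole sequence
  from it.\<close>

lemma (in finite_measure) L2_complete:
  fixes f :: "nat \<Rightarrow> 'a \<Rightarrow> real"
  assumes m [measurable]: "\<And>j. f j \<in> borel_measurable M" and i: "\<And>j. integrable M (\<lambda>x. (f j x)\<^sup>2)"
    and c: "\<And>e. 0 < e \<Longrightarrow> \<exists>J. \<forall>i\<ge>J. \<forall>j\<ge>J. (\<integral>x. (f i x - f j x)\<^sup>2 \<partial>M) < e"
  shows "\<exists>u\<in>borel_measurable M. integrable M (\<lambda>x. (u x)\<^sup>2) \<and> (\<lambda>j. \<integral>x. (f j x - u x)\<^sup>2 \<partial>M) \<longlonglongrightarrow> 0"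
proof -
  have sq: "integrable M (\<lambda>x. (g x - h x)\<^sup>2)"
    if "integrable M (\<lambda>x. (g x)\<^sup>2)" "integrable M (\<lambda>x. (h x)\<^sup>2)" "g \<in> borel_measurable M" "h \<in> borel_measurable M" for g h :: "'a \<Rightarrow> real"
  proof (rule Bochner_Integration.integrable_bound)
    show "integrable M (\<lambda>x. 2 * (g x)\<^sup>2 + 2 * (h x)\<^sup>2)" using that by simp
    show "AE x in M. norm ((g x - h x)\<^sup>2) \<le> norm (2 * (g x)\<^sup>2 + 2 * (h x)\<^sup>2)"
    proof (rule AE_I2)
      fix x
      have "0 \<le> (g x + h x)\<^sup>2" "0 \<le> (g x - h x)\<^sup>2" by simp_all
      then show "norm ((g x - h x)\<^sup>2) \<le> norm (2 * (g x)\<^sup>2 + 2 * (h x)\<^sup>2)"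
        by (simp add: power2_diff power2_sum)
    qed
  qed (use that in measurable)
  have nn: "(\<integral>\<^sup>+x. ennreal ((f i x - f j x)\<^sup>2) \<partial>M) = ennreal (\<integral>x. (f i x - f j x)\<^sup>2 \<partial>M)" for i j
    by (intro nn_integral_eq_integral sq i m) simp
  have "\<forall>k. \<exists>J. \<forall>i\<ge>J. \<forall>j\<ge>J. (\<integral>x. (f i x - f j x)\<^sup>2 \<partial>M) < (1/4) ^ k"
    using c by simp
  from choice[OF this] obtain J where J: "\<And>k i j. i \<ge> J k \<Longrightarrow> j \<ge> J k \<Longrightarrow> (\<integral>x. (f i x - f j x)\<^sup>2 \<partial>M) < (1/4) ^ k"
    by blast
  \<comment> \<open>The maximum makes r monotone and at least J k; the summand k ensures that r k is
    at least k, as used with Fatou's lemma.\<close>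
  define r where "r k = Max (J ` {..k}) + k" for k
  have rJ: "J k \<le> r k" for k unfolding r_def by (intro trans_le_add1 Max_ge) auto
  have rm: "r k \<le> r (Suc k)" for k unfolding r_def by (intro add_mono Max_mono) auto
  define g where "g k = f (r k)" for k
  have gm [measurable]: "g k \<in> borel_measurable M" for k by (simp add: g_def)
  define d where "d k x = \<bar>g (Suc k) x - g k x\<bar>" for k x
  have dm [measurable]: "d k \<in> borel_measurable M" for k unfolding d_def by measurable
  have dle: "(\<integral>\<^sup>+x. ennreal (d k x) \<partial>M) \<le> ennreal ((measure M (space M) + 1) * (1/2) ^ k)" for k
  proof -
    \<comment> \<open>Expanding the square of 2^k * d - 1 bounds d by a constant and d^2 with
      weights chosen so that, the measure being finite, both contributions are of order (1/2)^k
      after integration.\<close>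
    have "d k x \<le> (1/2) ^ k + 2 ^ k * (d k x)\<^sup>2" for x
    proof -
      have "0 \<le> (2 ^ k * d k x - 1)\<^sup>2" by simp
      then have "2 * (2 ^ k * d k x) \<le> (2 ^ k * d k x)\<^sup>2 + 1" by (simp add: power2_diff)
      moreover have "0 \<le> 2 ^ k * d k x" by (simp add: d_def)
      ultimately have "2 ^ k * d k x \<le> 2 ^ k * (2 ^ k * (d k x)\<^sup>2) + 1" by (simp add: power2_eq_square mult_ac)
      then show ?thesis by (simp add: field_simps power_one_over)
    qed
    then have "(\<integral>\<^sup>+x. ennreal (d k x) \<partial>M) \<le> (\<integral>\<^sup>+x. ennreal ((1/2) ^ k) + ennreal (2 ^ k) * ennreal ((d k x)\<^sup>2) \<partial>M)"
      by (intro nn_integral_mono) (simp add: ennreal_plus[symmetric] ennreal_mult[symmetric] ennreal_leI del: ennreal_plus)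
    also have "\<dots> = ennreal ((1/2) ^ k) * emeasure M (space M) + ennreal (2 ^ k) * (\<integral>\<^sup>+x. ennreal ((d k x)\<^sup>2) \<partial>M)"
      by (simp add: nn_integral_add nn_integral_cmult)
    also have "(\<integral>\<^sup>+x. ennreal ((d k x)\<^sup>2) \<partial>M) = ennreal (\<integral>x. (g (Suc k) x - g k x)\<^sup>2 \<partial>M)"
      by (simp add: d_def g_def nn)
    also have "\<dots> \<le> ennreal ((1/4) ^ k)"
      unfolding g_def using J[of k "r (Suc k)" "r k"] rJ[of k] rm[of k] by (intro ennreal_leI) auto
    also have "ennreal ((1/2) ^ k) * emeasure M (space M) + ennreal (2 ^ k) * ennreal ((1/4) ^ k) =
        ennreal ((1/2) ^ k * measure M (space M) + 2 ^ k * (1/4) ^ k)"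
      by (simp add: emeasure_eq_measure ennreal_mult[symmetric] ennreal_plus[symmetric] del: ennreal_plus)
    also have "(1/2) ^ k * measure M (space M) + 2 ^ k * (1/4) ^ k = (measure M (space M) + 1) * (1/2) ^ k"
      by (simp add: power_mult_distrib[symmetric] algebra_simps)
    finally show ?thesis by (simp add: add_left_mono mult_left_mono)
  qed
  have "(\<integral>\<^sup>+x. (\<Sum>k. ennreal (d k x)) \<partial>M) = (\<Sum>k. \<integral>\<^sup>+x. ennreal (d k x) \<partial>M)"
    by (rule nn_integral_suminf) measurable
  also have "\<dots> \<le> (\<Sum>k. ennreal ((measure M (space M) + 1) * (1/2) ^ k))"
    by (intro suminf_le dle) auto
  also have "\<dots> = ennreal (\<Sum>k. (measure M (space M) + 1) * (1/2) ^ k)"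
    by (intro suminf_ennreal2) (auto intro!: summable_mult summable_geometric)
  finally have fin: "(\<integral>\<^sup>+x. (\<Sum>k. ennreal (d k x)) \<partial>M) \<noteq> \<infinity>" by (auto simp: top_unique)
  have "AE x in M. (\<Sum>k. ennreal (d k x)) \<noteq> \<infinity>"
    by (rule nn_integral_PInf_AE[OF _ fin]) measurable
  then have conv: "AE x in M. convergent (\<lambda>k. g k x)"
  proof eventually_elim
    case (elim x)
    have "summable (\<lambda>k. d k x)"
      by (rule summable_suminf_not_top) (use elim in \<open>auto simp: d_def\<close>)
    then have "summable (\<lambda>k. g (Suc k) x - g k x)" unfolding d_def by (rule summable_rabs_cancel)
    then have "convergent (\<lambda>n. \<Sum>k<n. g (Suc k) x - g k x)" by (simp add: summable_iff_convergent)
    then have "convergent (\<lambda>n. g n x - g 0 x)" by (simp add: sum_lessThan_telescope[of "\<lambda>n. g n x"])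
    then show ?case using convergent_add[OF _ convergent_const, of "\<lambda>n. g n x - g 0 x" "g 0 x"] by simp
  qed
  define u where "u x = lim (\<lambda>k. g k x)" for x
  have um [measurable]: "u \<in> borel_measurable M" unfolding u_def by measurable
  have close: "(\<integral>\<^sup>+x. ennreal ((f n x - u x)\<^sup>2) \<partial>M) \<le> ennreal e"
    if "0 < e" and N: "\<forall>i\<ge>N. \<forall>j\<ge>N. (\<integral>x. (f i x - f j x)\<^sup>2 \<partial>M) < e" "n \<ge> N" for e n N
  proof -
    have "(\<integral>\<^sup>+x. ennreal ((f n x - u x)\<^sup>2) \<partial>M) = (\<integral>\<^sup>+x. liminf (\<lambda>k. ennreal ((f n x - g k x)\<^sup>2)) \<partial>M)"
      using conv
    proof (intro nn_integral_cong_AE, eventually_elim)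
      case (elim x)
      have "(\<lambda>k. ennreal ((f n x - g k x)\<^sup>2)) \<longlonglongrightarrow> ennreal ((f n x - u x)\<^sup>2)"
        using elim unfolding u_def by (intro tendsto_intros) (simp add: convergent_LIMSEQ_iff)
      then show ?case using lim_imp_Liminf[OF sequentially_bot] by metis
    qed
    also have "\<dots> \<le> liminf (\<lambda>k. \<integral>\<^sup>+x. ennreal ((f n x - g k x)\<^sup>2) \<partial>M)"
      by (rule nn_integral_liminf) measurable
    also have "\<dots> \<le> ennreal e"
    proof (rule Liminf_le)
      show "\<forall>\<^sub>F k in sequentially. (\<integral>\<^sup>+x. ennreal ((f n x - g k x)\<^sup>2) \<partial>M) \<le> ennreal e"
        unfolding eventually_sequentially
      proof (intro exI[of _ N] allI impI)
        fix k assume "N \<le> k"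
        then have "N \<le> r k" by (simp add: r_def)
        then show "(\<integral>\<^sup>+x. ennreal ((f n x - g k x)\<^sup>2) \<partial>M) \<le> ennreal e"
          using N unfolding g_def nn by (intro ennreal_leI less_imp_le) auto
      qed
    qed simp
    finally show ?thesis .
  qed
  have int: "integrable M (\<lambda>x. (f n x - u x)\<^sup>2) \<and> (\<integral>x. (f n x - u x)\<^sup>2 \<partial>M) \<le> e"
    if "0 < e" and N: "\<forall>i\<ge>N. \<forall>j\<ge>N. (\<integral>x. (f i x - f j x)\<^sup>2 \<partial>M) < e" "n \<ge> N" for e n N
  proof
    have le: "(\<integral>\<^sup>+x. ennreal ((f n x - u x)\<^sup>2) \<partial>M) \<le> ennreal e" by (rule close[OF that])
    then have "(\<integral>\<^sup>+x. ennreal ((f n x - u x)\<^sup>2) \<partial>M) < \<infinity>" by (rule le_less_trans) simp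
    then show i: "integrable M (\<lambda>x. (f n x - u x)\<^sup>2)" by (intro integrableI_nonneg) auto
    have "ennreal (\<integral>x. (f n x - u x)\<^sup>2 \<partial>M) \<le> ennreal e"
      using le nn_integral_eq_integral[OF i] by simp
    then show "(\<integral>x. (f n x - u x)\<^sup>2 \<partial>M) \<le> e" using \<open>0 < e\<close> by simp
  qed
  obtain N where N: "\<forall>i\<ge>N. \<forall>j\<ge>N. (\<integral>x. (f i x - f j x)\<^sup>2 \<partial>M) < 1" using c[of 1] by auto
  have "integrable M (\<lambda>x. (f N x - (f N x - u x))\<^sup>2)"
  proof (rule sq[OF i _ m])
    show "integrable M (\<lambda>x. (f N x - u x)\<^sup>2)" using int[of 1 N N] N by simp
  qed measurable
  then have iu: "integrable M (\<lambda>x. (u x)\<^sup>2)" by simp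
  have "(\<lambda>j. \<integral>x. (f j x - u x)\<^sup>2 \<partial>M) \<longlonglongrightarrow> 0"
  proof (rule LIMSEQ_I)
    fix e :: real assume e: "0 < e"
    obtain N where N: "\<forall>i\<ge>N. \<forall>j\<ge>N. (\<integral>x. (f i x - f j x)\<^sup>2 \<partial>M) < e/2" using c[of "e/2"] e by auto
    have "norm ((\<integral>x. (f n x - u x)\<^sup>2 \<partial>M) - 0) < e" if "n \<ge> N" for n
    proof -
      have "0 \<le> (\<integral>x. (f n x - u x)\<^sup>2 \<partial>M)" by (intro Bochner_Integration.integral_nonneg) simp
      moreover have "(\<integral>x. (f n x - u x)\<^sup>2 \<partial>M) \<le> e/2" using int[of "e/2" N n] N e that by simp
      ultimately show ?thesis using e by simp
    qed
    then show "\<exists>no. \<forall>n\<ge>no. norm ((\<integral>x. (f n x - u x)\<^sup>2 \<partial>M) - 0) < e" by blast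
  qed
  with iu um show ?thesis by blast
qed

text \<open>Extended by zero, the product w * X is C^1 on the whole space, because U and the
  complement of L are open and cover it; the integral of its derivative vanishes.\<close>

lemma integral_by_parts_compact_support:
  fixes w X :: "real^'n \<Rightarrow> real"
  assumes U: "open U" and L: "compact L" "L \<subseteq> U" "\<And>x. x \<in> U \<Longrightarrow> x \<notin> L \<Longrightarrow> w x = 0"
    and w: "Ck_on 1 U w" and X: "Ck_on 1 U X"
  shows "set_integrable lborel U (\<lambda>x. frechet_derivative w (at x) v * X x + w x * frechet_derivative X (at x) v)"
    and "(LINT x:U|lborel. frechet_derivative w (at x) v * X x + w x * frechet_derivative X (at x) v) = 0"
proof -
  define F where "F x = (if x \<in> U then w x * X x else 0)" for x
  define D where "D x = (if x \<in> U then frechet_derivative w (at x) v * X x + w x * frechet_derivative X (at x) v else 0)" for x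
  have oL: "open (- L)" using compact_imp_closed[OF L(1)] by (simp add: open_Compl)
  have F0: "F x = 0" if "x \<notin> L" for x using L(3) that by (simp add: F_def)
  have CF: "Ck_on 1 U F"
    by (rule Ck_on_cong[OF U _ Ck_on_mult[OF U w X]]) (simp add: F_def)
  have CL: "Ck_on 1 (- L) F"
    by (rule Ck_on_cong[OF oL _ Ck_on_const[of _ _ 0]]) (simp add: F0)
  have C: "Ck_on 1 UNIV F"
  proof (rule Ck_on_local)
    fix x :: "real^'n"
    show "\<exists>W. open W \<and> x \<in> W \<and> Ck_on 1 W F"
      using CF CL U oL L(2) by (cases "x \<in> U") blast+
  qed
  have dF: "F differentiable (at x)" and cF: "continuous_on UNIV (\<lambda>x. frechet_derivative F (at x) v)" for x
    using C by simp_all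
  have D: "frechet_derivative F (at x) v = D x" for x
  proof (cases "x \<in> U")
    case True
    have "w differentiable (at x)" "X differentiable (at x)" using w X True by simp_all
    then have "((\<lambda>x. w x * X x) has_derivative (\<lambda>v. w x * frechet_derivative X (at x) v + frechet_derivative w (at x) v * X x)) (at x)"
      by (intro has_derivative_mult) (simp_all add: frechet_derivative_works)
    then have "(F has_derivative (\<lambda>v. w x * frechet_derivative X (at x) v + frechet_derivative w (at x) v * X x)) (at x)"
      by (rule has_derivative_transform_within_open[OF _ U True]) (simp add: F_def)
    then show ?thesis using True by (simp add: frechet_derivative_at[symmetric] D_def)
  next
    case False
    then have "x \<in> - L" using L(2) by auto
    then have "frechet_derivative F (at x) v = 0" by (rule frechet_derivative_zero_open[OF oL]) (simp add: F0)
    then show ?thesis using False by (simp add: D_def)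
  qed
  note I = integral_derivative_compact_support[of L F v, OF L(1) F0 dF cF]
  have e: "(\<lambda>x. indicator U x *\<^sub>R (frechet_derivative w (at x) v * X x + w x * frechet_derivative X (at x) v)) = (\<lambda>x. frechet_derivative F (at x) v)"
    by (auto simp: D D_def indicator_def)
  show "set_integrable lborel U (\<lambda>x. frechet_derivative w (at x) v * X x + w x * frechet_derivative X (at x) v)"
    unfolding set_integrable_def e using I by simp
  show "(LINT x:U|lborel. frechet_derivative w (at x) v * X x + w x * frechet_derivative X (at x) v) = 0"
    unfolding set_lebesgue_integral_def e using I by simp
qed

section \<open>Test functions in the charts\<close>

context compact_riemannian_mfd begin

text \<open>Smoothness at interior points only, where the coordinate domains are open and no local
  extensions have to be chosen.\<close>

definition smoothm :: "('a \<Rightarrow> real) \<Rightarrow> bool" where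
  "smoothm f \<longleftrightarrow> (\<forall>c\<in>atlas R. \<forall>k. Ck_on k (uset c) (f \<circ> param c))"

lemma smoothmD: "smoothm f \<Longrightarrow> c \<in> atlas R \<Longrightarrow> Ck_on k (uset c) (f \<circ> param c)"
  by (simp add: smoothm_def)

lemma closed_compl_chart:
  assumes c: "c \<in> atlas R" and K: "compact K"
  shows "openin (top_of_set halfspace) {y \<in> crange c. param c y \<notin> K}"
proof -
  have "openin (top_of_set (crange c)) (crange c \<inter> param c -` (- K))"
    using continuous_param[OF c] compact_imp_closed[OF K]
    by (intro continuous_openin_preimage_gen) (auto simp: open_Compl)
  moreover have "crange c \<inter> param c -` (- K) = {y \<in> crange c. param c y \<notin> K}" by auto
  ultimately have "openin (top_of_set (crange c)) {y \<in> crange c. param c y \<notin> K}" by (simp only:)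
  then show ?thesis using openin_crange[OF c] by (rule openin_trans)
qed

text \<open>Smoothness in the interior suffices since at a boundary point the zero function is a
  local extension: the support is compact in the interior and stays away.\<close>

lemma test_fun_iff:
  assumes \<Omega>: "\<Omega> \<subseteq> inn"
  shows "f \<in> test_fun R \<Omega> \<longleftrightarrow> smoothm f \<and> (\<exists>K. compact K \<and> K \<subseteq> \<Omega> \<and> (\<forall>p\<in>pts R - K. f p = 0))"
proof
  assume "f \<in> test_fun R \<Omega>"
  then show "smoothm f \<and> (\<exists>K. compact K \<and> K \<subseteq> \<Omega> \<and> (\<forall>p\<in>pts R - K. f p = 0))"
    unfolding test_fun_def smoothm_def using smooth_on_Ck_on[OF _ open_uset uset_subset] by blast
next
  assume r: "smoothm f \<and> (\<exists>K. compact K \<and> K \<subseteq> \<Omega> \<and> (\<forall>p\<in>pts R - K. f p = 0))"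
  then obtain K where f: "smoothm f" and K: "compact K" "K \<subseteq> \<Omega>" "\<forall>p\<in>pts R - K. f p = 0" by blast
  have "smooth_on (crange c) (f \<circ> param c)" if c: "c \<in> atlas R" for c
    unfolding smooth_on_def
  proof
    fix x assume x: "x \<in> crange c"
    show "\<exists>W F. open W \<and> x \<in> W \<and> (\<forall>k. Ck_on k W F) \<and> (\<forall>y\<in>W \<inter> crange c. F y = (f \<circ> param c) y)"
    proof (cases "x \<in> uset c")
      case True
      then show ?thesis using smoothmD[OF f c] open_uset[OF c]
        by (intro exI[of _ "uset c"] exI[of _ "f \<circ> param c"]) simp
    next
      case False
      then have "param c x \<notin> inn" using inn_iff[OF c param_in[OF x]] x by simp
      then have xK: "x \<in> {y \<in> crange c. param c y \<notin> K}" using x K(2) \<Omega> by auto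
      obtain W where W: "open W" "{y \<in> crange c. param c y \<notin> K} = halfspace \<inter> W"
        using closed_compl_chart[OF c K(1)] by (auto simp: openin_open)
      have "f (param c y) = 0" if "y \<in> W \<inter> crange c" for y
      proof -
        have "y \<in> {y \<in> crange c. param c y \<notin> K}" using that crange_subset[OF c] W(2) by blast
        then show ?thesis using K(3) param_pts[OF c] by blast
      qed
      then show ?thesis using W(1) xK unfolding W(2)
        by (intro exI[of _ W] exI[of _ "\<lambda>_. 0"]) (auto simp: Ck_on_const)
    qed
  qed
  then show "f \<in> test_fun R \<Omega>" using K unfolding test_fun_def by blast
qed

lemma smoothm_add: "smoothm f \<Longrightarrow> smoothm g \<Longrightarrow> smoothm (f + g)"
  unfolding smoothm_def by (auto simp: o_def intro!: Ck_on_add[unfolded o_def] open_uset)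

lemma smoothm_mult: "smoothm f \<Longrightarrow> smoothm g \<Longrightarrow> smoothm (\<lambda>p. f p * g p)"
  unfolding smoothm_def by (auto simp: o_def intro!: Ck_on_mult[unfolded o_def] open_uset)

lemma smoothm_const: "smoothm (\<lambda>p. r)"
  unfolding smoothm_def by (auto simp: o_def intro!: Ck_on_const)

lemma smoothm_sum: "(\<And>i. i \<in> I \<Longrightarrow> smoothm (f i)) \<Longrightarrow> smoothm (\<lambda>p. \<Sum>i\<in>I. f i p)"
  unfolding smoothm_def by (auto simp: o_def intro!: Ck_on_sum[unfolded o_def] open_uset)

lemma subspace_test_fun:
  assumes \<Omega>: "\<Omega> \<subseteq> inn"
  shows "subspace (test_fun R \<Omega>)"
proof (rule subspaceI)
  show "0 \<in> test_fun R \<Omega>" unfolding test_fun_iff[OF \<Omega>]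
    using smoothm_const[of 0] by (auto simp: zero_fun_def intro!: exI[of _ "{}"])
next
  fix f g assume "f \<in> test_fun R \<Omega>" "g \<in> test_fun R \<Omega>"
  then obtain K L where f: "smoothm f" "compact K" "K \<subseteq> \<Omega>" "\<forall>p\<in>pts R - K. f p = 0"
    and g: "smoothm g" "compact L" "L \<subseteq> \<Omega>" "\<forall>p\<in>pts R - L. g p = 0" unfolding test_fun_iff[OF \<Omega>] by blast
  then show "f + g \<in> test_fun R \<Omega>" unfolding test_fun_iff[OF \<Omega>]
    by (intro conjI smoothm_add exI[of _ "K \<union> L"]) (auto intro: compact_Un)
next
  fix f and r :: real assume "f \<in> test_fun R \<Omega>"
  then obtain K where f: "smoothm f" "compact K" "K \<subseteq> \<Omega>" "\<forall>p\<in>pts R - K. f p = 0" unfolding test_fun_iff[OF \<Omega>] by blast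
  then show "r *\<^sub>R f \<in> test_fun R \<Omega>" unfolding test_fun_iff[OF \<Omega>]
    using smoothm_mult[OF smoothm_const f(1), of r]
    by (intro conjI exI[of _ K]) (auto simp: scaleR_fun_def)
qed

end

section \<open>Green's formula\<close>

lemma set_integrable_compact_support:
  fixes h :: "real^'n \<Rightarrow> real"
  assumes h: "continuous_on U h" and L: "compact L" "L \<subseteq> U" "\<And>x. x \<in> U \<Longrightarrow> x \<notin> L \<Longrightarrow> h x = 0"
  shows "set_integrable lborel U h"
proof -
  have "integrable lborel (\<lambda>x. indicator L x *\<^sub>R h x)"
    by (rule borel_integrable_compact[OF L(1) continuous_on_subset[OF h L(2)]])
  moreover have "(\<lambda>x. indicator L x *\<^sub>R h x) = (\<lambda>x. indicator U x *\<^sub>R h x)"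
    using L(2,3) by (auto simp: indicator_def fun_eq_iff)
  ultimately show ?thesis by (simp only: set_integrable_def)
qed

context compact_riemannian_mfd begin

definition dvec :: "('a, 'n) chart \<Rightarrow> ('a \<Rightarrow> real) \<Rightarrow> real^'n \<Rightarrow> real^'n" where
  "dvec c f x = (\<chi> i. frechet_derivative (f \<circ> param c) (at x) (axis i 1))"

definition grad_ip :: "('a \<Rightarrow> real) \<Rightarrow> ('a \<Rightarrow> real) \<Rightarrow> 'a \<Rightarrow> real" where
  "grad_ip f g p = (let c = chart_at R p; x = coord c p in dvec c f x \<bullet> (ginv c x *v dvec c g x))"

text \<open>The i-th component of the gradient weighted by the density; its Euclidean divergence is
  the density times the Laplacian.\<close>

definition flux :: "('a, 'n) chart \<Rightarrow> ('a \<Rightarrow> real) \<Rightarrow> 'n \<Rightarrow> real^'n \<Rightarrow> real" where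
  "flux c f i x = dens c x * (ginv c x *v dvec c f x) $ i"

definition lapc :: "('a, 'n) chart \<Rightarrow> ('a \<Rightarrow> real) \<Rightarrow> real^'n \<Rightarrow> real" where
  "lapc c f x = (\<Sum>i\<in>UNIV. frechet_derivative (flux c f i) (at x) (axis i 1)) / dens c x"

lemma at_within_halfspace: "x \<in> uset c \<Longrightarrow> at x within halfspace = at x"
  by (rule at_within_interior) (simp add: interior_halfspace uset_def)

lemma partial_uset: "x \<in> uset c \<Longrightarrow> partial i h x = frechet_derivative h (at x) (axis i 1)"
  by (simp add: partial_def at_within_halfspace)

lemma coord_uset: "c \<in> atlas R \<Longrightarrow> p \<in> cdom c \<Longrightarrow> p \<in> inn \<Longrightarrow> coord c p \<in> uset c"
  using inn_iff by blast

lemma grad_sq_eq: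
  assumes p: "p \<in> inn"
  shows "grad_sq R f p = grad_ip f f p"
proof -
  have "chart_at R p \<in> atlas R" "p \<in> cdom (chart_at R p)" using chart_at inn_subset p by blast+
  then have "coord (chart_at R p) p \<in> uset (chart_at R p)" using p coord_uset by blast
  then show ?thesis
    by (simp add: grad_sq_def grad_ip_def Let_def partial_uset inner_vec_def matrix_vector_mult_def dvec_def ginv_def
        sum_distrib_left mult_ac)
qed

lemma Ck_on_dvec: "smoothm f \<Longrightarrow> c \<in> atlas R \<Longrightarrow> Ck_on k (uset c) (\<lambda>x. dvec c f x $ i)"
  using smoothmD[of f c "Suc k"] by (simp add: dvec_def)

lemma Ck_on_flux: "smoothm f \<Longrightarrow> c \<in> atlas R \<Longrightarrow> Ck_on k (uset c) (flux c f i)"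
  unfolding flux_def matrix_vector_mult_def
  by (simp, intro Ck_on_mult Ck_on_sum open_uset Ck_on_dens Ck_on_ginv Ck_on_dvec)

lemma laplacian_eq:
  assumes p: "p \<in> inn" and f: "smoothm f"
  shows "laplacian R f p = lapc (chart_at R p) f (coord (chart_at R p) p)"
proof -
  let ?c = "chart_at R p"
  let ?x = "coord ?c p"
  have c: "?c \<in> atlas R" "p \<in> cdom ?c" using chart_at inn_subset p by blast+
  then have x: "?x \<in> uset ?c" using p coord_uset by blast
  have e: "partial i (\<lambda>y. sqrt (det (coeff R ?c y)) * (\<Sum>j\<in>UNIV. matrix_inv (coeff R ?c y) $ i $ j * partial j (f \<circ> param ?c) y)) ?x
    = frechet_derivative (flux ?c f i) (at ?x) (axis i 1)" for i
  proof -
    have "frechet_derivative (flux ?c f i) (at ?x) = frechet_derivative (\<lambda>y. sqrt (det (coeff R ?c y)) *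
      (\<Sum>j\<in>UNIV. matrix_inv (coeff R ?c y) $ i $ j * partial j (f \<circ> param ?c) y)) (at ?x)"
    proof (rule frechet_derivative_transform_within_open[OF _ open_uset[OF c(1)] x])
      show "flux ?c f i differentiable at ?x" using Ck_on_flux[OF f c(1), of 1 i] x by simp
      show "flux ?c f i y = sqrt (det (coeff R ?c y)) * (\<Sum>j\<in>UNIV. matrix_inv (coeff R ?c y) $ i $ j * partial j (f \<circ> param ?c) y)"
        if "y \<in> uset ?c" for y
        using that by (simp add: flux_def dens_def ginv_def dvec_def matrix_vector_mult_def partial_uset)
    qed
    then show ?thesis by (simp add: partial_uset[OF x])
  qed
  show ?thesis by (simp add: laplacian_def Let_def e lapc_def dens_def)
qed

lemma open_overlap_pos:
  assumes "c \<in> atlas R" "c' \<in> atlas R"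
  shows "open (overlap c c' \<inter> uset c)"
proof -
  obtain W where W: "open W" "overlap c c' = halfspace \<inter> W"
    using openin_overlap[OF assms] by (auto simp: openin_open)
  have "overlap c c' \<inter> uset c = W \<inter> uset c"
    using uset_subset crange_subset[OF assms(1)] unfolding W(2) by blast
  then show ?thesis using open_Int[OF W(1) open_uset[OF assms(1)]] by simp
qed

lemma trans_uset:
  assumes "c \<in> atlas R" "c' \<in> atlas R" "x \<in> overlap c c'" "x \<in> uset c"
  shows "trans c c' x \<in> uset c'"
  using trans_pos[OF assms(1-3)] trans_in[OF assms(1,3)] overlap_subset[of c' c] assms(4) by (auto simp: uset_def)

lemma Ck_on_trans: "c \<in> atlas R \<Longrightarrow> c' \<in> atlas R \<Longrightarrow> Ck_on k (overlap c c' \<inter> uset c) (trans c c')"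
  by (rule smooth_on_Ck_on[OF smooth_trans open_overlap_pos]) auto

lemma dvec_trans:
  assumes c: "c \<in> atlas R" "c' \<in> atlas R" and x: "x \<in> overlap c c'" "x \<in> uset c" and f: "smoothm f"
  shows "dvec c f x = transpose (jac c c' x) *v dvec c' f (trans c c' x)"
proof -
  let ?y = "trans c c' x" and ?D = "frechet_derivative (f \<circ> param c') (at (trans c c' x))"
  have y: "?y \<in> uset c'" by (rule trans_uset[OF c x])
  have dy: "(f \<circ> param c') differentiable (at ?y)" using smoothmD[OF f c(2), of 1] y by simp
  have D: "?D w = dvec c' f ?y \<bullet> w" for w
    using frechet_derivative_cart_sum[of "f \<circ> param c'" ?y UNIV w] dy
    by (simp add: dvec_def inner_vec_def mult.commute)
  have "(trans c c' has_derivative (*v) (jac c c' x)) (at x)"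
    using has_derivative_trans[OF c x(1)] at_within_halfspace[OF x(2)] by simp
  moreover have "((f \<circ> param c') has_derivative ?D) (at ?y)" using dy by (simp add: frechet_derivative_works)
  ultimately have "((\<lambda>z. (f \<circ> param c') (trans c c' z)) has_derivative (\<lambda>v. ?D (jac c c' x *v v))) (at x)"
    by (rule has_derivative_compose)
  then have "((f \<circ> param c) has_derivative (\<lambda>v. ?D (jac c c' x *v v))) (at x)"
    by (rule has_derivative_transform_within_open[OF _ open_overlap_pos[OF c]])
      (use x param_trans[OF c] in auto)
  then have "frechet_derivative (f \<circ> param c) (at x) = (\<lambda>v. ?D (jac c c' x *v v))"
    by (simp add: frechet_derivative_at[symmetric])
  then have "dvec c f x $ i = (transpose (jac c c' x) *v dvec c' f ?y) \<bullet> axis i 1" for i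
    by (simp only: dvec_def[of c] D vec_lambda_beta) (metis inner_commute inner_matrix_left)
  then show ?thesis by (simp add: vec_eq_iff inner_axis)
qed

lemma grad_ip_chart:
  assumes c: "c \<in> atlas R" and p: "p \<in> cdom c" "p \<in> inn" and f: "smoothm f" and g: "smoothm g"
  shows "grad_ip f g p = dvec c f (coord c p) \<bullet> (ginv c (coord c p) *v dvec c g (coord c p))"
proof -
  let ?c = "chart_at R p"
  let ?x = "coord ?c p" and ?J = "jac ?c c (coord ?c p)"
  have c0: "?c \<in> atlas R" "p \<in> cdom ?c" using chart_at inn_subset p by blast+
  have x: "?x \<in> overlap ?c c" "?x \<in> uset ?c" using c0 p coord_uset by (auto simp: overlap_def)
  have t: "trans ?c c ?x = coord c p" using c0 by (simp add: trans_def)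
  have "grad_ip f g p = (transpose ?J *v dvec c f (coord c p)) \<bullet> (ginv ?c ?x *v (transpose ?J *v dvec c g (coord c p)))"
    unfolding grad_ip_def Let_def dvec_trans[OF c0(1) c x f] dvec_trans[OF c0(1) c x g] t ..
  also have "\<dots> = dvec c f (coord c p) \<bullet> ((?J ** ginv ?c ?x ** transpose ?J) *v dvec c g (coord c p))"
    by (simp only: inner_matrix_left transpose_transpose matrix_vector_mul_assoc matrix_mul_assoc)
  also have "?J ** ginv ?c ?x ** transpose ?J = ginv c (coord c p)"
    using ginv_jac[OF c0(1) c x(1)] t by simp
  finally show ?thesis .
qed

lemma continuous_on_chart:
  assumes c: "c \<in> atlas R" and H: "continuous_on (uset c) H"
  shows "continuous_on (cdom c \<inter> inn) (\<lambda>p. H (coord c p))"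
  by (rule continuous_on_compose2[OF H continuous_on_subset[OF continuous_coord[OF c]]]) (use coord_uset[OF c] in auto)

lemma continuous_on_inn_local:
  assumes "\<And>p. p \<in> inn \<Longrightarrow> \<exists>N. openin (top_of_set inn) N \<and> p \<in> N \<and> continuous_on N h"
  shows "continuous_on inn h"
  unfolding continuous_on_eq_continuous_within
proof
  fix p assume "p \<in> inn"
  then obtain N where N: "openin (top_of_set inn) N" "p \<in> N" "continuous_on N h" using assms by blast
  have "continuous (at p within N) h" using N(2,3) continuous_on_eq_continuous_within by blast
  then show "continuous (at p within inn) h"
    unfolding continuous_within using at_within_openin[OF N(1,2)] by simp
qed

lemma openin_cdom_inn: "c \<in> atlas R \<Longrightarrow> openin (top_of_set inn) (cdom c \<inter> inn)"
  using openin_subset_trans[OF openin_Int[OF openin_cdom openin_inn] _ inn_subset] by auto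

lemma continuous_on_inn:
  assumes "\<And>c. c \<in> atlas R \<Longrightarrow> continuous_on (uset c) (H c)"
    and "\<And>c p. c \<in> atlas R \<Longrightarrow> p \<in> cdom c \<Longrightarrow> p \<in> inn \<Longrightarrow> h p = H c (coord c p)"
  shows "continuous_on inn h"
proof (rule continuous_on_inn_local)
  fix p assume p: "p \<in> inn"
  then obtain c where c: "c \<in> atlas R" "p \<in> cdom c" using chart_exists inn_subset by blast
  have "continuous_on (cdom c \<inter> inn) h"
    by (rule continuous_on_eq[OF continuous_on_chart[OF c(1) assms(1)[OF c(1)]]]) (use assms(2)[OF c(1)] in simp)
  then show "\<exists>N. openin (top_of_set inn) N \<and> p \<in> N \<and> continuous_on N h"
    using openin_cdom_inn[OF c(1)] p c(2) by blast
qed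

lemma inn_borel: "inn \<in> sets borel" using openin_pts_borel[OF openin_inn] .

lemma inn_sets: "inn \<in> sets (vol R)" using inn_borel inn_subset by (simp add: sets_vol_iff)

lemma borel_vol: "h \<in> borel_measurable borel \<Longrightarrow> h \<in> borel_measurable (vol R)"
  unfolding measurable_vol_iff by (rule measurable_restrict_space1)

lemma indicator_inn_measurable:
  fixes h :: "'a \<Rightarrow> real"
  assumes "continuous_on inn h"
  shows "(\<lambda>p. indicator inn p *\<^sub>R h p) \<in> borel_measurable (vol R)"
  by (rule borel_vol[OF borel_measurable_continuous_on_indicator[OF inn_borel assms]])

lemma set_integrable_inn:
  fixes h :: "'a \<Rightarrow> real"
  assumes h: "continuous_on inn h" and K: "compact K" "K \<subseteq> inn" "\<And>p. p \<in> inn - K \<Longrightarrow> h p = 0"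
  shows "set_integrable (vol R) inn h"
proof -
  have "bounded (h ` K)"
    by (intro compact_imp_bounded compact_continuous_image continuous_on_subset[OF h K(2)] K(1))
  then obtain B where B: "\<And>p. p \<in> K \<Longrightarrow> \<bar>h p\<bar> \<le> B" unfolding bounded_iff by auto
  show ?thesis unfolding set_integrable_def
  proof (rule vol.integrable_const_bound)
    show "AE p in vol R. norm (indicator inn p *\<^sub>R h p) \<le> \<bar>B\<bar>"
    proof (rule AE_I2)
      fix p
      show "norm (indicator inn p *\<^sub>R h p) \<le> \<bar>B\<bar>"
        using B[of p] K(3)[of p] by (cases "p \<in> K"; cases "p \<in> inn") auto
    qed
  qed (rule indicator_inn_measurable[OF h])
qed

lemma integral_inn_chart:
  fixes h :: "'a \<Rightarrow> real"
  assumes c: "c \<in> atlas R" and h: "(\<lambda>p. indicator inn p *\<^sub>R h p) \<in> borel_measurable (vol R)"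
    and K: "K \<subseteq> cdom c" "\<And>p. p \<in> inn - K \<Longrightarrow> h p = 0"
  shows "(LINT p:inn|vol R. h p) = (LINT x:uset c|lborel. dens c x * h (param c x))"
proof -
  have "(LINT p:inn|vol R. h p) = (LINT p:cdom c|vol R. indicator inn p *\<^sub>R h p)"
    unfolding set_lebesgue_integral_def
    by (intro Bochner_Integration.integral_cong refl) (use K in \<open>auto simp: indicator_def\<close>)
  also have "\<dots> = (LINT x:crange c|lborel. dens c x * (indicator inn (param c x) *\<^sub>R h (param c x)))"
    by (rule integral_chart(2)[OF c h])
  also have "\<dots> = (LINT x:uset c|lborel. dens c x * h (param c x))"
    unfolding set_lebesgue_integral_def
  proof (intro Bochner_Integration.integral_cong refl)
    fix x
    have "x \<in> uset c \<longleftrightarrow> x \<in> crange c \<and> param c x \<in> inn"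
      using inn_iff[OF c param_in, of x] uset_subset[of c] by (cases "x \<in> crange c") auto
    then show "indicator (crange c) x *\<^sub>R (dens c x * (indicator inn (param c x) *\<^sub>R h (param c x))) =
      indicator (uset c) x *\<^sub>R (dens c x * h (param c x))" by (auto simp: indicator_def)
  qed
  finally show ?thesis .
qed

lemma compact_coord_image:
  assumes "c \<in> atlas R" "compact K" "K \<subseteq> cdom c" "K \<subseteq> inn"
  shows "compact (coord c ` K)" "coord c ` K \<subseteq> uset c"
proof -
  show "compact (coord c ` K)"
    by (rule compact_continuous_image[OF continuous_on_subset[OF continuous_coord[OF assms(1)] assms(3)] assms(2)])
  show "coord c ` K \<subseteq> uset c"
    by (intro image_subsetI coord_uset[OF assms(1)]) (use assms(3,4) in blast)+
qed

lemma continuous_on_lapc: "smoothm f \<Longrightarrow> c \<in> atlas R \<Longrightarrow> continuous_on (uset c) (lapc c f)"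
  unfolding lapc_def using Ck_on_flux[of f c 1] Ck_on_dens[of c 0] dens_pos[of c] uset_subset[of c]
  by (intro continuous_intros) (auto simp: less_le subset_iff)

lemma continuous_on_grad_ip:
  assumes "smoothm f" "smoothm g"
  shows "continuous_on inn (grad_ip f g)"
proof (rule continuous_on_inn)
  fix c assume c: "c \<in> atlas R"
  show "continuous_on (uset c) (\<lambda>x. dvec c f x \<bullet> (ginv c x *v dvec c g x))"
    using Ck_on_dvec[OF assms(1) c, of 0] Ck_on_dvec[OF assms(2) c, of 0] Ck_on_ginv[OF c, of 0]
    unfolding inner_vec_def matrix_vector_mult_def by (simp, intro continuous_on_sum continuous_on_mult) auto
qed (use grad_ip_chart assms in auto)

lemma continuous_on_smoothm: "smoothm f \<Longrightarrow> continuous_on inn f"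
  by (rule continuous_on_inn[where H="\<lambda>c. f \<circ> param c"]) (auto dest: smoothmD[of f _ 0])

lemma dvec_zero:
  assumes c: "c \<in> atlas R" and K: "compact K" "\<And>p. p \<in> pts R - K \<Longrightarrow> f p = 0" and x: "x \<in> uset c" "param c x \<notin> K"
  shows "dvec c f x = 0"
proof -
  obtain W where W: "open W" "{y \<in> crange c. param c y \<notin> K} = halfspace \<inter> W"
    using closed_compl_chart[OF c K(1)] by (auto simp: openin_open)
  have "open (W \<inter> uset c)" using W(1) open_uset[OF c] by (rule open_Int)
  moreover have "x \<in> W \<inter> uset c" using W(2) x uset_subset by blast
  moreover have "(f \<circ> param c) y = 0" if "y \<in> W \<inter> uset c" for y
  proof -
    have "y \<in> halfspace \<inter> W" using that uset_subset crange_subset[OF c] by blast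
    then show ?thesis using W(2) K(2) param_pts[OF c] by auto
  qed
  ultimately have "frechet_derivative (f \<circ> param c) (at x) v = 0" for v
    by (rule frechet_derivative_zero_open)
  then show ?thesis by (simp add: dvec_def vec_eq_iff)
qed

lemma grad_ip_zero:
  assumes K: "compact K" "\<And>p. p \<in> pts R - K \<Longrightarrow> f p = 0" and p: "p \<in> inn - K"
  shows "grad_ip f g p = 0" "grad_ip g f p = 0"
proof -
  let ?c = "chart_at R p"
  have c0: "?c \<in> atlas R" "p \<in> cdom ?c" using chart_at inn_subset p by blast+
  have "dvec ?c f (coord ?c p) = 0"
    by (rule dvec_zero[OF c0(1) K]) (use c0 p coord_uset in auto)
  then show "grad_ip f g p = 0" "grad_ip g f p = 0" by (simp_all add: grad_ip_def Let_def)
qed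

text \<open>The support of v lies in one chart, where the divergence theorem for compact supports applies.\<close>

lemma green_chart:
  assumes c: "c \<in> atlas R" and f: "smoothm f" and v: "smoothm v"
    and K: "compact K" "K \<subseteq> cdom c" "K \<subseteq> inn" "\<And>p. p \<in> pts R - K \<Longrightarrow> v p = 0"
  shows "(LINT p:inn|vol R. v p * lapc c f (coord c p)) = - (LINT p:inn|vol R. grad_ip v f p)"
    and "continuous_on inn (\<lambda>p. v p * lapc c f (coord c p))"
proof -
  let ?w = "v \<circ> param c" and ?L = "coord c ` K"
  note L = compact_coord_image[OF c K(1-3)]
  have w0: "?w x = 0" if "x \<in> uset c" "x \<notin> ?L" for x
  proof -
    have x: "x \<in> crange c" using that uset_subset by blast
    then have "param c x \<notin> K" using that(2) coord_param[OF x] by (metis image_eqI)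
    then show ?thesis using K(4) param_pts[OF c x] by simp
  qed
  \<comment> \<open>Off the chart domain \<open>coord c\<close> has arbitrary values, but there v is
    zero in a neighbourhood.\<close>
  show cont: "continuous_on inn (\<lambda>p. v p * lapc c f (coord c p))"
  proof (rule continuous_on_inn_local)
    fix p assume p: "p \<in> inn"
    show "\<exists>N. openin (top_of_set inn) N \<and> p \<in> N \<and> continuous_on N (\<lambda>p. v p * lapc c f (coord c p))"
    proof (cases "p \<in> cdom c")
      case True
      have "continuous_on (cdom c \<inter> inn) (\<lambda>p. v p * lapc c f (coord c p))"
        by (intro continuous_on_mult continuous_on_chart c continuous_on_lapc f
            continuous_on_subset[OF continuous_on_smoothm[OF v]]) auto
      then show ?thesis using openin_cdom_inn[OF c] True p by blast
    next
      case False
      have "openin (top_of_set inn) (inn \<inter> (- K))"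
        using compact_imp_closed[OF K(1)] by (intro openin_open_Int) (simp add: open_Compl)
      moreover have "continuous_on (inn \<inter> (- K)) (\<lambda>p. v p * lapc c f (coord c p))"
        using K(4) inn_subset by (subst continuous_on_cong[OF refl, of _ _ "\<lambda>_. 0"]) auto
      ultimately show ?thesis using False p K(2) by blast
    qed
  qed
  have m: "(\<lambda>p. indicator inn p *\<^sub>R (v p * lapc c f (coord c p))) \<in> borel_measurable (vol R)"
    by (rule indicator_inn_measurable[OF cont])
  have d: "0 < dens c x" if "x \<in> uset c" for x using that dens_pos[OF c] uset_subset by blast
  have w: "Ck_on 1 (uset c) ?w" by (rule smoothmD[OF v c])
  have X: "Ck_on 1 (uset c) (flux c f i)" for i by (rule Ck_on_flux[OF f c])
  note P = integral_by_parts_compact_support[OF open_uset[OF c] L w0 w X]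
  have A: "(LINT p:inn|vol R. v p * lapc c f (coord c p)) =
      (LINT x:uset c|lborel. \<Sum>i\<in>UNIV. ?w x * frechet_derivative (flux c f i) (at x) (axis i 1))"
  proof (subst integral_inn_chart[OF c m K(2)])
    show "v p * lapc c f (coord c p) = 0" if "p \<in> inn - K" for p using K(4) that inn_subset by auto
    show "(LINT x:uset c|lborel. dens c x * (v (param c x) * lapc c f (coord c (param c x)))) =
      (LINT x:uset c|lborel. \<Sum>i\<in>UNIV. ?w x * frechet_derivative (flux c f i) (at x) (axis i 1))"
      unfolding set_lebesgue_integral_def
    proof (intro Bochner_Integration.integral_cong refl)
      fix x
      show "indicator (uset c) x *\<^sub>R (dens c x * (v (param c x) * lapc c f (coord c (param c x)))) =
        indicator (uset c) x *\<^sub>R (\<Sum>i\<in>UNIV. ?w x * frechet_derivative (flux c f i) (at x) (axis i 1))"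
        using d[of x] subsetD[OF uset_subset, of x c]
        by (cases "x \<in> uset c") (simp_all add: lapc_def sum_distrib_left[symmetric])
    qed
  qed
  have B: "(LINT p:inn|vol R. grad_ip v f p) =
      (LINT x:uset c|lborel. \<Sum>i\<in>UNIV. frechet_derivative ?w (at x) (axis i 1) * flux c f i x)"
  proof (subst integral_inn_chart[OF c indicator_inn_measurable[OF continuous_on_grad_ip[OF v f]] K(2)])
    show "grad_ip v f p = 0" if "p \<in> inn - K" for p using grad_ip_zero[OF K(1,4) that] by simp
    show "(LINT x:uset c|lborel. dens c x * grad_ip v f (param c x)) =
      (LINT x:uset c|lborel. \<Sum>i\<in>UNIV. frechet_derivative ?w (at x) (axis i 1) * flux c f i x)"
      unfolding set_lebesgue_integral_def
    proof (intro Bochner_Integration.integral_cong refl)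
      fix x
      show "indicator (uset c) x *\<^sub>R (dens c x * grad_ip v f (param c x)) =
        indicator (uset c) x *\<^sub>R (\<Sum>i\<in>UNIV. frechet_derivative ?w (at x) (axis i 1) * flux c f i x)"
      proof (cases "x \<in> uset c")
        case True
        then have x: "x \<in> crange c" using uset_subset by blast
        have "grad_ip v f (param c x) = dvec c v x \<bullet> (ginv c x *v dvec c f x)"
          using grad_ip_chart[OF c param_in[OF x] param_inn[OF c True] v f] x by simp
        then show ?thesis by (simp add: flux_def inner_vec_def dvec_def sum_distrib_left mult_ac)
      qed simp
    qed
  qed
  have i1: "set_integrable lborel (uset c) (\<lambda>x. ?w x * frechet_derivative (flux c f i) (at x) (axis i 1))"
    and i2: "set_integrable lborel (uset c) (\<lambda>x. frechet_derivative ?w (at x) (axis i 1) * flux c f i x)" for i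
  proof -
    have dw0: "frechet_derivative ?w (at x) (axis i 1) = 0" if "x \<in> uset c" "x \<notin> ?L" for x
    proof (rule frechet_derivative_zero_open)
      show "open (uset c \<inter> - ?L)" using open_uset[OF c] compact_imp_closed[OF L(1)] by (simp add: open_Compl open_Int)
    qed (use that w0 in auto)
    show "set_integrable lborel (uset c) (\<lambda>x. ?w x * frechet_derivative (flux c f i) (at x) (axis i 1))"
      by (rule set_integrable_compact_support[OF continuous_on_mult L])
        (use X[of i] Ck_on_le[OF w, of 0] w0 in auto)
    show "set_integrable lborel (uset c) (\<lambda>x. frechet_derivative ?w (at x) (axis i 1) * flux c f i x)"
      by (rule set_integrable_compact_support[OF continuous_on_mult L])
        (use w Ck_on_le[OF X, of 0] dw0 in auto)
  qed
  have Ai: "(LINT x:uset c|lborel. \<Sum>i\<in>UNIV. h i x) = (\<Sum>i\<in>UNIV. LINT x:uset c|lborel. h i x)"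
    if "\<And>i. set_integrable lborel (uset c) (h i)" for h :: "'n \<Rightarrow> real^'n \<Rightarrow> real"
    using that unfolding set_lebesgue_integral_def set_integrable_def scaleR_sum_right
    by (intro Bochner_Integration.integral_sum) auto
  have "(LINT x:uset c|lborel. frechet_derivative ?w (at x) (axis i 1) * flux c f i x) +
     (LINT x:uset c|lborel. ?w x * frechet_derivative (flux c f i) (at x) (axis i 1)) = 0" for i
    using P(2)[of "axis i 1" i] set_integral_add(2)[OF i2[of i] i1[of i]] by simp
  then have "(\<Sum>i\<in>UNIV. (LINT x:uset c|lborel. ?w x * frechet_derivative (flux c f i) (at x) (axis i 1))) =
     - (\<Sum>i\<in>UNIV. (LINT x:uset c|lborel. frechet_derivative ?w (at x) (axis i 1) * flux c f i x))"
    unfolding sum_negf[symmetric] by (intro sum.cong refl) (simp add: eq_neg_iff_add_eq_0 add.commute)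
  then show "(LINT p:inn|vol R. v p * lapc c f (coord c p)) = - (LINT p:inn|vol R. grad_ip v f p)"
    unfolding A B Ai[OF i1] Ai[OF i2] .
qed

end

section \<open>Bump functions, chart independence of the Laplacian, Green's formula on the
  manifold\<close>

context compact_riemannian_mfd begin

lemma zero_near_chart:
  assumes c: "c \<in> atlas R" and K: "compact K" and y: "y \<in> uset c" "param c y \<notin> K"
  shows "\<exists>W. open W \<and> y \<in> W \<and> W \<subseteq> uset c \<and> (\<forall>z\<in>W. param c z \<in> pts R - K)"
proof -
  obtain W where W: "open W" "{y \<in> crange c. param c y \<notin> K} = halfspace \<inter> W"
    using closed_compl_chart[OF c K] by (auto simp: openin_open)
  have "param c z \<in> pts R - K" if "z \<in> W \<inter> uset c" for z
  proof -
    have "z \<in> {y \<in> crange c. param c y \<notin> K}" using that uset_subset crange_subset[OF c] unfolding W(2) by blast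
    then show ?thesis using param_pts[OF c] by blast
  qed
  moreover have "y \<in> W" using y uset_subset W(2) by blast
  ultimately show ?thesis using open_Int[OF W(1) open_uset[OF c]] y(1) by (intro exI[of _ "W \<inter> uset c"]) auto
qed

text \<open>A Euclidean bump on a coordinate ball, extended by zero. In another chart it is the bump
  composed with the transition map on the overlap, and zero near every point outside the compact
  image of the ball.\<close>

lemma bump_exists:
  assumes c: "c \<in> atlas R" and N: "openin (top_of_set inn) N" and p: "p \<in> N" "p \<in> cdom c"
  shows "\<exists>K \<psi>. smoothm \<psi> \<and> compact K \<and> K \<subseteq> cdom c \<and> K \<subseteq> N \<and> (\<forall>q\<in>pts R - K. \<psi> q = 0) \<and> (\<forall>q. 0 \<le> \<psi> q) \<and> 0 < \<psi> p"
proof -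
  have Ni: "N \<subseteq> inn" using N openin_imp_subset by blast
  have oN: "openin (top_of_set (pts R)) (N \<inter> cdom c)"
    using openin_trans[OF N openin_inn] openin_cdom[OF c] by (rule openin_Int)
  let ?V = "coord c ` (N \<inter> cdom c)" and ?x = "coord c p"
  have Vu: "?V \<subseteq> uset c" using coord_uset[OF c] Ni by (intro image_subsetI) blast
  have "openin (top_of_set halfspace) ?V" by (rule openin_coord_image[OF c oN]) simp
  then obtain W where W: "open W" "?V = halfspace \<inter> W" by (auto simp: openin_open)
  have "?V = W \<inter> uset c" using Vu uset_subset crange_subset[OF c] unfolding W(2) by blast
  then have "open ?V" using open_Int[OF W(1) open_uset[OF c]] by simp
  moreover have "?x \<in> ?V" using p by blast
  ultimately obtain r where r: "0 < r" "cball ?x r \<subseteq> ?V" by (meson open_contains_cball)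
  define K where "K = param c ` cball ?x r"
  define \<psi> where "\<psi> q = (if q \<in> cdom c then bump ?x r (coord c q) else 0)" for q
  have cb: "cball ?x r \<subseteq> uset c" "cball ?x r \<subseteq> crange c" using r Vu uset_subset by blast+
  have K: "compact K" unfolding K_def
    by (intro compact_continuous_image continuous_on_subset[OF continuous_param[OF c] cb(2)] compact_cball)
  have Kc: "K \<subseteq> cdom c \<inter> N"
  proof
    fix q assume "q \<in> K"
    then obtain y where y: "y \<in> cball ?x r" "q = param c y" by (auto simp: K_def)
    then obtain q' where "q' \<in> N \<inter> cdom c" "y = coord c q'" using r(2) by blast
    then show "q \<in> cdom c \<inter> N" using y(2) param_coord[OF c] by auto
  qed
  have z: "\<psi> q = 0" if "q \<notin> K" for q
  proof (cases "q \<in> cdom c")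
    case True
    then have "coord c q \<notin> cball ?x r" using that param_coord[OF c True] unfolding K_def by (metis image_eqI)
    then show ?thesis using r(1) by (simp add: \<psi>_def bump_zero dist_norm norm_minus_commute)
  qed (simp add: \<psi>_def)
  have "smoothm \<psi>" unfolding smoothm_def
  proof (intro ballI allI Ck_on_local)
    fix c' k y assume c': "c' \<in> atlas R" and y: "y \<in> uset c'"
    show "\<exists>W. open W \<and> y \<in> W \<and> Ck_on k W (\<psi> \<circ> param c')"
    proof (cases "param c' y \<in> cdom c")
      case True
      have yc: "y \<in> crange c'" using y uset_subset by blast
      have "Ck_on k (overlap c' c \<inter> uset c') (\<psi> \<circ> param c')"
      proof (rule Ck_on_cong[OF open_overlap_pos[OF c' c]])
        show "Ck_on k (overlap c' c \<inter> uset c') (\<lambda>z. bump ?x r (trans c' c z))"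
          by (rule Ck_on_compose[OF open_overlap_pos[OF c' c] open_UNIV Ck_on_trans[OF c' c] Ck_on_bump]) simp
        show "bump ?x r (trans c' c z) = (\<psi> \<circ> param c') z" if "z \<in> overlap c' c \<inter> uset c'" for z
          using that mem_overlap[OF c'] by (simp add: \<psi>_def trans_def)
      qed
      moreover have "y \<in> overlap c' c" using mem_overlap[OF c'] yc True by blast
      ultimately show ?thesis using y open_overlap_pos[OF c' c] by blast
    next
      case False
      then have "param c' y \<notin> K" using Kc by blast
      from zero_near_chart[OF c' K y this] obtain W where W: "open W" "y \<in> W" "\<forall>z\<in>W. param c' z \<in> pts R - K" by blast
      have "Ck_on k W (\<psi> \<circ> param c')"
        by (rule Ck_on_cong[OF W(1) _ Ck_on_const[of _ _ 0]]) (use W(3) z in simp)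
      then show ?thesis using W by blast
    qed
  qed
  moreover have "0 < \<psi> p" using p r(1) by (simp add: \<psi>_def bump_pos)
  moreover have "\<forall>q. 0 \<le> \<psi> q" by (simp add: \<psi>_def bump_nonneg)
  ultimately show ?thesis using K Kc z by (intro exI[of _ K] exI[of _ \<psi>]) auto
qed

text \<open>The quotient is smooth although \<Psi> may vanish off K: near points outside K the
  numerator is zero, near points of K the denominator is not.\<close>

lemma smoothm_divide:
  assumes v: "smoothm v" and \<Psi>: "smoothm \<Psi>" and K: "compact K" "\<And>p. p \<in> pts R - K \<Longrightarrow> v p = 0"
    and pos: "\<And>p. p \<in> K \<Longrightarrow> \<Psi> p \<noteq> 0"
  shows "smoothm (\<lambda>p. v p / \<Psi> p)"
  unfolding smoothm_def
proof (intro ballI allI Ck_on_local)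
  fix c k y assume c: "c \<in> atlas R" and y: "y \<in> uset c"
  show "\<exists>W. open W \<and> y \<in> W \<and> Ck_on k W ((\<lambda>p. v p / \<Psi> p) \<circ> param c)"
  proof (cases "param c y \<in> K")
    case True
    let ?W = "uset c \<inter> (\<Psi> \<circ> param c) -` (- {0})"
    have "continuous_on (uset c) (\<Psi> \<circ> param c)" using smoothmD[OF \<Psi> c, of 0] by simp
    then have W: "open ?W" by (intro continuous_open_preimage open_uset[OF c]) auto
    have "Ck_on k ?W (\<lambda>z. (v \<circ> param c) z / (\<Psi> \<circ> param c) z)"
      by (intro Ck_on_divide W Ck_on_subset[OF smoothmD[OF v c]] Ck_on_subset[OF smoothmD[OF \<Psi> c]]) auto
    then show ?thesis using W y pos[OF True] by (intro exI[of _ ?W]) (auto simp: o_def)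
  next
    case False
    from zero_near_chart[OF c K(1) y this] obtain W where W: "open W" "y \<in> W" "\<forall>z\<in>W. param c z \<in> pts R - K" by blast
    have "Ck_on k W ((\<lambda>p. v p / \<Psi> p) \<circ> param c)"
      by (rule Ck_on_cong[OF W(1) _ Ck_on_const[of _ _ 0]]) (use W(3) K(2) in simp)
    then show ?thesis using W by blast
  qed
qed

definition bumps :: "(('a, 'n) chart \<times> 'a set \<times> ('a \<Rightarrow> real)) set" where
  "bumps = {(c, L, \<psi>). c \<in> atlas R \<and> smoothm \<psi> \<and> compact L \<and> L \<subseteq> cdom c \<and> L \<subseteq> inn \<and>
     (\<forall>q\<in>pts R - L. \<psi> q = 0) \<and> (\<forall>q. 0 \<le> \<psi> q)}"

lemma finite_bumps:
  assumes K: "compact K" "K \<subseteq> inn"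
  shows "\<exists>F\<subseteq>bumps. finite F \<and> (\<forall>p\<in>K. 0 < (\<Sum>(c, L, \<psi>)\<in>F. \<psi> p))"
proof -
  let ?S = "\<lambda>t. case t of (c, L, \<psi>) \<Rightarrow> K \<inter> \<psi> -` {0<..}"
  have "openin (top_of_set K) (?S t)" if "t \<in> bumps" for t
  proof -
    obtain c L \<psi> where t: "t = (c, L, \<psi>)" by (cases t)
    then have "smoothm \<psi>" using that by (simp add: bumps_def)
    then have "continuous_on K \<psi>" using continuous_on_subset[OF continuous_on_smoothm K(2)] by blast
    then show ?thesis unfolding t prod.case by (intro continuous_openin_preimage_gen) auto
  qed
  moreover have "K \<subseteq> \<Union> (?S ` bumps)"
  proof
    fix p assume p: "p \<in> K"
    then obtain c where c: "c \<in> atlas R" "p \<in> cdom c" using K(2) inn_subset chart_exists by blast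
    have io: "openin (top_of_set inn) inn" by simp
    have "\<exists>L \<psi>. smoothm \<psi> \<and> compact L \<and> L \<subseteq> cdom c \<and> L \<subseteq> inn \<and> (\<forall>q\<in>pts R - L. \<psi> q = 0) \<and> (\<forall>q. 0 \<le> \<psi> q) \<and> 0 < \<psi> p"
      using bump_exists[OF c(1) io _ c(2)] p K(2) by blast
    then obtain L \<psi> where "(c, L, \<psi>) \<in> bumps" "0 < \<psi> p" unfolding bumps_def using c(1) by blast
    then show "p \<in> \<Union> (?S ` bumps)" using p by (intro UN_I[of "(c, L, \<psi>)"]) auto
  qed
  ultimately have "\<exists>D\<subseteq>?S ` bumps. finite D \<and> K \<subseteq> \<Union>D"
    by (intro K(1)[unfolded compact_eq_openin_cover, THEN spec, THEN mp] conjI ballI) auto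
  then obtain D where D: "D \<subseteq> ?S ` bumps" "finite D" "K \<subseteq> \<Union>D" by (elim exE conjE)
  obtain F where F: "F \<subseteq> bumps" "finite F" "D = ?S ` F" using finite_subset_image[OF D(2,1)] by (elim exE conjE)
  have "0 < (\<Sum>(c, L, \<psi>)\<in>F. \<psi> p)" if pK: "p \<in> K" for p
  proof -
    obtain t where t: "t \<in> F" "p \<in> ?S t" using subsetD[OF D(3) pK] unfolding F(3) by (elim UN_E)
    show ?thesis
    proof (rule sum_pos2[OF F(2) t(1)])
      show "0 < (case t of (c, L, \<psi>) \<Rightarrow> \<psi> p)" using t(2) by (cases t) auto
      show "0 \<le> (case s of (c, L, \<psi>) \<Rightarrow> \<psi> p)" if "s \<in> F" for s
        using subsetD[OF F(1) that] by (cases s) (auto simp: bumps_def)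
    qed
  qed
  then show ?thesis using F(1,2) by blast
qed

text \<open>In a chart the set becomes a non-empty open subset of Euclidean space, and the density
  is positive there.\<close>

lemma emeasure_open_pos:
  assumes N: "openin (top_of_set inn) N" and p: "p \<in> N"
  shows "0 < emeasure (vol R) N"
proof -
  have Ni: "N \<subseteq> inn" using N openin_imp_subset by blast
  obtain c where c: "c \<in> atlas R" "p \<in> cdom c" using p Ni inn_subset chart_exists by blast
  have oN: "openin (top_of_set (pts R)) (N \<inter> cdom c)"
    using openin_trans[OF N openin_inn] openin_cdom[OF c(1)] by (rule openin_Int)
  let ?V = "coord c ` (N \<inter> cdom c)"
  have Vu: "?V \<subseteq> uset c" using coord_uset[OF c(1)] Ni by (intro image_subsetI) blast
  have "openin (top_of_set halfspace) ?V" by (rule openin_coord_image[OF c(1) oN]) simp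
  then obtain W where W: "open W" "?V = halfspace \<inter> W" by (auto simp: openin_open)
  have "?V = W \<inter> uset c" using Vu uset_subset crange_subset[OF c(1)] unfolding W(2) by blast
  then have oV: "open ?V" using open_Int[OF W(1) open_uset[OF c(1)]] by simp
  have b: "N \<inter> cdom c \<in> sets borel" "N \<in> sets (vol R)"
    using openin_pts_borel[OF oN] openin_pts_borel[OF openin_trans[OF N openin_inn]] Ni inn_subset by (auto simp: sets_vol_iff)
  have "emeasure (vol R) (N \<inter> cdom c) \<noteq> 0"
  proof
    assume "emeasure (vol R) (N \<inter> cdom c) = 0"
    then have 0: "(\<integral>\<^sup>+x. ennreal (dens c x) * indicator ?V x \<partial>lborel) = 0"
      using emeasure_vol_chart[OF c(1) b(1)] by (simp add: cvol_def)
    have e: "ennreal (dens c x) * indicator ?V x = ennreal (indicator ?V x * dens c x)" for x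
      by (simp add: indicator_def)
    have "(\<lambda>x. indicator ?V x * dens c x) \<in> borel_measurable borel"
      using oV Vu uset_subset by (intro indicator_dens_measurable c(1)) auto
    then have "AE x in lborel. ennreal (indicator ?V x * dens c x) = 0"
      using 0 unfolding e by (subst (asm) nn_integral_0_iff_AE) auto
    then have "AE x in lborel. x \<notin> ?V"
      by eventually_elim (use dens_pos[OF c(1)] Vu uset_subset in \<open>auto simp: indicator_def ennreal_eq_0_iff split: if_splits, force\<close>)
    then have "?V \<in> null_sets lborel" using oV by (subst (asm) AE_iff_null_sets[symmetric]) auto
    then have "negligible ?V" by (simp add: negligible_iff_null_sets null_sets_completionI)
    then show False using open_not_negligible[OF oV] p c(2) by blast
  qed
  then have "0 < emeasure (vol R) (N \<inter> cdom c)" by (simp add: zero_less_iff_neq_zero)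
  also have "\<dots> \<le> emeasure (vol R) N" by (intro emeasure_mono b) auto
  finally show ?thesis .
qed

lemma integral_inn_pos:
  fixes h :: "'a \<Rightarrow> real"
  assumes h: "continuous_on inn h" and K: "compact K" "K \<subseteq> inn" "\<And>p. p \<in> inn - K \<Longrightarrow> h p = 0"
    and nn: "\<And>p. p \<in> inn \<Longrightarrow> 0 \<le> h p" and p: "p \<in> inn" "0 < h p"
  shows "0 < (LINT p:inn|vol R. h p)"
proof (rule ccontr)
  have i: "integrable (vol R) (\<lambda>p. indicator inn p *\<^sub>R h p)"
    using set_integrable_inn[OF h K] by (simp add: set_integrable_def)
  have nn': "AE p in vol R. 0 \<le> indicator inn p *\<^sub>R h p" using nn by (intro AE_I2) (simp add: indicator_def)
  have "0 \<le> (LINT p:inn|vol R. h p)" unfolding set_lebesgue_integral_def using nn' by (rule integral_nonneg_AE)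
  moreover assume "\<not> 0 < (LINT p:inn|vol R. h p)"
  ultimately have "(LINT p:inn|vol R. h p) = 0" by simp
  then have "AE p in vol R. indicator inn p *\<^sub>R h p = 0"
    unfolding set_lebesgue_integral_def using integral_nonneg_eq_0_iff_AE[OF i nn'] by simp
  then have ae: "AE p in vol R. p \<notin> inn \<inter> h -` {0<..}" by eventually_elim auto
  have o: "openin (top_of_set inn) (inn \<inter> h -` {0<..})"
    using h by (intro continuous_openin_preimage_gen) auto
  then have "inn \<inter> h -` {0<..} \<in> sets (vol R)"
    using openin_pts_borel[OF openin_trans[OF o openin_inn]] inn_subset by (auto simp: sets_vol_iff)
  then have "inn \<inter> h -` {0<..} \<in> null_sets (vol R)" using ae by (subst (asm) AE_iff_null_sets[symmetric]) auto
  then have "emeasure (vol R) (inn \<inter> h -` {0<..}) = 0" by auto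
  then show False using emeasure_open_pos[OF o, of p] p by simp
qed

text \<open>The coordinate Laplacian is determined by testing it against bump functions.\<close>

lemma lapc_le:
  assumes f: "smoothm f" and c: "c \<in> atlas R" "c' \<in> atlas R" and p: "p \<in> cdom c" "p \<in> cdom c'" "p \<in> inn"
  shows "lapc c f (coord c p) \<le> lapc c' f (coord c' p)"
proof (rule ccontr)
  define E where "E q = lapc c f (coord c q) - lapc c' f (coord c' q)" for q
  assume "\<not> lapc c f (coord c p) \<le> lapc c' f (coord c' p)"
  then have Ep: "0 < E p" by (simp add: E_def)
  let ?M = "cdom c \<inter> cdom c' \<inter> inn"
  have M: "openin (top_of_set inn) ?M"
    using openin_Int[OF openin_cdom_inn[OF c(1)] openin_cdom_inn[OF c(2)]] by (simp add: Int_ac)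
  have cE: "continuous_on ?M E" unfolding E_def
    by (intro continuous_on_diff continuous_on_subset[OF continuous_on_chart[OF c(1) continuous_on_lapc[OF f c(1)]]]
        continuous_on_subset[OF continuous_on_chart[OF c(2) continuous_on_lapc[OF f c(2)]]]) auto
  have N: "openin (top_of_set inn) (?M \<inter> E -` {0<..})"
    by (rule openin_trans[OF _ M]) (intro continuous_openin_preimage_gen cE, auto)
  have "p \<in> ?M \<inter> E -` {0<..}" using p Ep by simp
  from bump_exists[OF c(1) N this p(1)] obtain K \<psi> where \<psi>: "smoothm \<psi>" "compact K" "K \<subseteq> ?M \<inter> E -` {0<..}"
    "\<forall>q\<in>pts R - K. \<psi> q = 0" "\<forall>q. 0 \<le> \<psi> q" "0 < \<psi> p" by blast
  have K: "K \<subseteq> cdom c" "K \<subseteq> cdom c'" "K \<subseteq> inn" "\<And>q. q \<in> pts R - K \<Longrightarrow> \<psi> q = 0" using \<psi> by blast+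
  \<comment> \<open>Both charts give the same right-hand side, the integral of
    \<open>grad_ip \<psi> f\<close>, in which no chart occurs any more.\<close>
  note g = green_chart[OF c(1) f \<psi>(1,2) K(1,3,4)] green_chart[OF c(2) f \<psi>(1,2) K(2,3,4)]
  let ?h = "\<lambda>q. \<psi> q * lapc c f (coord c q) - \<psi> q * lapc c' f (coord c' q)"
  have z: "\<psi> q = 0" if "q \<in> inn - K" for q using that \<psi>(4) inn_subset by blast
  have "0 < (LINT q:inn|vol R. ?h q)"
  proof (rule integral_inn_pos[where p=p])
    show "continuous_on inn ?h" by (intro continuous_on_diff g)
    show "0 \<le> ?h q" if "q \<in> inn" for q
    proof (cases "q \<in> K")
      case True
      then have "0 \<le> \<psi> q * E q" using \<psi>(3,5) by (intro mult_nonneg_nonneg) (auto simp: subset_iff less_imp_le)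
      then show ?thesis by (simp add: E_def algebra_simps)
    qed (use z that in simp)
    have "0 < \<psi> p * E p" using \<psi>(6) Ep by simp
    then show "0 < ?h p" by (simp add: E_def algebra_simps)
  qed (use \<psi> K z p in auto)
  moreover have "(LINT q:inn|vol R. ?h q) = 0"
  proof (subst set_integral_diff(2))
    show "set_integrable (vol R) inn (\<lambda>q. \<psi> q * lapc c f (coord c q))"
      "set_integrable (vol R) inn (\<lambda>q. \<psi> q * lapc c' f (coord c' q))"
      using z by (auto intro!: set_integrable_inn[OF g(2) \<psi>(2) K(3)] set_integrable_inn[OF g(4) \<psi>(2) K(3)])
  qed (simp only: g(1,3) diff_self)
  ultimately show False by simp
qed

text \<open>The inequality \<open>lapc_le\<close> in both directions. Only now is the Laplacian,
  computed in a chart selected point by point, known to be continuous on the interior.\<close>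

lemma laplacian_chart:
  assumes f: "smoothm f" and c: "c \<in> atlas R" and p: "p \<in> cdom c" "p \<in> inn"
  shows "laplacian R f p = lapc c f (coord c p)"
proof -
  have "chart_at R p \<in> atlas R" "p \<in> cdom (chart_at R p)" using chart_at inn_subset p by blast+
  then show ?thesis unfolding laplacian_eq[OF p(2) f] using lapc_le[OF f] c p by (intro antisym) auto
qed

lemma continuous_on_laplacian: "smoothm f \<Longrightarrow> continuous_on inn (laplacian R f)"
  by (rule continuous_on_inn[where H="\<lambda>c. lapc c f"]) (auto intro: continuous_on_lapc laplacian_chart)

lemma laplacian_zero:
  assumes f: "smoothm f" and K: "compact K" "\<And>p. p \<in> pts R - K \<Longrightarrow> f p = 0" and p: "p \<in> inn - K"
  shows "laplacian R f p = 0"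
proof -
  obtain c where c: "c \<in> atlas R" "p \<in> cdom c" using p inn_subset chart_exists by blast
  have x: "coord c p \<in> uset c" "param c (coord c p) \<notin> K" using coord_uset[OF c] c p by auto
  from zero_near_chart[OF c(1) K(1) x] obtain W where W: "open W" "coord c p \<in> W" "W \<subseteq> uset c" "\<forall>z\<in>W. param c z \<in> pts R - K" by blast
  have "flux c f i z = 0" if "z \<in> W" for i z
    using dvec_zero[OF c(1) K, where x=z] W(3,4) that by (auto simp: flux_def)
  then have "frechet_derivative (flux c f i) (at (coord c p)) v = 0" for i v
    by (intro frechet_derivative_zero_open[OF W(1,2)])
  then show ?thesis using laplacian_chart[OF f c] p by (simp add: lapc_def)
qed

lemma dvec_add:
  assumes "smoothm f" "smoothm g" "c \<in> atlas R" "x \<in> uset c"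
  shows "dvec c (f + g) x = dvec c f x + dvec c g x"
proof -
  have "(f \<circ> param c) differentiable at x" "(g \<circ> param c) differentiable at x"
    using smoothmD[OF assms(1,3), of 1] smoothmD[OF assms(2,3), of 1] assms(4) by simp_all
  then have "(((f + g) \<circ> param c) has_derivative (\<lambda>v. frechet_derivative (f \<circ> param c) (at x) v + frechet_derivative (g \<circ> param c) (at x) v)) (at x)"
    using has_derivative_add[of "f \<circ> param c" _ "at x" "g \<circ> param c"] by (simp add: frechet_derivative_works o_def)
  then show ?thesis by (simp add: dvec_def vec_eq_iff frechet_derivative_at[symmetric])
qed

lemma dvec_scale:
  assumes "smoothm f" "c \<in> atlas R" "x \<in> uset c"
  shows "dvec c (r *\<^sub>R f) x = r *\<^sub>R dvec c f x"
proof -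
  have "(f \<circ> param c) differentiable at x" using smoothmD[OF assms(1,2), of 1] assms(3) by simp
  then have "(((r *\<^sub>R f) \<circ> param c) has_derivative (\<lambda>v. r * frechet_derivative (f \<circ> param c) (at x) v)) (at x)"
    using has_derivative_mult_right[of "f \<circ> param c" _ "at x" r] by (simp add: frechet_derivative_works o_def)
  then show ?thesis by (simp add: dvec_def vec_eq_iff frechet_derivative_at[symmetric])
qed

lemma chart_at_inn: "p \<in> inn \<Longrightarrow> chart_at R p \<in> atlas R \<and> coord (chart_at R p) p \<in> uset (chart_at R p)"
  using chart_at[of p] coord_uset[of "chart_at R p" p] inn_subset by blast

lemma grad_ip_add: "smoothm f \<Longrightarrow> smoothm g \<Longrightarrow> p \<in> inn \<Longrightarrow> grad_ip (f + g) h p = grad_ip f h p + grad_ip g h p"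
  using chart_at_inn[of p] by (simp add: grad_ip_def Let_def dvec_add inner_add_left)

lemma grad_ip_scale: "smoothm f \<Longrightarrow> p \<in> inn \<Longrightarrow> grad_ip (r *\<^sub>R f) h p = r * grad_ip f h p"
  using chart_at_inn[of p] by (simp add: grad_ip_def Let_def dvec_scale)

lemma posdef_ginv: "c \<in> atlas R \<Longrightarrow> x \<in> crange c \<Longrightarrow> posdef (ginv c x)"
  and transpose_ginv: "c \<in> atlas R \<Longrightarrow> x \<in> crange c \<Longrightarrow> transpose (ginv c x) = ginv c x"
  unfolding ginv_def using posdef_matrix_inv posdef_coeff by blast+

lemma grad_ip_sym: "p \<in> inn \<Longrightarrow> grad_ip f g p = grad_ip g f p"
  using chart_at_inn[of p] transpose_ginv[of "chart_at R p" "coord (chart_at R p) p"] uset_subset[of "chart_at R p"]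
  by (simp add: grad_ip_def Let_def subset_iff) (metis inner_commute inner_matrix_left)

lemma grad_ip_nonneg: "p \<in> inn \<Longrightarrow> 0 \<le> grad_ip f f p"
  using chart_at_inn[of p] posdef_ginv[of "chart_at R p" "coord (chart_at R p) p"] uset_subset[of "chart_at R p"]
  by (auto simp: grad_ip_def Let_def posdef_def subset_iff) (metis inner_zero_left less_imp_le order_refl)

lemma grad_ip_sum:
  assumes "finite I" "\<And>i. i \<in> I \<Longrightarrow> smoothm (f i)" "p \<in> inn"
  shows "grad_ip (\<Sum>i\<in>I. f i) h p = (\<Sum>i\<in>I. grad_ip (f i) h p) \<and> smoothm (\<Sum>i\<in>I. f i)"
  using assms(1,2)
proof (induction I rule: finite_induct)
  case empty
  have "frechet_derivative ((0::'a \<Rightarrow> real) \<circ> param c) (at x) v = 0" for c :: "('a, 'n) chart" and x v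
    by (rule frechet_derivative_zero_open[OF open_UNIV]) auto
  then have "dvec c 0 x = 0" for c x by (simp add: dvec_def vec_eq_iff)
  then show ?case using smoothm_const[of 0] by (simp add: grad_ip_def Let_def zero_fun_def)
next
  case (insert i I)
  then show ?case unfolding sum.insert[OF insert(1,2)]
    using assms(3) grad_ip_add[of "f i" "sum f I" p h] smoothm_add[of "f i" "sum f I"] by (simp add: plus_fun_def)
qed

text \<open>A partition of unity adapted to v: with \<Psi> the sum of finitely many bumps \<psi>,
  positive on the support of v, the function v is the sum of the \<psi> * v / \<Psi>, and each of
  these lives in a single chart.\<close>

theorem green:
  assumes f: "smoothm f" and v: "smoothm v" and K: "compact K" "K \<subseteq> inn" "\<And>p. p \<in> pts R - K \<Longrightarrow> v p = 0"
  shows "(LINT p:inn|vol R. v p * laplacian R f p) = - (LINT p:inn|vol R. grad_ip v f p)"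
proof -
  obtain F where F: "F \<subseteq> bumps" "finite F" "\<forall>p\<in>K. 0 < (\<Sum>(c, L, \<psi>)\<in>F. \<psi> p)"
    using finite_bumps[OF K(1,2)] by blast
  define \<Psi> where "\<Psi> p = (\<Sum>(c, L, \<psi>)\<in>F. \<psi> p)" for p
  define u where "u t = (\<lambda>p. (snd (snd t)) p * (v p / \<Psi> p))" for t :: "('a, 'n) chart \<times> 'a set \<times> ('a \<Rightarrow> real)"
  have B: "fst t \<in> atlas R" "smoothm (snd (snd t))" "compact (fst (snd t))" "fst (snd t) \<subseteq> cdom (fst t)"
    "fst (snd t) \<subseteq> inn" "\<And>q. q \<in> pts R - fst (snd t) \<Longrightarrow> snd (snd t) q = 0" if "t \<in> F" for t
    using subsetD[OF F(1) that] by (auto simp: bumps_def)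
  have "smoothm \<Psi>" unfolding \<Psi>_def case_prod_unfold using B by (intro smoothm_sum) blast
  then have "smoothm (\<lambda>p. v p / \<Psi> p)"
  proof (intro smoothm_divide[OF v _ K(1,3)])
    show "\<Psi> p \<noteq> 0" if "p \<in> K" for p using bspec[OF F(3) that] unfolding \<Psi>_def by linarith
  qed
  then have u: "smoothm (u t)" if "t \<in> F" for t unfolding u_def using smoothm_mult B(2)[OF that] by blast
  have sumu: "(\<Sum>t\<in>F. u t p) = v p" if "p \<in> pts R" for p
  proof (cases "p \<in> K")
    case True
    then have "0 < \<Psi> p" using F(3) by (simp add: \<Psi>_def)
    moreover have "(\<Sum>t\<in>F. u t p) = \<Psi> p * (v p / \<Psi> p)" by (simp only: u_def \<Psi>_def case_prod_unfold sum_distrib_right)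
    ultimately show ?thesis by simp
  qed (use K(3) that in \<open>simp add: u_def\<close>)
  have uz: "u t q = 0" if "t \<in> F" "q \<in> pts R - fst (snd t)" for t q using B(6)[OF that] by (simp add: u_def)
  have ct: "continuous_on inn (\<lambda>p. u t p * laplacian R f p)" if "t \<in> F" for t
    by (intro continuous_on_mult continuous_on_smoothm u that continuous_on_laplacian f)
  have it: "set_integrable (vol R) inn (\<lambda>p. u t p * laplacian R f p)" if "t \<in> F" for t
    by (rule set_integrable_inn[OF ct[OF that] B(3,5)[OF that]]) (use uz[OF that] inn_subset in auto)
  have ig: "set_integrable (vol R) inn (grad_ip (u t) f)" if "t \<in> F" for t
    by (rule set_integrable_inn[OF continuous_on_grad_ip[OF u[OF that] f] B(3,5)[OF that]])
      (rule grad_ip_zero(1)[OF B(3)[OF that] uz[OF that]])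
  have gt: "(LINT p:inn|vol R. u t p * laplacian R f p) = - (LINT p:inn|vol R. grad_ip (u t) f p)" if t: "t \<in> F" for t
  proof -
    have "(LINT p:inn|vol R. u t p * laplacian R f p) = (LINT p:inn|vol R. u t p * lapc (fst t) f (coord (fst t) p))"
      unfolding set_lebesgue_integral_def
    proof (intro Bochner_Integration.integral_cong refl)
      fix p
      show "indicator inn p *\<^sub>R (u t p * laplacian R f p) = indicator inn p *\<^sub>R (u t p * lapc (fst t) f (coord (fst t) p))"
      proof (cases "p \<in> inn \<and> p \<in> fst (snd t)")
        case True
        then show ?thesis using laplacian_chart[OF f B(1)[OF t], of p] B(4)[OF t] by auto
      next
        case False
        then show ?thesis using uz[OF t] inn_subset by (auto simp: indicator_def)
      qed
    qed
    also have "\<dots> = - (LINT p:inn|vol R. grad_ip (u t) f p)"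
      by (rule green_chart(1)[OF B(1)[OF t] f u[OF t] B(3,4,5)[OF t] uz[OF t]])
    finally show ?thesis .
  qed
  have S: "(LINT p:inn|vol R. \<Sum>t\<in>F. h t p) = (\<Sum>t\<in>F. LINT p:inn|vol R. h t p)"
    if "\<And>t. t \<in> F \<Longrightarrow> set_integrable (vol R) inn (h t)" for h :: "_ \<Rightarrow> 'a \<Rightarrow> real"
    using that unfolding set_lebesgue_integral_def set_integrable_def scaleR_sum_right
    by (intro Bochner_Integration.integral_sum) auto
  have "(LINT p:inn|vol R. v p * laplacian R f p) = (LINT p:inn|vol R. \<Sum>t\<in>F. u t p * laplacian R f p)"
    unfolding set_lebesgue_integral_def
    by (intro Bochner_Integration.integral_cong refl) (simp add: sum_distrib_right[symmetric] sumu)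
  also have "\<dots> = (\<Sum>t\<in>F. - (LINT p:inn|vol R. grad_ip (u t) f p))" using S[OF it] gt by simp
  also have "\<dots> = - (LINT p:inn|vol R. \<Sum>t\<in>F. grad_ip (u t) f p)" using S[OF ig] by (simp add: sum_negf)
  also have "(LINT p:inn|vol R. \<Sum>t\<in>F. grad_ip (u t) f p) = (LINT p:inn|vol R. grad_ip v f p)"
    unfolding set_lebesgue_integral_def
  proof (intro Bochner_Integration.integral_cong refl)
    fix p
    show "indicator inn p *\<^sub>R (\<Sum>t\<in>F. grad_ip (u t) f p) = indicator inn p *\<^sub>R grad_ip v f p"
    proof (cases "p \<in> inn")
      case True
      \<comment> \<open>The summands add up to v only on the manifold, not as functions on the whole
        type; coordinate derivatives see no more than that.\<close>
      have "dvec (chart_at R p) (\<Sum>t\<in>F. u t) x = dvec (chart_at R p) v x" if "x \<in> uset (chart_at R p)" for x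
      proof -
        have cp: "chart_at R p \<in> atlas R" using chart_at_inn[OF True] by blast
        have "frechet_derivative ((\<Sum>t\<in>F. u t) \<circ> param (chart_at R p)) (at x) = frechet_derivative (v \<circ> param (chart_at R p)) (at x)"
        proof (rule frechet_derivative_transform_within_open[OF _ open_uset[OF cp] that])
          show "((\<Sum>t\<in>F. u t) \<circ> param (chart_at R p)) differentiable at x"
            using smoothmD[where k=1, OF conjunct2[OF grad_ip_sum[OF F(2) u True]] cp] that by simp
          show "((\<Sum>t\<in>F. u t) \<circ> param (chart_at R p)) y = (v \<circ> param (chart_at R p)) y" if "y \<in> uset (chart_at R p)" for y
          proof -
            have "param (chart_at R p) y \<in> pts R" using that uset_subset param_pts[OF cp] by blast
            then show ?thesis using sumu by (simp add: sum_fun_apply)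
          qed
        qed
        then show ?thesis by (simp add: dvec_def)
      qed
      then have "grad_ip (\<Sum>t\<in>F. u t) f p = grad_ip v f p"
        using chart_at_inn[OF True] by (simp add: grad_ip_def Let_def)
      then show ?thesis using grad_ip_sum[OF F(2) u True] by simp
    qed simp
  qed
  finally show ?thesis .
qed

end

section \<open>Rellich's theorem\<close>

lemma null_cbox_minus_box: "cbox a b - box a b \<in> null_sets (lborel :: 'a::euclidean_space measure)"
proof -
  have "cbox a b - box a b \<in> null_sets lebesgue"
    using negligible_frontier_interval[of a b] by (simp add: negligible_iff_null_sets)
  then show ?thesis by (auto simp: null_sets_def)
qed

text \<open>A tagged division fine for the gauge of balls of radius \<delta>; passing to interiors
  makes the cells open and disjoint at the price of their faces, which are null sets.\<close>

lemma fine_box_partition: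
  fixes a b :: "'a::euclidean_space"
  assumes \<delta>: "0 < \<delta>"
  shows "\<exists>P. finite P \<and> (\<forall>U\<in>P. (\<exists>u v. U = box u v) \<and> U \<noteq> {} \<and> U \<subseteq> cbox a b \<and> (\<forall>x\<in>U. \<forall>y\<in>U. norm (x - y) \<le> 2 * \<delta>)) \<and>
    (\<forall>U\<in>P. \<forall>U'\<in>P. U \<noteq> U' \<longrightarrow> U \<inter> U' = {}) \<and> (AE x in lborel. x \<in> cbox a b \<longrightarrow> x \<in> \<Union>P)"
proof -
  have "gauge (\<lambda>x::'a. ball x \<delta>)" using \<delta> by (rule gauge_ball)
  then obtain p where p: "p tagged_division_of cbox a b" "(\<lambda>x. ball x \<delta>) fine p" using fine_division_exists by blast
  define dv where "dv = snd ` p"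
  have dv: "dv division_of cbox a b" unfolding dv_def by (rule division_of_tagged_division[OF p(1)])
  define P where "P = interior ` {K \<in> dv. interior K \<noteq> {}}"
  have finP: "finite P" unfolding P_def using division_ofD(1)[OF dv] by simp
  have PD: "(\<exists>u v. U = box u v) \<and> U \<noteq> {} \<and> U \<subseteq> cbox a b \<and> (\<forall>x\<in>U. \<forall>y\<in>U. norm (x - y) \<le> 2 * \<delta>)" if UP: "U \<in> P" for U
  proof -
    obtain K where K: "K \<in> dv" "U = interior K" "U \<noteq> {}" using UP by (auto simp: P_def)
    obtain u v where uv: "K = cbox u v" using division_ofD(4)[OF dv K(1)] by blast
    have U: "U = box u v" using K(2) uv by simp
    have KQ: "K \<subseteq> cbox a b" by (rule division_ofD(2)[OF dv K(1)])
    have "U \<subseteq> K" using K(2) interior_subset by blast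
    then have UQ: "U \<subseteq> cbox a b" using KQ by blast
    obtain z where "(z, K) \<in> p" using K(1) by (auto simp: dv_def)
    then have Kb: "K \<subseteq> ball z \<delta>" using p(2) by (auto simp: fine_def)
    have "norm (x - y) \<le> 2 * \<delta>" if "x \<in> U" "y \<in> U" for x y
    proof -
      have "dist z x < \<delta>" "dist z y < \<delta>" using that \<open>U \<subseteq> K\<close> Kb by auto
      then show ?thesis using dist_triangle3[of x y z] by (simp add: dist_norm)
    qed
    then show ?thesis using U K(3) UQ by blast
  qed
  have Pdisj: "U \<inter> U' = {}" if "U \<in> P" "U' \<in> P" "U \<noteq> U'" for U U'
    using that division_ofD(5)[OF dv] by (auto simp: P_def)
  have Pn: "AE x in lborel. x \<in> cbox a b \<longrightarrow> x \<in> \<Union>P"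
  proof -
    have "AE x in lborel. x \<notin> K - interior K" if Kd: "K \<in> dv" for K
    proof -
      obtain u v where "K = cbox u v" using division_ofD(4)[OF dv Kd] by blast
      then show ?thesis using AE_not_in[OF null_cbox_minus_box[of u v]] by simp
    qed
    then have "AE x in lborel. \<forall>K\<in>dv. x \<notin> K - interior K"
      using division_ofD(1)[OF dv] by (intro AE_finite_allI)
    then show ?thesis
    proof eventually_elim
      case (elim x)
      show ?case
      proof
        assume "x \<in> cbox a b"
        then obtain K where "K \<in> dv" "x \<in> K" using division_ofD(6)[OF dv] by blast
        then show "x \<in> \<Union>P" using elim by (auto simp: P_def)
      qed
    qed
  qed
  show ?thesis by (intro exI[of _ P] conjI ballI impI finP PD Pdisj Pn)
qed

section \<open>The Dirichlet forms and their local estimates\<close>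

context compact_riemannian_mfd begin

definition aform :: "('a \<Rightarrow> real) \<Rightarrow> ('a \<Rightarrow> real) \<Rightarrow> real" where
  "aform f g = (LINT p:inn|vol R. grad_ip f g p)"

definition bform :: "('a \<Rightarrow> real) \<Rightarrow> ('a \<Rightarrow> real) \<Rightarrow> real" where
  "bform f g = (LINT p:inn|vol R. f p * g p)"

lemma test_funD:
  assumes "f \<in> test_fun R \<Omega>" "\<Omega> \<subseteq> inn"
  shows "smoothm f" "\<exists>K. compact K \<and> K \<subseteq> \<Omega> \<and> K \<subseteq> inn \<and> (\<forall>p\<in>pts R - K. f p = 0)"
  using assms(1) unfolding test_fun_iff[OF assms(2)] using assms(2) by auto

lemma test_fun_mono: "\<Omega> \<subseteq> \<Omega>' \<Longrightarrow> test_fun R \<Omega> \<subseteq> test_fun R \<Omega>'"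
  unfolding test_fun_def by blast

lemma integrable_forms:
  assumes f: "f \<in> test_fun R \<Omega>" "\<Omega> \<subseteq> inn" and g: "smoothm g"
  shows "set_integrable (vol R) inn (\<lambda>p. f p * g p)" "set_integrable (vol R) inn (grad_ip f g)"
    "set_integrable (vol R) inn (\<lambda>p. g p * laplacian R f p)"
proof -
  obtain K where K: "compact K" "K \<subseteq> inn" "\<And>p. p \<in> pts R - K \<Longrightarrow> f p = 0" using test_funD(2)[OF f] by blast
  note s = test_funD(1)[OF f]
  show "set_integrable (vol R) inn (\<lambda>p. f p * g p)"
    by (rule set_integrable_inn[OF continuous_on_mult[OF continuous_on_smoothm[OF s] continuous_on_smoothm[OF g]] K(1,2)])
      (use K(3) inn_subset in auto)
  show "set_integrable (vol R) inn (grad_ip f g)"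
    by (rule set_integrable_inn[OF continuous_on_grad_ip[OF s g] K(1,2)]) (rule grad_ip_zero(1)[OF K(1,3)])
  show "set_integrable (vol R) inn (\<lambda>p. g p * laplacian R f p)"
    by (rule set_integrable_inn[OF continuous_on_mult[OF continuous_on_smoothm[OF g] continuous_on_laplacian[OF s]] K(1,2)])
      (use laplacian_zero[OF s K(1,3)] in simp)
qed

lemma set_lebesgue_integral_cong_inn:
  fixes h k :: "'a \<Rightarrow> real"
  shows "(\<And>p. p \<in> inn \<Longrightarrow> h p = k p) \<Longrightarrow> (LINT p:inn|vol R. h p) = (LINT p:inn|vol R. k p)"
  by (rule set_lebesgue_integral_cong[OF inn_sets]) auto

lemma form_pair_test_fun:
  assumes \<Omega>: "\<Omega> \<subseteq> inn"
  shows "form_pair (test_fun R \<Omega>) aform bform"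
proof
  show "subspace (test_fun R \<Omega>)" by (rule subspace_test_fun[OF \<Omega>])
  fix f g h and r :: real assume f: "f \<in> test_fun R \<Omega>" and g: "g \<in> test_fun R \<Omega>" and h: "h \<in> test_fun R \<Omega>"
  note s = test_funD(1)[OF f \<Omega>] test_funD(1)[OF g \<Omega>] test_funD(1)[OF h \<Omega>]
  note i = integrable_forms[OF f \<Omega> s(3)] integrable_forms[OF g \<Omega> s(3)]
  have "aform (f + g) h = (LINT p:inn|vol R. grad_ip f h p + grad_ip g h p)"
    unfolding aform_def by (rule set_lebesgue_integral_cong_inn) (rule grad_ip_add[OF s(1,2)])
  then show "aform (f + g) h = aform f h + aform g h" unfolding aform_def by (simp add: set_integral_add(2)[OF i(2) i(5)])
  have "bform (f + g) h = (LINT p:inn|vol R. f p * h p + g p * h p)"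
    unfolding bform_def by (rule set_lebesgue_integral_cong_inn) (simp add: algebra_simps)
  then show "bform (f + g) h = bform f h + bform g h" unfolding bform_def by (simp add: set_integral_add(2)[OF i(1) i(4)])
  have "aform (r *\<^sub>R f) g = (LINT p:inn|vol R. r * grad_ip f g p)"
    unfolding aform_def by (rule set_lebesgue_integral_cong_inn) (rule grad_ip_scale[OF s(1)])
  then show "aform (r *\<^sub>R f) g = r * aform f g" unfolding aform_def by simp
  show "bform (r *\<^sub>R f) g = r * bform f g" unfolding bform_def by (simp add: mult.assoc)
  show "aform f g = aform g f" unfolding aform_def by (rule set_lebesgue_integral_cong_inn) (rule grad_ip_sym)
  show "bform f g = bform g f" unfolding bform_def by (simp add: mult.commute)
  show "0 \<le> aform f f" unfolding aform_def set_lebesgue_integral_def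
    by (intro Bochner_Integration.integral_nonneg) (simp add: indicator_def grad_ip_nonneg)
  show "0 \<le> bform f f" unfolding bform_def set_lebesgue_integral_def
    by (intro Bochner_Integration.integral_nonneg) (simp add: indicator_def)
qed

lemma test_fun_measurable:
  assumes f: "f \<in> test_fun R \<Omega>" "\<Omega> \<subseteq> inn"
  shows "f \<in> borel_measurable (vol R)"
proof -
  obtain K where K: "K \<subseteq> inn" "\<And>p. p \<in> pts R - K \<Longrightarrow> f p = 0" using test_funD(2)[OF f] by blast
  have "(\<lambda>p. indicator inn p *\<^sub>R f p) \<in> borel_measurable (vol R)"
    by (rule indicator_inn_measurable[OF continuous_on_smoothm[OF test_funD(1)[OF f]]])
  then show ?thesis by (rule measurable_cong[THEN iffD1, rotated]) (use K in \<open>auto simp: indicator_def\<close>)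
qed

lemma test_fun_bounded:
  assumes f: "f \<in> test_fun R \<Omega>" "\<Omega> \<subseteq> inn"
  shows "\<exists>B. \<forall>p\<in>pts R. \<bar>f p\<bar> \<le> B"
proof -
  obtain K where K: "compact K" "K \<subseteq> inn" "\<And>p. p \<in> pts R - K \<Longrightarrow> f p = 0" using test_funD(2)[OF f] by blast
  have "bounded (f ` K)"
    by (intro compact_imp_bounded compact_continuous_image continuous_on_subset[OF continuous_on_smoothm[OF test_funD(1)[OF f]] K(2)] K(1))
  then obtain B where B: "\<And>p. p \<in> K \<Longrightarrow> \<bar>f p\<bar> \<le> B" unfolding bounded_iff by auto
  have "\<bar>f p\<bar> \<le> \<bar>B\<bar>" if "p \<in> pts R" for p using B[of p] K(3)[of p] that by (cases "p \<in> K") auto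
  then show ?thesis by blast
qed

lemma nn_integral_test_fun_sq:
  assumes f: "f \<in> test_fun R \<Omega>" "\<Omega> \<subseteq> inn"
  shows "(\<integral>\<^sup>+p. ennreal ((f p)\<^sup>2) \<partial>vol R) = ennreal (bform f f)"
proof -
  obtain K where K: "K \<subseteq> inn" "\<And>p. p \<in> pts R - K \<Longrightarrow> f p = 0" using test_funD(2)[OF f] by blast
  have "(\<integral>\<^sup>+p. ennreal ((f p)\<^sup>2) \<partial>vol R) = (\<integral>\<^sup>+p. ennreal (indicator inn p *\<^sub>R (f p * f p)) \<partial>vol R)"
    using K by (intro nn_integral_cong) (auto simp: indicator_def power2_eq_square)
  also have "\<dots> = ennreal (bform f f)"
    unfolding bform_def set_lebesgue_integral_def
    using integrable_forms(1)[OF f test_funD(1)[OF f]]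
    by (intro nn_integral_eq_integral) (auto simp: set_integrable_def indicator_def)
  finally show ?thesis .
qed

lemma nn_integral_uset_grad:
  assumes c: "c \<in> atlas R" and f: "f \<in> test_fun R \<Omega>" "\<Omega> \<subseteq> inn"
  shows "(\<integral>\<^sup>+x\<in>uset c. ennreal (dens c x * grad_ip f f (param c x)) \<partial>lborel) \<le> ennreal (aform f f)"
proof -
  let ?H = "\<lambda>p. ennreal (indicator inn p *\<^sub>R grad_ip f f p)"
  have m: "?H \<in> borel_measurable (vol R)"
    using indicator_inn_measurable[OF continuous_on_grad_ip[OF test_funD(1)[OF f] test_funD(1)[OF f]]] by measurable
  have "(\<integral>\<^sup>+x\<in>uset c. ennreal (dens c x * grad_ip f f (param c x)) \<partial>lborel) \<le> (\<integral>\<^sup>+x\<in>crange c. (ennreal (dens c x) * ?H (param c x)) \<partial>lborel)"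
  proof (intro nn_integral_mono)
    fix x
    show "ennreal (dens c x * grad_ip f f (param c x)) * indicator (uset c) x \<le> ennreal (dens c x) * ?H (param c x) * indicator (crange c) x"
    proof (cases "x \<in> uset c")
      case True
      then have "x \<in> crange c" using uset_subset by blast
      then show ?thesis using True param_inn[OF c True] dens_pos[OF c, of x] grad_ip_nonneg[OF param_inn[OF c True]]
        by (simp add: ennreal_mult)
    qed simp
  qed
  also have "\<dots> = (\<integral>\<^sup>+p\<in>cdom c. ?H p \<partial>vol R)" by (rule nn_integral_chart[OF c m, symmetric])
  also have "\<dots> \<le> (\<integral>\<^sup>+p. ?H p \<partial>vol R)" by (intro nn_integral_mono) (simp add: indicator_def)
  also have "\<dots> = ennreal (aform f f)"
    unfolding aform_def set_lebesgue_integral_def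
    using integrable_forms(2)[OF f test_funD(1)[OF f]]
    by (intro nn_integral_eq_integral) (auto simp: set_integrable_def indicator_def grad_ip_nonneg)
  finally show ?thesis .
qed

lemma dens_bounds:
  assumes c: "c \<in> atlas R" and Q: "compact Q" "Q \<subseteq> crange c"
  shows "\<exists>d D. 0 < d \<and> 0 < D \<and> (\<forall>x\<in>Q. d \<le> dens c x \<and> dens c x \<le> D)"
proof (cases "Q = {}")
  case False
  have dQ: "continuous_on Q (dens c)" by (rule continuous_on_subset[OF continuous_on_dens[OF c] Q(2)])
  obtain y where y: "y \<in> Q" "\<forall>x\<in>Q. dens c y \<le> dens c x" using continuous_attains_inf[OF Q(1) False dQ] by blast
  obtain z where z: "z \<in> Q" "\<forall>x\<in>Q. dens c x \<le> dens c z" using continuous_attains_sup[OF Q(1) False dQ] by blast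
  have "0 < dens c y" "0 < dens c z" using dens_pos[OF c subsetD[OF Q(2) y(1)]] dens_pos[OF c subsetD[OF Q(2) z(1)]] .
  then show ?thesis using y(2) z(2) by (intro exI[of _ "dens c y"] exI[of _ "dens c z"]) simp
qed (auto intro: exI[of _ 1])

text \<open>On a compact coordinate box the density lies between d and D and the inverse metric is
  at least m, so Euclidean and Riemannian integrals are comparable. On cells of diameter at most 2 *
  \<delta> Poincare's inequality leaves \<delta>^2 times the energy and the means over the cells;
  \<delta> is chosen afterwards.\<close>

lemma box_rellich:
  assumes c: "c \<in> atlas R" and Q: "cbox a b \<subseteq> crange c" and \<epsilon>: "0 < \<epsilon>"
  shows "\<exists>P k. finite P \<and> (\<forall>U\<in>P. open U \<and> bounded U \<and> U \<subseteq> uset c \<and> U \<subseteq> cbox a b) \<and> (\<forall>f\<in>test_fun R inn.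
    (\<integral>\<^sup>+p\<in>param c ` cbox a b. ennreal ((f p)\<^sup>2) \<partial>vol R) \<le>
      ennreal (\<epsilon> * aform f f) + ennreal (\<Sum>U\<in>P. (k U * (LINT x:U|lborel. f (param c x)))\<^sup>2))"
proof -
  let ?Q = "cbox a b"
  obtain d D where d: "0 < d" "\<And>x. x \<in> ?Q \<Longrightarrow> d \<le> dens c x" and D: "0 < D" "\<And>x. x \<in> ?Q \<Longrightarrow> dens c x \<le> D"
    using dens_bounds[OF c compact_cbox Q] by blast
  obtain m where m: "0 < m" "\<And>x \<xi>. x \<in> ?Q \<Longrightarrow> m * (\<xi> \<bullet> \<xi>) \<le> \<xi> \<bullet> (ginv c x *v \<xi>)"
    using posdef_lower_bound[OF compact_cbox continuous_on_subset[OF continuous_on_ginv[OF c] Q] posdef_ginv[OF c subsetD[OF Q]]] by blast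
  \<comment> \<open>Collects the constants: Poincare's 2 * 2^n, the factor 1 / (m * d) for the
    gradient term and D for the integral of f^2. Then \<delta> is fixed by C * \<delta>^2 =
    \<epsilon>.\<close>
  define C where "C = 2 * 2 ^ CARD('n) / (m * d) * D"
  have C: "0 < C" unfolding C_def using m d D by simp
  define \<delta> where "\<delta> = sqrt (\<epsilon> / C)"
  have \<delta>: "0 < \<delta>" "C * \<delta>\<^sup>2 = \<epsilon>" unfolding \<delta>_def using C \<epsilon> by simp_all
  obtain P where P: "finite P \<and> (\<forall>U\<in>P. (\<exists>u v. U = box u v) \<and> U \<noteq> {} \<and> U \<subseteq> ?Q \<and> (\<forall>x\<in>U. \<forall>y\<in>U. norm (x - y) \<le> 2 * \<delta>)) \<and>
    (\<forall>U\<in>P. \<forall>U'\<in>P. U \<noteq> U' \<longrightarrow> U \<inter> U' = {}) \<and> (AE x in lborel. x \<in> ?Q \<longrightarrow> x \<in> \<Union>P)"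
    using fine_box_partition[OF \<delta>(1), of a b] by (elim exE)
  note finP = conjunct1[OF P] and PD0 = bspec[OF conjunct1[OF conjunct2[OF P]]]
    and Pdisj = conjunct1[OF conjunct2[OF conjunct2[OF P]], rule_format] and Pn = conjunct2[OF conjunct2[OF conjunct2[OF P]]]
  have PD: "\<exists>u v. U = box u v \<and> U \<noteq> {} \<and> U \<subseteq> uset c \<and> U \<subseteq> ?Q \<and> (\<forall>x\<in>U. \<forall>y\<in>U. norm (x - y) \<le> 2 * \<delta>)" if UP: "U \<in> P" for U
  proof -
    obtain u v where U: "U = box u v" "U \<subseteq> ?Q" using PD0[OF UP] by blast
    \<comment> \<open>The closed box may touch the boundary hyperplane, but an open cell inside the
      half-space lies in its interior, where derivatives exist.\<close>
    have "U \<subseteq> interior halfspace" using U Q crange_subset[OF c] by (intro interior_maximal) auto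
    then have "U \<subseteq> uset c" using U(2) Q by (auto simp: uset_def interior_halfspace)
    then show ?thesis using PD0[OF UP] by blast
  qed
  \<comment> \<open>Chosen so that the square of k U times the integral of f over U is D times the
    mean term of Poincare's inequality.\<close>
  define k where "k U = sqrt (D / measure lborel U)" for U :: "(real^'n) set"
  have main: "(\<integral>\<^sup>+p\<in>param c ` ?Q. ennreal ((f p)\<^sup>2) \<partial>vol R) \<le>
      ennreal (\<epsilon> * aform f f) + ennreal (\<Sum>U\<in>P. (k U * (LINT x:U|lborel. f (param c x)))\<^sup>2)" if f: "f \<in> test_fun R inn" for f
  proof -
    let ?h = "f \<circ> param c"
    let ?G = "\<lambda>x. \<Sum>i\<in>UNIV. (frechet_derivative ?h (at x) (axis i 1))\<^sup>2"
    let ?I = "\<lambda>U. LINT x:U|lborel. ?h x"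
    let ?\<phi> = "\<lambda>x. ennreal (dens c x * grad_ip f f (param c x))"
    note sf = test_funD(1)[OF f order_refl]
    have aff: "0 \<le> aform f f" using form_pair.axioms(1)[OF form_pair_test_fun[OF order_refl]] semi_form.nonneg f by blast
    obtain B where B: "\<And>p. p \<in> pts R \<Longrightarrow> \<bar>f p\<bar> \<le> B" using test_fun_bounded[OF f order_refl] by blast
    have hB: "\<bar>?h x\<bar> \<le> B" if "x \<in> uset c" for x
      using B[OF param_pts[OF c subsetD[OF uset_subset that]]] by simp
    have Gle: "ennreal (?G x) \<le> ennreal (1 / (m * d)) * ?\<phi> x" if x: "x \<in> uset c" "x \<in> ?Q" for x
    proof -
      have xc: "x \<in> crange c" using x(1) uset_subset by blast
      have g: "grad_ip f f (param c x) = dvec c f x \<bullet> (ginv c x *v dvec c f x)"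
        using grad_ip_chart[OF c param_in[OF xc] param_inn[OF c x(1)] sf sf] xc by simp
      have "?G x = dvec c f x \<bullet> dvec c f x" by (simp add: dvec_def inner_vec_def power2_eq_square)
      then have "m * ?G x \<le> grad_ip f f (param c x)" using m(2)[OF x(2)] g by simp
      moreover have "d * grad_ip f f (param c x) \<le> dens c x * grad_ip f f (param c x)"
        using d(2)[OF x(2)] grad_ip_nonneg[OF param_inn[OF c x(1)]] by (rule mult_right_mono)
      ultimately have "d * (m * ?G x) \<le> dens c x * grad_ip f f (param c x)"
        using d(1) by (meson mult_left_mono less_imp_le order_trans)
      then have "?G x \<le> 1 / (m * d) * (dens c x * grad_ip f f (param c x))"
        using m(1) d(1) by (simp add: field_simps)
      then have "ennreal (?G x) \<le> ennreal (1 / (m * d) * (dens c x * grad_ip f f (param c x)))" by (rule ennreal_leI)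
      also have "\<dots> = ennreal (1 / (m * d)) * ?\<phi> x" using m(1) d(1) by (intro ennreal_mult') simp
      finally show ?thesis .
    qed
    have phim: "(\<lambda>x. ?\<phi> x * indicator U x) \<in> borel_measurable lborel"
      and hm: "(\<lambda>x. ennreal ((?h x)\<^sup>2) * indicator U x) \<in> borel_measurable lborel" if UP: "U \<in> P" for U
    proof -
      obtain u v where "U = box u v" and U: "U \<subseteq> uset c" using PD[OF UP] by blast
      then have oU: "U \<in> sets borel" by simp
      have "continuous_on U (\<lambda>x. dens c x * (dvec c f x \<bullet> (ginv c x *v dvec c f x)))"
        using Ck_on_dvec[OF sf c, of 0] Ck_on_ginv[OF c, of 0] Ck_on_dens[OF c, of 0]
        unfolding inner_vec_def matrix_vector_mult_def
        by (simp, intro continuous_on_subset[OF _ U] continuous_on_sum continuous_on_mult) auto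
      then have "continuous_on U (\<lambda>x. dens c x * grad_ip f f (param c x))"
      proof (rule continuous_on_eq)
        fix x assume "x \<in> U"
        then have x: "x \<in> uset c" "x \<in> crange c" using U uset_subset by blast+
        show "dens c x * (dvec c f x \<bullet> (ginv c x *v dvec c f x)) = dens c x * grad_ip f f (param c x)"
          using grad_ip_chart[OF c param_in[OF x(2)] param_inn[OF c x(1)] sf sf] x by simp
      qed
      then have "(\<lambda>x. indicator U x *\<^sub>R (dens c x * grad_ip f f (param c x))) \<in> borel_measurable borel"
        using oU by (intro borel_measurable_continuous_on_indicator) auto
      then have "(\<lambda>x. ennreal (indicator U x *\<^sub>R (dens c x * grad_ip f f (param c x)))) \<in> borel_measurable lborel" by simp
      then show "(\<lambda>x. ?\<phi> x * indicator U x) \<in> borel_measurable lborel"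
        by (rule measurable_cong[THEN iffD1, rotated]) (auto simp: indicator_def)
      have "continuous_on U ?h" by (rule continuous_on_subset[OF _ U]) (use smoothmD[OF sf c, of 0] in simp)
      then have "(\<lambda>x. indicator U x *\<^sub>R (?h x)\<^sup>2) \<in> borel_measurable borel"
        by (intro borel_measurable_continuous_on_indicator oU continuous_on_power)
      then have "(\<lambda>x. ennreal (indicator U x *\<^sub>R (?h x)\<^sup>2)) \<in> borel_measurable lborel" by simp
      then show "(\<lambda>x. ennreal ((?h x)\<^sup>2) * indicator U x) \<in> borel_measurable lborel"
        by (rule measurable_cong[THEN iffD1, rotated]) (auto simp: indicator_def)
    qed
    have piece: "(\<integral>\<^sup>+x\<in>U. ennreal ((?h x)\<^sup>2) \<partial>lborel) \<le>
        ennreal ((?I U)\<^sup>2 / measure lborel U) + ennreal (2 * \<delta>\<^sup>2 * 2 ^ CARD('n) / (m * d)) * (\<integral>\<^sup>+x\<in>U. ?\<phi> x \<partial>lborel)" if UP: "U \<in> P" for U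
    proof -
      obtain u v where U: "U = box u v" "U \<noteq> {}" "U \<subseteq> uset c" "U \<subseteq> ?Q" "\<forall>x\<in>U. \<forall>y\<in>U. norm (x - y) \<le> 2 * \<delta>" using PD[OF UP] by blast
      have oU: "open U" "convex U" "bounded U" using U(1) by (auto intro: convex_box bounded_box)
      have Ck: "Ck_on 1 U ?h" by (rule Ck_on_subset[OF smoothmD[OF sf c] U(3)])
      have hU: "\<bar>?h x\<bar> \<le> B" if "x \<in> U" for x using hB U(3) that by blast
      define \<mu> where "\<mu> = measure lborel U"
      define T where "T = (\<integral>\<^sup>+x\<in>U. ennreal (?G x) \<partial>lborel)"
      have "(\<integral>\<^sup>+x\<in>U. ennreal ((?h x)\<^sup>2) \<partial>lborel) \<le> ennreal ((?I U)\<^sup>2 / \<mu>) + ennreal (2 * \<delta>\<^sup>2 * 2 ^ CARD('n)) * T"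
        unfolding \<mu>_def T_def by (rule poincare_nn_integral[OF oU U(2) Ck hU \<delta>(1)]) (use U(5) in auto)
      also have "\<dots> \<le> ennreal ((?I U)\<^sup>2 / \<mu>) + ennreal (2 * \<delta>\<^sup>2 * 2 ^ CARD('n)) * (ennreal (1 / (m * d)) * (\<integral>\<^sup>+x\<in>U. ?\<phi> x \<partial>lborel))"
      proof (intro add_left_mono mult_left_mono)
        have "T \<le> (\<integral>\<^sup>+x. ennreal (1 / (m * d)) * (?\<phi> x * indicator U x) \<partial>lborel)"
          unfolding T_def using Gle U(3,4) by (intro nn_integral_mono) (auto simp: indicator_def)
        also have "\<dots> = ennreal (1 / (m * d)) * (\<integral>\<^sup>+x\<in>U. ?\<phi> x \<partial>lborel)"
          by (rule nn_integral_cmult[OF phim[OF UP]])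
        finally show "T \<le> ennreal (1 / (m * d)) * (\<integral>\<^sup>+x\<in>U. ?\<phi> x \<partial>lborel)" .
      qed auto
      also have "\<dots> = ennreal ((?I U)\<^sup>2 / \<mu>) + ennreal (2 * \<delta>\<^sup>2 * 2 ^ CARD('n) / (m * d)) * (\<integral>\<^sup>+x\<in>U. ?\<phi> x \<partial>lborel)"
      proof -
        have "ennreal (2 * \<delta>\<^sup>2 * 2 ^ CARD('n)) * ennreal (1 / (m * d)) = ennreal (2 * \<delta>\<^sup>2 * 2 ^ CARD('n) / (m * d))"
          using m(1) d(1) by (simp add: ennreal_mult[symmetric])
        then show ?thesis by (simp only: mult.assoc[symmetric])
      qed
      finally show ?thesis unfolding \<mu>_def .
    qed
    let ?H = "\<lambda>p. ennreal ((f p)\<^sup>2) * indicator (param c ` ?Q) p"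
    let ?\<kappa> = "2 * \<delta>\<^sup>2 * 2 ^ CARD('n) / (m * d)"
    have pQ: "param c ` ?Q \<in> sets borel" "param c ` ?Q \<subseteq> cdom c"
      using param_image_borel[OF c _ Q] Q param_in by (auto simp: subset_iff)
    have Hm: "?H \<in> borel_measurable (vol R)"
      using test_fun_measurable[OF f order_refl] pQ cdom_subset[OF c]
      by (intro borel_measurable_times_ennreal borel_measurable_indicator) (auto simp: sets_vol_iff)
    have "(\<integral>\<^sup>+p\<in>param c ` ?Q. ennreal ((f p)\<^sup>2) \<partial>vol R) = (\<integral>\<^sup>+p\<in>cdom c. ?H p \<partial>vol R)"
      using pQ by (intro nn_integral_cong) (auto simp: indicator_def)
    also have "\<dots> = (\<integral>\<^sup>+x\<in>crange c. (ennreal (dens c x) * ?H (param c x)) \<partial>lborel)"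
      by (rule nn_integral_chart[OF c Hm])
    also have "\<dots> \<le> (\<integral>\<^sup>+x. (\<Sum>U\<in>P. ennreal D * (ennreal ((?h x)\<^sup>2) * indicator U x)) \<partial>lborel)"
    proof (rule nn_integral_mono_AE)
      show "AE x in lborel. ennreal (dens c x) * ?H (param c x) * indicator (crange c) x \<le>
          (\<Sum>U\<in>P. ennreal D * (ennreal ((?h x)\<^sup>2) * indicator U x))"
        using Pn
      proof eventually_elim
        case (elim x)
        show ?case
        proof (cases "x \<in> crange c \<and> param c x \<in> param c ` ?Q")
          case True
          then obtain y where y: "y \<in> ?Q" "param c x = param c y" by blast
          have "x = coord c (param c x)" using True by (simp only: coord_param)
          also have "\<dots> = coord c (param c y)" by (simp only: y(2))
          also have "\<dots> = y" by (rule coord_param[OF subsetD[OF Q y(1)]])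
          finally have x: "x \<in> ?Q" using y(1) by simp
          then obtain U where U: "U \<in> P" "x \<in> U" using elim by blast
          have "ennreal (dens c x) * ?H (param c x) * indicator (crange c) x \<le> ennreal D * (ennreal ((?h x)\<^sup>2) * indicator U x)"
            using True U D(2)[OF x] by (simp add: mult_right_mono ennreal_leI)
          also have "\<dots> \<le> (\<Sum>U\<in>P. ennreal D * (ennreal ((?h x)\<^sup>2) * indicator U x))"
            by (rule member_le_sum[OF U(1) _ finP]) simp
          finally show ?thesis .
        qed auto
      qed
    qed
    also have "\<dots> = (\<Sum>U\<in>P. \<integral>\<^sup>+x. ennreal D * (ennreal ((?h x)\<^sup>2) * indicator U x) \<partial>lborel)"
      by (intro nn_integral_sum borel_measurable_times_ennreal hm) auto
    also have "\<dots> = (\<Sum>U\<in>P. ennreal D * (\<integral>\<^sup>+x\<in>U. ennreal ((?h x)\<^sup>2) \<partial>lborel))"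
      by (intro sum.cong refl nn_integral_cmult hm)
    also have "\<dots> \<le> (\<Sum>U\<in>P. ennreal D * (ennreal ((?I U)\<^sup>2 / measure lborel U) + ennreal ?\<kappa> * (\<integral>\<^sup>+x\<in>U. ?\<phi> x \<partial>lborel)))"
      by (intro sum_mono mult_left_mono piece) auto
    also have "\<dots> = (\<Sum>U\<in>P. ennreal ((k U * ?I U)\<^sup>2) + ennreal (D * ?\<kappa>) * (\<integral>\<^sup>+x\<in>U. ?\<phi> x \<partial>lborel))"
    proof (intro sum.cong refl)
      fix U
      have "(k U * ?I U)\<^sup>2 = D * ((?I U)\<^sup>2 / measure lborel U)"
        using D(1) by (simp add: k_def power_mult_distrib)
      then have "ennreal ((k U * ?I U)\<^sup>2) = ennreal D * ennreal ((?I U)\<^sup>2 / measure lborel U)"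
        using D(1) by (simp only:) (intro ennreal_mult', simp)
      moreover have "ennreal (D * ?\<kappa>) = ennreal D * ennreal ?\<kappa>" using D(1) by (intro ennreal_mult') simp
      ultimately show "ennreal D * (ennreal ((?I U)\<^sup>2 / measure lborel U) + ennreal ?\<kappa> * (\<integral>\<^sup>+x\<in>U. ?\<phi> x \<partial>lborel)) =
        ennreal ((k U * ?I U)\<^sup>2) + ennreal (D * ?\<kappa>) * (\<integral>\<^sup>+x\<in>U. ?\<phi> x \<partial>lborel)"
        by (simp only: distrib_left mult.assoc)
    qed
    also have "\<dots> = ennreal (\<Sum>U\<in>P. (k U * ?I U)\<^sup>2) + ennreal (D * ?\<kappa>) * (\<Sum>U\<in>P. \<integral>\<^sup>+x\<in>U. ?\<phi> x \<partial>lborel)"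
    proof -
      have "(\<Sum>U\<in>P. ennreal ((k U * ?I U)\<^sup>2)) = ennreal (\<Sum>U\<in>P. (k U * ?I U)\<^sup>2)" by (rule sum_ennreal) simp
      then show ?thesis by (simp only: sum.distrib sum_distrib_left)
    qed
    also have "\<dots> \<le> ennreal (\<Sum>U\<in>P. (k U * ?I U)\<^sup>2) + ennreal (D * ?\<kappa>) * ennreal (aform f f)"
    proof (intro add_left_mono mult_left_mono)
      have "(\<Sum>U\<in>P. \<integral>\<^sup>+x\<in>U. ?\<phi> x \<partial>lborel) = (\<integral>\<^sup>+x. (\<Sum>U\<in>P. ?\<phi> x * indicator U x) \<partial>lborel)"
        by (rule nn_integral_sum[symmetric]) (rule phim)
      also have "\<dots> \<le> (\<integral>\<^sup>+x\<in>uset c. ?\<phi> x \<partial>lborel)"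
      proof (intro nn_integral_mono)
        fix x
        show "(\<Sum>U\<in>P. ?\<phi> x * indicator U x) \<le> ?\<phi> x * indicator (uset c) x"
        proof (cases "\<exists>U\<in>P. x \<in> U")
          case True
          then obtain U where U: "U \<in> P" "x \<in> U" by blast
          have "(\<Sum>U\<in>P - {U}. ?\<phi> x * indicator U x) = 0"
            using Pdisj[OF U(1)] U(2) by (intro sum.neutral) (auto simp: indicator_def)
          then have "(\<Sum>U\<in>P. ?\<phi> x * indicator U x) = ?\<phi> x" using U by (simp add: sum.remove[OF finP U(1)])
          moreover have "x \<in> uset c" using PD[OF U(1)] U(2) by blast
          ultimately show ?thesis by simp
        next
          case False
          then have "(\<Sum>U\<in>P. ?\<phi> x * indicator U x) = 0" by (intro sum.neutral) auto
          then show ?thesis by simp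
        qed
      qed
      also have "\<dots> \<le> ennreal (aform f f)" by (rule nn_integral_uset_grad[OF c f order_refl])
      finally show "(\<Sum>U\<in>P. \<integral>\<^sup>+x\<in>U. ?\<phi> x \<partial>lborel) \<le> ennreal (aform f f)" .
    qed auto
    also have "D * ?\<kappa> = \<epsilon>" using \<delta>(2) by (simp add: C_def field_simps)
    also have "ennreal \<epsilon> * ennreal (aform f f) = ennreal (\<epsilon> * aform f f)" using \<epsilon> by (intro ennreal_mult'[symmetric]) simp
    finally show ?thesis by (simp only: add.commute o_apply)
  qed
  have "\<forall>U\<in>P. open U \<and> bounded U \<and> U \<subseteq> uset c \<and> U \<subseteq> ?Q"
  proof
    fix U assume "U \<in> P"
    from PD[OF this] show "open U \<and> bounded U \<and> U \<subseteq> uset c \<and> U \<subseteq> ?Q" by (auto intro: bounded_box)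
  qed
  with finP main show ?thesis by blast
qed

end

context compact_riemannian_mfd begin

lemma set_integrable_param:
  assumes c: "c \<in> atlas R" and U: "open U" "bounded U" "U \<subseteq> uset c" and f: "f \<in> test_fun R inn"
  shows "set_integrable lborel U (\<lambda>x. f (param c x))" "set_integrable lborel U (\<lambda>x. (f (param c x))\<^sup>2)"
proof -
  obtain B where B: "\<And>p. p \<in> pts R \<Longrightarrow> \<bar>f p\<bar> \<le> B" using test_fun_bounded[OF f order_refl] by blast
  have hB: "\<bar>f (param c x)\<bar> \<le> B" if "x \<in> U" for x
    using B[OF param_pts[OF c subsetD[OF uset_subset subsetD[OF U(3) that]]]] .
  have "continuous_on U (f \<circ> param c)"
    by (rule continuous_on_subset[OF _ U(3)]) (use smoothmD[OF test_funD(1)[OF f order_refl] c, of 0] in simp)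
  then have ch: "continuous_on U (\<lambda>x. f (param c x))" by (simp add: o_def)
  show "set_integrable lborel U (\<lambda>x. f (param c x))"
    by (rule set_integrable_bounded_continuous[OF U(1,2) ch hB])
  show "set_integrable lborel U (\<lambda>x. (f (param c x))\<^sup>2)"
  proof (rule set_integrable_bounded_continuous[OF U(1,2) continuous_on_power[OF ch], where B="B\<^sup>2"])
    show "\<bar>(f (param c x))\<^sup>2\<bar> \<le> B\<^sup>2" if "x \<in> U" for x using power_mono[OF hB[OF that], of 2] by simp
  qed
qed

text \<open>The functionals only have to be bounded along sequences with bounded forms, so the crude
  estimate of the absolute value of f by 1 + f^2 is enough.\<close>

lemma functional_bound:
  assumes c: "c \<in> atlas R" and Q: "cbox a b \<subseteq> crange c" and U: "open U" "bounded U" "U \<subseteq> uset c" "U \<subseteq> cbox a b"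
  shows "\<exists>C\<ge>0. \<forall>f\<in>test_fun R inn. \<bar>LINT x:U|lborel. f (param c x)\<bar> \<le> C * (1 + bform f f)"
proof -
  obtain d where d: "0 < d" "\<And>x. x \<in> cbox a b \<Longrightarrow> d \<le> dens c x" using dens_bounds[OF c compact_cbox Q] by blast
  have "\<bar>LINT x:U|lborel. f (param c x)\<bar> \<le> (measure lborel U + 1 / d) * (1 + bform f f)" if f: "f \<in> test_fun R inn" for f
  proof -
    note i = set_integrable_param[OF c U(1-3) f]
    have b: "0 \<le> bform f f" using form_pair.axioms(2)[OF form_pair_test_fun[OF order_refl]] semi_form.nonneg f by blast
    have i1: "set_integrable lborel U (\<lambda>x. 1::real)"
      using emeasure_bounded_finite[OF U(2)] U(1) by (simp add: set_integrable_def integrable_real_indicator)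
    have fm: "(\<lambda>p. ennreal ((f p)\<^sup>2)) \<in> borel_measurable (vol R)" using test_fun_measurable[OF f order_refl] by measurable
    have "ennreal (LINT x:U|lborel. (f (param c x))\<^sup>2) = (\<integral>\<^sup>+x. ennreal (indicator U x *\<^sub>R (f (param c x))\<^sup>2) \<partial>lborel)"
      unfolding set_lebesgue_integral_def
      using i(2) by (intro nn_integral_eq_integral[symmetric]) (auto simp: set_integrable_def)
    also have "\<dots> \<le> (\<integral>\<^sup>+x\<in>crange c. (ennreal (dens c x) * ennreal ((f (param c x))\<^sup>2)) * ennreal (1 / d) \<partial>lborel)"
    proof (intro nn_integral_mono)
      fix x
      show "ennreal (indicator U x *\<^sub>R (f (param c x))\<^sup>2) \<le> ennreal (dens c x) * ennreal ((f (param c x))\<^sup>2) * ennreal (1 / d) * indicator (crange c) x"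
      proof (cases "x \<in> U")
        case True
        then have x: "x \<in> crange c" "d \<le> dens c x" using U(4) Q d(2) by auto
        have "(f (param c x))\<^sup>2 * d \<le> (f (param c x))\<^sup>2 * dens c x" using x(2) by (intro mult_left_mono) auto
        then have "(f (param c x))\<^sup>2 \<le> dens c x * (f (param c x))\<^sup>2 * (1 / d)" using d(1) by (simp add: field_simps)
        moreover have "ennreal (dens c x) * ennreal ((f (param c x))\<^sup>2) * ennreal (1 / d) = ennreal (dens c x * (f (param c x))\<^sup>2 * (1 / d))"
          using d(1) x(2) by (simp add: ennreal_mult[symmetric])
        ultimately show ?thesis using True x(1) by (simp add: ennreal_leI)
      qed simp
    qed
    also have "\<dots> = (\<integral>\<^sup>+x\<in>crange c. (ennreal (dens c x) * (ennreal ((f (param c x))\<^sup>2) * ennreal (1 / d))) \<partial>lborel)"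
      by (simp only: mult.assoc)
    also have "\<dots> = (\<integral>\<^sup>+p\<in>cdom c. (ennreal ((f p)\<^sup>2) * ennreal (1 / d)) \<partial>vol R)"
      by (rule nn_integral_chart[OF c borel_measurable_times_ennreal[OF fm borel_measurable_const], symmetric])
    also have "\<dots> \<le> (\<integral>\<^sup>+p. ennreal ((f p)\<^sup>2) * ennreal (1 / d) \<partial>vol R)"
      by (intro nn_integral_mono) (simp add: indicator_def)
    also have "\<dots> = ennreal (bform f f) * ennreal (1 / d)"
      using nn_integral_test_fun_sq[OF f order_refl] fm by (simp add: nn_integral_multc)
    also have "\<dots> = ennreal (bform f f * (1 / d))" using b by (intro ennreal_mult'[symmetric])
    finally have I2: "(LINT x:U|lborel. (f (param c x))\<^sup>2) \<le> bform f f * (1 / d)"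
      using b d(1) by (subst (asm) ennreal_le_iff) auto
    have "\<bar>LINT x:U|lborel. f (param c x)\<bar> \<le> (LINT x:U|lborel. \<bar>f (param c x)\<bar>)"
      using set_integral_norm_bound[OF i(1)] by simp
    also have "\<dots> \<le> (LINT x:U|lborel. 1 + (f (param c x))\<^sup>2)"
    proof (rule set_integral_mono)
      show "set_integrable lborel U (\<lambda>x. \<bar>f (param c x)\<bar>)" using set_integrable_abs[OF i(1)] .
      show "set_integrable lborel U (\<lambda>x. 1 + (f (param c x))\<^sup>2)" by (rule set_integral_add(1)[OF i1 i(2)])
      fix x
      show "\<bar>f (param c x)\<bar> \<le> 1 + (f (param c x))\<^sup>2"
      proof -
        have "0 \<le> (\<bar>f (param c x)\<bar> - 1/2)\<^sup>2" by simp
        then have "\<bar>f (param c x)\<bar> \<le> 1/4 + (f (param c x))\<^sup>2" by (simp add: power2_diff power_divide)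
        then show ?thesis by simp
      qed
    qed
    also have "\<dots> = measure lborel U + (LINT x:U|lborel. (f (param c x))\<^sup>2)"
      unfolding set_integral_add(2)[OF i1 i(2)] by (simp add: set_lebesgue_integral_def)
    also have "\<dots> \<le> measure lborel U + bform f f * (1 / d)" using I2 by simp
    also have "\<dots> \<le> (measure lborel U + 1 / d) * (1 + bform f f)"
      using b d(1) by (simp add: algebra_simps)
    finally show ?thesis .
  qed
  then show ?thesis using d(1) by (intro exI[of _ "measure lborel U + 1 / d"]) auto
qed

text \<open>The functionals are multiples of the means over small boxes in coordinates.\<close>

lemma rellich_functionals:
  assumes \<epsilon>: "0 < \<epsilon>"
  shows "\<exists>(I :: ((('a, 'n) chart \<times> (real^'n) \<times> (real^'n)) \<times> (real^'n) set) set) l. finite I \<and>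
    (\<forall>i\<in>I. (\<forall>f\<in>test_fun R inn. \<forall>g\<in>test_fun R inn. l i (f - g) = l i f - l i g) \<and>
      (\<exists>C\<ge>0. \<forall>f\<in>test_fun R inn. \<bar>l i f\<bar> \<le> C * (1 + bform f f))) \<and>
    (\<forall>f\<in>test_fun R inn. bform f f \<le> \<epsilon> * aform f f + (\<Sum>i\<in>I. (l i f)\<^sup>2))"
proof -
  obtain F where F: "finite F \<and> (\<forall>(c, a, b)\<in>F. c \<in> atlas R \<and> cbox a b \<subseteq> crange c) \<and>
    pts R = (\<Union>(c, a, b)\<in>F. param c ` cbox a b)" using finite_box_cover by (elim exE)
  define ch where "ch t = fst t" for t :: "('a, 'n) chart \<times> (real^'n) \<times> (real^'n)"
  define bx where "bx t = cbox (fst (snd t)) (snd (snd t))" for t :: "('a, 'n) chart \<times> (real^'n) \<times> (real^'n)"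
  have fF: "finite F" and tF: "\<And>t. t \<in> F \<Longrightarrow> ch t \<in> atlas R \<and> bx t \<subseteq> crange (ch t)"
    and cov: "pts R = (\<Union>t\<in>F. param (ch t) ` bx t)"
    using F unfolding ch_def bx_def by (auto simp: case_prod_unfold)
  \<comment> \<open>An equal share of \<epsilon> for each box of the cover; the summand 1 keeps the
    denominator positive when there is none.\<close>
  define \<eta> where "\<eta> = \<epsilon> / (real (card F) + 1)"
  have \<eta>: "0 < \<eta>" "real (card F) * \<eta> \<le> \<epsilon>" using \<epsilon> by (simp_all add: \<eta>_def field_simps)
  have "\<forall>t\<in>F. \<exists>Pk. finite (fst Pk) \<and> (\<forall>U\<in>fst Pk. open U \<and> bounded U \<and> U \<subseteq> uset (ch t) \<and> U \<subseteq> bx t) \<and> (\<forall>f\<in>test_fun R inn.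
    (\<integral>\<^sup>+p\<in>param (ch t) ` bx t. ennreal ((f p)\<^sup>2) \<partial>vol R) \<le>
      ennreal (\<eta> * aform f f) + ennreal (\<Sum>U\<in>fst Pk. (snd Pk U * (LINT x:U|lborel. f (param (ch t) x)))\<^sup>2))"
    (is "\<forall>t\<in>F. ?P t")
  proof
    fix t assume t: "t \<in> F"
    from box_rellich[of "ch t" "fst (snd t)" "snd (snd t)" \<eta>] tF[OF t] \<eta>(1)
    obtain P k where "finite P \<and> (\<forall>U\<in>P. open U \<and> bounded U \<and> U \<subseteq> uset (ch t) \<and> U \<subseteq> bx t) \<and> (\<forall>f\<in>test_fun R inn.
    (\<integral>\<^sup>+p\<in>param (ch t) ` bx t. ennreal ((f p)\<^sup>2) \<partial>vol R) \<le>
      ennreal (\<eta> * aform f f) + ennreal (\<Sum>U\<in>P. (k U * (LINT x:U|lborel. f (param (ch t) x)))\<^sup>2))"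
      unfolding bx_def by blast
    then show "?P t"
      by (intro exI[of _ "(P, k)"]) simp
  qed
  from bchoice[OF this] obtain Pk where Pk: "\<forall>t\<in>F. finite (fst (Pk t)) \<and> (\<forall>U\<in>fst (Pk t). open U \<and> bounded U \<and> U \<subseteq> uset (ch t) \<and> U \<subseteq> bx t) \<and> (\<forall>f\<in>test_fun R inn.
    (\<integral>\<^sup>+p\<in>param (ch t) ` bx t. ennreal ((f p)\<^sup>2) \<partial>vol R) \<le>
      ennreal (\<eta> * aform f f) + ennreal (\<Sum>U\<in>fst (Pk t). (snd (Pk t) U * (LINT x:U|lborel. f (param (ch t) x)))\<^sup>2))"
    by (elim exE)
  define I where "I = Sigma F (\<lambda>t. fst (Pk t))"
  define l where "l i f = snd (Pk (fst i)) (snd i) * (LINT x:snd i|lborel. f (param (ch (fst i)) x))"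
    for i :: "(('a, 'n) chart \<times> (real^'n) \<times> (real^'n)) \<times> (real^'n) set" and f :: "'a \<Rightarrow> real"
  have "finite I" unfolding I_def using fF Pk by (intro finite_SigmaI) auto
  moreover have "\<forall>i\<in>I. (\<forall>f\<in>test_fun R inn. \<forall>g\<in>test_fun R inn. l i (f - g) = l i f - l i g) \<and>
      (\<exists>C\<ge>0. \<forall>f\<in>test_fun R inn. \<bar>l i f\<bar> \<le> C * (1 + bform f f))"
  proof
    fix i assume "i \<in> I"
    then have t: "fst i \<in> F" and U: "snd i \<in> fst (Pk (fst i))" by (auto simp: I_def)
    have c: "ch (fst i) \<in> atlas R" "bx (fst i) \<subseteq> crange (ch (fst i))" using tF[OF t] by auto
    have U': "open (snd i)" "bounded (snd i)" "snd i \<subseteq> uset (ch (fst i))" "snd i \<subseteq> bx (fst i)"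
      using bspec[OF conjunct1[OF conjunct2[OF bspec[OF Pk t]]] U] by auto
    obtain C where C: "0 \<le> C" "\<And>f. f \<in> test_fun R inn \<Longrightarrow> \<bar>LINT x:snd i|lborel. f (param (ch (fst i)) x)\<bar> \<le> C * (1 + bform f f)"
      using functional_bound[OF c(1) c(2)[unfolded bx_def] U'(1-3) U'(4)[unfolded bx_def]] by blast
    have "\<bar>l i f\<bar> \<le> (\<bar>snd (Pk (fst i)) (snd i)\<bar> * C) * (1 + bform f f)" if "f \<in> test_fun R inn" for f
      unfolding l_def abs_mult using mult_left_mono[OF C(2)[OF that], of "\<bar>snd (Pk (fst i)) (snd i)\<bar>"] by (simp add: mult.assoc)
    moreover have "l i (f - g) = l i f - l i g" if "f \<in> test_fun R inn" "g \<in> test_fun R inn" for f g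
      unfolding l_def using set_integral_diff(2)[OF set_integrable_param(1)[OF c(1) U'(1-3) that(1)] set_integrable_param(1)[OF c(1) U'(1-3) that(2)]]
      by (simp add: right_diff_distrib)
    ultimately show "(\<forall>f\<in>test_fun R inn. \<forall>g\<in>test_fun R inn. l i (f - g) = l i f - l i g) \<and>
      (\<exists>C\<ge>0. \<forall>f\<in>test_fun R inn. \<bar>l i f\<bar> \<le> C * (1 + bform f f))"
      using C(1) by (intro conjI ballI exI[of _ "\<bar>snd (Pk (fst i)) (snd i)\<bar> * C"]) auto
  qed
  moreover have "\<forall>f\<in>test_fun R inn. bform f f \<le> \<epsilon> * aform f f + (\<Sum>i\<in>I. (l i f)\<^sup>2)"
  proof
    fix f assume f: "f \<in> test_fun R inn"
    have aff: "0 \<le> aform f f" using form_pair.axioms(1)[OF form_pair_test_fun[OF order_refl]] semi_form.nonneg f by blast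
    have pm: "param (ch t) ` bx t \<in> sets (vol R)" if "t \<in> F" for t
    proof -
      have "param (ch t) ` bx t \<subseteq> pts R" using tF[OF that] by (intro image_subsetI param_pts) auto
      moreover have "param (ch t) ` bx t \<in> sets borel"
        using tF[OF that] by (intro param_image_borel) (auto simp: bx_def)
      ultimately show ?thesis by (simp add: sets_vol_iff)
    qed
    have fm: "(\<lambda>p. ennreal ((f p)\<^sup>2)) \<in> borel_measurable (vol R)" using test_fun_measurable[OF f order_refl] by measurable
    let ?S = "\<lambda>t. \<Sum>U\<in>fst (Pk t). (snd (Pk t) U * (LINT x:U|lborel. f (param (ch t) x)))\<^sup>2"
    have "ennreal (bform f f) = (\<integral>\<^sup>+p. ennreal ((f p)\<^sup>2) \<partial>vol R)" by (rule nn_integral_test_fun_sq[OF f order_refl, symmetric])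
    also have "\<dots> \<le> (\<integral>\<^sup>+p. (\<Sum>t\<in>F. ennreal ((f p)\<^sup>2) * indicator (param (ch t) ` bx t) p) \<partial>vol R)"
    proof (rule nn_integral_mono)
      fix p assume "p \<in> space (vol R)"
      then have "p \<in> pts R" by simp
      then obtain t where t: "t \<in> F" "p \<in> param (ch t) ` bx t" using cov by (elim UN_E[OF subst[OF cov, of "\<lambda>X. p \<in> X"]])
      have "ennreal ((f p)\<^sup>2) = ennreal ((f p)\<^sup>2) * indicator (param (ch t) ` bx t) p" using t(2) by simp
      also have "\<dots> \<le> (\<Sum>t\<in>F. ennreal ((f p)\<^sup>2) * indicator (param (ch t) ` bx t) p)"
        by (rule member_le_sum[OF t(1) _ fF]) simp
      finally show "ennreal ((f p)\<^sup>2) \<le> (\<Sum>t\<in>F. ennreal ((f p)\<^sup>2) * indicator (param (ch t) ` bx t) p)" .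
    qed
    also have "\<dots> = (\<Sum>t\<in>F. \<integral>\<^sup>+p\<in>param (ch t) ` bx t. ennreal ((f p)\<^sup>2) \<partial>vol R)"
      by (rule nn_integral_sum) (intro borel_measurable_times_ennreal fm borel_measurable_indicator pm)
    also have "\<dots> \<le> (\<Sum>t\<in>F. ennreal (\<eta> * aform f f) + ennreal (?S t))"
      using Pk f by (intro sum_mono) blast
    also have "\<dots> = (\<Sum>t\<in>F. ennreal (\<eta> * aform f f + ?S t))"
      using \<eta>(1) aff by (intro sum.cong refl ennreal_plus[symmetric]) (auto intro!: sum_nonneg)
    also have "\<dots> = ennreal (\<Sum>t\<in>F. \<eta> * aform f f + ?S t)"
      using \<eta>(1) aff by (intro sum_ennreal add_nonneg_nonneg sum_nonneg) auto
    finally have "bform f f \<le> (\<Sum>t\<in>F. \<eta> * aform f f + ?S t)"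
      using \<eta>(1) aff by (subst (asm) ennreal_le_iff) (auto intro!: add_nonneg_nonneg sum_nonneg)
    also have "\<dots> = real (card F) * \<eta> * aform f f + (\<Sum>t\<in>F. ?S t)" by (simp add: sum.distrib)
    also have "\<dots> \<le> \<epsilon> * aform f f + (\<Sum>t\<in>F. ?S t)" using mult_right_mono[OF \<eta>(2) aff] by simp
    also have "(\<Sum>t\<in>F. ?S t) = (\<Sum>i\<in>I. (l i f)\<^sup>2)"
      unfolding I_def l_def using fF Pk by (subst sum.Sigma) (auto simp: case_prod_unfold)
    finally show "bform f f \<le> \<epsilon> * aform f f + (\<Sum>i\<in>I. (l i f)\<^sup>2)" .
  qed
  ultimately show ?thesis by blast
qed

text \<open>The functionals for all tolerances 1 / (n + 1) are countably many, so one diagonal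
  subsequence makes all of them converge. Applied to differences, the estimate for a single large n
  then has a small energy term and finitely many small functionals.\<close>

lemma rellich:
  assumes f: "\<And>j::nat. f j \<in> test_fun R inn" and K: "\<And>j. aform (f j) (f j) + bform (f j) (f j) \<le> K"
  shows "\<exists>r. strict_mono (r :: nat \<Rightarrow> nat) \<and> (\<forall>e>0. \<exists>N. \<forall>i\<ge>N. \<forall>j\<ge>N. bform (f (r i) - f (r j)) (f (r i) - f (r j)) < e)"
proof -
  interpret form_pair "test_fun R inn" aform bform by (rule form_pair_test_fun[OF order_refl])
  have "\<forall>n. \<exists>Il :: ((('a, 'n) chart \<times> (real^'n) \<times> (real^'n)) \<times> (real^'n) set) set \<times> (((('a, 'n) chart \<times> (real^'n) \<times> (real^'n)) \<times> (real^'n) set) \<Rightarrow> ('a \<Rightarrow> real) \<Rightarrow> real). finite (fst Il) \<and>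
    (\<forall>i\<in>fst Il. (\<forall>f\<in>test_fun R inn. \<forall>g\<in>test_fun R inn. snd Il i (f - g) = snd Il i f - snd Il i g) \<and>
      (\<exists>C\<ge>0. \<forall>f\<in>test_fun R inn. \<bar>snd Il i f\<bar> \<le> C * (1 + bform f f))) \<and>
    (\<forall>f\<in>test_fun R inn. bform f f \<le> (1 / (real n + 1)) * aform f f + (\<Sum>i\<in>fst Il. (snd Il i f)\<^sup>2))"
    (is "\<forall>n. \<exists>Il. ?P n Il")
  proof
    fix n
    have "0 < 1 / (real n + 1)" by simp
    from rellich_functionals[OF this] obtain I :: "((('a, 'n) chart \<times> (real^'n) \<times> (real^'n)) \<times> (real^'n) set) set" and l
      where "?P n (I, l)" unfolding fst_conv snd_conv by (elim exE)
    then show "\<exists>Il. ?P n Il" by (rule exI[of _ "(I, l)"])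
  qed
  from choice[OF this] obtain Il where Il0: "\<And>n. ?P n (Il n)" by (elim exE) blast
  have Il: "\<And>n. finite (fst (Il n))"
    "\<And>n i f g. i \<in> fst (Il n) \<Longrightarrow> f \<in> test_fun R inn \<Longrightarrow> g \<in> test_fun R inn \<Longrightarrow> snd (Il n) i (f - g) = snd (Il n) i f - snd (Il n) i g"
    "\<And>n i. i \<in> fst (Il n) \<Longrightarrow> \<exists>C\<ge>0. \<forall>f\<in>test_fun R inn. \<bar>snd (Il n) i f\<bar> \<le> C * (1 + bform f f)"
    "\<And>n f. f \<in> test_fun R inn \<Longrightarrow> bform f f \<le> (1 / (real n + 1)) * aform f f + (\<Sum>i\<in>fst (Il n). (snd (Il n) i f)\<^sup>2)"
    using Il0 by blast+
  define J where "J = Sigma UNIV (\<lambda>n. fst (Il n))"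
  have cJ: "countable J" unfolding J_def using Il(1) by (intro countable_SIGMA) (auto intro: countable_finite)
  \<comment> \<open>The functionals of all n are enumerated as columns; the value 0 covers the case
    that there are none.\<close>
  define X where "X j k = (if J = {} then 0 else snd (Il (fst (from_nat_into J k))) (snd (from_nat_into J k)) (f j))" for j k
  have "bounded (range (\<lambda>j. X j k))" for k
  proof (cases "J = {}")
    case False
    then have "from_nat_into J k \<in> J" by (rule from_nat_into)
    then have i: "snd (from_nat_into J k) \<in> fst (Il (fst (from_nat_into J k)))" by (auto simp: J_def)
    obtain C where C: "0 \<le> C" "\<And>g. g \<in> test_fun R inn \<Longrightarrow> \<bar>snd (Il (fst (from_nat_into J k))) (snd (from_nat_into J k)) g\<bar> \<le> C * (1 + bform g g)"
      using Il(3)[OF i] by blast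
    have "\<bar>X j k\<bar> \<le> C * (1 + K)" for j
    proof -
      have "\<bar>X j k\<bar> \<le> C * (1 + bform (f j) (f j))" using C(2)[OF f] False by (simp add: X_def)
      also have "\<dots> \<le> C * (1 + K)" using C(1) K[of j] A.nonneg[OF f[of j]] by (intro mult_left_mono) auto
      finally show ?thesis .
    qed
    then show ?thesis unfolding bounded_iff by auto
  qed (simp add: X_def)
  from common_convergent_subsequence[of X, OF this]
  obtain r :: "nat \<Rightarrow> nat" where r: "strict_mono r" "\<And>k. convergent (\<lambda>j. X (r j) k)" by blast
  have conv: "Cauchy (\<lambda>j. snd (Il n) i (f (r j)))" if i: "i \<in> fst (Il n)" for n i
  proof -
    have "(n, i) \<in> J" using i by (simp add: J_def)
    then obtain k where k: "from_nat_into J k = (n, i)" using from_nat_into_surj[OF cJ] by blast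
    have "X j k = snd (Il n) i (f j)" for j using k \<open>(n, i) \<in> J\<close> by (auto simp: X_def)
    then have "convergent (\<lambda>j. snd (Il n) i (f (r j)))" using r(2)[of k] by simp
    then show ?thesis by (rule convergent_Cauchy)
  qed
  have K0: "0 \<le> K" using K[of 0] A.nonneg[OF f[of 0]] B.nonneg[OF f[of 0]] by linarith
  \<comment> \<open>The parallelogram identity: the forms at f - g and f + g sum to twice the forms
    at f and g.\<close>
  have adiff: "aform (f i - f j) (f i - f j) \<le> 4 * K" for i j
  proof -
    have "0 \<le> aform (f i + f j) (f i + f j)" by (rule A.nonneg[OF A.V_add[OF f f]])
    then have "aform (f i - f j) (f i - f j) \<le> 2 * aform (f i) (f i) + 2 * aform (f j) (f j)"
      using f by (simp add: A.quad_add A.quad_diff)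
    also have "\<dots> \<le> 2 * K + 2 * K" using K[of i] K[of j] B.nonneg[OF f] by (intro add_mono) (smt (verit))+
    finally show ?thesis by simp
  qed
  have "\<exists>N. \<forall>i\<ge>N. \<forall>j\<ge>N. bform (f (r i) - f (r j)) (f (r i) - f (r j)) < e" if e: "0 < e" for e
  proof -
    \<comment> \<open>Half of e goes to the energy term, bounded by 4 * K / (n + 1), the other half
      to the functionals, in equal shares \<eta>.\<close>
    obtain n :: nat where n: "4 * K / (real n + 1) < e / 2"
    proof -
      obtain n :: nat where "8 * K / e < real n" using reals_Archimedean2 by blast
      then have "8 * K < real n * e" using e by (simp add: field_simps)
      then have "8 * K < (real n + 1) * e" using e by (simp add: algebra_simps)
      then have "4 * K / (real n + 1) < e / 2" by (simp add: field_simps)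
      then show ?thesis by (rule that)
    qed
    define \<eta> where "\<eta> = e / (2 * (real (card (fst (Il n))) + 1))"
    have \<eta>: "0 < \<eta>" using e by (simp add: \<eta>_def)
    have "\<forall>i\<in>fst (Il n). \<exists>N. \<forall>j\<ge>N. \<forall>k\<ge>N. \<bar>snd (Il n) i (f (r j)) - snd (Il n) i (f (r k))\<bar> < sqrt \<eta>"
      using conv \<eta> by (auto simp: Cauchy_def dist_real_def)
    from bchoice[OF this] obtain N where N: "\<forall>i\<in>fst (Il n). \<forall>j\<ge>N i. \<forall>k\<ge>N i. \<bar>snd (Il n) i (f (r j)) - snd (Il n) i (f (r k))\<bar> < sqrt \<eta>"
      by (elim exE)
    define M where "M = Max (insert 0 (N ` fst (Il n)))"
    have NM: "N i \<le> M" if "i \<in> fst (Il n)" for i unfolding M_def using Il(1) that by (intro Max_ge) auto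
    have "bform (f (r j) - f (r k)) (f (r j) - f (r k)) < e" if jk: "j \<ge> M" "k \<ge> M" for j k
    proof -
      have V: "f (r j) - f (r k) \<in> test_fun R inn" by (rule A.V_diff[OF f f])
      have "bform (f (r j) - f (r k)) (f (r j) - f (r k)) \<le>
        (1 / (real n + 1)) * aform (f (r j) - f (r k)) (f (r j) - f (r k)) + (\<Sum>i\<in>fst (Il n). (snd (Il n) i (f (r j) - f (r k)))\<^sup>2)"
        by (rule Il(4)[OF V])
      also have "\<dots> \<le> (1 / (real n + 1)) * (4 * K) + (\<Sum>i\<in>fst (Il n). \<eta>)"
      proof (intro add_mono mult_left_mono adiff sum_mono)
        fix i assume i: "i \<in> fst (Il n)"
        have "\<bar>snd (Il n) i (f (r j) - f (r k))\<bar> < sqrt \<eta>"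
          using N i NM[OF i] jk by (auto simp: Il(2)[OF i f f])
        then have "\<bar>snd (Il n) i (f (r j) - f (r k))\<bar>\<^sup>2 \<le> (sqrt \<eta>)\<^sup>2" by (intro power_mono) auto
        then show "(snd (Il n) i (f (r j) - f (r k)))\<^sup>2 \<le> \<eta>" using \<eta> by simp
      qed simp
      also have "\<dots> < e / 2 + e / 2"
      proof (rule add_less_le_mono)
        show "1 / (real n + 1) * (4 * K) < e / 2" using n by simp
        show "(\<Sum>i\<in>fst (Il n). \<eta>) \<le> e / 2" using e by (simp add: \<eta>_def field_simps)
      qed
      finally show ?thesis by simp
    qed
    then show ?thesis by blast
  qed
  then show ?thesis using r(1) by blast
qed

lemma compact_form_pair_test_fun:
  assumes \<Omega>: "\<Omega> \<subseteq> inn"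
  shows "compact_form_pair (test_fun R \<Omega>) aform bform"
proof -
  interpret form_pair "test_fun R \<Omega>" aform bform by (rule form_pair_test_fun[OF \<Omega>])
  show ?thesis
  proof unfold_locales
    fix f :: "nat \<Rightarrow> 'a \<Rightarrow> real" and K
    assume f: "\<And>j. f j \<in> test_fun R \<Omega>" and K: "\<And>j. C.nrm (f j) \<le> K"
    have f': "f j \<in> test_fun R inn" for j using f test_fun_mono[OF \<Omega>] by blast
    have "aform (f j) (f j) + bform (f j) (f j) \<le> K\<^sup>2" for j
      using power_mono[OF K[of j] C.nrm_nonneg[OF f], of 2] C.nrm_power2[OF f[of j]] by simp
    from rellich[of f, OF f' this] obtain r :: "nat \<Rightarrow> nat" where r: "strict_mono r"
      "\<forall>e>0. \<exists>N. \<forall>i\<ge>N. \<forall>j\<ge>N. bform (f (r i) - f (r j)) (f (r i) - f (r j)) < e" by blast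
    have "B.qcauchy (f \<circ> r)" unfolding B.qcauchy_def
    proof (intro allI impI)
      fix e :: real assume e: "0 < e"
      then obtain N where N: "\<forall>i\<ge>N. \<forall>j\<ge>N. bform (f (r i) - f (r j)) (f (r i) - f (r j)) < e\<^sup>2" using r(2) by (meson zero_less_power)
      have "B.nrm ((f \<circ> r) i - (f \<circ> r) j) < e" if "i \<ge> N" "j \<ge> N" for i j
        using real_sqrt_less_mono[OF N[rule_format, OF that]] e by (simp add: B.nrm_def)
      then show "\<exists>J. \<forall>i\<ge>J. \<forall>j\<ge>J. B.nrm ((f \<circ> r) i - (f \<circ> r) j) < e" by blast
    qed
    then show "\<exists>r. strict_mono (r :: nat \<Rightarrow> nat) \<and> B.qcauchy (f \<circ> r)" using r(1) by blast
  qed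
qed

end

section \<open>Distance to the boundary\<close>

text \<open>The fundamental theorem of calculus with finitely many exceptional points. The speed is
  not assumed integrable: if its integral is infinite there is nothing to show.\<close>

lemma norm_increment_le_nn_integral:
  fixes y :: "real \<Rightarrow> 'b::euclidean_space"
  assumes S: "finite S" and ab: "a \<le> b" and D: "\<And>t. t \<in> {a<..<b} - S \<Longrightarrow> (y has_vector_derivative D t) (at t)"
    and cD: "continuous_on ({a<..<b} - S) D" and cy: "continuous_on {a..b} y"
  shows "ennreal (norm (y b - y a)) \<le> (\<integral>\<^sup>+t\<in>{a<..<b} - S. ennreal (norm (D t)) \<partial>lborel)"
proof -
  let ?T = "{a<..<b} - S"
  define h where "h t = indicator ?T t *\<^sub>R D t" for t
  have "open ?T" using S by (intro open_Diff finite_imp_closed) auto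
  then have mh: "h \<in> borel_measurable lborel"
    using borel_measurable_continuous_on_indicator[OF _ cD] unfolding h_def[abs_def] by simp
  have eq: "(\<integral>\<^sup>+t\<in>?T. ennreal (norm (D t)) \<partial>lborel) = (\<integral>\<^sup>+t. ennreal (norm (h t)) \<partial>lborel)"
    by (intro nn_integral_cong) (simp add: h_def indicator_def)
  show ?thesis
  proof (cases "(\<integral>\<^sup>+t. ennreal (norm (h t)) \<partial>lborel) < \<infinity>")
    case True
    then have ih: "integrable lborel h" using mh by (intro integrableI_bounded)
    have "(h has_integral (y b - y a)) {a..b}"
    proof (rule fundamental_theorem_of_calculus_interior_strong[OF S ab _ cy])
      show "(y has_vector_derivative h t) (at t)" if "t \<in> ?T" for t using D[OF that] that by (simp add: h_def)
    qed
    then have "(h has_integral (y b - y a)) UNIV"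
      by (rule has_integral_on_superset) (auto simp: h_def)
    then have "y b - y a = integral\<^sup>L lborel h" using has_integral_integral_lborel[OF ih] by (rule has_integral_unique)
    then have "norm (y b - y a) \<le> (\<integral>t. norm (h t) \<partial>lborel)" by (simp add: integral_norm_bound)
    then have "ennreal (norm (y b - y a)) \<le> ennreal (\<integral>t. norm (h t) \<partial>lborel)" by (rule ennreal_leI)
    also have "\<dots> = (\<integral>\<^sup>+t. ennreal (norm (h t)) \<partial>lborel)"
      using ih by (intro nn_integral_eq_integral[symmetric]) auto
    finally show ?thesis unfolding eq .
  next
    case False
    then show ?thesis unfolding eq by (simp add: not_less top_unique)
  qed
qed

section \<open>Lengths of paths that reach the boundary\<close>

context compact_riemannian_mfd begin

text \<open>\<open>speed\<close> uses a chart selected anew at each point of the path. The chain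
  rule through the transition map and the transformation law of the metric bring it back to one
  fixed chart.\<close>

lemma speed_in_chart:
  assumes c: "c \<in> atlas R" and \<gamma>: "path \<gamma>" "path_image \<gamma> \<subseteq> pts R" and t: "t \<in> {0<..<1}" "\<gamma> t \<in> cdom c" "\<gamma> t \<in> inn"
    and v: "((coord c \<circ> \<gamma>) has_vector_derivative v) (at t)"
  shows "speed R \<gamma> t = sqrt (ginner R c (coord c (\<gamma> t)) v v)"
proof -
  define c' where "c' = chart_at R (\<gamma> t)"
  define x where "x = coord c (\<gamma> t)"
  define J where "J = jac c c' x"
  have c': "c' \<in> atlas R" "\<gamma> t \<in> cdom c'" using chart_at[OF subsetD[OF inn_subset t(3)]] by (simp_all add: c'_def)
  have xu: "x \<in> uset c" using inn_iff[OF c t(2)] t(3) by (simp add: x_def)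
  have xo: "x \<in> overlap c c'" using t(2) c'(2) by (simp add: x_def overlap_def)
  have "x \<in> interior halfspace" using xu by (simp add: uset_def interior_halfspace)
  then have dT: "(trans c c' has_derivative (*v) J) (at ((coord c \<circ> \<gamma>) t))"
    using has_derivative_trans[OF c c'(1) xo] at_within_interior[of x halfspace] by (simp add: J_def x_def)
  have dc: "((trans c c' \<circ> (coord c \<circ> \<gamma>)) has_derivative ((*v) J \<circ> (\<lambda>s. s *\<^sub>R v))) (at t)"
    by (rule diff_chain_at[OF v[unfolded has_vector_derivative_def] dT])
  have "(*v) J \<circ> (\<lambda>s. s *\<^sub>R v) = (\<lambda>s. s *\<^sub>R (J *v v))" by (auto simp: matrix_vector_mult_scaleR)
  then have d1: "((trans c c' \<circ> (coord c \<circ> \<gamma>)) has_vector_derivative (J *v v)) (at t)"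
    using dc unfolding has_vector_derivative_def by simp
  have cg: "continuous_on {0<..<1} \<gamma>" using \<gamma>(1) unfolding path_def by (rule continuous_on_subset) auto
  have pg: "\<gamma> \<in> {0<..<1} \<rightarrow> pts R" using \<gamma>(2) by (auto simp: path_image_def)
  have "openin (top_of_set {0<..<1}) ({0<..<1} \<inter> \<gamma> -` cdom c)"
    by (rule continuous_openin_preimage[OF cg pg openin_cdom[OF c]])
  then have op: "open ({0<..<1} \<inter> \<gamma> -` cdom c)" by (rule openin_open_trans) simp
  have "((coord c' \<circ> \<gamma>) has_vector_derivative (J *v v)) (at t)"
  proof (rule has_vector_derivative_transform_within_open[OF d1 op])
    show "t \<in> {0<..<1} \<inter> \<gamma> -` cdom c" using t by auto
    show "(trans c c' \<circ> (coord c \<circ> \<gamma>)) s = (coord c' \<circ> \<gamma>) s" if "s \<in> {0<..<1} \<inter> \<gamma> -` cdom c" for s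
      using that c by (simp add: trans_def)
  qed
  then have vd: "vector_derivative (coord c' \<circ> \<gamma>) (at t) = J *v v" by (rule vector_derivative_at)
  have xc: "trans c c' x = coord c' (\<gamma> t)" using c t(2) by (simp add: x_def trans_def)
  have "ginner R c x v v = (J *v v) \<bullet> (coeff R c' (trans c c' x) *v (J *v v))"
    unfolding ginner_def metric_jac[OF c c'(1) xo] J_def[symmetric]
    by (simp only: inner_matrix_left matrix_vector_mul_assoc matrix_mul_assoc)
  then show ?thesis unfolding speed_def Let_def c'_def[symmetric] vd xc by (simp add: ginner_def x_def)
qed

text \<open>Up to its first exit the path stays in one chart, where it covers a Euclidean distance
  of at least r/2, and the Riemannian speed is at least sqrt m times the Euclidean one. Starting
  within r/2 of the centre makes the bound uniform near the centre.\<close>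

lemma curve_length_lower_bound:
  assumes c: "c \<in> atlas R" and r: "0 < r" "cball x0 r \<subseteq> uset c" and m: "0 < m" "\<And>x v. x \<in> cball x0 r \<Longrightarrow> m * (v \<bullet> v) \<le> ginner R c x v v"
    and \<gamma>: "pw_C1_path R \<gamma>" "pathfinish \<gamma> \<in> bdry R" "pathstart \<gamma> \<in> param c ` ball x0 (r / 2)"
  shows "ennreal (sqrt m * (r / 2)) \<le> curve_length R \<gamma>"
proof -
  obtain S where g: "path \<gamma>" "path_image \<gamma> \<subseteq> pts R" and S: "finite S"
    and C1: "\<forall>c\<in>atlas R. (coord c \<circ> \<gamma>) C1_differentiable_on {t \<in> {0..1} - S. \<gamma> t \<in> cdom c}"
    using \<gamma>(1) unfolding pw_C1_path_def by blast
  obtain D where D: "\<And>t. t \<in> {0..1} - S \<Longrightarrow> \<gamma> t \<in> cdom c \<Longrightarrow> ((coord c \<circ> \<gamma>) has_vector_derivative D t) (at t)"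
    "continuous_on {t \<in> {0..1} - S. \<gamma> t \<in> cdom c} D"
    using bspec[OF C1 c] unfolding C1_differentiable_on_def by auto
  have cg: "continuous_on {0..1} \<gamma>" using g(1) by (simp add: path_def)
  have pg: "\<gamma> \<in> {0..1} \<rightarrow> pts R" using g(2) by (auto simp: path_image_def)
  define Ob where "Ob = param c ` ball x0 r"
  define Kc where "Kc = param c ` cball x0 r"
  have cr: "cball x0 r \<subseteq> crange c" using r(2) uset_subset by (rule order_trans)
  have br: "ball x0 r \<subseteq> crange c" using cr ball_subset_cball by (rule order_trans[rotated])
  have OK: "Ob \<subseteq> Kc" unfolding Ob_def Kc_def by (intro image_mono ball_subset_cball)
  have "openin (top_of_set halfspace) (ball x0 r)"
    by (rule open_subset[OF order_trans[OF br crange_subset[OF c]] open_ball])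
  then have oO: "openin (top_of_set (pts R)) Ob" unfolding Ob_def by (rule openin_param_image[OF c _ br])
  have Kcd: "Kc \<subseteq> cdom c"
  proof
    fix p assume "p \<in> Kc"
    then obtain x where x: "x \<in> cball x0 r" "p = param c x" unfolding Kc_def by (elim imageE)
    show "p \<in> cdom c" unfolding x(2) by (rule param_in[OF subsetD[OF cr x(1)]])
  qed
  have Ki: "Kc \<subseteq> inn"
  proof
    fix p assume "p \<in> Kc"
    then obtain x where x: "x \<in> cball x0 r" "p = param c x" unfolding Kc_def by (elim imageE)
    show "p \<in> inn" unfolding x(2) by (rule param_inn[OF c subsetD[OF r(2) x(1)]])
  qed
  have cK: "compact Kc" unfolding Kc_def
    by (intro compact_continuous_image continuous_on_subset[OF continuous_param[OF c] cr] compact_cball)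
  have cc: "coord c p \<in> cball x0 r" if "p \<in> Kc" for p
  proof -
    obtain x where x: "x \<in> cball x0 r" "p = param c x" using \<open>p \<in> Kc\<close> unfolding Kc_def by (elim imageE)
    show ?thesis unfolding x(2) using x(1) subsetD[OF cr x(1)] by simp
  qed
  define T where "T = {0..1} - ({0..1} \<inter> \<gamma> -` Ob)"
  have "openin (top_of_set {0..1}) ({0..1} \<inter> \<gamma> -` Ob)" by (rule continuous_openin_preimage[OF cg pg oO])
  then have "closedin (top_of_set {0..1}) T" unfolding T_def by (simp add: closedin_diff)
  then have cT: "closed T" by (rule closedin_closed_trans) simp
  have "\<gamma> 1 \<notin> inn" using \<gamma>(2) by (simp add: pathfinish_def inn_def)
  then have T1: "1 \<in> T" using OK Ki by (auto simp: T_def)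
  have Tb: "bdd_below T" by (rule bdd_belowI[of _ 0]) (auto simp: T_def)
  \<comment> \<open>the first time at which the path leaves the ball\<close>
  define s where "s = Inf T"
  have sT: "s \<in> T" unfolding s_def by (rule closed_contains_Inf[OF _ Tb cT]) (use T1 in blast)
  have "\<gamma> 0 \<in> param c ` ball x0 (r / 2)" using \<gamma>(3) by (simp add: pathstart_def)
  then obtain x1 where x1: "x1 \<in> ball x0 (r / 2)" "\<gamma> 0 = param c x1" by (elim imageE)
  have x1r: "x1 \<in> ball x0 r" using x1(1) r(1) by auto
  then have "\<gamma> 0 \<in> Ob" unfolding Ob_def x1(2) by (rule imageI)
  then have s01: "0 < s" "s \<le> 1" using sT by (auto simp: T_def less_le)
  have before: "\<gamma> t \<in> Ob" if "0 \<le> t" "t < s" for t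
  proof (rule ccontr)
    assume "\<gamma> t \<notin> Ob"
    then have "t \<in> T" using that s01 by (auto simp: T_def)
    then have "s \<le> t" unfolding s_def by (rule cInf_lower[OF _ Tb])
    then show False using that by simp
  qed
  \<comment> \<open>The exit point is a limit of points of the open ball, so it lies on the compact
    coordinate ball, still inside the chart, at distance exactly r.\<close>
  have gsK: "\<gamma> s \<in> Kc"
  proof -
    have "continuous_on {0..s} \<gamma>" using cg s01 by (elim continuous_on_subset) auto
    moreover have "closed Kc" using cK by (rule compact_imp_closed)
    moreover have "closure {0..<s} = {0..s}" using s01 by simp
    ultimately have "\<gamma> ` {0..s} \<subseteq> Kc"
      using image_closure_subset[of "{0..<s}" \<gamma> Kc] before subsetD[OF OK] by (simp add: image_subset_iff)
    then show ?thesis using s01 by auto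
  qed
  have gK: "\<gamma> t \<in> Kc" if "t \<in> {0..s}" for t
    using that gsK before OK by (cases "t = s") auto
  have dist_s: "dist x0 (coord c (\<gamma> s)) = r"
  proof -
    have "coord c (\<gamma> s) \<notin> ball x0 r"
    proof
      assume "coord c (\<gamma> s) \<in> ball x0 r"
      then have "param c (coord c (\<gamma> s)) \<in> Ob" unfolding Ob_def by (rule imageI)
      then show False using sT param_coord[OF c subsetD[OF Kcd gsK]] by (auto simp: T_def)
    qed
    then show ?thesis using cc[OF gsK] by simp
  qed
  let ?y = "coord c \<circ> \<gamma>"
  have cy: "continuous_on {0..s} ?y"
  proof (rule continuous_on_compose)
    show "continuous_on {0..s} \<gamma>" using cg s01 by (elim continuous_on_subset) auto
    show "continuous_on (\<gamma> ` {0..s}) (coord c)"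
      by (rule continuous_on_subset[OF continuous_coord[OF c]]) (use gK Kcd in blast)
  qed
  have Dt: "(?y has_vector_derivative D t) (at t)" if "t \<in> {0<..<s} - S" for t
    by (rule D(1)) (use that s01 gK Kcd in auto)
  have cD: "continuous_on ({0<..<s} - S) D"
    by (rule continuous_on_subset[OF D(2)]) (use s01 gK Kcd in auto)
  have "r / 2 \<le> norm (?y s - ?y 0)"
  proof -
    have "?y 0 = x1" using x1 br x1r by (simp add: subset_iff)
    then have "r \<le> dist x0 x1 + norm (?y s - ?y 0)"
      using dist_s dist_triangle[of x0 "coord c (\<gamma> s)" x1] by (simp add: dist_norm norm_minus_commute)
    then show ?thesis using x1(1) by simp
  qed
  then have "ennreal (sqrt m * (r / 2)) \<le> ennreal (sqrt m) * ennreal (norm (?y s - ?y 0))"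
    using m(1) r(1) by (subst ennreal_mult[symmetric]) (auto intro!: ennreal_leI mult_left_mono)
  also have "\<dots> \<le> ennreal (sqrt m) * (\<integral>\<^sup>+t\<in>{0<..<s} - S. ennreal (norm (D t)) \<partial>lborel)"
    by (intro mult_left_mono norm_increment_le_nn_integral[OF S _ Dt cD cy]) (use s01 in auto)
  also have "\<dots> = (\<integral>\<^sup>+t. ennreal (sqrt m) * (ennreal (norm (D t)) * indicator ({0<..<s} - S) t) \<partial>lborel)"
  proof (rule nn_integral_cmult[symmetric])
    have "open ({0<..<s} - S)" using S by (intro open_Diff finite_imp_closed) auto
    then have "(\<lambda>t. indicator ({0<..<s} - S) t *\<^sub>R D t) \<in> borel_measurable lborel"
      using borel_measurable_continuous_on_indicator[OF _ cD] by simp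
    then have "(\<lambda>t. ennreal (norm (indicator ({0<..<s} - S) t *\<^sub>R D t))) \<in> borel_measurable lborel" by measurable
    then show "(\<lambda>t. ennreal (norm (D t)) * indicator ({0<..<s} - S) t) \<in> borel_measurable lborel"
      by (rule measurable_cong[THEN iffD1, rotated]) (simp add: indicator_def)
  qed
  also have "\<dots> \<le> curve_length R \<gamma>" unfolding curve_length_def
  proof (rule nn_integral_mono)
    fix t :: real
    show "ennreal (sqrt m) * (ennreal (norm (D t)) * indicator ({0<..<s} - S) t) \<le> ennreal (speed R \<gamma> t) * indicator {0..1} t"
    proof (cases "t \<in> {0<..<s} - S")
      case True
      then have t: "t \<in> {0<..<1}" "t \<in> {0..s}" using s01 by auto
      note K = gK[OF t(2)]
      have sp: "speed R \<gamma> t = sqrt (ginner R c (coord c (\<gamma> t)) (D t) (D t))"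
        by (rule speed_in_chart[OF c g t(1) subsetD[OF Kcd K] subsetD[OF Ki K] Dt[OF True]])
      have "sqrt m * norm (D t) = sqrt (m * (D t \<bullet> D t))" by (simp add: real_sqrt_mult norm_eq_sqrt_inner)
      also have "\<dots> \<le> speed R \<gamma> t" unfolding sp by (intro real_sqrt_le_mono m(2) cc K)
      finally have "ennreal (sqrt m * norm (D t)) \<le> ennreal (speed R \<gamma> t)" by (rule ennreal_leI)
      then show ?thesis using True t m(1) by (simp add: ennreal_mult)
    qed simp
  qed
  finally show ?thesis .
qed

lemma bdry_dist_lower_bound:
  assumes p: "p \<in> inn"
  shows "\<exists>U t. openin (top_of_set (pts R)) U \<and> p \<in> U \<and> 0 < t \<and> (\<forall>q\<in>U. ennreal t \<le> bdry_dist R q)"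
proof -
  obtain c where c: "c \<in> atlas R" "p \<in> cdom c" using chart_exists subsetD[OF inn_subset p] by blast
  let ?x = "coord c p"
  have "?x \<in> uset c" using inn_iff[OF c] p by simp
  then obtain r where r: "0 < r" "cball ?x r \<subseteq> uset c" using open_uset[OF c(1)] open_contains_cball by blast
  have cr: "cball ?x r \<subseteq> crange c" using r(2) uset_subset by (rule order_trans)
  have cg: "continuous_on (cball ?x r) (\<lambda>x. coeff R c x $ i $ j)" for i j
    by (intro continuous_on_component continuous_on_subset[OF continuous_on_coeff[OF c(1)] cr])
  obtain m where m: "0 < m" "\<And>x v. x \<in> cball ?x r \<Longrightarrow> m * (v \<bullet> v) \<le> v \<bullet> (coeff R c x *v v)"
    using posdef_lower_bound[OF compact_cball cg posdef_coeff(1)[OF c(1) subsetD[OF cr]]] by blast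
  let ?t = "sqrt m * (r / 2)"
  let ?U = "param c ` ball ?x (r / 2)"
  have b: "ball ?x (r / 2) \<subseteq> cball ?x r" using r(1) by (auto simp: subset_iff)
  have "openin (top_of_set (pts R)) ?U"
    by (rule openin_param_image[OF c(1) open_subset[OF _ open_ball]])
      (use b cr crange_subset[OF c(1)] in \<open>blast+\<close>)
  moreover have "p \<in> ?U"
    by (rule image_eqI[of _ _ ?x]) (use param_coord[OF c] r(1) in simp_all)
  moreover have "0 < ?t" using m(1) r(1) by simp
  moreover have "ennreal ?t \<le> bdry_dist R q" if q: "q \<in> ?U" for q
    unfolding bdry_dist_def rdist_def
  proof (intro INF_greatest)
    fix z \<gamma> assume z: "z \<in> bdry R" and \<gamma>: "\<gamma> \<in> {\<gamma>. pw_C1_path R \<gamma> \<and> pathstart \<gamma> = q \<and> pathfinish \<gamma> = z}"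
    show "ennreal ?t \<le> curve_length R \<gamma>"
      by (rule curve_length_lower_bound[OF c(1) r m(1) m(2)[folded ginner_def]]) (use \<gamma> z q in auto)
  qed
  ultimately show ?thesis by blast
qed

lemma compact_subset_trunc:
  assumes K: "compact K" "K \<subseteq> inn"
  shows "\<exists>t0>0. \<forall>t\<le>t0. K \<subseteq> mfd_interior R (trunc R t)"
proof -
  have "\<forall>p\<in>K. \<exists>Wt. open (fst Wt) \<and> p \<in> fst Wt \<and> 0 < snd Wt \<and> (\<forall>q\<in>fst Wt \<inter> pts R. ennreal (snd Wt) \<le> bdry_dist R q)"
  proof
    fix p assume "p \<in> K"
    then have "p \<in> inn" using K(2) by blast
    from bdry_dist_lower_bound[OF this] obtain U t where U: "openin (top_of_set (pts R)) U" "p \<in> U" "0 < t" "\<forall>q\<in>U. ennreal t \<le> bdry_dist R q"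
      by blast
    then obtain W where W: "open W" "U = pts R \<inter> W" by (auto simp: openin_open)
    show "\<exists>Wt. open (fst Wt) \<and> p \<in> fst Wt \<and> 0 < snd Wt \<and> (\<forall>q\<in>fst Wt \<inter> pts R. ennreal (snd Wt) \<le> bdry_dist R q)"
      using U W by (intro exI[of _ "(W, t)"]) auto
  qed
  from bchoice[OF this] obtain Wt where Wt: "\<forall>p\<in>K. open (fst (Wt p)) \<and> p \<in> fst (Wt p) \<and> 0 < snd (Wt p) \<and>
    (\<forall>q\<in>fst (Wt p) \<inter> pts R. ennreal (snd (Wt p)) \<le> bdry_dist R q)" by (elim exE)
  obtain C where C: "C \<subseteq> K" "finite C" "K \<subseteq> (\<Union>p\<in>C. fst (Wt p))"
  proof (rule compactE_image[OF K(1), of K "\<lambda>p. fst (Wt p)"])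
    show "open (fst (Wt p))" if "p \<in> K" for p using Wt that by blast
    show "K \<subseteq> (\<Union>p\<in>K. fst (Wt p))" using Wt by blast
  qed
  \<comment> \<open>The inserted 1 gives the minimum a value when C is empty.\<close>
  define t0 where "t0 = Min (insert 1 ((\<lambda>p. snd (Wt p)) ` C))"
  have "0 < t0" unfolding t0_def using C(1,2) Wt by (subst Min_gr_iff) auto
  moreover have "K \<subseteq> mfd_interior R (trunc R t)" if t: "t \<le> t0" for t
  proof
    fix q assume q: "q \<in> K"
    then obtain p where p: "p \<in> C" "q \<in> fst (Wt p)" using C(3) by blast
    have "t0 \<le> snd (Wt p)" unfolding t0_def using C(2) p(1) by (intro Min_le) auto
    then have le: "ennreal t \<le> ennreal (snd (Wt p))" using t by (intro ennreal_leI) simp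
    have W: "open (fst (Wt p))" "\<forall>z\<in>fst (Wt p) \<inter> pts R. ennreal (snd (Wt p)) \<le> bdry_dist R z"
      using Wt p(1) C(1) by blast+
    have "pts R \<inter> fst (Wt p) \<subseteq> trunc R t" using W(2) le by (auto simp: trunc_def intro: order_trans)
    moreover have "openin (top_of_set (pts R)) (pts R \<inter> fst (Wt p))" using W(1) by blast
    moreover have "q \<in> pts R \<inter> fst (Wt p)" "q \<in> pts R - bdry R" using q K(2) p(2) by (auto simp: inn_def)
    ultimately show "q \<in> mfd_interior R (trunc R t)" unfolding mfd_interior_def by blast
  qed
  ultimately show ?thesis by blast
qed

section \<open>The open sets on which the Dirichlet problems are posed\<close>

lemma mfd_interior_pts: "mfd_interior R (pts R) = inn"
  unfolding mfd_interior_def inn_def by (auto intro!: exI[of _ "pts R"])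

lemma mfd_interior_subset: "mfd_interior R N \<subseteq> inn"
  unfolding mfd_interior_def inn_def by auto

lemma openin_mfd_interior: "openin (top_of_set (pts R)) (mfd_interior R N)"
proof -
  have "mfd_interior R N = inn \<inter> \<Union>{U. openin (top_of_set (pts R)) U \<and> U \<subseteq> N}"
    unfolding mfd_interior_def inn_def by blast
  then show ?thesis using openin_Int[OF openin_inn openin_Union[of "{U. openin (top_of_set (pts R)) U \<and> U \<subseteq> N}"]] by simp
qed

text \<open>An infimum over the empty set is infinite in the extended reals.\<close>

lemma trunc_no_boundary: "bdry R = {} \<Longrightarrow> trunc R t = pts R"
  by (auto simp: trunc_def bdry_dist_def)

end

section \<open>Eigenvalues counted with multiplicity\<close>

lemma (in semi_form) qlim_const_tendsto:
  assumes F: "F \<in> seqs" and G: "G \<in> seqs"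
  shows "(\<lambda>m. qlim F (\<lambda>j. G m)) \<longlonglongrightarrow> qlim F G"
proof -
  interpret W: semi_form seqs qlim by (rule semi_form_seqs)
  have cs: "(\<lambda>j. G m) \<in> seqs" for m using const_seqs seqsD(1)[OF G] by blast
  show ?thesis using W.qconv_left[OF cs G F seqs_const_qconv[OF G]] by (simp add: W.sym[OF _ F] cs G)
qed

context form_pair begin

text \<open>Independence modulo the null space of b, without orthonormality: the abstract
  counterpart of eigenfunctions that are independent almost everywhere.\<close>

definition eigenfamily :: "nat \<Rightarrow> real \<Rightarrow> (nat \<Rightarrow> 'v) \<Rightarrow> bool" where
  "eigenfamily m \<mu> e \<longleftrightarrow> (\<forall>i<m. e i \<in> V \<and> (\<forall>z\<in>V. a (e i) z = \<mu> * b (e i) z)) \<and>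
     (\<forall>\<gamma>. (\<exists>i<m. \<gamma> i \<noteq> 0) \<longrightarrow> 0 < b (\<Sum>i<m. \<gamma> i *\<^sub>R e i) (\<Sum>i<m. \<gamma> i *\<^sub>R e i))"

lemma eigenfamily_le:
  assumes "eigenfamily m \<mu> e" "n \<le> m"
  shows "eigenfamily n \<mu> e"
  unfolding eigenfamily_def
proof (intro conjI allI impI)
  show "e i \<in> V" "\<forall>z\<in>V. a (e i) z = \<mu> * b (e i) z" if "i < n" for i
    using assms that unfolding eigenfamily_def by auto
next
  fix \<gamma> :: "nat \<Rightarrow> real" assume g: "\<exists>i<n. \<gamma> i \<noteq> 0"
  define \<delta> where "\<delta> i = (if i < n then \<gamma> i else 0)" for i
  have "(\<Sum>i<m. \<delta> i *\<^sub>R e i) = (\<Sum>i<n. \<gamma> i *\<^sub>R e i)"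
    using assms(2) by (intro sum.mono_neutral_cong_right) (auto simp: \<delta>_def)
  moreover have "\<exists>i<m. \<delta> i \<noteq> 0" using g assms(2) by (auto simp: \<delta>_def intro: less_le_trans)
  ultimately show "0 < b (\<Sum>i<n. \<gamma> i *\<^sub>R e i) (\<Sum>i<n. \<gamma> i *\<^sub>R e i)"
    using assms(1) unfolding eigenfamily_def by metis
qed

text \<open>Allows families over any finite index set with at least k members; an injection of the
  numbers below k selects the members to use.\<close>

lemma rayleigh_family:
  assumes I: "finite I" "k \<le> card I" and e: "\<And>i. i \<in> I \<Longrightarrow> e i \<in> V"
    and R: "\<And>\<gamma>. (\<exists>i\<in>I. \<gamma> i \<noteq> 0) \<Longrightarrow> 0 < b (\<Sum>i\<in>I. \<gamma> i *\<^sub>R e i) (\<Sum>i\<in>I. \<gamma> i *\<^sub>R e i)"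
    "\<And>\<gamma>. a (\<Sum>i\<in>I. \<gamma> i *\<^sub>R e i) (\<Sum>i\<in>I. \<gamma> i *\<^sub>R e i) \<le> x * b (\<Sum>i\<in>I. \<gamma> i *\<^sub>R e i) (\<Sum>i\<in>I. \<gamma> i *\<^sub>R e i)"
  shows "rayleigh k x"
proof -
  obtain \<phi> where \<phi>: "\<phi> ` {..<k} \<subseteq> I" "inj_on \<phi> {..<k}"
    using card_le_inj[of "{..<k}" I] I by auto
  have "let w = (\<Sum>i<k. \<gamma> i *\<^sub>R e (\<phi> i)) in ((\<exists>i<k. \<gamma> i \<noteq> 0) \<longrightarrow> 0 < b w w) \<and> a w w \<le> x * b w w" for \<gamma>
  proof -
    define \<delta> where "\<delta> i = (if i \<in> \<phi> ` {..<k} then \<gamma> (inv_into {..<k} \<phi> i) else 0)" for i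
    have d: "\<delta> (\<phi> i) = \<gamma> i" if "i < k" for i using that \<phi>(2) by (auto simp: \<delta>_def)
    have "(\<Sum>i\<in>I. \<delta> i *\<^sub>R e i) = (\<Sum>i\<in>\<phi> ` {..<k}. \<delta> i *\<^sub>R e i)"
      using I(1) \<phi>(1) by (intro sum.mono_neutral_right) (auto simp: \<delta>_def)
    also have "\<dots> = (\<Sum>i<k. \<gamma> i *\<^sub>R e (\<phi> i))" unfolding sum.reindex[OF \<phi>(2)] by (intro sum.cong) (auto simp: d)
    finally have w: "(\<Sum>i\<in>I. \<delta> i *\<^sub>R e i) = (\<Sum>i<k. \<gamma> i *\<^sub>R e (\<phi> i))" .
    have "\<exists>i\<in>I. \<delta> i \<noteq> 0" if "\<exists>i<k. \<gamma> i \<noteq> 0" using that d \<phi>(1) by force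
    then show ?thesis using R[of \<delta>] unfolding Let_def w by blast
  qed
  moreover have "\<forall>i<k. e (\<phi> i) \<in> V" using e \<phi>(1) by auto
  ultimately show ?thesis unfolding rayleigh_def by (intro exI[of _ "\<lambda>i. e (\<phi> i)"] conjI) auto
qed

text \<open>Eigenvectors of different eigenvalues are b-orthogonal, so the dimensions of the
  families add up, and on their sum the quotient is at most the largest eigenvalue.\<close>

lemma rayleigh_eigenfamilies:
  assumes S: "finite S" "\<And>\<mu>. \<mu> \<in> S \<Longrightarrow> \<mu> \<le> x" and e: "\<And>\<mu>. \<mu> \<in> S \<Longrightarrow> eigenfamily (n \<mu>) \<mu> (e \<mu>)"
    and k: "k \<le> (\<Sum>\<mu>\<in>S. n \<mu>)"
  shows "rayleigh k x"
proof (rule rayleigh_family)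
  let ?I = "Sigma S (\<lambda>\<mu>. {..<n \<mu>})"
  let ?e = "\<lambda>i. e (fst i) (snd i)"
  show "finite ?I" using S(1) by simp
  show "k \<le> card ?I" using k S(1) by simp
  have eV: "e \<mu> i \<in> V" "\<And>z. z \<in> V \<Longrightarrow> a (e \<mu> i) z = \<mu> * b (e \<mu> i) z" if "\<mu> \<in> S" "i < n \<mu>" for \<mu> i
    using e[OF that(1)] that(2) unfolding eigenfamily_def by auto
  show "?e i \<in> V" if "i \<in> ?I" for i using that eV by auto
  fix \<gamma> :: "real \<times> nat \<Rightarrow> real"
  define w where "w \<mu> = (\<Sum>i<n \<mu>. \<gamma> (\<mu>, i) *\<^sub>R e \<mu> i)" for \<mu>
  have wV: "w \<mu> \<in> V" if "\<mu> \<in> S" for \<mu> unfolding w_def using eV[OF that] by (intro A.V_sum A.V_scale) auto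
  have wE: "a (w \<mu>) z = \<mu> * b (w \<mu>) z" if "\<mu> \<in> S" "z \<in> V" for \<mu> z
  proof -
    have "a (w \<mu>) z = (\<Sum>i<n \<mu>. \<gamma> (\<mu>, i) * a (e \<mu> i) z)"
      unfolding w_def by (rule A.lincomb_left) (use eV[OF that(1)] that(2) in auto)
    also have "\<dots> = \<mu> * (\<Sum>i<n \<mu>. \<gamma> (\<mu>, i) * b (e \<mu> i) z)"
      using eV[OF that(1)] that(2) by (simp add: sum_distrib_left mult_ac)
    also have "(\<Sum>i<n \<mu>. \<gamma> (\<mu>, i) * b (e \<mu> i) z) = b (w \<mu>) z"
      unfolding w_def by (rule B.lincomb_left[symmetric]) (use eV[OF that(1)] that(2) in auto)
    finally show ?thesis .
  qed
  \<comment> \<open>The factor 1 presents the vector as a linear combination of one eigenvector w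
    \<mu> per eigenvalue, the form in which the quotient estimate and \<open>B.lincomb\<close>
    apply.\<close>
  have sum: "(\<Sum>i\<in>?I. \<gamma> i *\<^sub>R ?e i) = (\<Sum>\<mu>\<in>S. 1 *\<^sub>R w \<mu>)"
    unfolding w_def using S(1) by (simp add: sum.Sigma case_prod_unfold)
  show "a (\<Sum>i\<in>?I. \<gamma> i *\<^sub>R ?e i) (\<Sum>i\<in>?I. \<gamma> i *\<^sub>R ?e i) \<le> x * b (\<Sum>i\<in>?I. \<gamma> i *\<^sub>R ?e i) (\<Sum>i\<in>?I. \<gamma> i *\<^sub>R ?e i)"
    by (rule eigenvectors_quotient_le[OF wV wE S(2) sum])
  assume "\<exists>i\<in>?I. \<gamma> i \<noteq> 0"
  then obtain \<nu> i where \<nu>: "\<nu> \<in> S" "i < n \<nu>" "\<gamma> (\<nu>, i) \<noteq> 0" by auto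
  have "0 < b (w \<nu>) (w \<nu>)"
    using e[OF \<nu>(1)] \<nu>(2,3) unfolding eigenfamily_def w_def by (auto dest!: spec[of _ "\<lambda>i. \<gamma> (\<nu>, i)"])
  also have "\<dots> \<le> (\<Sum>\<mu>\<in>S. b (w \<mu>) (w \<mu>))"
    using S(1) \<nu>(1) B.nonneg[OF wV] by (intro member_le_sum) auto
  also have "\<dots> = (\<Sum>\<mu>\<in>S. \<Sum>\<nu>\<in>S. b (w \<mu>) (w \<nu>))"
  proof (intro sum.cong refl)
    fix \<mu> assume \<mu>: "\<mu> \<in> S"
    have "b (w \<mu>) (w \<nu>) = 0" if "\<nu> \<in> S" "\<nu> \<noteq> \<mu>" for \<nu>
      by (rule eigenvectors_orthogonal[of _ _ \<mu> \<nu>]) (use \<mu> that wV wE in auto)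
    then have "(\<Sum>\<nu>\<in>S. b (w \<mu>) (w \<nu>)) = (\<Sum>\<nu>\<in>{\<mu>}. b (w \<mu>) (w \<nu>))"
      using S(1) \<mu> by (intro sum.mono_neutral_right) auto
    then show "b (w \<mu>) (w \<mu>) = (\<Sum>\<nu>\<in>S. b (w \<mu>) (w \<nu>))" by simp
  qed
  also have "\<dots> = b (\<Sum>\<mu>\<in>S. 1 *\<^sub>R w \<mu>) (\<Sum>\<mu>\<in>S. 1 *\<^sub>R w \<mu>)"
    by (subst B.lincomb) (use wV in auto)
  finally show "0 < b (\<Sum>i\<in>?I. \<gamma> i *\<^sub>R ?e i) (\<Sum>i\<in>?I. \<gamma> i *\<^sub>R ?e i)" unfolding sum .
qed

lemma eigensystem_eigenfamily:
  assumes E: "eigensystem k u \<mu>"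
  shows "\<exists>e. eigenfamily (card {i. i < k \<and> \<mu> i = \<nu>}) \<nu> e"
proof -
  let ?I = "{i. i < k \<and> \<mu> i = \<nu>}"
  obtain \<phi> where \<phi>: "bij_betw \<phi> {..<card ?I} ?I" using ex_bij_betw_nat_finite[of ?I] by (auto simp: atLeast0LessThan)
  have \<phi>I: "\<phi> i < k" "\<mu> (\<phi> i) = \<nu>" if "i < card ?I" for i using bij_betwE[OF \<phi>] that by auto
  have uV: "u i \<in> V" "\<And>z. z \<in> V \<Longrightarrow> a (u i) z = \<mu> i * b (u i) z" if "i < k" for i using E that unfolding eigensystem_def by auto
  have uo: "b (u i) (u j) = (if i = j then 1 else 0)" if "i < k" "j < k" for i j using E that unfolding eigensystem_def by auto
  have "eigenfamily (card ?I) \<nu> (u \<circ> \<phi>)" unfolding eigenfamily_def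
  proof (intro conjI allI impI ballI)
    show "(u \<circ> \<phi>) i \<in> V" if "i < card ?I" for i using uV \<phi>I[OF that] by simp
    show "a ((u \<circ> \<phi>) i) z = \<nu> * b ((u \<circ> \<phi>) i) z" if "i < card ?I" "z \<in> V" for i z using uV(2)[OF \<phi>I(1)[OF that(1)] that(2)] \<phi>I[OF that(1)] by simp
    fix \<gamma> :: "nat \<Rightarrow> real" assume "\<exists>i<card ?I. \<gamma> i \<noteq> 0"
    then have "0 < (\<Sum>i<card ?I. (\<gamma> i)\<^sup>2)" by (auto intro!: sum_pos2)
    also have "\<dots> = (\<Sum>i<card ?I. \<Sum>j<card ?I. \<gamma> i * \<gamma> j * b ((u \<circ> \<phi>) i) ((u \<circ> \<phi>) j))"
    proof (intro sum.cong refl)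
      fix i assume i: "i \<in> {..<card ?I}"
      have "b ((u \<circ> \<phi>) i) ((u \<circ> \<phi>) j) = (if j = i then 1 else 0)" if "j < card ?I" for j
        using uo[OF \<phi>I(1) \<phi>I(1), of i j] i that bij_betw_imp_inj_on[OF \<phi>] by (auto simp: inj_on_def)
      then have "(\<Sum>j<card ?I. \<gamma> i * \<gamma> j * b ((u \<circ> \<phi>) i) ((u \<circ> \<phi>) j)) = (\<Sum>j<card ?I. if j = i then \<gamma> i * \<gamma> j else 0)"
        by (intro sum.cong) auto
      then show "(\<gamma> i)\<^sup>2 = (\<Sum>j<card ?I. \<gamma> i * \<gamma> j * b ((u \<circ> \<phi>) i) ((u \<circ> \<phi>) j))"
        using i by (simp add: power2_eq_square)
    qed
    also have "\<dots> = b (\<Sum>i<card ?I. \<gamma> i *\<^sub>R (u \<circ> \<phi>) i) (\<Sum>i<card ?I. \<gamma> i *\<^sub>R (u \<circ> \<phi>) i)"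
      using uV \<phi>I by (subst B.lincomb) auto
    finally show "0 < b (\<Sum>i<card ?I. \<gamma> i *\<^sub>R (u \<circ> \<phi>) i) (\<Sum>i<card ?I. \<gamma> i *\<^sub>R (u \<circ> \<phi>) i)" .
  qed
  then show ?thesis by blast
qed

end

text \<open>Multiplicities may be infinite a priori; a finite part of each already accounts for
  k.\<close>

lemma enat_le_sum_choose:
  assumes S: "finite S" and k: "enat k \<le> (\<Sum>\<mu>\<in>S. M \<mu>)"
  shows "\<exists>n. (\<forall>\<mu>\<in>S. enat (n \<mu>) \<le> M \<mu>) \<and> k \<le> (\<Sum>\<mu>\<in>S. n \<mu>)"
proof -
  \<comment> \<open>An infinite multiplicity alone provides k, so k is a sufficient finite
    substitute.\<close>
  define n where "n \<mu> = (case M \<mu> of enat m \<Rightarrow> m | \<infinity> \<Rightarrow> k)" for \<mu>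
  have n: "enat (n \<mu>) \<le> M \<mu>" for \<mu> by (cases "M \<mu>") (simp_all add: n_def)
  have "k \<le> (\<Sum>\<mu>\<in>S. n \<mu>)"
  proof (cases "\<exists>\<mu>\<in>S. M \<mu> = \<infinity>")
    case True
    then obtain \<mu> where \<mu>: "\<mu> \<in> S" "M \<mu> = \<infinity>" by blast
    then have "k = n \<mu>" by (simp add: n_def)
    also have "\<dots> \<le> (\<Sum>\<mu>\<in>S. n \<mu>)" using S \<mu>(1) by (intro member_le_sum) auto
    finally show ?thesis .
  next
    case False
    have "M \<mu> = enat (n \<mu>)" if "\<mu> \<in> S" for \<mu> using False that by (cases "M \<mu>") (auto simp: n_def)
    then have "(\<Sum>\<mu>\<in>S. M \<mu>) = (\<Sum>\<mu>\<in>S. enat (n \<mu>))" by (intro sum.cong) auto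
    also have "\<dots> = enat (\<Sum>\<mu>\<in>S. n \<mu>)" using S by (induction S rule: finite_induct) (auto simp: zero_enat_def)
    finally show ?thesis using k by simp
  qed
  then show ?thesis using n by blast
qed

text \<open>Being at least \<open>Suc m\<close> means exceeding m, and a strict lower bound of a
  supremum is exceeded by a member.\<close>

lemma enat_le_Sup_choose:
  assumes "enat n \<le> Sup X" "X \<noteq> {}"
  shows "\<exists>y\<in>X. enat n \<le> y"
proof (cases n)
  case 0
  then show ?thesis using assms(2) by (auto simp: zero_enat_def[symmetric])
next
  case (Suc m)
  then have "enat m < Sup X" using assms(1) by (metis enat_ord_simps(2) less_le_trans lessI)
  then obtain y where "y \<in> X" "enat m < y" by (auto simp: less_Sup_iff)
  then show ?thesis unfolding Suc by (intro bexI[of _ y]) (auto simp: Suc_ile_eq)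
qed

lemma semi_form_L2:
  "semi_form {f \<in> borel_measurable M. integrable M (\<lambda>x. (f x)\<^sup>2 :: real)} (\<lambda>f g. \<integral>x. f x * g x \<partial>M)"
proof -
  let ?V = "{f \<in> borel_measurable M. integrable M (\<lambda>x. (f x)\<^sup>2 :: real)}"
  have prod: "integrable M (\<lambda>x. f x * g x)" if f: "f \<in> ?V" and g: "g \<in> ?V" for f g
  proof (rule Bochner_Integration.integrable_bound)
    show "integrable M (\<lambda>x. (f x)\<^sup>2 + (g x)\<^sup>2)" using f g by auto
    show "(\<lambda>x. f x * g x) \<in> borel_measurable M" by (rule borel_measurable_times) (use f g in auto)
    have "\<bar>u * v\<bar> \<le> u\<^sup>2 + v\<^sup>2" for u v :: real
    proof -
      have "2 * \<bar>u\<bar> * \<bar>v\<bar> \<le> u\<^sup>2 + v\<^sup>2" using sum_squares_bound[of "\<bar>u\<bar>" "\<bar>v\<bar>"] by simp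
      moreover have "0 \<le> \<bar>u\<bar> * \<bar>v\<bar>" by simp
      ultimately show ?thesis unfolding abs_mult by linarith
    qed
    then show "AE x in M. norm (f x * g x) \<le> norm ((f x)\<^sup>2 + (g x)\<^sup>2)" by simp
  qed
  show ?thesis
  proof
    show "subspace ?V"
    proof (rule subspaceI)
      fix f g assume f: "f \<in> ?V" and g: "g \<in> ?V"
      have "integrable M (\<lambda>x. (f x)\<^sup>2 + 2 * (f x * g x) + (g x)\<^sup>2)"
        using f g prod[OF f g] by (intro Bochner_Integration.integrable_add integrable_mult_right) auto
      then show "f + g \<in> ?V" using f g by (auto simp: plus_fun_def power2_sum algebra_simps)
    next
      fix f and r :: real assume f: "f \<in> ?V"
      then show "r *\<^sub>R f \<in> ?V" by (auto simp: scaleR_fun_def power_mult_distrib)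
    qed (simp add: zero_fun_def)
    fix f g h and r :: real assume f: "f \<in> ?V" and g: "g \<in> ?V" and h: "h \<in> ?V"
    show "(\<integral>x. (f + g) x * h x \<partial>M) = (\<integral>x. f x * h x \<partial>M) + (\<integral>x. g x * h x \<partial>M)"
      using prod[OF f h] prod[OF g h] by (simp add: distrib_right)
    show "(\<integral>x. (r *\<^sub>R f) x * g x \<partial>M) = r * (\<integral>x. f x * g x \<partial>M)" by (simp add: mult.assoc)
    show "(\<integral>x. f x * g x \<partial>M) = (\<integral>x. g x * f x \<partial>M)" by (simp add: mult.commute)
    show "0 \<le> (\<integral>x. f x * f x \<partial>M)" by simp
  qed
qed

section \<open>The Dirichlet spectrum\<close>

lemma (in semi_form) qconv_both:
  assumes f: "\<And>j. f j \<in> V" "u \<in> V" "qconv f u" and g: "\<And>j. g j \<in> V" "v \<in> V" "qconv g v"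
  shows "(\<lambda>j. q (f j) (g j)) \<longlonglongrightarrow> q u v"
proof (rule LIM_zero_cancel, rule Lim_null_comparison)
  show "(\<lambda>j. nrm (f j - u) * nrm (g j - v) + nrm (f j - u) * nrm v + nrm u * nrm (g j - v)) \<longlonglongrightarrow> 0"
    using f(3) g(3) unfolding qconv_def by (auto intro!: tendsto_eq_intros)
  have "norm (q (f j) (g j) - q u v) \<le> nrm (f j - u) * nrm (g j - v) + nrm (f j - u) * nrm v + nrm u * nrm (g j - v)" for j
  proof -
    have "q (f j) (g j) - q u v = q (f j - u) (g j - v) + q (f j - u) v + q u (g j - v)"
      using f(1)[of j] f(2) g(1)[of j] g(2) by (simp add: diff_left diff_right V_diff)
    then show ?thesis
      using abs_le_nrm[OF V_diff[OF f(1)[of j] f(2)] V_diff[OF g(1)[of j] g(2)]] abs_le_nrm[OF V_diff[OF f(1)[of j] f(2)] g(2)]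
        abs_le_nrm[OF f(2) V_diff[OF g(1)[of j] g(2)]] by simp
  qed
  then show "\<forall>\<^sub>F j in sequentially. norm (q (f j) (g j) - q u v) \<le> nrm (f j - u) * nrm (g j - v) + nrm (f j - u) * nrm v + nrm u * nrm (g j - v)"
    by (intro always_eventually allI)
qed

lemma (in semi_form) qconv_qcauchy:
  assumes f: "\<And>j. f j \<in> V" "u \<in> V" "qconv f u"
  shows "qcauchy f"
  unfolding qcauchy_def
proof (intro allI impI)
  fix e :: real assume "0 < e"
  then obtain J where J: "\<forall>j\<ge>J. nrm (f j - u) < e/2"
    using order_tendstoD(2)[OF f(3)[unfolded qconv_def], of "e/2"] by (auto simp: eventually_sequentially)
  have "nrm (f i - f j) < e" if "i \<ge> J" "j \<ge> J" for i j
    using nrm_triangle[OF f(1) f(2) f(1), of i j] nrm_minus_commute[OF f(1) f(2), of j] J[rule_format, OF that(1)] J[rule_format, OF that(2)] by simp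
  then show "\<exists>J. \<forall>i\<ge>J. \<forall>j\<ge>J. nrm (f i - f j) < e" by blast
qed

context compact_riemannian_mfd begin

definition lsq :: "('a \<Rightarrow> real) set" where
  "lsq = {f \<in> borel_measurable (vol R). integrable (vol R) (\<lambda>p. (f p)\<^sup>2)}"

definition ip :: "('a \<Rightarrow> real) \<Rightarrow> ('a \<Rightarrow> real) \<Rightarrow> real" where
  "ip f g = (\<integral>p. f p * g p \<partial>vol R)"

sublocale Q: semi_form lsq ip
  unfolding lsq_def ip_def[abs_def] by (rule semi_form_L2)

lemma lsqD: "f \<in> lsq \<Longrightarrow> f \<in> borel_measurable (vol R)" "f \<in> lsq \<Longrightarrow> integrable (vol R) (\<lambda>p. (f p)\<^sup>2)"
  by (simp_all add: lsq_def)

lemma ip_zero_iff: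
  assumes "f \<in> lsq"
  shows "ip f f = 0 \<longleftrightarrow> (AE p in vol R. f p = 0)"
  using integral_nonneg_eq_0_iff_AE[OF lsqD(2)[OF assms]] by (simp add: ip_def power2_eq_square)

text \<open>Cut off outside the interior, so that for a test function it is measurable and square
  integrable on the whole manifold.\<close>

definition lapf :: "('a \<Rightarrow> real) \<Rightarrow> 'a \<Rightarrow> real" where
  "lapf f p = indicator inn p * laplacian R f p"

end

locale dirichlet_domain = compact_riemannian_mfd R for R :: "('a::t2_space, 'n::finite) rmfd" +
  fixes \<Omega> :: "'a set"
  assumes dom_subset: "\<Omega> \<subseteq> inn" and openin_dom: "openin (top_of_set (pts R)) \<Omega>"
begin

sublocale compact_form_pair "test_fun R \<Omega>" aform bform
  by (rule compact_form_pair_test_fun[OF dom_subset])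

sublocale W: complete_form_pair C.seqs A.qlim B.qlim
  by (rule complete_form_pair_seqs)

lemma dom_sets: "\<Omega> \<in> sets (vol R)"
  unfolding sets_vol_iff using openin_pts_borel[OF openin_dom] openin_imp_subset[OF openin_dom] by blast

lemma test_fun_zero: "f \<in> test_fun R \<Omega> \<Longrightarrow> p \<in> pts R - \<Omega> \<Longrightarrow> f p = 0"
  using test_funD(2)[OF _ dom_subset, of f] by blast

lemma test_fun_lsq: "f \<in> test_fun R \<Omega> \<Longrightarrow> f \<in> lsq"
  unfolding lsq_def
  using test_fun_measurable[OF _ dom_subset, of f] nn_integral_test_fun_sq[OF _ dom_subset, of f]
  by (auto intro!: integrableI_nn_integral_finite)

lemma bform_eq: "f \<in> test_fun R \<Omega> \<Longrightarrow> bform f g = ip f g"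
  unfolding bform_def ip_def set_lebesgue_integral_def
  using test_fun_zero[of f] dom_subset by (intro Bochner_Integration.integral_cong) (auto simp: indicator_def)

lemma lapf_lsq:
  assumes f: "f \<in> test_fun R \<Omega>"
  shows "lapf f \<in> lsq"
proof -
  obtain K where K: "compact K" "K \<subseteq> inn" "\<And>p. p \<in> pts R - K \<Longrightarrow> f p = 0" using test_funD(2)[OF f dom_subset] by blast
  note s = test_funD(1)[OF f dom_subset]
  have "lapf f \<in> borel_measurable (vol R)"
    unfolding lapf_def[abs_def] using indicator_inn_measurable[OF continuous_on_laplacian[OF s]] by simp
  moreover have "set_integrable (vol R) inn (\<lambda>p. (laplacian R f p)\<^sup>2)"
    by (rule set_integrable_inn[OF continuous_on_power[OF continuous_on_laplacian[OF s]] K(1,2)])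
      (use laplacian_zero[OF s K(1,3)] in simp)
  moreover have "(\<lambda>p. indicator inn p *\<^sub>R (laplacian R f p)\<^sup>2) = (\<lambda>p. (lapf f p)\<^sup>2)"
    by (auto simp: lapf_def indicator_def)
  ultimately show ?thesis by (simp add: lsq_def set_integrable_def)
qed

lemma ip_lapf:
  assumes f: "f \<in> test_fun R \<Omega>" and g: "g \<in> test_fun R \<Omega>"
  shows "ip g (lapf f) = - aform g f"
proof -
  obtain K where K: "compact K" "K \<subseteq> inn" "\<And>p. p \<in> pts R - K \<Longrightarrow> g p = 0" using test_funD(2)[OF g dom_subset] by blast
  have "ip g (lapf f) = (LINT p:inn|vol R. g p * laplacian R f p)"
    unfolding ip_def lapf_def set_lebesgue_integral_def by (intro Bochner_Integration.integral_cong) auto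
  then show ?thesis
    unfolding aform_def using green[OF test_funD(1)[OF f dom_subset] test_funD(1)[OF g dom_subset] K] by simp
qed

text \<open>Membership in \<open>L2 R \<Omega>\<close> controls integrability on \<Omega> only;
  extension by zero embeds these functions into the square integrable functions of the
  manifold.\<close>

definition cut :: "('a \<Rightarrow> real) \<Rightarrow> 'a \<Rightarrow> real" where
  "cut u p = indicator \<Omega> p * u p"

lemma integral_cut_laplacian: "(LINT p:\<Omega>|vol R. u p * - laplacian R f p) = - ip (cut u) (lapf f)"
proof -
  have "(LINT p:\<Omega>|vol R. u p * - laplacian R f p) = (\<integral>p. - (cut u p * lapf f p) \<partial>vol R)"
    unfolding set_lebesgue_integral_def
    using dom_subset by (intro Bochner_Integration.integral_cong) (auto simp: cut_def lapf_def indicator_def)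
  then show ?thesis by (simp add: ip_def)
qed

lemma integral_cut: "(LINT p:\<Omega>|vol R. u p * f p) = ip (cut u) f"
  unfolding set_lebesgue_integral_def ip_def by (simp add: cut_def mult.assoc)

lemma cut_measurable: "u \<in> borel_measurable (vol R) \<Longrightarrow> cut u \<in> borel_measurable (vol R)"
  unfolding cut_def[abs_def] using dom_sets by (intro borel_measurable_times borel_measurable_indicator)

lemma L2_iff: "u \<in> L2 R \<Omega> \<longleftrightarrow> u \<in> borel_measurable (vol R) \<and> cut u \<in> lsq"
proof -
  have "(\<lambda>p. indicator \<Omega> p *\<^sub>R (u p)\<^sup>2) = (\<lambda>p. (cut u p)\<^sup>2)" by (auto simp: cut_def indicator_def)
  then show ?thesis using cut_measurable by (auto simp: L2_def lsq_def set_integrable_def)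
qed

lemma integral_diff_cut:
  assumes f: "f \<in> test_fun R \<Omega>"
  shows "(LINT p:\<Omega>|vol R. (f p - u p)\<^sup>2) = ip (f - cut u) (f - cut u)"
  unfolding set_lebesgue_integral_def ip_def
  using test_fun_zero[OF f] by (intro Bochner_Integration.integral_cong) (auto simp: cut_def indicator_def power2_eq_square)

lemma qconv_cut_iff:
  assumes f: "\<And>j. f j \<in> test_fun R \<Omega>" and u: "cut u \<in> lsq"
  shows "Q.qconv f (cut u) \<longleftrightarrow> (\<lambda>j. LINT p:\<Omega>|vol R. (f j p - u p)\<^sup>2) \<longlonglongrightarrow> 0"
proof -
  have n: "(Q.nrm (f j - cut u))\<^sup>2 = (LINT p:\<Omega>|vol R. (f j p - u p)\<^sup>2)" for j
    unfolding integral_diff_cut[OF f] by (rule Q.nrm_power2[OF Q.V_diff[OF test_fun_lsq[OF f] u]])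
  have r: "Q.nrm (f j - cut u) = sqrt (LINT p:\<Omega>|vol R. (f j p - u p)\<^sup>2)" for j
    unfolding integral_diff_cut[OF f] Q.nrm_def ..
  show ?thesis unfolding Q.qconv_def
  proof
    assume "(\<lambda>j. Q.nrm (f j - cut u)) \<longlonglongrightarrow> 0"
    from tendsto_power[OF this, of 2] show "(\<lambda>j. LINT p:\<Omega>|vol R. (f j p - u p)\<^sup>2) \<longlonglongrightarrow> 0" unfolding n by simp
  next
    assume "(\<lambda>j. LINT p:\<Omega>|vol R. (f j p - u p)\<^sup>2) \<longlonglongrightarrow> 0"
    from tendsto_real_sqrt[OF this] show "(\<lambda>j. Q.nrm (f j - cut u)) \<longlonglongrightarrow> 0" unfolding r by simp
  qed
qed

lemma integral_grad_sq:
  assumes h: "h \<in> test_fun R \<Omega>"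
  shows "(LINT p:\<Omega>|vol R. grad_sq R h p) = aform h h"
proof -
  obtain K where K: "compact K" "K \<subseteq> \<Omega>" "\<And>p. p \<in> pts R - K \<Longrightarrow> h p = 0" using test_funD(2)[OF h dom_subset] by blast
  show ?thesis unfolding aform_def set_lebesgue_integral_def
  proof (intro Bochner_Integration.integral_cong refl)
    fix p
    show "indicator \<Omega> p *\<^sub>R grad_sq R h p = indicator inn p *\<^sub>R grad_ip h h p"
    proof (cases "p \<in> inn")
      case True
      have "grad_ip h h p = 0" if "p \<notin> \<Omega>" by (rule grad_ip_zero(1)[OF K(1,3)]) (use that True K(2) in auto)
      then show ?thesis using True grad_sq_eq[OF True] by (auto simp: indicator_def)
    qed (use dom_subset in \<open>auto simp: indicator_def\<close>)
  qed
qed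

lemma B_nrm_eq: "f \<in> test_fun R \<Omega> \<Longrightarrow> B.nrm f = Q.nrm f"
  by (simp add: B.nrm_def Q.nrm_def bform_eq)

lemma A_qcauchy_iff:
  assumes f: "\<And>j::nat. f j \<in> test_fun R \<Omega>"
  shows "A.qcauchy f \<longleftrightarrow> (\<forall>e>0. \<exists>J. \<forall>i\<ge>J. \<forall>j\<ge>J. (LINT p:\<Omega>|vol R. grad_sq R (\<lambda>q. f i q - f j q) p) < e)"
proof -
  have eq: "(LINT p:\<Omega>|vol R. grad_sq R (\<lambda>q. f i q - f j q) p) = aform (f i - f j) (f i - f j)" for i j
    using integral_grad_sq[OF A.V_diff[OF f f]] by (simp add: fun_diff_def)
  show ?thesis unfolding eq A.qcauchy_def A.nrm_def
  proof (intro iffI allI impI)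
    fix e :: real
    assume c: "\<forall>e>0. \<exists>J. \<forall>i\<ge>J. \<forall>j\<ge>J. sqrt (aform (f i - f j) (f i - f j)) < e" and e: "0 < e"
    then obtain J where "\<forall>i\<ge>J. \<forall>j\<ge>J. sqrt (aform (f i - f j) (f i - f j)) < sqrt e" by (meson real_sqrt_gt_0_iff)
    then show "\<exists>J. \<forall>i\<ge>J. \<forall>j\<ge>J. aform (f i - f j) (f i - f j) < e" by auto
  next
    fix e :: real
    assume c: "\<forall>e>0. \<exists>J. \<forall>i\<ge>J. \<forall>j\<ge>J. aform (f i - f j) (f i - f j) < e" and e: "0 < e"
    then obtain J where J: "\<forall>i\<ge>J. \<forall>j\<ge>J. aform (f i - f j) (f i - f j) < e\<^sup>2" by (meson zero_less_power)
    have "sqrt (aform (f i - f j) (f i - f j)) < e" if "i \<ge> J" "j \<ge> J" for i j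
      using real_sqrt_less_mono[OF J[rule_format, OF that]] e by simp
    then show "\<exists>J. \<forall>i\<ge>J. \<forall>j\<ge>J. sqrt (aform (f i - f j) (f i - f j)) < e" by blast
  qed
qed

lemma B_qcauchy_iff: "(\<And>j. f j \<in> test_fun R \<Omega>) \<Longrightarrow> B.qcauchy f \<longleftrightarrow> Q.qcauchy f"
  by (simp add: B.qcauchy_def Q.qcauchy_def B_nrm_eq A.V_diff)

text \<open>An approximating sequence in the definition is Cauchy for a by requirement and for b
  because it converges, so it is an element of the abstract completion.\<close>

lemma H10_iff: "u \<in> H10 R \<Omega> \<longleftrightarrow> u \<in> borel_measurable (vol R) \<and> cut u \<in> lsq \<and> (\<exists>F\<in>C.seqs. Q.qconv F (cut u))"
proof
  assume "u \<in> H10 R \<Omega>"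
  then obtain f where u: "u \<in> L2 R \<Omega>" and f: "\<And>j::nat. f j \<in> test_fun R \<Omega>"
    and c: "(\<lambda>j. LINT p:\<Omega>|vol R. (f j p - u p)\<^sup>2) \<longlonglongrightarrow> 0"
    and g: "\<forall>e>0. \<exists>J. \<forall>i\<ge>J. \<forall>j\<ge>J. (LINT p:\<Omega>|vol R. grad_sq R (\<lambda>q. f i q - f j q) p) < e"
    unfolding H10_def by blast
  have u': "u \<in> borel_measurable (vol R)" "cut u \<in> lsq" using u by (auto simp: L2_iff)
  have q: "Q.qconv f (cut u)" using c by (simp add: qconv_cut_iff[OF f u'(2)])
  have "B.qcauchy f" unfolding B_qcauchy_iff[OF f] by (rule Q.qconv_qcauchy[OF test_fun_lsq[OF f] u'(2) q])
  moreover have "A.qcauchy f" unfolding A_qcauchy_iff[OF f] by (rule g)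
  ultimately have "f \<in> C.seqs" using f qcauchy_C[OF f] by (simp add: C.seqs_def)
  then show "u \<in> borel_measurable (vol R) \<and> cut u \<in> lsq \<and> (\<exists>F\<in>C.seqs. Q.qconv F (cut u))" using u' q by blast
next
  assume "u \<in> borel_measurable (vol R) \<and> cut u \<in> lsq \<and> (\<exists>F\<in>C.seqs. Q.qconv F (cut u))"
  then obtain F where u: "u \<in> borel_measurable (vol R)" "cut u \<in> lsq" and F: "F \<in> C.seqs" "Q.qconv F (cut u)" by blast
  note FV = C.seqsD(1)[OF F(1)]
  have "\<forall>e>0. \<exists>J. \<forall>i\<ge>J. \<forall>j\<ge>J. (LINT p:\<Omega>|vol R. grad_sq R (\<lambda>q. F i q - F j q) p) < e"
    unfolding A_qcauchy_iff[OF FV, symmetric] using A.seqsD(2) seqs_subset(1) F(1) by blast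
  then show "u \<in> H10 R \<Omega>" unfolding H10_def L2_iff
    using u FV F(2)[unfolded qconv_cut_iff[OF FV u(2)]] by blast
qed

text \<open>Completeness of L2 gives a limit on the whole manifold. The test functions vanish off
  \<Omega>, so cutting the limit there can only bring it closer.\<close>

lemma seqs_limit:
  assumes F: "F \<in> C.seqs"
  shows "\<exists>u\<in>borel_measurable (vol R). cut u \<in> lsq \<and> Q.qconv F (cut u)"
proof -
  note FV = C.seqsD(1)[OF F]
  note FL = test_fun_lsq[OF FV]
  have "B.qcauchy F" using B.seqsD(2) seqs_subset(2) F by blast
  then have c: "Q.qcauchy F" unfolding B_qcauchy_iff[OF FV] .
  have "\<exists>J. \<forall>i\<ge>J. \<forall>j\<ge>J. (\<integral>p. (F i p - F j p)\<^sup>2 \<partial>vol R) < e" if e: "0 < e" for e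
  proof -
    obtain J where J: "\<forall>i\<ge>J. \<forall>j\<ge>J. Q.nrm (F i - F j) < sqrt e" using Q.qcauchyD[OF c, of "sqrt e"] e by auto
    have "(\<integral>p. (F i p - F j p)\<^sup>2 \<partial>vol R) < e" if "i \<ge> J" "j \<ge> J" for i j
      using J[rule_format, OF that] by (simp add: Q.nrm_def ip_def power2_eq_square)
    then show ?thesis by blast
  qed
  from vol.L2_complete[of F, OF lsqD(1)[OF FL] lsqD(2)[OF FL] this]
  obtain u where u: "u \<in> borel_measurable (vol R)" "integrable (vol R) (\<lambda>p. (u p)\<^sup>2)" "(\<lambda>j. \<integral>p. (F j p - u p)\<^sup>2 \<partial>vol R) \<longlonglongrightarrow> 0"
    by blast
  have uL: "u \<in> lsq" using u by (simp add: lsq_def)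
  have cL: "cut u \<in> lsq"
  proof -
    have "integrable (vol R) (\<lambda>p. (cut u p)\<^sup>2)"
    proof (rule Bochner_Integration.integrable_bound[OF u(2)])
      show "(\<lambda>p. (cut u p)\<^sup>2) \<in> borel_measurable (vol R)" using cut_measurable[OF u(1)] by measurable
    qed (simp add: cut_def indicator_def)
    then show ?thesis using cut_measurable[OF u(1)] by (simp add: lsq_def)
  qed
  have "(\<lambda>j. LINT p:\<Omega>|vol R. (F j p - u p)\<^sup>2) \<longlonglongrightarrow> 0"
  proof (rule Lim_null_comparison[OF _ u(3)], intro always_eventually allI)
    fix j
    have i1: "integrable (vol R) (\<lambda>p. ((F j - u) p)\<^sup>2)" by (rule lsqD(2)[OF Q.V_diff[OF FL uL]])
    have i2: "integrable (vol R) (\<lambda>p. ((F j - cut u) p)\<^sup>2)" by (rule lsqD(2)[OF Q.V_diff[OF FL cL]])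
    have "(LINT p:\<Omega>|vol R. (F j p - u p)\<^sup>2) = (\<integral>p. ((F j - cut u) p)\<^sup>2 \<partial>vol R)"
      unfolding integral_diff_cut[OF FV] ip_def by (simp add: power2_eq_square)
    also have "\<dots> \<le> (\<integral>p. ((F j - u) p)\<^sup>2 \<partial>vol R)"
    proof (rule integral_mono[OF i2 i1])
      fix p assume "p \<in> space (vol R)"
      then show "((F j - cut u) p)\<^sup>2 \<le> ((F j - u) p)\<^sup>2"
        using test_fun_zero[OF FV[of j], of p] by (cases "p \<in> \<Omega>") (auto simp: cut_def)
    qed
    finally show "norm (LINT p:\<Omega>|vol R. (F j p - u p)\<^sup>2) \<le> (\<integral>p. (F j p - u p)\<^sup>2 \<partial>vol R)"
      using Q.nonneg[OF Q.V_diff[OF FL[of j] cL]] by (simp add: integral_diff_cut[OF FV])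
  qed
  then have "Q.qconv F (cut u)" using qconv_cut_iff[of F u, OF FV cL] by blast
  then show ?thesis using u(1) cL by blast
qed

lemma B_qlim_eq:
  assumes F: "F \<in> C.seqs" "h \<in> lsq" "Q.qconv F h" and G: "G \<in> C.seqs" "k \<in> lsq" "Q.qconv G k"
  shows "B.qlim F G = ip h k"
proof (rule B.qlim_eqI)
  show "F \<in> B.seqs" "G \<in> B.seqs" using F(1) G(1) seqs_subset(2) by auto
  show "(\<lambda>j. bform (F j) (G j)) \<longlonglongrightarrow> ip h k"
    using Q.qconv_both[OF test_fun_lsq[OF C.seqsD(1)[OF F(1)]] F(2,3) test_fun_lsq[OF C.seqsD(1)[OF G(1)]] G(2,3)]
    by (simp add: bform_eq[OF C.seqsD(1)[OF F(1)]])
qed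

lemma B_qlim_const:
  assumes F: "F \<in> C.seqs" "h \<in> lsq" "Q.qconv F h" and f: "f \<in> test_fun R \<Omega>"
  shows "B.qlim F (\<lambda>j. f) = ip h f"
  by (rule B_qlim_eq[OF F C.const_seqs[OF f] test_fun_lsq[OF f]]) (simp add: Q.qconv_def Q.nrm_def Q.zero_left[OF Q.V_zero])

text \<open>Green's formula moves all derivatives to the fixed test function, after which L2
  convergence determines the limit.\<close>

lemma A_qlim_const:
  assumes F: "F \<in> C.seqs" "h \<in> lsq" "Q.qconv F h" and f: "f \<in> test_fun R \<Omega>"
  shows "A.qlim F (\<lambda>j. f) = - ip h (lapf f)"
proof (rule A.qlim_eqI)
  show "F \<in> A.seqs" "(\<lambda>j. f) \<in> A.seqs" using F(1) C.const_seqs[OF f] seqs_subset(1) by auto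
  have "aform (F j) f = - ip (F j) (lapf f)" for j by (simp add: ip_lapf[OF f C.seqsD(1)[OF F(1)]])
  then show "(\<lambda>j. aform (F j) f) \<longlonglongrightarrow> - ip h (lapf f)"
    using tendsto_minus[OF Q.qconv_left[OF test_fun_lsq[OF C.seqsD(1)[OF F(1)]] F(2) lapf_lsq[OF f] F(3)]] by simp
qed

text \<open>By density it suffices to test the completed forms against test functions.\<close>

lemma eigenspace_iff:
  "u \<in> dirichlet_eigenspace R \<Omega> \<mu> \<longleftrightarrow> u \<in> borel_measurable (vol R) \<and> cut u \<in> lsq \<and>
     (\<exists>F\<in>C.seqs. Q.qconv F (cut u) \<and> (\<forall>G\<in>C.seqs. A.qlim F G = \<mu> * B.qlim F G))"
proof
  assume "u \<in> dirichlet_eigenspace R \<Omega> \<mu>"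
  then have u: "u \<in> H10 R \<Omega>" and e: "\<And>f. f \<in> test_fun R \<Omega> \<Longrightarrow> - ip (cut u) (lapf f) = \<mu> * ip (cut u) f"
    unfolding dirichlet_eigenspace_def integral_cut_laplacian integral_cut by auto
  obtain F where um: "u \<in> borel_measurable (vol R)" "cut u \<in> lsq" and F: "F \<in> C.seqs" "Q.qconv F (cut u)" using u unfolding H10_iff by blast
  have "A.qlim F G = \<mu> * B.qlim F G" if G: "G \<in> C.seqs" for G
  proof (rule LIMSEQ_unique)
    show "(\<lambda>m. A.qlim F (\<lambda>j. G m)) \<longlonglongrightarrow> A.qlim F G"
      by (rule A.qlim_const_tendsto) (use F(1) G seqs_subset(1) in auto)
    have "A.qlim F (\<lambda>j. G m) = \<mu> * B.qlim F (\<lambda>j. G m)" for m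
      using e[OF C.seqsD(1)[OF G]] by (simp add: A_qlim_const[OF F(1) um(2) F(2) C.seqsD(1)[OF G]] B_qlim_const[OF F(1) um(2) F(2) C.seqsD(1)[OF G]])
    moreover have "(\<lambda>m. \<mu> * B.qlim F (\<lambda>j. G m)) \<longlonglongrightarrow> \<mu> * B.qlim F G"
      by (rule tendsto_mult_left[OF B.qlim_const_tendsto]) (use F(1) G seqs_subset(2) in auto)
    ultimately show "(\<lambda>m. A.qlim F (\<lambda>j. G m)) \<longlonglongrightarrow> \<mu> * B.qlim F G" by simp
  qed
  then show "u \<in> borel_measurable (vol R) \<and> cut u \<in> lsq \<and>
     (\<exists>F\<in>C.seqs. Q.qconv F (cut u) \<and> (\<forall>G\<in>C.seqs. A.qlim F G = \<mu> * B.qlim F G))" using um F by blast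
next
  assume "u \<in> borel_measurable (vol R) \<and> cut u \<in> lsq \<and>
     (\<exists>F\<in>C.seqs. Q.qconv F (cut u) \<and> (\<forall>G\<in>C.seqs. A.qlim F G = \<mu> * B.qlim F G))"
  then obtain F where um: "u \<in> borel_measurable (vol R)" "cut u \<in> lsq" and F: "F \<in> C.seqs" "Q.qconv F (cut u)"
    and e: "\<And>G. G \<in> C.seqs \<Longrightarrow> A.qlim F G = \<mu> * B.qlim F G" by blast
  have "u \<in> H10 R \<Omega>" unfolding H10_iff using um F by blast
  moreover have "- ip (cut u) (lapf f) = \<mu> * ip (cut u) f" if f: "f \<in> test_fun R \<Omega>" for f
    using e[OF C.const_seqs[OF f]] by (simp add: A_qlim_const[OF F(1) um(2) F(2) f] B_qlim_const[OF F(1) um(2) F(2) f])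
  ultimately show "u \<in> dirichlet_eigenspace R \<Omega> \<mu>"
    unfolding dirichlet_eigenspace_def integral_cut_laplacian integral_cut by blast
qed

text \<open>The completed form b and the L2 inner product of the limits have the same Gram matrix,
  so null combinations are those that vanish almost everywhere on \<Omega>.\<close>

lemma B_qlim_lincomb_zero:
  assumes F: "\<And>i. i < m \<Longrightarrow> F i \<in> C.seqs" and u: "\<And>i. i < m \<Longrightarrow> cut (u i) \<in> lsq" and c: "\<And>i. i < m \<Longrightarrow> Q.qconv (F i) (cut (u i))"
  shows "B.qlim (\<Sum>i<m. \<gamma> i *\<^sub>R F i) (\<Sum>i<m. \<gamma> i *\<^sub>R F i) = 0 \<longleftrightarrow> (AE p in vol R. p \<in> \<Omega> \<longrightarrow> (\<Sum>i<m. \<gamma> i * u i p) = 0)"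
proof -
  define s where "s = (\<Sum>i<m. \<gamma> i *\<^sub>R cut (u i))"
  have sL: "s \<in> lsq" unfolding s_def using u by (intro Q.V_sum Q.V_scale) auto
  have "B.qlim (\<Sum>i<m. \<gamma> i *\<^sub>R F i) (\<Sum>i<m. \<gamma> i *\<^sub>R F i) = (\<Sum>i<m. \<Sum>j<m. \<gamma> i * \<gamma> j * B.qlim (F i) (F j))"
    by (rule W.B.lincomb) (use F in auto)
  also have "\<dots> = (\<Sum>i<m. \<Sum>j<m. \<gamma> i * \<gamma> j * ip (cut (u i)) (cut (u j)))"
    by (intro sum.cong refl) (simp add: B_qlim_eq[OF F u c F u c])
  also have "\<dots> = ip s s" unfolding s_def by (rule Q.lincomb[symmetric]) (use u in auto)
  finally have eq: "B.qlim (\<Sum>i<m. \<gamma> i *\<^sub>R F i) (\<Sum>i<m. \<gamma> i *\<^sub>R F i) = ip s s" .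
  have "s p = indicator \<Omega> p * (\<Sum>i<m. \<gamma> i * u i p)" for p
    by (simp add: s_def sum_fun_apply cut_def sum_distrib_left mult_ac)
  then have "s p = 0 \<longleftrightarrow> (p \<in> \<Omega> \<longrightarrow> (\<Sum>i<m. \<gamma> i * u i p) = 0)" for p by (simp add: indicator_def)
  then show ?thesis unfolding eq ip_zero_iff[OF sL] by simp
qed

text \<open>Links the analytic notion of multiplicity with the abstract one: Cauchy sequences and
  their L2 limits exchange eigenvalue equations and independence.\<close>

lemma independent_eigenfunctions_iff:
  "(\<exists>u. (\<forall>i<m. u i \<in> dirichlet_eigenspace R \<Omega> \<mu>) \<and> lin_indep_ae R \<Omega> m u) \<longleftrightarrow> (\<exists>F. W.eigenfamily m \<mu> F)"
proof
  assume "\<exists>u. (\<forall>i<m. u i \<in> dirichlet_eigenspace R \<Omega> \<mu>) \<and> lin_indep_ae R \<Omega> m u"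
  then obtain u where u: "\<forall>i<m. u i \<in> dirichlet_eigenspace R \<Omega> \<mu>" and li: "lin_indep_ae R \<Omega> m u" by blast
  have uL: "cut (u i) \<in> lsq" if "i < m" for i using u that unfolding eigenspace_iff by blast
  have "\<forall>i\<in>{..<m}. \<exists>F. F \<in> C.seqs \<and> Q.qconv F (cut (u i)) \<and> (\<forall>G\<in>C.seqs. A.qlim F G = \<mu> * B.qlim F G)"
    using u unfolding eigenspace_iff by blast
  from bchoice[OF this] obtain F where F: "\<And>i. i < m \<Longrightarrow> F i \<in> C.seqs" "\<And>i. i < m \<Longrightarrow> Q.qconv (F i) (cut (u i))"
    "\<And>i G. i < m \<Longrightarrow> G \<in> C.seqs \<Longrightarrow> A.qlim (F i) G = \<mu> * B.qlim (F i) G" by auto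
  have "0 < B.qlim (\<Sum>i<m. \<gamma> i *\<^sub>R F i) (\<Sum>i<m. \<gamma> i *\<^sub>R F i)" if "\<exists>i<m. \<gamma> i \<noteq> 0" for \<gamma>
  proof -
    have "(\<Sum>i<m. \<gamma> i *\<^sub>R F i) \<in> C.seqs" using F(1) by (intro W.A.V_sum W.A.V_scale) auto
    then have "0 \<le> B.qlim (\<Sum>i<m. \<gamma> i *\<^sub>R F i) (\<Sum>i<m. \<gamma> i *\<^sub>R F i)" by (rule W.B.nonneg)
    moreover have "B.qlim (\<Sum>i<m. \<gamma> i *\<^sub>R F i) (\<Sum>i<m. \<gamma> i *\<^sub>R F i) \<noteq> 0"
    proof -
    have "B.qlim (\<Sum>i<m. \<gamma> i *\<^sub>R F i) (\<Sum>i<m. \<gamma> i *\<^sub>R F i) = 0 \<longleftrightarrow> (AE p in vol R. p \<in> \<Omega> \<longrightarrow> (\<Sum>i<m. \<gamma> i * u i p) = 0)"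
      by (rule B_qlim_lincomb_zero) (use F uL in auto)
    then show ?thesis using li that unfolding lin_indep_ae_def by blast
    qed
    ultimately show ?thesis by simp
  qed
  then have "W.eigenfamily m \<mu> F" unfolding W.eigenfamily_def using F(1,3) by blast
  then show "\<exists>F. W.eigenfamily m \<mu> F" by blast
next
  assume "\<exists>F. W.eigenfamily m \<mu> F"
  then obtain F where F: "W.eigenfamily m \<mu> F" by blast
  have FS: "F i \<in> C.seqs" "\<And>G. G \<in> C.seqs \<Longrightarrow> A.qlim (F i) G = \<mu> * B.qlim (F i) G" if "i < m" for i
    using F that unfolding W.eigenfamily_def by auto
  have "\<forall>i\<in>{..<m}. \<exists>u. u \<in> borel_measurable (vol R) \<and> cut u \<in> lsq \<and> Q.qconv (F i) (cut u)"
    using seqs_limit[OF FS(1)] by blast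
  from bchoice[OF this] obtain u where u: "\<And>i. i < m \<Longrightarrow> u i \<in> borel_measurable (vol R)" "\<And>i. i < m \<Longrightarrow> cut (u i) \<in> lsq"
    "\<And>i. i < m \<Longrightarrow> Q.qconv (F i) (cut (u i))" by auto
  have "u i \<in> dirichlet_eigenspace R \<Omega> \<mu>" if "i < m" for i
    unfolding eigenspace_iff using u[OF that] FS[OF that] by blast
  moreover have "lin_indep_ae R \<Omega> m u" unfolding lin_indep_ae_def
  proof (intro allI impI)
    fix \<gamma> i assume ae: "AE p in vol R. p \<in> \<Omega> \<longrightarrow> (\<Sum>i<m. \<gamma> i * u i p) = 0" and i: "i < m"
    have "B.qlim (\<Sum>i<m. \<gamma> i *\<^sub>R F i) (\<Sum>i<m. \<gamma> i *\<^sub>R F i) = 0 \<longleftrightarrow> (AE p in vol R. p \<in> \<Omega> \<longrightarrow> (\<Sum>i<m. \<gamma> i * u i p) = 0)"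
      by (rule B_qlim_lincomb_zero) (use FS u in auto)
    then have "B.qlim (\<Sum>i<m. \<gamma> i *\<^sub>R F i) (\<Sum>i<m. \<gamma> i *\<^sub>R F i) = 0" using ae by blast
    moreover have "0 < B.qlim (\<Sum>i<m. \<gamma> i *\<^sub>R F i) (\<Sum>i<m. \<gamma> i *\<^sub>R F i)" if "\<gamma> i \<noteq> 0"
      using conjunct2[OF F[unfolded W.eigenfamily_def], THEN spec, of \<gamma>] i that by blast
    ultimately show "\<gamma> i = 0" by fastforce
  qed
  ultimately show "\<exists>u. (\<forall>i<m. u i \<in> dirichlet_eigenspace R \<Omega> \<mu>) \<and> lin_indep_ae R \<Omega> m u" by blast
qed

lemma dirichlet_mult_eq: "dirichlet_mult R \<Omega> \<mu> = Sup {enat m | m. \<exists>F. W.eigenfamily m \<mu> F}"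
proof -
  have "{enat m | m u. (\<forall>i<m. u i \<in> dirichlet_eigenspace R \<Omega> \<mu>) \<and> lin_indep_ae R \<Omega> m u} = {enat m | m. \<exists>F. W.eigenfamily m \<mu> F}"
    unfolding independent_eigenfunctions_iff[symmetric] by blast
  then show ?thesis by (simp only: dirichlet_mult_def)
qed

text \<open>The eigenvectors span a suitable space in the completion; \<epsilon> is the price for
  approximating it by test functions.\<close>

lemma rayleigh_of_dirichlet_mult:
  assumes S: "finite S" "S \<subseteq> {..x}" and k: "enat k \<le> (\<Sum>\<mu>\<in>S. dirichlet_mult R \<Omega> \<mu>)" and \<epsilon>: "0 < \<epsilon>"
  shows "rayleigh k (x + \<epsilon>)"
proof -
  obtain n where n: "\<And>\<mu>. \<mu> \<in> S \<Longrightarrow> enat (n \<mu>) \<le> dirichlet_mult R \<Omega> \<mu>" "k \<le> (\<Sum>\<mu>\<in>S. n \<mu>)"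
    using enat_le_sum_choose[OF S(1) k] by blast
  have "\<forall>\<mu>\<in>S. \<exists>F. W.eigenfamily (n \<mu>) \<mu> F"
  proof
    fix \<mu> assume \<mu>: "\<mu> \<in> S"
    have "W.eigenfamily 0 \<mu> (\<lambda>_ _. 0)" by (simp add: W.eigenfamily_def)
    then have "{enat m | m. \<exists>F. W.eigenfamily m \<mu> F} \<noteq> {}" by blast
    from enat_le_Sup_choose[OF n(1)[OF \<mu>, unfolded dirichlet_mult_eq] this]
    obtain m F where "n \<mu> \<le> m" "W.eigenfamily m \<mu> F" by auto
    then show "\<exists>F. W.eigenfamily (n \<mu>) \<mu> F" using W.eigenfamily_le by blast
  qed
  from bchoice[OF this] obtain F where F: "\<forall>\<mu>\<in>S. W.eigenfamily (n \<mu>) \<mu> (F \<mu>)" by (elim exE)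
  have "W.rayleigh k x"
    by (rule W.rayleigh_eigenfamilies[OF S(1) _ _ n(2)]) (use S(2) F in auto)
  then show ?thesis by (rule rayleigh_approx[OF _ \<epsilon>])
qed

lemma dirichlet_mult_of_eigensystem:
  assumes E: "W.eigensystem k U \<mu>"
  shows "enat k \<le> (\<Sum>\<nu>\<in>\<mu> ` {..<k}. dirichlet_mult R \<Omega> \<nu>)"
proof -
  have "{..<k} = (\<Union>\<nu>\<in>\<mu> ` {..<k}. {i. i < k \<and> \<mu> i = \<nu>})" by auto
  then have "k = card (\<Union>\<nu>\<in>\<mu> ` {..<k}. {i. i < k \<and> \<mu> i = \<nu>})" by (metis card_lessThan)
  also have "\<dots> = (\<Sum>\<nu>\<in>\<mu> ` {..<k}. card {i. i < k \<and> \<mu> i = \<nu>})" by (rule card_UN_disjoint) auto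
  finally have "enat k = enat (\<Sum>\<nu>\<in>\<mu> ` {..<k}. card {i. i < k \<and> \<mu> i = \<nu>})" by simp
  also have "\<dots> = (\<Sum>\<nu>\<in>\<mu> ` {..<k}. enat (card {i. i < k \<and> \<mu> i = \<nu>}))"
    by (simp only: of_nat_eq_enat[symmetric] of_nat_sum)
  also have "\<dots> \<le> (\<Sum>\<nu>\<in>\<mu> ` {..<k}. dirichlet_mult R \<Omega> \<nu>)"
    unfolding dirichlet_mult_eq using W.eigensystem_eigenfamily[OF E] by (intro sum_mono Sup_upper) blast
  finally show ?thesis .
qed

text \<open>The largest of the k constructed eigenvalues is the minimum of the set in the
  definition: it belongs to the set by counting multiplicities, and a member x provides bounds x +
  \<epsilon> for every \<epsilon>, none of which is smaller than a constructed eigenvalue.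
  \<open>R0\<close> provides the space from which the construction starts.\<close>

lemma eigenvalue_variational:
  assumes N: "mfd_interior R N = \<Omega>" and k: "1 \<le> k" and R0: "rayleigh k x0"
  shows "rayleigh k x \<Longrightarrow> dirichlet_eigenvalue R N k \<le> x"
    and "0 < \<epsilon> \<Longrightarrow> rayleigh k (dirichlet_eigenvalue R N k + \<epsilon>)"
proof -
  obtain U \<mu> where E: "W.eigensystem k U \<mu>" and le: "\<And>i x. i < k \<Longrightarrow> rayleigh k x \<Longrightarrow> \<mu> i \<le> x"
    using eigensystem_seqs[OF R0] by blast
  define S where "S = \<mu> ` {..<k}"
  define m where "m = Max S"
  let ?X = "{x. \<exists>S. finite S \<and> S \<subseteq> {..x} \<and> enat k \<le> (\<Sum>\<mu>\<in>S. dirichlet_mult R \<Omega> \<mu>)}"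
  \<comment> \<open>\<open>1 \<le> k\<close> makes the set of eigenvalues non-empty, so that
    \<open>Max\<close> is one of them.\<close>
  have S: "finite S" "S \<noteq> {}" using k by (auto simp: S_def lessThan_empty_iff)
  have mX: "m \<in> ?X"
    using S dirichlet_mult_of_eigensystem[OF E] by (auto intro!: exI[of _ S] simp: m_def S_def[symmetric])
  have mR: "m \<le> x" if "rayleigh k x" for x
    unfolding m_def using S le that by (auto simp: S_def)
  have lower: "m \<le> x" if "x \<in> ?X" for x
  proof (rule field_le_epsilon)
    fix \<epsilon> :: real assume "0 < \<epsilon>"
    then have "rayleigh k (x + \<epsilon>)" using that rayleigh_of_dirichlet_mult by blast
    then show "m \<le> x + \<epsilon>" by (rule mR)
  qed
  have "dirichlet_eigenvalue R N k = m"
    unfolding dirichlet_eigenvalue_def N by (rule cInf_eq_minimum[OF mX lower])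
  then show "rayleigh k x \<Longrightarrow> dirichlet_eigenvalue R N k \<le> x"
    and "0 < \<epsilon> \<Longrightarrow> rayleigh k (dirichlet_eigenvalue R N k + \<epsilon>)"
    using mR mX rayleigh_of_dirichlet_mult by blast+
qed

end

section \<open>Convergence of the eigenvalues\<close>

context compact_riemannian_mfd begin

abbreviation rayleigh_on :: "'a set \<Rightarrow> nat \<Rightarrow> real \<Rightarrow> bool" where
  "rayleigh_on \<Omega> \<equiv> form_pair.rayleigh (test_fun R \<Omega>) aform bform"

lemmas rayleigh_on_def = form_pair.rayleigh_def[OF form_pair_test_fun]

lemma rayleigh_on_mono:
  assumes "\<Omega> \<subseteq> \<Omega>'" "\<Omega>' \<subseteq> inn" and R: "rayleigh_on \<Omega> k x"
  shows "rayleigh_on \<Omega>' k x"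
proof -
  obtain e where e: "\<forall>i<k. e i \<in> test_fun R \<Omega>"
    "\<forall>\<gamma>. let w = (\<Sum>i<k. \<gamma> i *\<^sub>R e i) in ((\<exists>i<k. \<gamma> i \<noteq> 0) \<longrightarrow> 0 < bform w w) \<and> aform w w \<le> x * bform w w"
    using R unfolding rayleigh_on_def[OF order_trans[OF assms(1,2)]] by (elim exE conjE)
  show ?thesis unfolding rayleigh_on_def[OF assms(2)]
    by (intro exI[of _ e] conjI e(2)) (use e(1) test_fun_mono[OF assms(1)] in blast)
qed

lemma rayleigh_on_compact:
  assumes R: "rayleigh_on inn k x"
  shows "\<exists>K. compact K \<and> K \<subseteq> inn \<and> (\<forall>\<Omega>. K \<subseteq> \<Omega> \<longrightarrow> \<Omega> \<subseteq> inn \<longrightarrow> rayleigh_on \<Omega> k x)"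
proof -
  obtain e where e: "\<forall>i<k. e i \<in> test_fun R inn"
    "\<forall>\<gamma>. let w = (\<Sum>i<k. \<gamma> i *\<^sub>R e i) in ((\<exists>i<k. \<gamma> i \<noteq> 0) \<longrightarrow> 0 < bform w w) \<and> aform w w \<le> x * bform w w"
    using R unfolding rayleigh_on_def[OF order_refl] by (elim exE conjE)
  have "\<forall>i\<in>{..<k}. \<exists>K. compact K \<and> K \<subseteq> inn \<and> (\<forall>p\<in>pts R - K. e i p = 0)"
  proof
    fix i assume "i \<in> {..<k}"
    then have "e i \<in> test_fun R inn" using e(1) by simp
    from test_funD(2)[OF this order_refl] show "\<exists>K. compact K \<and> K \<subseteq> inn \<and> (\<forall>p\<in>pts R - K. e i p = 0)" by blast
  qed
  from bchoice[OF this] obtain K where K: "\<forall>i\<in>{..<k}. compact (K i) \<and> K i \<subseteq> inn \<and> (\<forall>p\<in>pts R - K i. e i p = 0)" by (elim exE)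
  have "compact (\<Union>i<k. K i)" using K by (intro compact_UN) auto
  moreover have "(\<Union>i<k. K i) \<subseteq> inn" using K by blast
  moreover have "rayleigh_on \<Omega> k x" if \<Omega>: "(\<Union>i<k. K i) \<subseteq> \<Omega>" "\<Omega> \<subseteq> inn" for \<Omega>
  proof -
    have "e i \<in> test_fun R \<Omega>" if i: "i < k" for i
      unfolding test_fun_iff[OF \<Omega>(2)] using test_funD(1)[OF e(1)[rule_format, OF i] order_refl] K i \<Omega>(1)
      by (intro conjI exI[of _ "K i"]) auto
    then show ?thesis unfolding rayleigh_on_def[OF \<Omega>(2)] by (intro exI[of _ e] conjI e(2)) blast
  qed
  ultimately show ?thesis by blast
qed

text \<open>Disjoint supports will make both forms diagonal, so independence and the bound on the
  quotient need no computation of mixed terms.\<close>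

lemma disjoint_bumps:
  fixes k :: nat
  assumes p: "p \<in> inn"
  shows "\<exists>\<psi> K. \<forall>i<k. smoothm (\<psi> i) \<and> compact (K i) \<and> K i \<subseteq> inn \<and> (\<forall>q\<in>pts R - K i. \<psi> i q = 0) \<and> (\<exists>q\<in>inn. 0 < \<psi> i q) \<and>
    (\<forall>j<k. i \<noteq> j \<longrightarrow> K i \<inter> K j = {})"
proof -
  obtain c where c: "c \<in> atlas R" "p \<in> cdom c" using chart_exists subsetD[OF inn_subset p] by blast
  let ?x = "coord c p"
  \<comment> \<open>Any coordinate serves; the ball is sliced across this one.\<close>
  let ?j = "undefined :: 'n"
  have "?x \<in> uset c" using inn_iff[OF c] p by simp
  then obtain r where r: "0 < r" "ball ?x r \<subseteq> uset c" using open_uset[OF c(1)] open_contains_ball by blast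
  \<comment> \<open>The i-th of k slabs of width r/k on the positive side of the centre, with the
    inequalities multiplied by k.\<close>
  define U where "U i = {y \<in> ball ?x r. r * real i < real k * (y $ ?j - ?x $ ?j) \<and> real k * (y $ ?j - ?x $ ?j) < r * real (Suc i)}" for i :: nat
  have Uu: "U i \<subseteq> uset c" for i unfolding U_def using r(2) by blast
  have oU: "open (U i)" for i
  proof -
    have "U i = ball ?x r \<inter> {y. r * real i < real k * (y $ ?j - ?x $ ?j)} \<inter> {y. real k * (y $ ?j - ?x $ ?j) < r * real (Suc i)}"
      by (auto simp: U_def)
    moreover have "open \<dots>" by (intro open_Int open_ball open_Collect_less continuous_intros)
    ultimately show ?thesis by simp
  qed
  have disj: "U i \<inter> U j = {}" if "i \<noteq> j" for i j
  proof (rule ccontr)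
    assume "U i \<inter> U j \<noteq> {}"
    then obtain y where y: "y \<in> U i" "y \<in> U j" by blast
    have "r * real i < r * real (Suc j)" "r * real j < r * real (Suc i)"
      using y unfolding U_def by (blast intro: less_trans)+
    then show False using r(1) that by (simp add: mult_less_cancel_left_pos)
  qed
  \<comment> \<open>The middle of the i-th slab on the axis through the centre; it lies in the ball
    because i + 1/2 < k.\<close>
  have pt: "?x + (r * (real i + 1/2) / real k) *\<^sub>R axis ?j 1 \<in> U i" if i: "i < k" for i
  proof -
    have k: "0 < real k" using i by simp
    have "real i + 1/2 < real k" using i by linarith
    then have "r * (real i + 1/2) / real k < r" using r(1) k by (simp add: divide_less_eq mult_less_cancel_left_pos)
    then have "norm ((r * (real i + 1/2) / real k) *\<^sub>R (axis ?j 1 :: real^'n)) < r" using r(1) k by (simp add: abs_of_nonneg)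
    moreover have "r * real i < r * (real i + 1/2)" "r * (real i + 1/2) < r * real (Suc i)" using r(1) by simp_all
    ultimately show ?thesis using k by (simp add: U_def dist_norm axis_def)
  qed
  let ?N = "\<lambda>i. param c ` U i"
  have Ninn: "?N i \<subseteq> inn" for i
  proof
    fix q assume "q \<in> ?N i"
    then obtain y where y: "y \<in> U i" "q = param c y" by (elim imageE)
    show "q \<in> inn" unfolding y(2) by (rule param_inn[OF c(1) subsetD[OF Uu y(1)]])
  qed
  have oN: "openin (top_of_set inn) (?N i)" for i
  proof (rule openin_subset_trans[OF _ Ninn inn_subset])
    have "U i \<subseteq> crange c" using Uu uset_subset by (rule order_trans)
    then show "openin (top_of_set (pts R)) (?N i)"
      using openin_param_image[OF c(1) open_subset[OF order_trans[OF _ crange_subset[OF c(1)]] oU]] by blast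
  qed
  have disjN: "?N i \<inter> ?N j = {}" if "i \<noteq> j" for i j
  proof (rule ccontr)
    assume "?N i \<inter> ?N j \<noteq> {}"
    then obtain q where "q \<in> ?N i" "q \<in> ?N j" by blast
    then obtain y z where y: "y \<in> U i" "q = param c y" and z: "z \<in> U j" "q = param c z" by (elim imageE)
    have "y = z"
      using coord_param[OF subsetD[OF uset_subset subsetD[OF Uu y(1)]]] coord_param[OF subsetD[OF uset_subset subsetD[OF Uu z(1)]]] y(2) z(2) by simp
    then show False using y(1) z(1) disj[OF that] by blast
  qed
  have "\<forall>i\<in>{..<k}. \<exists>\<psi>K. smoothm (fst \<psi>K) \<and> compact (snd \<psi>K) \<and> snd \<psi>K \<subseteq> ?N i \<and> (\<forall>q\<in>pts R - snd \<psi>K. fst \<psi>K q = 0) \<and> (\<exists>q\<in>inn. 0 < fst \<psi>K q)"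
  proof
    fix i assume "i \<in> {..<k}"
    then have i: "i < k" by simp
    let ?q = "param c (?x + (r * (real i + 1/2) / real k) *\<^sub>R axis ?j 1)"
    have q: "?q \<in> ?N i" using pt[OF i] by (rule imageI)
    have qc: "?q \<in> cdom c" by (rule param_in[OF subsetD[OF uset_subset subsetD[OF Uu pt[OF i]]]])
    from bump_exists[OF c(1) oN q qc] obtain K \<psi> where "smoothm \<psi>" "compact K" "K \<subseteq> ?N i" "\<forall>z\<in>pts R - K. \<psi> z = 0" "0 < \<psi> ?q"
      by (elim exE conjE)
    then show "\<exists>\<psi>K. smoothm (fst \<psi>K) \<and> compact (snd \<psi>K) \<and> snd \<psi>K \<subseteq> ?N i \<and> (\<forall>q\<in>pts R - snd \<psi>K. fst \<psi>K q = 0) \<and> (\<exists>q\<in>inn. 0 < fst \<psi>K q)"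
      using subsetD[OF Ninn q] by (intro exI[of _ "(\<psi>, K)"]) auto
  qed
  from bchoice[OF this] obtain \<psi>K where \<psi>K: "\<forall>i\<in>{..<k}. smoothm (fst (\<psi>K i)) \<and> compact (snd (\<psi>K i)) \<and> snd (\<psi>K i) \<subseteq> ?N i \<and>
    (\<forall>q\<in>pts R - snd (\<psi>K i). fst (\<psi>K i) q = 0) \<and> (\<exists>q\<in>inn. 0 < fst (\<psi>K i) q)" by (elim exE)
  have sub: "snd (\<psi>K i) \<subseteq> ?N i" if "i < k" for i using \<psi>K that by blast
  show ?thesis
  proof (intro exI[of _ "\<lambda>i. fst (\<psi>K i)"] exI[of _ "\<lambda>i. snd (\<psi>K i)"] allI impI conjI)
    fix i assume i: "i < k"
    show "snd (\<psi>K i) \<subseteq> inn" using sub[OF i] Ninn by (rule order_trans)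
    fix j assume "j < k" "i \<noteq> j"
    then show "snd (\<psi>K i) \<inter> snd (\<psi>K j) = {}" using sub[OF i] sub[of j] disjN[of i j] by blast
  qed (use \<psi>K in auto)
qed

text \<open>In the interior there is room for bumps with disjoint supports in any number, so the
  infimum that defines an eigenvalue is not taken over the empty set.\<close>

lemma rayleigh_on_exists:
  assumes p: "p \<in> inn"
  shows "\<exists>x. rayleigh_on inn k x"
proof -
  interpret form_pair "test_fun R inn" aform bform by (rule form_pair_test_fun[OF order_refl])
  obtain \<psi> K where \<psi>: "\<forall>i<k. smoothm (\<psi> i) \<and> compact (K i) \<and> K i \<subseteq> inn \<and> (\<forall>q\<in>pts R - K i. \<psi> i q = 0) \<and> (\<exists>q\<in>inn. 0 < \<psi> i q) \<and>
    (\<forall>j<k. i \<noteq> j \<longrightarrow> K i \<inter> K j = {})" using disjoint_bumps[OF p, of k] by (elim exE)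
  have s: "smoothm (\<psi> i)" and K: "compact (K i)" "K i \<subseteq> inn" "\<And>q. q \<in> pts R - K i \<Longrightarrow> \<psi> i q = 0"
    and pos: "\<exists>q\<in>inn. 0 < \<psi> i q" if "i < k" for i using \<psi> that by auto
  have V: "\<psi> i \<in> test_fun R inn" if "i < k" for i
    unfolding test_fun_iff[OF order_refl] using s[OF that] K[OF that] by blast
  have off: "aform (\<psi> i) (\<psi> j) = 0" "bform (\<psi> i) (\<psi> j) = 0" if ij: "i < k" "j < k" "i \<noteq> j" for i j
  proof -
    have d: "K i \<inter> K j = {}" using \<psi> ij by blast
    have "grad_ip (\<psi> i) (\<psi> j) q = 0" if q: "q \<in> inn" for q
    proof (cases "q \<in> K i")
      case True
      then have "q \<in> inn - K j" using q d by blast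
      show ?thesis by (rule grad_ip_zero(2)[OF K(1)[OF ij(2)] K(3)[OF ij(2)] \<open>q \<in> inn - K j\<close>])
    next
      case False
      then have "q \<in> inn - K i" using q by blast
      show ?thesis by (rule grad_ip_zero(1)[OF K(1)[OF ij(1)] K(3)[OF ij(1)] \<open>q \<in> inn - K i\<close>])
    qed
    then have "aform (\<psi> i) (\<psi> j) = (LINT p:inn|vol R. 0)" unfolding aform_def by (rule set_lebesgue_integral_cong_inn)
    then show "aform (\<psi> i) (\<psi> j) = 0" by simp
    have "\<psi> i q * \<psi> j q = 0" if q: "q \<in> inn" for q
      using K(3)[OF ij(1), of q] K(3)[OF ij(2), of q] d q inn_subset by (cases "q \<in> K i") auto
    then have "bform (\<psi> i) (\<psi> j) = (LINT p:inn|vol R. 0)" unfolding bform_def by (rule set_lebesgue_integral_cong_inn)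
    then show "bform (\<psi> i) (\<psi> j) = 0" by simp
  qed
  have bpos: "0 < bform (\<psi> i) (\<psi> i)" if i: "i < k" for i
  proof -
    obtain q where q: "q \<in> inn" "0 < \<psi> i q" using pos[OF i] by blast
    show ?thesis unfolding bform_def
    proof (rule integral_inn_pos[OF _ K(1,2)[OF i] _ _ q(1)])
      show "continuous_on inn (\<lambda>p. \<psi> i p * \<psi> i p)" by (intro continuous_on_mult continuous_on_smoothm s[OF i])
      show "\<psi> i z * \<psi> i z = 0" if "z \<in> inn - K i" for z using K(3)[OF i, of z] that inn_subset by auto
    qed (use q in auto)
  qed
  have diag: "(\<Sum>i<k. \<Sum>j<k. \<gamma> i * \<gamma> j * h i j) = (\<Sum>i<k. (\<gamma> i)\<^sup>2 * h i i)"
    if h: "\<And>i j. i < k \<Longrightarrow> j < k \<Longrightarrow> i \<noteq> j \<Longrightarrow> h i j = 0" for \<gamma> :: "nat \<Rightarrow> real" and h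
  proof (intro sum.cong refl)
    fix i assume i: "i \<in> {..<k}"
    have "(\<Sum>j<k. \<gamma> i * \<gamma> j * h i j) = (\<Sum>j\<in>{i}. \<gamma> i * \<gamma> j * h i j)"
      using i h by (intro sum.mono_neutral_right) auto
    then show "(\<Sum>j<k. \<gamma> i * \<gamma> j * h i j) = (\<gamma> i)\<^sup>2 * h i i" by (simp add: power2_eq_square)
  qed
  \<comment> \<open>The quotients are nonnegative, so their sum dominates each of them.\<close>
  define x where "x = (\<Sum>i<k. aform (\<psi> i) (\<psi> i) / bform (\<psi> i) (\<psi> i))"
  have ax: "aform (\<psi> i) (\<psi> i) \<le> x * bform (\<psi> i) (\<psi> i)" if i: "i < k" for i
  proof -
    have "aform (\<psi> i) (\<psi> i) / bform (\<psi> i) (\<psi> i) \<le> x" unfolding x_def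
      using i bpos A.nonneg[OF V] by (intro member_le_sum) (auto intro: divide_nonneg_pos)
    then show ?thesis using bpos[OF i] by (simp add: divide_le_eq)
  qed
  have "rayleigh k x" unfolding rayleigh_def Let_def
  proof (intro exI[of _ \<psi>] conjI allI impI V)
    fix \<gamma> :: "nat \<Rightarrow> real"
    let ?w = "\<Sum>i<k. \<gamma> i *\<^sub>R \<psi> i"
    have a: "aform ?w ?w = (\<Sum>i<k. (\<gamma> i)\<^sup>2 * aform (\<psi> i) (\<psi> i))"
      by (subst A.lincomb) (use V diag[of "\<lambda>i j. aform (\<psi> i) (\<psi> j)"] off(1) in auto)
    have b: "bform ?w ?w = (\<Sum>i<k. (\<gamma> i)\<^sup>2 * bform (\<psi> i) (\<psi> i))"
      by (subst B.lincomb) (use V diag[of "\<lambda>i j. bform (\<psi> i) (\<psi> j)"] off(2) in auto)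
    show "0 < bform ?w ?w" if "\<exists>i<k. \<gamma> i \<noteq> 0"
    proof -
      obtain i where i: "i < k" "\<gamma> i \<noteq> 0" using \<open>\<exists>i<k. \<gamma> i \<noteq> 0\<close> by blast
      have "0 < (\<gamma> i)\<^sup>2 * bform (\<psi> i) (\<psi> i)" using i bpos by simp
      also have "\<dots> \<le> bform ?w ?w" unfolding b using i(1) B.nonneg[OF V]
        by (intro member_le_sum) auto
      finally show ?thesis .
    qed
    have "aform ?w ?w \<le> (\<Sum>i<k. (\<gamma> i)\<^sup>2 * (x * bform (\<psi> i) (\<psi> i)))"
      unfolding a by (intro sum_mono mult_left_mono ax) auto
    then show "aform ?w ?w \<le> x * bform ?w ?w" unfolding b by (simp add: sum_distrib_left mult.left_commute)
  qed
  then show ?thesis by blast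
qed

lemma inn_nonempty:
  assumes "pts R \<noteq> {}"
  shows "inn \<noteq> {}"
proof -
  obtain p where "p \<in> pts R" using assms by blast
  then obtain c where c: "c \<in> atlas R" "p \<in> cdom c" using chart_exists by blast
  let ?x = "coord c p"
  obtain W where W: "open W" "crange c = halfspace \<inter> W" using openin_crange[OF c(1)] by (auto simp: openin_open)
  have x: "?x \<in> halfspace \<inter> W" unfolding W(2)[symmetric] using c(2) by (rule imageI)
  then obtain r where r: "0 < r" "ball ?x r \<subseteq> W" using W(1) open_contains_ball by blast
  \<comment> \<open>A possible boundary point is pushed into the half-space by half the radius,
    which keeps it in the chart range.\<close>
  define y where "y = ?x + (r / 2) *\<^sub>R axis bdi 1"
  have "y \<in> ball ?x r" using r(1) by (simp add: y_def dist_norm)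
  moreover have "0 < y $ bdi" using x r(1) by (simp add: y_def halfspace_def)
  ultimately have "y \<in> uset c" unfolding uset_def W(2) using r(2) by (auto simp: halfspace_def)
  then show ?thesis using param_inn[OF c(1)] by blast
qed

theorem dirichlet_eigenvalue_trunc_tendsto:
  assumes k: "1 \<le> k"
  shows "((\<lambda>t. dirichlet_eigenvalue R (trunc R t) k) \<longlongrightarrow> dirichlet_eigenvalue R (pts R) k) (at_right 0)"
proof (cases "bdry R = {}")
  case True
  then show ?thesis by (simp add: trunc_no_boundary)
next
  case False
  \<comment> \<open>A boundary point shows that the manifold is not empty; hence it has interior
    points and min-max bounds exist. The case without boundary was different in that truncation
    changes nothing.\<close>
  then have "pts R \<noteq> {}" using cdom_subset by (auto simp: bdry_def)
  from inn_nonempty[OF this] obtain p where p: "p \<in> inn" by blast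
  obtain x0 where x0: "rayleigh_on inn k x0" using rayleigh_on_exists[OF p] by blast
  have D: "dirichlet_domain R (mfd_interior R N)" for N
    by unfold_locales (rule mfd_interior_subset openin_mfd_interior)+
  note D0 = D[of "pts R", unfolded mfd_interior_pts]
  note var0 = dirichlet_domain.eigenvalue_variational[OF D0 mfd_interior_pts k x0]
  let ?l = "dirichlet_eigenvalue R (pts R) k"
  show ?thesis
  proof (rule tendstoI)
    fix e :: real assume e: "0 < e"
    obtain K where K: "compact K" "K \<subseteq> inn" "\<And>\<Omega>. K \<subseteq> \<Omega> \<Longrightarrow> \<Omega> \<subseteq> inn \<Longrightarrow> rayleigh_on \<Omega> k (?l + e / 2)"
      using rayleigh_on_compact[OF var0(2)[of "e / 2"]] e by auto
    obtain t0 where t0: "0 < t0" "\<And>t. t \<le> t0 \<Longrightarrow> K \<subseteq> mfd_interior R (trunc R t)"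
      using compact_subset_trunc[OF K(1,2)] by blast
    have "dist (dirichlet_eigenvalue R (trunc R t) k) ?l < e" if t: "t \<le> t0" for t
    proof -
      let ?lt = "dirichlet_eigenvalue R (trunc R t) k"
      \<comment> \<open>Serves twice: as the existence of some bound, which the variational
        characterisation on the truncated manifold presupposes, and as the bound itself.\<close>
      have Rt: "rayleigh_on (mfd_interior R (trunc R t)) k (?l + e / 2)" by (rule K(3)[OF t0(2)[OF t] mfd_interior_subset])
      note var = dirichlet_domain.eigenvalue_variational[OF D[of "trunc R t"] refl k Rt]
      have "?lt \<le> ?l + e / 2" by (rule var(1)[OF Rt])
      \<comment> \<open>Monotonicity in the domain. An arbitrary \<epsilon> enters because the
        eigenvalue of the truncated manifold need not itself be a bound realised by test
        functions.\<close>
      moreover have "?l \<le> ?lt"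
      proof (rule field_le_epsilon)
        fix \<epsilon> :: real assume "0 < \<epsilon>"
        then show "?l \<le> ?lt + \<epsilon>"
          by (intro var0(1) rayleigh_on_mono[OF mfd_interior_subset[of "trunc R t"] order_refl] var(2))
      qed
      ultimately show ?thesis using e by (simp add: dist_real_def)
    qed
    then show "\<forall>\<^sub>F t in at_right 0. dist (dirichlet_eigenvalue R (trunc R t) k) ?l < e"
      using t0(1) by (auto simp: eventually_at_right[of 0 t0] intro!: exI[of _ t0])
  qed
qed

end

theorem proposition1p4:
  fixes R :: "('a::t2_space, 'n::finite) rmfd" and lam D i0 s0 :: real and k :: nat
  assumes "lam > 0" and "D > 0" and "i0 > 0" and "s0 > 0"
    and "R \<in> mfd_class lam D i0 s0"
    and "k \<ge> 1"
  shows "((\<lambda>t. dirichlet_eigenvalue R (trunc R t) k) \<longlongrightarrow> dirichlet_eigenvalue R (pts R) k) (at_right 0)"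
proof -
  interpret compact_riemannian_mfd R using assms(5) by unfold_locales (simp add: mfd_class_def)
  show ?thesis by (rule dirichlet_eigenvalue_trunc_tendsto[OF assms(6)])
qed

end
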